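(* Let $X$ be a $(\psi,\phi)$-MCSBP and let $w$ be the vector with entries $w(i):=-\log\mathbf{P}_{\delta_i}(\mathcal{E})$, $i\in\mathbb{N}$, where $\mathcal{E}=\{\lim_{t\to\infty}\langle1,X_t\rangle=0\}$. Then $w$ is a non-negative solution to $$\psi(i,w(i))+\phi(i,w)=0,\qquad i\in\mathbb{N}.$$
   Context: $\mathbb{N}=\{1,2,\dots\}$; $\mathcal{B}(\mathbb{N})$: bounded functions on $\mathbb{N}$; $\mathcal{B}^+(\mathbb{N})$: bounded positive functions; $\mathcal{M}(\mathbb{N})$: finite measures on $\mathbb{N}$; $\langle f,\mu\rangle=\sum_{i\ge1}f(i)\mu(i)$; $\delta_i$ is the unit mass at $i$. Mechanisms. $\psi(i,z)=b(i)z+c(i)z^2+\int_0^\infty(e^{-zu}-1+zu)\ell(i,\mathrm{d}u)$ with $b\in\mathcal{B}(\mathbb{N})$, $c\in\mathcal{B}^+(\mathbb{N})$ and $(u\wedge u^2)\ell(i,\mathrm{d}u)$ a bounded kernel from $\mathbb{N}$ to $(0,\infty)$; $\phi(i,f)=-\beta(i)\left[d(i)\langle f,\pi_i\rangle+\int_0^\infty(1-e^{-u\langle f,\pi_i\rangle})\mathrm{n}(i,\mathrm{d}u)\right]$ with $d,\beta\in\mathcal{B}^+(\mathbb{N})$, $\pi_i$ a probability distribution on $\mathbb{N}\setminus\{i\}$, and $u\,\mathrm{n}(i,\mathrm{d}u)$ a bounded kernel from $\mathbb{N}$ to $(0,\infty)$ with $d(i)+\int_0^\infty u\,\mathrm{n}(i,\mathrm{d}u)\le1$.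 A $(\psi,\phi)$-MCSBP is a $[0,\infty)^{\mathbb{N}}$-valued strong Markov process $X=(X_t,t\ge0)$ with laws $\{\mathbf{P}_\mu:\mu\in\mathcal{M}(\mathbb{N})\}$ (with $X_0=\mu$ under $\mathbf{P}_\mu$) such that $\mathbf{E}_\mu[e^{-\langle f,X_t\rangle}]=\exp\{-\langle V_tf,\mu\rangle\}$ for $f\in\mathcal{B}^+(\mathbb{N})$, where $V_tf(i)=f(i)-\int_0^t[\psi(i,V_sf(i))+\phi(i,V_sf)]\mathrm{d}s$.
   Formalization: The equation is asserted at every i with w(i) < ∞, since w(i) = ∞ when the extinction probability from δ_i is 0 and the equation then has no meaning; "positive" for c, d, β means strictly positive, and X is taken with right-continuous coordinates and V_t f non-negative and locally bounded. *)

theory Defs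
  imports "HOL-Probability.Probability"
begin

text \<open>
  The countable type set \<open>{1, 2, \<dots>}\<close> is relabelled as the type \<^typ>\<open>nat\<close>; no order or arithmetic on
  types is ever used.  A measure on the type set is given by its point masses, i.e. as a function
  \<^typ>\<open>nat \<Rightarrow> real\<close>; vectors in \<open>[0,\<infinity>)\<^sup>\<nat>\<close> are such functions as well.
\<close>

definition bounded_funs :: "(nat \<Rightarrow> real) set" where
  "bounded_funs = {f. bounded (range f)}"

text \<open>
  Positive means strictly positive.  This matters for \<open>d\<close> below: if \<open>d i = 0 < \<beta> i\<close> is allowed,
  a single discrete offspring event can found countably many populations, each of which dies out
  although their total mass does not tend to \<open>0\<close>, and \<open>w\<close> need not be a solution.
\<close>

definition bounded_pos_funs :: "(nat \<Rightarrow> real) set" where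
  "bounded_pos_funs = {f \<in> bounded_funs. \<forall>i. 0 < f i}"

definition finite_measures :: "(nat \<Rightarrow> real) set" where
  "finite_measures = {\<mu>. (\<forall>i. 0 \<le> \<mu> i) \<and> summable \<mu>}"

definition unit_mass :: "nat \<Rightarrow> nat \<Rightarrow> real" where
  "unit_mass i = indicator {i}"

text \<open>The pairing \<open>\<langle>f, \<mu>\<rangle>\<close> of non-negative arguments; it is \<open>\<infinity>\<close> if the series diverges.\<close>

definition pairing :: "(nat \<Rightarrow> ennreal) \<Rightarrow> (nat \<Rightarrow> real) \<Rightarrow> ennreal" where
  "pairing f \<mu> = (\<Sum>i. f i * ennreal (\<mu> i))"

text \<open>\<open>exp (- x)\<close> on \<open>[0,\<infinity>]\<close> and \<open>- log p\<close> on \<open>[0,1]\<close>, with \<open>exp (- \<infinity>) = 0\<close> and \<open>- log 0 = \<infinity>\<close>.\<close>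

definition exp_neg :: "ennreal \<Rightarrow> real" where
  "exp_neg x = (if x = \<infinity> then 0 else exp (- enn2real x))"

definition neg_log :: "real \<Rightarrow> ennreal" where
  "neg_log p = (if p = 0 then \<infinity> else ennreal (- ln p))"


section \<open>Mechanisms\<close>

definition psi ::
  "(nat \<Rightarrow> real) \<Rightarrow> (nat \<Rightarrow> real) \<Rightarrow> (nat \<Rightarrow> real measure) \<Rightarrow> nat \<Rightarrow> real \<Rightarrow> real" where
  "psi b c l i z = b i * z + c i * z\<^sup>2 + (\<integral>u. (exp (- z * u) - 1 + z * u) \<partial>l i)"

text \<open>Meaningful whenever \<open>\<langle>f, \<pi>\<^sub>i\<rangle> < \<infinity>\<close>, in particular for bounded \<open>f\<close>.\<close>

definition phi ::
  "(nat \<Rightarrow> real) \<Rightarrow> (nat \<Rightarrow> real) \<Rightarrow> (nat \<Rightarrow> nat pmf) \<Rightarrow> (nat \<Rightarrow> real measure)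
    \<Rightarrow> nat \<Rightarrow> (nat \<Rightarrow> ennreal) \<Rightarrow> real" where
  "phi \<beta> d \<pi> n i f =
     (let m = enn2real (pairing f (pmf (\<pi> i)))
      in - \<beta> i * (d i * m + (\<integral>u. (1 - exp (- u * m)) \<partial>n i)))"

definition local_mechanism ::
  "(nat \<Rightarrow> real) \<Rightarrow> (nat \<Rightarrow> real) \<Rightarrow> (nat \<Rightarrow> real measure) \<Rightarrow> bool" where
  "local_mechanism b c l \<longleftrightarrow>
     b \<in> bounded_funs \<and> c \<in> bounded_pos_funs \<and>
     (\<forall>i. sets (l i) = sets (restrict_space borel {0<..})) \<and>
     (\<exists>K::real. \<forall>i. (\<integral>\<^sup>+u. ennreal (min u (u\<^sup>2)) \<partial>l i) \<le> ennreal K)"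

definition nonlocal_mechanism ::
  "(nat \<Rightarrow> real) \<Rightarrow> (nat \<Rightarrow> real) \<Rightarrow> (nat \<Rightarrow> nat pmf) \<Rightarrow> (nat \<Rightarrow> real measure) \<Rightarrow> bool" where
  "nonlocal_mechanism \<beta> d \<pi> n \<longleftrightarrow>
     \<beta> \<in> bounded_pos_funs \<and> d \<in> bounded_pos_funs \<and>
     (\<forall>i. i \<notin> set_pmf (\<pi> i)) \<and>
     (\<forall>i. sets (n i) = sets (restrict_space borel {0<..})) \<and>
     (\<forall>i. ennreal (d i) + (\<integral>\<^sup>+u. ennreal u \<partial>n i) \<le> 1)"


section \<open>Strong Markov processes\<close>

text \<open>
  Time ranges over \<open>[0,\<infinity>)\<close>; values of \<open>X\<close> at negative times are irrelevant.  The filtration is indexed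
  by \<open>[0,\<infinity>]\<close>, so that stopping times may be infinite.
\<close>

definition natural_filtration ::
  "'w measure \<Rightarrow> (real \<Rightarrow> 'w \<Rightarrow> nat \<Rightarrow> real) \<Rightarrow> ennreal \<Rightarrow> 'w measure" where
  "natural_filtration \<Omega> X t =
     sigma (space \<Omega>) {X s -` B \<inter> space \<Omega> | s B. 0 \<le> s \<and> ennreal s \<le> t \<and> B \<in> sets borel}"

text \<open>
  The process takes values in \<open>[0,\<infinity>)\<^sup>\<nat>\<close> with right-continuous paths in the product topology, and its
  laws are indexed by the finite measures.  It is strong Markov with respect to its natural
  filtration, the weakest choice; on \<open>T < \<infinity>\<close> the state \<open>X\<^sub>T\<close> has to be almost surely a finite measure
  for \<open>P (X\<^sub>T)\<close> to make sense.
\<close>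

definition strong_markov_process ::
  "'w measure \<Rightarrow> (real \<Rightarrow> 'w \<Rightarrow> nat \<Rightarrow> real) \<Rightarrow> ((nat \<Rightarrow> real) \<Rightarrow> 'w measure) \<Rightarrow> bool" where
  "strong_markov_process \<Omega> X P \<longleftrightarrow>
     (\<forall>t\<ge>0. X t \<in> \<Omega> \<rightarrow>\<^sub>M borel) \<and>
     (\<forall>\<omega>\<in>space \<Omega>. \<forall>t\<ge>0. (\<forall>i. 0 \<le> X t \<omega> i) \<and> continuous (at_right t) (\<lambda>s. X s \<omega>)) \<and>
     (\<forall>\<mu>\<in>finite_measures. prob_space (P \<mu>) \<and> sets (P \<mu>) = sets \<Omega> \<and> (AE \<omega> in P \<mu>. X 0 \<omega> = \<mu>)) \<and>
     (\<forall>t\<ge>0. \<forall>B\<in>sets borel.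
        (\<lambda>\<mu>. measure (P \<mu>) {\<omega>\<in>space \<Omega>. X t \<omega> \<in> B})
          \<in> borel_measurable (restrict_space borel finite_measures)) \<and>
     (\<forall>\<mu>\<in>finite_measures. \<forall>T. stopping_time (natural_filtration \<Omega> X) T \<longrightarrow>
        (AE \<omega> in P \<mu>. T \<omega> < \<infinity> \<longrightarrow> X (enn2real (T \<omega>)) \<omega> \<in> finite_measures) \<and>
        (\<forall>t\<ge>0. \<forall>B\<in>sets borel.
           AE \<omega> in P \<mu>. T \<omega> < \<infinity> \<longrightarrow>
             real_cond_exp (P \<mu>)
               (filtration.pre_sigma (space \<Omega>) (natural_filtration \<Omega> X) T)
               (indicator {\<omega>\<in>space \<Omega>. T \<omega> < \<infinity> \<and> X (enn2real (T \<omega>) + t) \<omega> \<in> B}) \<omega>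
             = measure (P (X (enn2real (T \<omega>)) \<omega>)) {\<omega>'\<in>space \<Omega>. X t \<omega>' \<in> B}))"


section \<open>Multi-type continuous-state branching processes\<close>

text \<open>
  As usual, the solution \<open>V\<close> of the evolution equation is non-negative and locally bounded in time,
  uniformly over types.
\<close>

definition is_mcsbp ::
  "(nat \<Rightarrow> real) \<Rightarrow> (nat \<Rightarrow> real) \<Rightarrow> (nat \<Rightarrow> real measure)
    \<Rightarrow> (nat \<Rightarrow> real) \<Rightarrow> (nat \<Rightarrow> real) \<Rightarrow> (nat \<Rightarrow> nat pmf) \<Rightarrow> (nat \<Rightarrow> real measure)
    \<Rightarrow> 'w measure \<Rightarrow> (real \<Rightarrow> 'w \<Rightarrow> nat \<Rightarrow> real) \<Rightarrow> ((nat \<Rightarrow> real) \<Rightarrow> 'w measure) \<Rightarrow> bool" where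
  "is_mcsbp b c l \<beta> d \<pi> n \<Omega> X P \<longleftrightarrow>
     strong_markov_process \<Omega> X P \<and>
     (\<exists>V :: real \<Rightarrow> (nat \<Rightarrow> real) \<Rightarrow> nat \<Rightarrow> real. \<forall>f\<in>bounded_pos_funs. \<forall>t\<ge>0.
        (\<forall>i. 0 \<le> V t f i) \<and>
        (\<exists>K. \<forall>s\<in>{0..t}. \<forall>i. V s f i \<le> K) \<and>
        (\<forall>i. set_integrable lborel {0..t}
               (\<lambda>s. psi b c l i (V s f i) + phi \<beta> d \<pi> n i (\<lambda>j. ennreal (V s f j)))) \<and>
        (\<forall>i. V t f i = f i - (LINT s:{0..t}|lborel.
               psi b c l i (V s f i) + phi \<beta> d \<pi> n i (\<lambda>j. ennreal (V s f j)))) \<and>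
        (\<forall>\<mu>\<in>finite_measures.
           (\<integral>\<omega>. exp_neg (pairing (\<lambda>j. ennreal (f j)) (X t \<omega>)) \<partial>P \<mu>)
             = exp_neg (pairing (\<lambda>j. ennreal (V t f j)) \<mu>)))"

definition extinction :: "'w measure \<Rightarrow> (real \<Rightarrow> 'w \<Rightarrow> nat \<Rightarrow> real) \<Rightarrow> 'w set" where
  "extinction \<Omega> X = {\<omega>\<in>space \<Omega>. ((\<lambda>t. pairing (\<lambda>_. 1) (X t \<omega>)) \<longlongrightarrow> 0) at_top}"

text \<open>
  Right-continuity of the coordinates makes extinction an event, so that its probability is not a
  default value: the total mass is lower semicontinuous from the right, hence its suprema over
  half-lines are suprema over rational times.
\<close>

lemma total_mass_le_if_rational:
  fixes X :: "real \<Rightarrow> nat \<Rightarrow> real"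
  assumes rc: "continuous (at_right t) X"
    and le: "\<And>q. q \<in> \<rat> \<Longrightarrow> t < q \<Longrightarrow> pairing (\<lambda>_. 1) (X q) \<le> e"
  shows "pairing (\<lambda>_. 1) (X t) \<le> e"
proof -
  have fin: "(\<Sum>i<n. ennreal (X t i)) \<le> e" for n
  proof -
    have "((\<lambda>s. X s i) \<longlongrightarrow> X t i) (at_right t)" for i
      using continuous_on_tendsto_compose[OF continuous_on_product_coordinates
          rc[unfolded continuous_within]] by simp
    then have lim: "((\<lambda>s. \<Sum>i<n. ennreal (X s i)) \<longlongrightarrow> (\<Sum>i<n. ennreal (X t i))) (at_right t)"
      by (intro tendsto_sum tendsto_ennrealI)
    show ?thesis
    proof (rule ccontr)
      assume "\<not> ?thesis"
      then have "\<forall>\<^sub>F s in at_right t. e < (\<Sum>i<n. ennreal (X s i))"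
        by (intro order_tendstoD(1)[OF lim]) simp
      then obtain b where b: "b > t" "\<And>s. t < s \<Longrightarrow> s < b \<Longrightarrow> e < (\<Sum>i<n. ennreal (X s i))"
        unfolding eventually_at_right_field by blast
      obtain q where q: "q \<in> \<rat>" "t < q" "q < b"
        using Rats_dense_in_real[OF b(1)] by blast
      have "(\<Sum>i<n. ennreal (X q i)) \<le> pairing (\<lambda>_. 1) (X q)"
        unfolding pairing_def by (simp add: sum_le_suminf)
      with b(2)[OF q(2,3)] le[OF q(1,2)] show False
        by (meson leD le_less_trans less_le_trans)
    qed
  qed
  show ?thesis
    unfolding pairing_def by (simp add: suminf_le_const[OF summableI] fin)
qed

lemma extinction_in_sets:
  assumes "strong_markov_process \<Omega> X P"
  shows "extinction \<Omega> X \<in> sets \<Omega>"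
proof -
  have X [measurable]: "X t \<in> \<Omega> \<rightarrow>\<^sub>M borel" if "0 \<le> t" for t
    using assms that unfolding strong_markov_process_def by blast
  have rc: "continuous (at_right t) (\<lambda>s. X s \<omega>)" if "\<omega> \<in> space \<Omega>" "0 \<le> t" for \<omega> t
    using assms that unfolding strong_markov_process_def by blast
  have coord: "(\<lambda>\<omega>. X t \<omega> i) \<in> borel_measurable \<Omega>" if "0 \<le> t" for t i
    by (rule measurable_compose[OF X[OF that]
          borel_measurable_continuous_onI[OF continuous_on_product_coordinates]])
  have mass [measurable]: "(\<lambda>\<omega>. pairing (\<lambda>_. 1) (X t \<omega>)) \<in> borel_measurable \<Omega>" if "0 \<le> t" for t
    using coord[OF that] unfolding pairing_def by measurable
  define R where "R m = {q::real. q \<in> \<rat> \<and> real m < q}" for m :: nat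
  have ctbl: "countable (R m)" for m
    unfolding R_def by (rule countable_subset[OF _ countable_rat]) auto
  have "(((\<lambda>t. pairing (\<lambda>_. 1) (X t \<omega>)) \<longlongrightarrow> 0) at_top)
      \<longleftrightarrow> (\<forall>k. \<exists>m. \<forall>q\<in>R m. pairing (\<lambda>_. 1) (X q \<omega>) \<le> ennreal (1 / Suc k))"
    (is "?L \<longleftrightarrow> ?R") if \<omega>: "\<omega> \<in> space \<Omega>" for \<omega>
  proof
    assume ?L
    show ?R
    proof
      fix k
      have "\<forall>\<^sub>F t in at_top. pairing (\<lambda>_. 1) (X t \<omega>) < ennreal (1 / Suc k)"
        by (rule order_tendstoD(2)[OF \<open>?L\<close>]) simp
      then obtain N where N: "\<And>t. N \<le> t \<Longrightarrow> pairing (\<lambda>_. 1) (X t \<omega>) < ennreal (1 / Suc k)"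
        by (auto simp: eventually_at_top_linorder)
      obtain m where "N \<le> real m" by (rule real_arch_simple[THEN exE])
      then have "\<forall>q\<in>R m. pairing (\<lambda>_. 1) (X q \<omega>) \<le> ennreal (1 / Suc k)"
        using N unfolding R_def by (fastforce intro: less_imp_le)
      then show "\<exists>m. \<forall>q\<in>R m. pairing (\<lambda>_. 1) (X q \<omega>) \<le> ennreal (1 / Suc k)" ..
    qed
  next
    assume r: ?R
    show ?L
    proof (rule order_tendstoI)
      fix e :: ennreal assume "0 < e"
      obtain k :: nat where k: "ennreal (1 / Suc k) < e"
      proof (cases "e = \<infinity>")
        case True
        then show ?thesis using that[of 0] by simp
      next
        case False
        then have "0 < enn2real e" using \<open>0 < e\<close> by (simp add: enn2real_positive_iff less_top)
        then obtain k where "1 / Suc k < enn2real e"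
          using nat_approx_posE by blast
        then have "ennreal (1 / Suc k) < ennreal (enn2real e)"
          by (intro ennreal_lessI \<open>0 < enn2real e\<close>)
        then show ?thesis using that False by (simp add: less_top)
      qed
      obtain m where m: "\<And>q. q \<in> R m \<Longrightarrow> pairing (\<lambda>_. 1) (X q \<omega>) \<le> ennreal (1 / Suc k)"
        using r by blast
      have "pairing (\<lambda>_. 1) (X t \<omega>) < e" if "real m \<le> t" for t
      proof -
        have "0 \<le> t" using that by (meson of_nat_0_le_iff order_trans)
        have "pairing (\<lambda>_. 1) (X t \<omega>) \<le> ennreal (1 / Suc k)"
          by (rule total_mass_le_if_rational[where X = "\<lambda>s. X s \<omega>", OF rc[OF \<omega> \<open>0 \<le> t\<close>]])
            (use m that in \<open>auto simp: R_def\<close>)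
        with k show ?thesis by (rule le_less_trans[rotated])
      qed
      then show "\<forall>\<^sub>F t in at_top. pairing (\<lambda>_. 1) (X t \<omega>) < e"
        unfolding eventually_at_top_linorder by blast
    qed simp
  qed
  then have eq: "extinction \<Omega> X = {\<omega>\<in>space \<Omega>. \<forall>k. \<exists>m. \<forall>q\<in>R m.
      pairing (\<lambda>_. 1) (X q \<omega>) \<le> ennreal (1 / Suc k)}"
    unfolding extinction_def by blast
  have "{\<omega>\<in>space \<Omega>. pairing (\<lambda>_. 1) (X q \<omega>) \<le> ennreal (1 / Suc k)} \<in> sets \<Omega>"
    if "q \<in> R m" for q m k
  proof -
    have "0 \<le> q" using that unfolding R_def by (auto intro: order_trans[OF of_nat_0_le_iff less_imp_le])
    from mass[OF this] show ?thesis by measurable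
  qed
  then have "{\<omega>\<in>space \<Omega>. \<forall>q\<in>R m. pairing (\<lambda>_. 1) (X q \<omega>) \<le> ennreal (1 / Suc k)} \<in> sets \<Omega>" for m k
    by (rule sets.sets_Collect_countable_All'[OF _ ctbl])
  then show ?thesis
    unfolding eq by (intro sets.sets_Collect_countable_All sets.sets_Collect_countable_Ex)
qed

end

theory Submission
  imports Defs
begin

text \<open>
  Let \<open>\<E>\<close> be the event of extinction.  If the extinction probability were multiplicative over all
  types, invariance of \<open>\<E>\<close> under time shifts would make \<open>w\<close> a fixed point of the cumulant semigroup,
  and differentiating at time \<open>0\<close> would give the equation.  But over infinitely many types
  multiplicativity can fail: the extinction probability started from \<open>\<mu>\<close> may vanish although
  \<open>\<langle>w, \<mu>\<rangle>\<close> is finite.  The proof therefore works with \<open>\<kappa> = - log P\<^sub>\<pi>(\<E>)\<close>, the exponent of a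
  population distributed like the offspring \<open>\<pi>\<close> of type \<open>i\<close>.  It shows \<open>\<psi>(i, w(i)) = \<rho>(i, \<kappa>)\<close> with
  \<open>\<kappa> < \<infinity>\<close>, where \<open>\<rho>(i, \<langle>f, \<pi>\<rangle>) = - \<phi>(i, f)\<close>, and only then that \<open>\<kappa> = \<langle>w, \<pi>\<rangle>\<close>.
  
  Extinction has to be approximated by functionals with computable expectations.  For a large rate the
  potential \<open>Y\<^sub>t = \<integral> exp (- 8 B r) \<langle>1, X\<^bsub>t+r\<^esub>\<rangle> dr\<close> is finite in mean.  The joint Laplace transforms
  of the \<open>Y\<^bsub>\<sigma>+k\<^esub>\<close>, \<open>k = 0, 1, \<dots>\<close>, have the form \<open>exp (- \<langle>V\<^sub>\<sigma> F, \<mu>\<rangle>)\<close> (\<open>potential_laplace\<close>), so they inherit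
  the branching property and the evolution equation in \<open>\<sigma>\<close>.  Up to null sets \<open>\<E>\<close> is the event
  that \<open>Y\<^sub>k\<close> tends to \<open>0\<close> (\<open>prob_potential_extinction\<close>): while the potential is small, a mass above a
  fixed threshold is unlikely.  The indicator of null sequences is an iterated pointwise limit of
  combinations of exponentials that are decreasing in every coordinate (\<open>antitone_test_vanishing\<close>).
  
  Let \<open>G\<close> be such a decreasing combination, and take independent populations started from \<open>a \<delta>\<^sub>i\<close> and
  \<open>m \<pi>\<close>.  Let \<open>R(\<sigma>, a, m)\<close> be the expectation of \<open>G\<close> at the sum of \<open>\<lambda> Y\<^sub>\<sigma>\<close> of the first and \<open>\<lambda>' Y\<^sub>\<tau>\<close> of
  the second.  The evolution equation expresses the derivative of \<open>R\<close> in \<open>\<sigma>\<close> by the branching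
  mechanism acting on \<open>a\<close> and by the event that offspring enter the first population.  The potential
  satisfies \<open>Y\<^bsub>t+s\<^esub> \<le> exp (8 B s) Y\<^sub>t\<close>, so the factors can be chosen with \<open>\<lambda> Y\<^sub>\<sigma> \<le> \<lambda>' Y\<^sub>\<tau>\<close> for all
  \<open>\<sigma>\<close> in \<open>[0,1]\<close>.  Letting the offspring enter the second population instead then lowers \<open>G\<close>, which turns
  the equation into an inequality that involves \<open>R\<close> only.  Smearing \<open>a\<close> and \<open>m\<close> moves all
  derivatives to the weights, and the inequality survives pointwise limits
  (\<open>generator_ineq_limit\<close>).  For the indicator of null sequences neither \<open>\<sigma>\<close> nor the factors matter,
  \<open>R\<close> becomes \<open>exp (- a w(i)) exp (- m \<kappa>)\<close>, and the inequality reads \<open>\<psi>(i, w(i)) \<le> \<rho>(i, \<kappa>)\<close>.  The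
  factors with \<open>\<lambda> Y\<^sub>\<sigma> \<ge> \<lambda>' Y\<^sub>\<tau>\<close> give the reverse inequality, and they exclude \<open>\<kappa> = \<infinity>\<close> because
  \<open>\<beta>(i) d(i) > 0\<close> (\<open>extinction_equation\<close>).
  
  For \<open>\<kappa> = \<langle>w, \<pi>\<rangle>\<close>, split \<open>\<pi>\<close> into its restriction to the first \<open>N\<close> types, on which extinction is
  multiplicative, and a remainder of small mass.  A zero-one law shows that the remainder dies out with
  probability tending to \<open>1\<close> (\<open>small_population_dies\<close>, \<open>potential_extinction_mixture\<close>).
\<close>

section \<open>Branching mechanisms\<close>

lemma exp_neg_remainder_bounds:
  fixes x :: real
  assumes "0 \<le> x"
  shows "0 \<le> exp (- x) - 1 + x" "exp (- x) - 1 + x \<le> x" "exp (- x) - 1 + x \<le> x\<^sup>2"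
proof -
  show "0 \<le> exp (- x) - 1 + x" using exp_ge_add_one_self[of "- x"] by simp
  show le: "exp (- x) - 1 + x \<le> x" using assms by simp
  show "exp (- x) - 1 + x \<le> x\<^sup>2"
  proof (cases "x \<le> 1")
    case True
    have 1: "exp (- x) * (1 + x) \<le> 1"
      using mult_left_mono[OF exp_ge_add_one_self[of x], of "exp (- x)"]
      by (simp add: exp_minus_inverse mult.commute)
    have "(exp (- x) - 1 + x - x\<^sup>2) * (1 + x) = exp (- x) * (1 + x) - 1 - x ^ 3"
      by (simp add: algebra_simps power2_eq_square power3_eq_cube)
    also have "\<dots> \<le> 0" using 1 zero_le_power[OF assms, of 3] by linarith
    finally show ?thesis using assms by (simp add: mult_le_0_iff)
  next
    case False
    then have "x \<le> x\<^sup>2" by (simp add: power2_eq_square)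
    then show ?thesis using le by linarith
  qed
qed

locale mechanism =
  fixes b c \<beta> d :: "nat \<Rightarrow> real" and l n :: "nat \<Rightarrow> real measure" and \<pi> :: "nat \<Rightarrow> nat pmf"
  assumes loc: "local_mechanism b c l" and nonloc: "nonlocal_mechanism \<beta> d \<pi> n"
begin

lemma exists_common_bound:
  "\<exists>B\<ge>1. \<forall>i. \<bar>b i\<bar> \<le> B \<and> c i \<le> B \<and> \<beta> i \<le> B \<and> (\<integral>\<^sup>+u. ennreal (min u (u\<^sup>2)) \<partial>l i) \<le> ennreal B"
proof -
  obtain B1 where B1: "\<And>i. \<bar>b i\<bar> \<le> B1"
    using loc unfolding local_mechanism_def bounded_funs_def bounded_iff by auto
  obtain B2 where B2: "\<And>i. \<bar>c i\<bar> \<le> B2"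
    using loc unfolding local_mechanism_def bounded_pos_funs_def bounded_funs_def bounded_iff by auto
  obtain B3 where B3: "\<And>i. \<bar>\<beta> i\<bar> \<le> B3"
    using nonloc unfolding nonlocal_mechanism_def bounded_pos_funs_def bounded_funs_def bounded_iff by auto
  obtain B4 where B4: "\<And>i. (\<integral>\<^sup>+u. ennreal (min u (u\<^sup>2)) \<partial>l i) \<le> ennreal B4"
    using loc unfolding local_mechanism_def by auto
  show ?thesis
  proof (intro exI[of _ "max 1 (max (max B1 B2) (max B3 B4))"] conjI allI)
    fix i
    show "(\<integral>\<^sup>+u. ennreal (min u (u\<^sup>2)) \<partial>l i) \<le> ennreal (max 1 (max (max B1 B2) (max B3 B4)))"
      by (rule order_trans[OF B4]) (intro ennreal_leI, auto)
  qed (use B1 B2 B3 in \<open>auto simp: le_max_iff_disj intro: order_trans[OF abs_ge_self]\<close>)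
qed

text \<open>
  One constant for all bounds makes the growth rates uniform over the types.
\<close>

definition B :: real where
  "B = (SOME B. B \<ge> 1 \<and> (\<forall>i. \<bar>b i\<bar> \<le> B \<and> c i \<le> B \<and> \<beta> i \<le> B \<and>
     (\<integral>\<^sup>+u. ennreal (min u (u\<^sup>2)) \<partial>l i) \<le> ennreal B))"

lemma B_ge_1: "1 \<le> B" and B_pos: "0 < B"
  and b_le: "\<bar>b i\<bar> \<le> B" and c_le: "c i \<le> B" and \<beta>_le: "\<beta> i \<le> B"
  and l_le: "(\<integral>\<^sup>+u. ennreal (min u (u\<^sup>2)) \<partial>l i) \<le> ennreal B"
proof -
  have *: "B \<ge> 1 \<and> (\<forall>i. \<bar>b i\<bar> \<le> B \<and> c i \<le> B \<and> \<beta> i \<le> B \<and>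
     (\<integral>\<^sup>+u. ennreal (min u (u\<^sup>2)) \<partial>l i) \<le> ennreal B)"
    unfolding B_def by (rule someI_ex) (rule exists_common_bound)
  then show "1 \<le> B" "0 < B" "\<bar>b i\<bar> \<le> B" "c i \<le> B" "\<beta> i \<le> B"
    "(\<integral>\<^sup>+u. ennreal (min u (u\<^sup>2)) \<partial>l i) \<le> ennreal B" by auto
qed

lemma c_pos: "0 < c i" and \<beta>_pos: "0 < \<beta> i" and d_pos: "0 < d i"
  using loc nonloc unfolding local_mechanism_def nonlocal_mechanism_def bounded_pos_funs_def by auto

lemma sets_l: "sets (l i) = sets (restrict_space borel {0<..})"
  and sets_n: "sets (n i) = sets (restrict_space borel {0<..})"
  using loc nonloc unfolding local_mechanism_def nonlocal_mechanism_def by auto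

lemma space_l: "space (l i) = {0<..}" and space_n: "space (n i) = {0<..}"
  using sets_eq_imp_space_eq[OF sets_l] sets_eq_imp_space_eq[OF sets_n]
  by (auto simp: space_restrict_space)

lemma meas_l: "f \<in> borel_measurable borel \<Longrightarrow> f \<in> borel_measurable (l i)"
  and meas_n: "f \<in> borel_measurable borel \<Longrightarrow> f \<in> borel_measurable (n i)"
  for f :: "real \<Rightarrow> 'z::topological_space"
  by (simp_all add: measurable_cong_sets[OF sets_l refl] measurable_cong_sets[OF sets_n refl]
      measurable_restrict_space1)

lemma integrable_l: "integrable (l i) (\<lambda>u. min u (u\<^sup>2))"
  and integral_l_le: "(\<integral>u. min u (u\<^sup>2) \<partial>l i) \<le> B"
proof -
  show int: "integrable (l i) (\<lambda>u. min u (u\<^sup>2))"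
  proof (rule integrableI_nonneg)
    show "(\<integral>\<^sup>+u. ennreal (min u (u\<^sup>2)) \<partial>l i) < \<infinity>"
      using l_le by (rule le_less_trans) simp
  qed (auto intro: meas_l AE_I2 simp: space_l)
  have "ennreal (\<integral>u. min u (u\<^sup>2) \<partial>l i) \<le> ennreal B"
    using nn_integral_eq_integral[OF int AE_I2] l_le[of i] by (simp add: space_l)
  then show "(\<integral>u. min u (u\<^sup>2) \<partial>l i) \<le> B" using B_pos by (simp add: ennreal_le_iff)
qed

lemma integrable_n: "integrable (n i) (\<lambda>u. u)"
  and d_plus_integral_n: "d i + (\<integral>u. u \<partial>n i) \<le> 1"
proof -
  have le: "ennreal (d i) + (\<integral>\<^sup>+u. ennreal u \<partial>n i) \<le> 1"
    using nonloc unfolding nonlocal_mechanism_def by auto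
  have le1: "(\<integral>\<^sup>+u. ennreal u \<partial>n i) \<le> 1"
    by (rule order_trans[OF _ le]) simp
  show int: "integrable (n i) (\<lambda>u. u)"
  proof (rule integrableI_nonneg)
    show "(\<integral>\<^sup>+u. ennreal u \<partial>n i) < \<infinity>" using le1 by (rule le_less_trans) simp
  qed (auto intro: meas_n AE_I2 simp: space_n)
  have eq: "(\<integral>\<^sup>+u. ennreal u \<partial>n i) = ennreal (\<integral>u. u \<partial>n i)"
    by (rule nn_integral_eq_integral[OF int AE_I2]) (simp add: space_n)
  have "0 \<le> (\<integral>u. u \<partial>n i)" by (intro integral_nonneg_AE AE_I2) (auto simp: space_n)
  with le eq d_pos[of i] have "ennreal (d i + (\<integral>u. u \<partial>n i)) \<le> ennreal 1"
    by (simp add: ennreal_plus)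
  then show "d i + (\<integral>u. u \<partial>n i) \<le> 1" by (simp only: ennreal_le_iff)
qed

lemma exp_remainder_le:
  fixes u z :: real
  assumes "0 < u" "0 \<le> z"
  shows "0 \<le> exp (- z * u) - 1 + z * u" "exp (- z * u) - 1 + z * u \<le> (z + z\<^sup>2) * min u (u\<^sup>2)"
proof -
  have zu: "0 \<le> z * u" using assms by simp
  show "0 \<le> exp (- z * u) - 1 + z * u" using exp_neg_remainder_bounds(1)[OF zu] by simp
  have "exp (- z * u) - 1 + z * u \<le> min (z * u) (z\<^sup>2 * u\<^sup>2)"
    using exp_neg_remainder_bounds(2,3)[OF zu] by (simp add: power_mult_distrib)
  also have "\<dots> \<le> (z + z\<^sup>2) * min u (u\<^sup>2)"
  proof (cases "u \<le> u\<^sup>2")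
    case True
    have "z * u \<le> (z + z\<^sup>2) * u" using assms by (intro mult_right_mono) auto
    then show ?thesis using True by (simp add: min_le_iff_disj)
  next
    case False
    have "z\<^sup>2 * u\<^sup>2 \<le> (z + z\<^sup>2) * u\<^sup>2" using assms by (intro mult_right_mono) auto
    then show ?thesis using False by (simp add: min_le_iff_disj)
  qed
  finally show "exp (- z * u) - 1 + z * u \<le> (z + z\<^sup>2) * min u (u\<^sup>2)" .
qed

lemma integrable_exp_remainder:
  assumes "0 \<le> z"
  shows "integrable (l i) (\<lambda>u. exp (- z * u) - 1 + z * u)"
  by (rule Bochner_Integration.integrable_bound[where f = "\<lambda>u. (z + z\<^sup>2) * min u (u\<^sup>2)",
        OF integrable_mult_right[OF integrable_l]])
    (use exp_remainder_le[OF _ assms] assms in \<open>auto intro!: meas_l AE_I2 simp: space_l abs_mult\<close>)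

lemma integrable_one_minus_exp:
  assumes "0 \<le> z"
  shows "integrable (n i) (\<lambda>u. 1 - exp (- u * z))"
proof (rule Bochner_Integration.integrable_bound[where f = "\<lambda>u. z * u", OF integrable_mult_right[OF integrable_n]])
  show "AE u in n i. norm (1 - exp (- u * z)) \<le> norm (z * u)"
  proof (rule AE_I2)
    fix u assume "u \<in> space (n i)"
    then show "norm (1 - exp (- u * z)) \<le> norm (z * u)"
      using exp_ge_add_one_self[of "- u * z"] assms by (simp add: space_n mult.commute)
  qed
qed (auto intro!: meas_n)

abbreviation \<psi> :: "nat \<Rightarrow> real \<Rightarrow> real" where "\<psi> \<equiv> psi b c l"

text \<open>
  The mechanism \<open>\<phi>\<close> depends on its second argument through the pairing with \<open>\<pi>\<^sub>i\<close> only.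
\<close>

definition \<rho> :: "nat \<Rightarrow> real \<Rightarrow> real" where
  "\<rho> i m = \<beta> i * (d i * m + (\<integral>u. (1 - exp (- u * m)) \<partial>n i))"

lemma phi_eq: "phi \<beta> d \<pi> n i f = - \<rho> i (enn2real (pairing f (pmf (\<pi> i))))"
  unfolding phi_def \<rho>_def Let_def by simp

lemma psi_bounds:
  assumes "0 \<le> z"
  shows "- (B * z) \<le> \<psi> i z" "\<psi> i z \<le> 2 * B * (z + z\<^sup>2)"
proof -
  have 1: "0 \<le> (\<integral>u. (exp (- z * u) - 1 + z * u) \<partial>l i)"
    by (intro integral_nonneg_AE AE_I2 exp_remainder_le(1)) (use assms in \<open>auto simp: space_l\<close>)
  have "(\<integral>u. (exp (- z * u) - 1 + z * u) \<partial>l i) \<le> (\<integral>u. (z + z\<^sup>2) * min u (u\<^sup>2) \<partial>l i)"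
    by (intro integral_mono_AE integrable_exp_remainder integrable_mult_right integrable_l assms
        AE_I2 exp_remainder_le(2)) (use assms in \<open>auto simp: space_l\<close>)
  also have "\<dots> \<le> (z + z\<^sup>2) * B"
    using integral_l_le assms by (simp add: mult_left_mono)
  finally have 2: "(\<integral>u. (exp (- z * u) - 1 + z * u) \<partial>l i) \<le> (z + z\<^sup>2) * B" .
  have b: "\<bar>b i * z\<bar> \<le> B * z" using b_le[of i] assms by (simp add: abs_mult mult_right_mono)
  have c: "0 \<le> c i * z\<^sup>2" "c i * z\<^sup>2 \<le> B * z\<^sup>2"
    using c_le[of i] c_pos[of i] by (auto simp: mult_right_mono)
  show "- (B * z) \<le> \<psi> i z" unfolding psi_def using 1 b c by linarith
  show "\<psi> i z \<le> 2 * B * (z + z\<^sup>2)" unfolding psi_def using 2 b c by (simp add: algebra_simps)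
qed

lemma rho_bounds:
  assumes "0 \<le> z"
  shows "0 \<le> \<rho> i z" "\<rho> i z \<le> B * z"
proof -
  have 0: "0 \<le> (\<integral>u. (1 - exp (- u * z)) \<partial>n i)"
    by (intro integral_nonneg_AE AE_I2) (use assms in \<open>auto simp: space_n\<close>)
  have "(\<integral>u. (1 - exp (- u * z)) \<partial>n i) \<le> (\<integral>u. z * u \<partial>n i)"
  proof (intro integral_mono_AE integrable_one_minus_exp assms integrable_mult_right integrable_n AE_I2)
    fix u show "1 - exp (- u * z) \<le> z * u"
      using exp_ge_add_one_self[of "- u * z"] by (simp add: mult.commute)
  qed
  then have "d i * z + (\<integral>u. (1 - exp (- u * z)) \<partial>n i) \<le> (d i + (\<integral>u. u \<partial>n i)) * z"
    by (simp add: algebra_simps)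
  also have "\<dots> \<le> 1 * z" by (intro mult_right_mono d_plus_integral_n assms)
  finally have 1: "d i * z + (\<integral>u. (1 - exp (- u * z)) \<partial>n i) \<le> z" by simp
  have 2: "0 \<le> d i * z + (\<integral>u. (1 - exp (- u * z)) \<partial>n i)"
    using 0 d_pos[of i] assms by simp
  show "0 \<le> \<rho> i z" unfolding \<rho>_def using 2 \<beta>_pos[of i] by simp
  show "\<rho> i z \<le> B * z"
    unfolding \<rho>_def using 1 2 \<beta>_pos[of i] \<beta>_le[of i] by (intro mult_mono) auto
qed

text \<open>
  At negative arguments the integral in \<open>\<psi>\<close> may diverge, and \<open>\<psi>\<close> may be a default value there.
\<close>

lemma psi_continuous: "continuous_on {0..} (\<psi> i)"
proof (rule continuous_on_sequentiallyI)
  fix x :: "nat \<Rightarrow> real" and a assume x: "\<forall>n. x n \<in> {0..}" "a \<in> {0..}" "x \<longlonglongrightarrow> a"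
  obtain M where M: "\<And>k. \<bar>x k\<bar> \<le> M"
    using Bseq_def[of x] convergent_imp_Bseq[of x] x(3) by (auto simp: convergent_def)
  have "M \<ge> 0" using M[of 0] by linarith
  have "(\<lambda>k. \<integral>u. (exp (- x k * u) - 1 + x k * u) \<partial>l i) \<longlonglongrightarrow> (\<integral>u. (exp (- a * u) - 1 + a * u) \<partial>l i)"
  proof (rule integral_dominated_convergence[where w = "\<lambda>u. (M + M\<^sup>2) * min u (u\<^sup>2)"])
    show "AE u in l i. norm (exp (- x k * u) - 1 + x k * u) \<le> (M + M\<^sup>2) * min u (u\<^sup>2)" for k
    proof (rule AE_I2)
      fix u assume "u \<in> space (l i)"
      then have u: "0 < u" by (simp add: space_l)
      have xk: "0 \<le> x k" "x k \<le> M" using x(1) M[of k] by auto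
      have "(x k + (x k)\<^sup>2) * min u (u\<^sup>2) \<le> (M + M\<^sup>2) * min u (u\<^sup>2)"
        using xk u by (intro mult_right_mono add_mono power_mono) auto
      with exp_remainder_le[OF u xk(1)] show "norm (exp (- x k * u) - 1 + x k * u) \<le> (M + M\<^sup>2) * min u (u\<^sup>2)"
        by simp
    qed
    show "AE u in l i. (\<lambda>k. exp (- x k * u) - 1 + x k * u) \<longlonglongrightarrow> exp (- a * u) - 1 + a * u"
      by (intro AE_I2 tendsto_intros x(3))
  qed (auto intro!: meas_l integrable_mult_right integrable_l)
  then show "(\<lambda>k. \<psi> i (x k)) \<longlonglongrightarrow> \<psi> i a"
    unfolding psi_def by (intro tendsto_intros x(3))
qed

lemma rho_continuous: "continuous_on {0..} (\<rho> i)"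
proof (rule continuous_on_sequentiallyI)
  fix x :: "nat \<Rightarrow> real" and a assume x: "\<forall>n. x n \<in> {0..}" "a \<in> {0..}" "x \<longlonglongrightarrow> a"
  obtain M where M: "\<And>k. \<bar>x k\<bar> \<le> M"
    using Bseq_def[of x] convergent_imp_Bseq[of x] x(3) by (auto simp: convergent_def)
  have "(\<lambda>k. \<integral>u. (1 - exp (- u * x k)) \<partial>n i) \<longlonglongrightarrow> (\<integral>u. (1 - exp (- u * a)) \<partial>n i)"
  proof (rule integral_dominated_convergence[where w = "\<lambda>u. M * u"])
    show "AE u in n i. norm (1 - exp (- u * x k)) \<le> M * u" for k
    proof (rule AE_I2)
      fix u assume "u \<in> space (n i)"
      then have u: "0 < u" by (simp add: space_n)
      have xk: "0 \<le> x k" "x k \<le> M" using x(1) M[of k] by auto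
      have "u * x k \<le> M * u" using xk u by (simp add: mult.commute mult_left_mono)
      then have "1 - exp (- u * x k) \<le> M * u"
        using exp_ge_add_one_self[of "- u * x k"] by linarith
      then show "norm (1 - exp (- u * x k)) \<le> M * u"
        using u xk(1) by simp
    qed
    show "AE u in n i. (\<lambda>k. 1 - exp (- u * x k)) \<longlonglongrightarrow> 1 - exp (- u * a)"
      by (intro AE_I2 tendsto_intros x(3))
  qed (auto intro!: meas_n integrable_mult_right integrable_n)
  then show "(\<lambda>k. \<rho> i (x k)) \<longlonglongrightarrow> \<rho> i a"
    unfolding \<rho>_def by (intro tendsto_intros x(3))
qed

end

section \<open>The generator inequality in weak form\<close>

text \<open>
  Weights on the mass \<open>a\<close> of the first population.  The densities \<open>x\<^sup>p exp (- x) / p!\<close> are closed under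
  differentiation: the derivative of the density of order \<open>p\<close> is the one of order \<open>p - 1\<close> minus itself.
\<close>

definition erlang :: "nat \<Rightarrow> real measure" where
  "erlang p = density lborel (\<lambda>x. ennreal (erlang_density p 1 x))"

definition unif01 :: "real measure" where
  "unif01 = density lborel (\<lambda>x. indicator {0..1} x)"

lemma erlang_prob: "prob_space (erlang p)"
  unfolding erlang_def by (rule prob_space_erlang_density) simp

lemma sets_erlang [measurable_cong, simp]: "sets (erlang p) = sets borel"
  and space_erlang [simp]: "space (erlang p) = UNIV"
  and sets_unif01 [measurable_cong, simp]: "sets unif01 = sets borel"
  and space_unif01 [simp]: "space unif01 = UNIV"
  unfolding erlang_def unif01_def by auto

lemma unif01_prob: "prob_space unif01"
  unfolding unif01_def
  by (rule prob_spaceI) (auto simp: emeasure_density indicator_inter_arith[symmetric])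

lemma AE_erlang: "AE a in erlang p. 0 \<le> a"
  unfolding erlang_def by (subst AE_density) (auto simp: erlang_density_def intro!: AE_I2)

lemma AE_unif01: "AE x in unif01. 0 \<le> x \<and> x \<le> 1"
  unfolding unif01_def by (subst AE_density) (auto intro!: AE_I2 split: split_indicator_asm)

lemma integral_unif01: "f \<in> borel_measurable borel \<Longrightarrow> (\<integral>x. f x \<partial>unif01) = (\<integral>x. indicator {0..1} x * f x \<partial>lborel)"
  for f :: "real \<Rightarrow> real"
proof -
  assume [measurable]: "f \<in> borel_measurable borel"
  have eq: "unif01 = density lborel (\<lambda>x. ennreal (indicator {0..1} x))"
    unfolding unif01_def by (simp add: ennreal_indicator)
  have "(\<integral>x. f x \<partial>unif01) = (\<integral>x. f x \<partial>density lborel (\<lambda>x. ennreal (indicator {0..1} x)))"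
    by (subst eq) (rule refl)
  also have "\<dots> = (\<integral>x. indicator {0..1} x * f x \<partial>lborel)"
    by (subst integral_density) auto
  finally show ?thesis .
qed

lemma abs_integral_le:
  fixes f g :: "'x \<Rightarrow> real"
  assumes g: "integrable M g" and m: "f \<in> borel_measurable M" and le: "\<And>x. x \<in> space M \<Longrightarrow> \<bar>f x\<bar> \<le> g x"
  shows "\<bar>\<integral>x. f x \<partial>M\<bar> \<le> (\<integral>x. g x \<partial>M)"
proof -
  have "AE x in M. norm (f x) \<le> norm (g x)"
  proof (rule AE_I2)
    fix x assume "x \<in> space M"
    from le[OF this] show "norm (f x) \<le> norm (g x)" unfolding real_norm_def by linarith
  qed
  with g m have f: "integrable M f"
    by (rule Bochner_Integration.integrable_bound)
  have "\<bar>\<integral>x. f x \<partial>M\<bar> \<le> (\<integral>x. \<bar>f x\<bar> \<partial>M)" by (rule integral_abs_bound)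
  also have "\<dots> \<le> (\<integral>x. g x \<partial>M)"
    using integrable_abs[OF f] g le by (rule integral_mono)
  finally show ?thesis .
qed

lemma laplace_erlang:
  assumes "0 \<le> v"
  shows "(\<integral>a. exp (- (a * v)) \<partial>erlang p) = 1 / (1 + v) ^ Suc p"
proof -
  have "(\<integral>a. exp (- (a * v)) \<partial>erlang p) = (\<integral>a. erlang_density p 1 a * exp (- (a * v)) \<partial>lborel)"
    unfolding erlang_def by (subst integral_density) auto
  also have "\<dots> = (\<integral>a. 1 / (1 + v) ^ Suc p * erlang_density p (1 + v) a \<partial>lborel)"
  proof (rule Bochner_Integration.integral_cong)
    fix x :: real
    define Q where "Q = (1 + v) ^ Suc p"
    have e: "exp (- x) * exp (- (x * v)) = exp (- (1 + v) * x)"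
      by (simp add: exp_add[symmetric] algebra_simps)
    have Q: "Q \<noteq> 0" using assms by (simp add: Q_def)
    have "x ^ p * exp (- x) / fact p * exp (- (x * v)) = x ^ p * (exp (- x) * exp (- (x * v))) / fact p"
      by simp
    also have "\<dots> = 1 / Q * (Q * x ^ p * exp (- (1 + v) * x) / fact p)"
      unfolding e using Q by simp
    finally show "erlang_density p 1 x * exp (- (x * v)) = 1 / (1 + v) ^ Suc p * erlang_density p (1 + v) x"
      unfolding erlang_density_def Q_def by simp
  qed simp
  also have "\<dots> = 1 / (1 + v) ^ Suc p * (\<integral>a. erlang_density p (1 + v) a \<partial>lborel)"
    by (rule integral_mult_right_zero)
  also have "(\<integral>a. erlang_density p (1 + v) a \<partial>lborel) = 1"
  proof -
    interpret prob_space "density lborel (\<lambda>x. ennreal (erlang_density p (1 + v) x))"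
      by (rule prob_space_erlang_density) (use assms in simp)
    have "(\<integral>x. (1::real) \<partial>density lborel (\<lambda>x. ennreal (erlang_density p (1 + v) x))) = 1"
      using prob_space by simp
    then show ?thesis using assms by (subst (asm) integral_density) auto
  qed
  finally show ?thesis by simp
qed

lemma integral_abs_le_bound:
  assumes "prob_space M" "\<And>x. \<bar>f x\<bar> \<le> (C::real)" "0 \<le> C"
  shows "\<bar>\<integral>x. f x \<partial>M\<bar> \<le> C"
proof (cases "integrable M f")
  case True
  interpret prob_space M by fact
  have "\<bar>\<integral>x. f x \<partial>M\<bar> \<le> (\<integral>x. \<bar>f x\<bar> \<partial>M)" by (rule integral_abs_bound)
  also have "\<dots> \<le> (\<integral>x. C \<partial>M)" using True assms by (intro integral_mono) auto
  also have "\<dots> = C" using prob_space by simp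
  finally show ?thesis .
qed (simp add: not_integrable_integral_eq assms)

lemma prob_tendsto_integral:
  fixes f :: "nat \<Rightarrow> 'x \<Rightarrow> real"
  assumes "prob_space M" "\<And>k. f k \<in> borel_measurable M" "\<And>x. (\<lambda>k. f k x) \<longlonglongrightarrow> g x"
    and "\<And>k x. \<bar>f k x\<bar> \<le> C"
  shows "(\<lambda>k. \<integral>x. f k x \<partial>M) \<longlonglongrightarrow> (\<integral>x. g x \<partial>M)"
proof -
  interpret prob_space M by fact
  show ?thesis
    by (rule integral_dominated_convergence[where w = "\<lambda>_. C"])
      (use assms in \<open>auto intro: borel_measurable_LIMSEQ_real\<close>)
qed

lemma bounded_integrable:
  fixes f :: "'x \<Rightarrow> real"
  assumes "prob_space M" "f \<in> borel_measurable M" "\<And>x. \<bar>f x\<bar> \<le> C"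
  shows "integrable M f"
proof -
  interpret prob_space M by fact
  show ?thesis by (rule integrable_const_bound[where B = C]) (use assms in auto)
qed

text \<open>
  The two averages are over windows of length \<open>1\<close> that differ in two pieces of length at most \<open>u\<close>.  This
  bound involves no derivative of \<open>f\<close> and dominates the offspring integral.
\<close>

lemma shift_difference_bound:
  fixes f :: "real \<Rightarrow> real"
  assumes [measurable]: "f \<in> borel_measurable borel" and le: "\<And>x. \<bar>f x\<bar> \<le> 1" and u: "0 \<le> u"
  shows "\<bar>\<integral>m. f m - f (m + u) \<partial>unif01\<bar> \<le> 2 * u"
proof -
  have int: "integrable lborel (\<lambda>x. indicator {a..b} x * f x)" for a b :: real
    by (rule Bochner_Integration.integrable_bound[of _ "\<lambda>x. indicator {a..b} x :: real"])
      (use le in \<open>auto split: split_indicator simp: emeasure_lborel_Icc_eq intro!: integrable_real_indicator\<close>)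
  have shift: "(\<integral>m. indicator {0..1} m * f (m + u) \<partial>lborel) = (\<integral>x. indicator {u..1+u} x * f x \<partial>lborel)"
    by (subst lborel_integral_real_affine[where c = 1 and t = u])
      (auto intro!: Bochner_Integration.integral_cong simp: add.commute split: split_indicator)
  have "integrable unif01 f" "integrable unif01 (\<lambda>m. f (m + u))"
    by (rule bounded_integrable[OF unif01_prob, where C = 1]; use le in simp)+
  then have "(\<integral>m. f m - f (m + u) \<partial>unif01) = (\<integral>m. f m \<partial>unif01) - (\<integral>m. f (m + u) \<partial>unif01)"
    by (rule Bochner_Integration.integral_diff)
  also have "\<dots> = (\<integral>x. indicator {0..1} x * f x \<partial>lborel) - (\<integral>x. indicator {u..1+u} x * f x \<partial>lborel)"
    by (simp add: integral_unif01 shift)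
  also have "\<dots> = (\<integral>x. indicator {0..1} x * f x - indicator {u..1+u} x * f x \<partial>lborel)"
    by (rule Bochner_Integration.integral_diff[symmetric]) (rule int)+
  also have "\<bar>\<dots>\<bar> \<le> (\<integral>x. \<bar>indicator {0..1} x * f x - indicator {u..1+u} x * f x\<bar> \<partial>lborel)"
    by (rule integral_abs_bound)
  also have "\<dots> \<le> (\<integral>x. indicator {0..u} x + indicator {1..1+u} x \<partial>lborel)"
    by (intro integral_mono Bochner_Integration.integrable_add integrable_abs Bochner_Integration.integrable_diff int)
      (use u in \<open>auto split: split_indicator intro: le order_trans[OF le]\<close>)
  also have "\<dots> = 2 * u"
    using u by (subst Bochner_Integration.integral_add) auto
  finally show ?thesis .
qed

text \<open>
  The expectation of \<open>R \<sigma> \<cdot> m\<close> over a population of random size, shifted by \<open>r\<close>.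
\<close>

definition smear :: "nat \<Rightarrow> (real \<Rightarrow> real \<Rightarrow> real \<Rightarrow> real) \<Rightarrow> real \<Rightarrow> real \<Rightarrow> real \<Rightarrow> real" where
  "smear p R r \<sigma> m = (\<integral>a. R \<sigma> (a + r) m \<partial>erlang p)"

definition bounded_meas3 :: "(real \<Rightarrow> real \<Rightarrow> real \<Rightarrow> real) \<Rightarrow> bool" where
  "bounded_meas3 R \<longleftrightarrow> (\<lambda>x. R (fst x) (fst (snd x)) (snd (snd x))) \<in> borel_measurable (borel \<Otimes>\<^sub>M borel \<Otimes>\<^sub>M borel)
     \<and> (\<forall>\<sigma> a m. \<bar>R \<sigma> a m\<bar> \<le> 1)"

lemma meas3D:
  assumes "bounded_meas3 R" and [measurable]: "f \<in> borel_measurable N" "g \<in> borel_measurable N" "h \<in> borel_measurable N"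
  shows "(\<lambda>x. R (f x) (g x) (h x)) \<in> borel_measurable N"
proof -
  have "(\<lambda>x. (f x, g x, h x)) \<in> N \<rightarrow>\<^sub>M borel \<Otimes>\<^sub>M borel \<Otimes>\<^sub>M borel" by measurable
  from measurable_compose[OF this assms(1)[unfolded bounded_meas3_def, THEN conjunct1]] show ?thesis by simp
qed

lemma smear_le: "bounded_meas3 R \<Longrightarrow> \<bar>smear p R r \<sigma> m\<bar> \<le> 1"
  unfolding smear_def bounded_meas3_def by (intro integral_abs_le_bound erlang_prob) auto

lemma smear_meas:
  assumes "bounded_meas3 R" and [measurable]: "f \<in> borel_measurable N" "g \<in> borel_measurable N" "h \<in> borel_measurable N"
  shows "(\<lambda>x. smear p R (f x) (g x) (h x)) \<in> borel_measurable N"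
proof -
  interpret erlang: prob_space "erlang p" by (rule erlang_prob)
  show ?thesis unfolding smear_def
    by (rule erlang.borel_measurable_lebesgue_integral)
      (auto simp: split_beta' intro!: meas3D[OF assms(1)])
qed

lemma smear_tendsto:
  assumes "\<And>k. bounded_meas3 (R k)" "\<And>\<sigma> a m. (\<lambda>k. R k \<sigma> a m) \<longlonglongrightarrow> R' \<sigma> a m"
  shows "(\<lambda>k. smear p (R k) r \<sigma> m) \<longlonglongrightarrow> smear p R' r \<sigma> m"
  unfolding smear_def
  by (rule prob_tendsto_integral[OF erlang_prob, where C = 1])
    (use assms in \<open>auto intro!: meas3D[OF assms(1)] simp: bounded_meas3_def\<close>)

lemma bounded_meas3_limit:
  assumes "\<And>k. bounded_meas3 (R k)" "\<And>\<sigma> a m. (\<lambda>k. R k \<sigma> a m) \<longlonglongrightarrow> R' \<sigma> a m"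
  shows "bounded_meas3 R'"
  unfolding bounded_meas3_def
proof (intro conjI allI)
  show "(\<lambda>x. R' (fst x) (fst (snd x)) (snd (snd x))) \<in> borel_measurable (borel \<Otimes>\<^sub>M borel \<Otimes>\<^sub>M borel)"
    by (rule borel_measurable_LIMSEQ_real[OF assms(2)]) (use assms(1) in \<open>auto simp: bounded_meas3_def\<close>)
  fix \<sigma> a m
  show "\<bar>R' \<sigma> a m\<bar> \<le> 1"
    by (rule LIMSEQ_le_const2[OF tendsto_rabs[OF assms(2)]]) (use assms(1) in \<open>auto simp: bounded_meas3_def\<close>)
qed

context mechanism begin

text \<open>
  For \<open>R = exp (- a v)\<close> this is the average of \<open>(exp (- u v) - 1 + u v) exp (- a v)\<close> under the weight of
  order \<open>2\<close>, with the derivative in \<open>a\<close> integrated by parts.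
\<close>

definition jump_term :: "(real \<Rightarrow> real \<Rightarrow> real \<Rightarrow> real) \<Rightarrow> real \<Rightarrow> real \<Rightarrow> real \<Rightarrow> real" where
  "jump_term R \<sigma> m u = smear 2 R u \<sigma> m - smear 2 R 0 \<sigma> m + u * (smear 1 R 0 \<sigma> m - smear 2 R 0 \<sigma> m)"

text \<open>
  The branching mechanism \<open>\<psi>(i, - \<partial>\<^sub>a)\<close> applied to \<open>R\<close> and tested against the weight of order \<open>2\<close>, whose
  first and second derivatives are combinations of the weights of orders \<open>0\<close> to \<open>2\<close>.
\<close>

definition weak_psi :: "nat \<Rightarrow> (real \<Rightarrow> real \<Rightarrow> real \<Rightarrow> real) \<Rightarrow> real \<Rightarrow> real \<Rightarrow> real" where
  "weak_psi i R \<sigma> m = b i * (smear 1 R 0 \<sigma> m - smear 2 R 0 \<sigma> m)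
     + c i * (smear 0 R 0 \<sigma> m - 2 * smear 1 R 0 \<sigma> m + smear 2 R 0 \<sigma> m) + (\<integral>u. jump_term R \<sigma> m u \<partial>l i)"

definition offspring_term :: "(real \<Rightarrow> real \<Rightarrow> real \<Rightarrow> real) \<Rightarrow> real \<Rightarrow> real \<Rightarrow> real" where
  "offspring_term R \<sigma> u = (\<integral>m. smear 2 R 0 \<sigma> m - smear 2 R 0 \<sigma> (m + u) \<partial>unif01)"

text \<open>
  The operator \<open>\<psi>(i, - \<partial>\<^sub>a) - \<rho>(i, - \<partial>\<^sub>m)\<close>, tested against the weight of order \<open>2\<close> in \<open>a\<close> and the uniform
  weight on \<open>[0,1]\<close> in \<open>m\<close>.  The uniform weight turns \<open>\<partial>\<^sub>m\<close> into a difference of boundary values.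
\<close>

definition weak_gen :: "nat \<Rightarrow> (real \<Rightarrow> real \<Rightarrow> real \<Rightarrow> real) \<Rightarrow> real \<Rightarrow> real" where
  "weak_gen i R \<sigma> = (\<integral>m. weak_psi i R \<sigma> m \<partial>unif01) + \<beta> i * d i * (smear 2 R 0 \<sigma> 1 - smear 2 R 0 \<sigma> 0)
      - \<beta> i * (\<integral>u. offspring_term R \<sigma> u \<partial>n i)"

text \<open>
  If \<open>\<partial>\<^sub>\<sigma> R = a (\<psi> - \<rho>) R\<close>, the weight of order \<open>1\<close> produces \<open>a\<close> times itself, that is twice the weight of
  order \<open>2\<close>; this explains both orders and the factor \<open>1/2\<close>.  The bound on the jump term has a
  constant that does not depend on \<open>R\<close>, as dominated convergence along a sequence of functions
  requires.
\<close>

definition generator_ineq :: "nat \<Rightarrow> (real \<Rightarrow> real \<Rightarrow> real \<Rightarrow> real) \<Rightarrow> bool" where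
  "generator_ineq i R \<longleftrightarrow> bounded_meas3 R
     \<and> (\<forall>\<sigma> m u. 0 < u \<longrightarrow> \<bar>jump_term R \<sigma> m u\<bar> \<le> 4 * min u (u\<^sup>2))
     \<and> (\<lambda>x. \<integral>u. jump_term R (fst x) (snd x) u \<partial>l i) \<in> borel_measurable (borel \<Otimes>\<^sub>M borel)
     \<and> (\<lambda>\<sigma>. \<integral>u. offspring_term R \<sigma> u \<partial>n i) \<in> borel_measurable borel
     \<and> (\<integral>\<sigma>. weak_gen i R \<sigma> \<partial>unif01) \<le> (\<integral>m. smear 1 R 0 1 m - smear 1 R 0 0 m \<partial>unif01) / 2"

lemma jump_term_meas:
  "bounded_meas3 R \<Longrightarrow> f \<in> borel_measurable N \<Longrightarrow> g \<in> borel_measurable N \<Longrightarrow> h \<in> borel_measurable N \<Longrightarrow>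
    (\<lambda>x. jump_term R (f x) (g x) (h x)) \<in> borel_measurable N"
  unfolding jump_term_def by (intro borel_measurable_add borel_measurable_diff borel_measurable_times smear_meas) auto

lemma offspring_term_meas:
  assumes "bounded_meas3 R" and [measurable]: "f \<in> borel_measurable N" "g \<in> borel_measurable N"
  shows "(\<lambda>x. offspring_term R (f x) (g x)) \<in> borel_measurable N"
proof -
  interpret U: prob_space unif01 by (rule unif01_prob)
  show ?thesis unfolding offspring_term_def
    by (rule U.borel_measurable_lebesgue_integral)
      (auto simp: split_beta' intro!: borel_measurable_diff smear_meas[OF assms(1)])
qed

lemma offspring_term_le: "bounded_meas3 R \<Longrightarrow> 0 \<le> u \<Longrightarrow> \<bar>offspring_term R \<sigma> u\<bar> \<le> 2 * u"
  unfolding offspring_term_def by (rule shift_difference_bound) (auto intro: smear_meas smear_le)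

text \<open>
  Only integrals of bounded functions occur, and every integral has a dominating function that does
  not depend on \<open>R\<close>.
\<close>

lemma generator_ineq_limit:
  assumes generator_ineq: "\<And>k. generator_ineq i (R k)" and lim: "\<And>\<sigma> a m. (\<lambda>k. R k \<sigma> a m) \<longlonglongrightarrow> R' \<sigma> a m"
  shows "generator_ineq i R'"
proof -
  have m3: "bounded_meas3 (R k)" for k using generator_ineq unfolding generator_ineq_def by blast
  have m3': "bounded_meas3 R'" by (rule bounded_meas3_limit[OF m3 lim])
  have Lb: "\<bar>jump_term (R k) \<sigma> m u\<bar> \<le> 4 * min u (u\<^sup>2)" if "0 < u" for k \<sigma> m u
    using generator_ineq that unfolding generator_ineq_def by blast
  note I_lim = smear_tendsto[of R, OF m3 lim]
  have L_lim: "(\<lambda>k. jump_term (R k) \<sigma> m u) \<longlonglongrightarrow> jump_term R' \<sigma> m u" for \<sigma> m u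
    unfolding jump_term_def by (intro tendsto_intros I_lim)
  have Lint_lim: "(\<lambda>k. \<integral>u. jump_term (R k) \<sigma> m u \<partial>l i) \<longlonglongrightarrow> (\<integral>u. jump_term R' \<sigma> m u \<partial>l i)" for \<sigma> m
    by (rule integral_dominated_convergence[where w = "\<lambda>u. 4 * min u (u\<^sup>2)"])
      (use Lb L_lim in \<open>auto intro!: meas_l jump_term_meas m3 m3' integrable_mult_right integrable_l AE_I2 simp: space_l\<close>)
  have Lint_le: "\<bar>\<integral>u. jump_term (R k) \<sigma> m u \<partial>l i\<bar> \<le> 4 * B" for k \<sigma> m
  proof -
    have "\<bar>\<integral>u. jump_term (R k) \<sigma> m u \<partial>l i\<bar> \<le> (\<integral>u. 4 * min u (u\<^sup>2) \<partial>l i)"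
      by (rule abs_integral_le)
        (use Lb in \<open>auto intro!: meas_l jump_term_meas m3 integrable_mult_right integrable_l simp: space_l\<close>)
    also have "\<dots> \<le> 4 * B" using integral_l_le[of i] by simp
    finally show ?thesis .
  qed
  have weak_psi_lim: "(\<lambda>k. weak_psi i (R k) \<sigma> m) \<longlonglongrightarrow> weak_psi i R' \<sigma> m" for \<sigma> m
    unfolding weak_psi_def by (intro tendsto_intros I_lim Lint_lim)
  have weak_psi_le: "\<bar>weak_psi i (R k) \<sigma> m\<bar> \<le> 2 * \<bar>b i\<bar> + 4 * c i + 4 * B" for k \<sigma> m
  proof -
    note I1 = smear_le[OF m3[of k], of 0 0 \<sigma> m] and I2 = smear_le[OF m3[of k], of 1 0 \<sigma> m]
      and I3 = smear_le[OF m3[of k], of 2 0 \<sigma> m]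
    have "\<bar>b i * (smear 1 (R k) 0 \<sigma> m - smear 2 (R k) 0 \<sigma> m)\<bar> \<le> \<bar>b i\<bar> * 2"
      unfolding abs_mult by (rule mult_left_mono) (use I2 I3 in linarith, simp)
    moreover have "\<bar>c i * (smear 0 (R k) 0 \<sigma> m - 2 * smear 1 (R k) 0 \<sigma> m + smear 2 (R k) 0 \<sigma> m)\<bar> \<le> \<bar>c i\<bar> * 4"
      unfolding abs_mult by (rule mult_left_mono) (use I1 I2 I3 in linarith, simp)
    ultimately show ?thesis
      unfolding weak_psi_def using Lint_le[of k \<sigma> m] c_pos[of i] by linarith
  qed
  have Lint_meas: "(\<lambda>x. \<integral>u. jump_term (R k) (fst x) (snd x) u \<partial>l i) \<in> borel_measurable (borel \<Otimes>\<^sub>M borel)" for k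
    using generator_ineq unfolding generator_ineq_def by blast
  have weak_psi_meas: "(\<lambda>x. weak_psi i (R k) (f x) (g x)) \<in> borel_measurable N"
    if [measurable]: "f \<in> borel_measurable N" "g \<in> borel_measurable N" for k N and f g :: "'z \<Rightarrow> real"
  proof -
    have "(\<lambda>x. (f x, g x)) \<in> N \<rightarrow>\<^sub>M borel \<Otimes>\<^sub>M borel" by measurable
    from measurable_compose[OF this Lint_meas[of k]]
    have "(\<lambda>x. \<integral>u. jump_term (R k) (f x) (g x) u \<partial>l i) \<in> borel_measurable N" by simp
    then show ?thesis unfolding weak_psi_def
      by (intro borel_measurable_add borel_measurable_diff borel_measurable_times smear_meas m3) auto
  qed
  have mPsi_lim: "(\<lambda>k. \<integral>m. weak_psi i (R k) \<sigma> m \<partial>unif01) \<longlonglongrightarrow> (\<integral>m. weak_psi i R' \<sigma> m \<partial>unif01)" for \<sigma>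
    by (rule prob_tendsto_integral[OF unif01_prob]) (auto intro!: weak_psi_meas weak_psi_lim weak_psi_le)
  have mPsi_meas: "(\<lambda>\<sigma>. \<integral>m. weak_psi i (R k) \<sigma> m \<partial>unif01) \<in> borel_measurable borel" for k
  proof -
    interpret U: prob_space unif01 by (rule unif01_prob)
    show ?thesis by (rule U.borel_measurable_lebesgue_integral) (auto simp: split_beta' intro!: weak_psi_meas)
  qed
  have N_lim: "(\<lambda>k. offspring_term (R k) \<sigma> u) \<longlonglongrightarrow> offspring_term R' \<sigma> u" for \<sigma> u
    unfolding offspring_term_def
  proof (rule prob_tendsto_integral[OF unif01_prob])
    show "\<bar>smear 2 (R k) 0 \<sigma> m - smear 2 (R k) 0 \<sigma> (m + u)\<bar> \<le> 2" for k m
      using smear_le[OF m3[of k], of 2 0 \<sigma> m] smear_le[OF m3[of k], of 2 0 \<sigma> "m + u"] by linarith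
  qed (auto intro!: borel_measurable_diff smear_meas m3 tendsto_intros I_lim)
  have Nint_lim: "(\<lambda>k. \<integral>u. offspring_term (R k) \<sigma> u \<partial>n i) \<longlonglongrightarrow> (\<integral>u. offspring_term R' \<sigma> u \<partial>n i)" for \<sigma>
    by (rule integral_dominated_convergence[where w = "\<lambda>u. 2 * u"])
      (use N_lim in \<open>auto intro!: meas_n offspring_term_meas offspring_term_le m3 m3' integrable_mult_right integrable_n AE_I2 simp: space_n\<close>)
  have Nint_le: "\<bar>\<integral>u. offspring_term (R k) \<sigma> u \<partial>n i\<bar> \<le> 2" for k \<sigma>
  proof -
    have "\<bar>\<integral>u. offspring_term (R k) \<sigma> u \<partial>n i\<bar> \<le> (\<integral>u. 2 * u \<partial>n i)"
      by (rule abs_integral_le)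
        (auto intro!: meas_n offspring_term_meas offspring_term_le m3 integrable_mult_right integrable_n simp: space_n)
    also have "\<dots> \<le> 2" using d_plus_integral_n[of i] d_pos[of i] by simp
    finally show ?thesis .
  qed
  have Nint_meas: "(\<lambda>\<sigma>. \<integral>u. offspring_term (R k) \<sigma> u \<partial>n i) \<in> borel_measurable borel" for k
    using generator_ineq unfolding generator_ineq_def by blast
  have weak_gen_lim: "(\<lambda>k. weak_gen i (R k) \<sigma>) \<longlonglongrightarrow> weak_gen i R' \<sigma>" for \<sigma>
    unfolding weak_gen_def by (intro tendsto_intros mPsi_lim I_lim Nint_lim)
  have weak_gen_le: "\<bar>weak_gen i (R k) \<sigma>\<bar> \<le> (2 * \<bar>b i\<bar> + 4 * c i + 4 * B) + \<beta> i * d i * 2 + \<beta> i * 2" for k \<sigma>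
  proof -
    have 1: "\<bar>\<integral>m. weak_psi i (R k) \<sigma> m \<partial>unif01\<bar> \<le> 2 * \<bar>b i\<bar> + 4 * c i + 4 * B"
      by (rule integral_abs_le_bound[OF unif01_prob weak_psi_le]) (use c_pos[of i] B_pos in simp)
    have 2: "\<bar>\<beta> i * d i * (smear 2 (R k) 0 \<sigma> 1 - smear 2 (R k) 0 \<sigma> 0)\<bar> \<le> \<beta> i * d i * 2"
      unfolding abs_mult using \<beta>_pos[of i] d_pos[of i] smear_le[OF m3[of k], of 2 0 \<sigma> 1] smear_le[OF m3[of k], of 2 0 \<sigma> 0]
      by (intro mult_mono) auto
    have 3: "\<bar>\<beta> i * (\<integral>u. offspring_term (R k) \<sigma> u \<partial>n i)\<bar> \<le> \<beta> i * 2"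
      unfolding abs_mult using \<beta>_pos[of i] Nint_le[of k \<sigma>] by (intro mult_mono) auto
    show ?thesis unfolding weak_gen_def using 1 2 3 by linarith
  qed
  have weak_gen_meas: "weak_gen i (R k) \<in> borel_measurable borel" for k
    unfolding weak_gen_def
    by (intro borel_measurable_add borel_measurable_diff borel_measurable_times smear_meas m3 mPsi_meas Nint_meas) auto
  have lhs_lim: "(\<lambda>k. \<integral>\<sigma>. weak_gen i (R k) \<sigma> \<partial>unif01) \<longlonglongrightarrow> (\<integral>\<sigma>. weak_gen i R' \<sigma> \<partial>unif01)"
    by (rule prob_tendsto_integral[OF unif01_prob _ weak_gen_lim weak_gen_le]) (use weak_gen_meas in simp)
  have rhs_lim: "(\<lambda>k. (\<integral>m. smear 1 (R k) 0 1 m - smear 1 (R k) 0 0 m \<partial>unif01) / 2)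
      \<longlonglongrightarrow> (\<integral>m. smear 1 R' 0 1 m - smear 1 R' 0 0 m \<partial>unif01) / 2"
  proof (intro tendsto_intros prob_tendsto_integral[OF unif01_prob])
    show "\<bar>smear 1 (R k) 0 1 m - smear 1 (R k) 0 0 m\<bar> \<le> 2" for k m
      using smear_le[OF m3[of k], of 1 0 0 m] smear_le[OF m3[of k], of 1 0 1 m] by linarith
  qed (auto intro!: borel_measurable_diff smear_meas m3 tendsto_intros I_lim)
  show ?thesis
    unfolding generator_ineq_def
  proof (intro conjI m3' allI impI)
    show "\<bar>jump_term R' \<sigma> m u\<bar> \<le> 4 * min u (u\<^sup>2)" if "0 < u" for \<sigma> m u
      by (rule LIMSEQ_le_const2[OF tendsto_rabs[OF L_lim]]) (use Lb[OF that] in auto)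
    show "(\<integral>\<sigma>. weak_gen i R' \<sigma> \<partial>unif01) \<le> (\<integral>m. smear 1 R' 0 1 m - smear 1 R' 0 0 m \<partial>unif01) / 2"
      by (rule LIMSEQ_le[OF lhs_lim rhs_lim]) (use generator_ineq in \<open>auto simp: generator_ineq_def\<close>)
  qed (auto intro: borel_measurable_LIMSEQ_real[OF Lint_lim Lint_meas] borel_measurable_LIMSEQ_real[OF Nint_lim Nint_meas])
qed

end

section \<open>The generator inequality for exponential sums\<close>

lemma continuous_integrable_unif01:
  fixes f :: "real \<Rightarrow> real"
  assumes "continuous_on UNIV f"
  shows "integrable unif01 f"
proof -
  interpret prob_space unif01 by (rule unif01_prob)
  have "compact (f ` {0..1})"
    by (rule compact_continuous_image) (auto intro: continuous_on_subset[OF assms])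
  then obtain C where C: "\<And>x. x \<in> {0..1} \<Longrightarrow> \<bar>f x\<bar> \<le> C"
    using compact_imp_bounded by (force simp: bounded_iff)
  have "AE x in unif01. norm (f x) \<le> C"
    using AE_unif01 by eventually_elim (use C in auto)
  then show ?thesis
    by (rule integrable_const_bound) (use borel_measurable_continuous_onI[OF assms] in simp)
qed

lemma FTC_unif01:
  fixes f F :: "real \<Rightarrow> real"
  assumes "\<And>x. x \<in> {0..1} \<Longrightarrow> (F has_real_derivative f x) (at x within {0..1})" and "continuous_on UNIV f"
  shows "(\<integral>x. f x \<partial>unif01) = F 1 - F 0"
proof -
  have "(\<integral>x. f x \<partial>unif01) = (\<integral>x. indicator {0..1} x *\<^sub>R f x \<partial>lborel)"
    using integral_unif01[OF borel_measurable_continuous_onI[OF assms(2)]] by simp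
  also have "\<dots> = F 1 - F 0"
    by (rule integral_FTC_Icc)
      (use assms in \<open>auto simp: has_real_derivative_iff_has_vector_derivative intro: continuous_on_subset\<close>)
  finally show ?thesis .
qed

lemma laplace_unif01: "(\<integral>m. exp (- (m * z)) \<partial>unif01) * z = 1 - exp (- z)"
proof -
  have "(\<integral>m. exp (- (m * z)) * z \<partial>unif01) = (- exp (- (1 * z))) - (- exp (- (0 * z)))"
    by (rule FTC_unif01) (auto intro!: derivative_eq_intros continuous_intros)
  then show ?thesis by simp
qed

lemma inverse_powers_via_cube:
  fixes y :: real
  assumes "0 < y"
  shows "1 / y ^ Suc 2 = 1 / y ^ 3" "1 / y ^ Suc 1 = 1 / y ^ 3 * y" "1 / y ^ Suc 0 = 1 / y ^ 3 * y\<^sup>2"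
  using assms by (simp_all add: numeral_3_eq_3 numeral_2_eq_2)

text \<open>
  The individual coefficients and exponents are not bounded, so the estimate must come from the sums: the
  two assumptions bound the first and second derivative of the left-hand side in \<open>u\<close>, which vanishes
  to second order at \<open>0\<close>.
\<close>

lemma exp_remainder_sum_bound:
  fixes w v :: "'k \<Rightarrow> real"
  assumes 1: "\<And>u. 0 \<le> u \<Longrightarrow> \<bar>\<Sum>k\<in>S. w k * (v k * (1 - exp (- (u * v k))))\<bar> \<le> 4"
    and 2: "\<And>u. 0 \<le> u \<Longrightarrow> \<bar>\<Sum>k\<in>S. w k * ((v k)\<^sup>2 * exp (- (u * v k)))\<bar> \<le> 4"
    and u: "0 < u"
  shows "\<bar>\<Sum>k\<in>S. w k * (exp (- (u * v k)) - 1 + u * v k)\<bar> \<le> 4 * min u (u\<^sup>2)"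
proof -
  define F where "F u = (\<Sum>k\<in>S. w k * (exp (- (u * v k)) - 1 + u * v k))" for u
  define F1 where "F1 u = (\<Sum>k\<in>S. w k * (v k * (1 - exp (- (u * v k)))))" for u
  define F2 where "F2 u = (\<Sum>k\<in>S. w k * ((v k)\<^sup>2 * exp (- (u * v k))))" for u
  have F: "DERIV F x :> F1 x" for x
    unfolding F_def F1_def by (auto intro!: derivative_eq_intros sum.cong simp: algebra_simps)
  have F1: "DERIV F1 x :> F2 x" for x
    unfolding F2_def F1_def by (auto intro!: derivative_eq_intros sum.cong simp: power2_eq_square)
  obtain x where x: "0 < x" "x < u" "F u - F 0 = (u - 0) * F1 x"
    using MVT2[OF u, of F F1] F by blast
  obtain y where y: "0 < y" "y < x" "F1 x - F1 0 = (x - 0) * F2 y"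
    using MVT2[OF x(1), of F1 F2] F1 by blast
  have "F 0 = 0" "F1 0 = 0" by (simp_all add: F_def F1_def)
  then have Fu: "F u = u * F1 x" "F1 x = x * F2 y" using x y by simp_all
  have "\<bar>F1 x\<bar> \<le> 4" using 1[of x] x unfolding F1_def by simp
  then have a: "\<bar>F u\<bar> \<le> 4 * u" using u by (simp add: Fu(1) abs_mult mult.commute)
  have "\<bar>F2 y\<bar> \<le> 4" using 2[of y] y unfolding F2_def by simp
  then have "\<bar>F1 x\<bar> \<le> u * 4" unfolding Fu(2) abs_mult using x y by (intro mult_mono) auto
  then have "\<bar>F u\<bar> \<le> u * (u * 4)" unfolding Fu(1) abs_mult using u by (intro mult_mono) auto
  with a show ?thesis unfolding F_def[symmetric] by (simp add: min_def power2_eq_square)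
qed

text \<open>
  A nonnegative function keeps its sign when it is averaged over the two weights.
\<close>

lemma exp_sum_smear_nonneg:
  fixes x v \<zeta> :: "'k \<Rightarrow> real"
  assumes fin: "finite S" and v: "\<And>k. k \<in> S \<Longrightarrow> 0 \<le> v k" and z: "\<And>k. k \<in> S \<Longrightarrow> 0 \<le> \<zeta> k"
    and nonneg: "\<And>a m. 0 \<le> a \<Longrightarrow> 0 \<le> m \<Longrightarrow> 0 \<le> (\<Sum>k\<in>S. x k * exp (- (a * v k) - m * \<zeta> k))"
  shows "0 \<le> (\<Sum>k\<in>S. x k * (1 / (1 + v k) ^ 3 * (\<integral>m. exp (- (max 0 m * \<zeta> k)) \<partial>unif01)))"
proof -
  have E1: "(\<integral>a. exp (- (max 0 a * v k)) \<partial>erlang 2) = 1 / (1 + v k) ^ 3" if "k \<in> S" for k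
  proof -
    have "(\<integral>a. exp (- (max 0 a * v k)) \<partial>erlang 2) = (\<integral>a. exp (- (a * v k)) \<partial>erlang 2)"
      by (rule integral_cong_AE) (use AE_erlang[of 2] in \<open>auto elim!: eventually_mono simp: max_def\<close>)
    then show ?thesis using laplace_erlang[OF v[OF that], of 2] by (simp add: numeral_3_eq_3)
  qed
  have i1: "integrable (erlang 2) (\<lambda>a. exp (- (max 0 a * v k)))" if "k \<in> S" for k
    by (rule bounded_integrable[OF erlang_prob, where C = 1]) (use v[OF that] in auto)
  have i2: "integrable unif01 (\<lambda>m. exp (- (max 0 m * \<zeta> k)))" for k
    by (rule continuous_integrable_unif01) (intro continuous_intros)
  have step: "0 \<le> (\<Sum>k\<in>S. x k * (1 / (1 + v k) ^ 3 * exp (- (max 0 m * \<zeta> k))))" for m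
  proof -
    have "(\<integral>a. (\<Sum>k\<in>S. x k * (exp (- (max 0 a * v k)) * exp (- (max 0 m * \<zeta> k)))) \<partial>erlang 2)
        = (\<Sum>k\<in>S. x k * (1 / (1 + v k) ^ 3 * exp (- (max 0 m * \<zeta> k))))"
      using i1 E1 by (subst Bochner_Integration.integral_sum) auto
    moreover have "0 \<le> (\<integral>a. (\<Sum>k\<in>S. x k * (exp (- (max 0 a * v k)) * exp (- (max 0 m * \<zeta> k)))) \<partial>erlang 2)"
    proof (rule integral_nonneg_AE[OF AE_I2])
      fix a :: real
      show "0 \<le> (\<Sum>k\<in>S. x k * (exp (- (max 0 a * v k)) * exp (- (max 0 m * \<zeta> k))))"
        using nonneg[of "max 0 a" "max 0 m"] by (simp add: exp_diff exp_minus field_simps)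
    qed
    ultimately show ?thesis by simp
  qed
  have "(\<integral>m. (\<Sum>k\<in>S. x k * (1 / (1 + v k) ^ 3 * exp (- (max 0 m * \<zeta> k)))) \<partial>unif01)
      = (\<Sum>k\<in>S. x k * (1 / (1 + v k) ^ 3 * (\<integral>m. exp (- (max 0 m * \<zeta> k)) \<partial>unif01)))"
    using i2 by (subst Bochner_Integration.integral_sum) auto
  moreover have "0 \<le> (\<integral>m. (\<Sum>k\<in>S. x k * (1 / (1 + v k) ^ 3 * exp (- (max 0 m * \<zeta> k)))) \<partial>unif01)"
    by (rule integral_nonneg_AE[OF AE_I2]) (rule step)
  ultimately show ?thesis by simp
qed

lemma deriv_nonneg_at_0:
  fixes f :: "real \<Rightarrow> real"
  assumes "DERIV f 0 :> D" "f 0 = 0" "\<And>e. 0 \<le> e \<Longrightarrow> 0 \<le> f e"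
  shows "0 \<le> D"
proof (rule ccontr)
  assume "\<not> 0 \<le> D"
  then obtain r where "r > 0" "\<And>h. h > 0 \<Longrightarrow> h < r \<Longrightarrow> f 0 > f (0 + h)"
    using DERIV_neg_dec_right[OF assms(1)] by force
  from this(2)[of "r/2"] this(1) assms(2) assms(3)[of "r/2"] show False by simp
qed

lemma deriv_half_inverse_square:
  fixes y :: real
  assumes "0 \<le> y"
  shows "((\<lambda>y. 1 / (2 * (1 + y)\<^sup>2)) has_real_derivative - (1 / (1 + y) ^ 3)) (at y)"
proof -
  define x where "x = 1 + y"
  have x: "x > 0" using assms unfolding x_def by simp
  have "((\<lambda>y. inverse ((1 + y)\<^sup>2)) has_real_derivative - (inverse ((1 + y)\<^sup>2) * (2 * (1 + y)) * inverse ((1 + y)\<^sup>2))) (at y)"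
    by (rule DERIV_inverse') (use assms in \<open>auto intro!: derivative_eq_intros\<close>)
  then have "((\<lambda>y. inverse ((1 + y)\<^sup>2) / 2) has_real_derivative - (inverse ((1 + y)\<^sup>2) * (2 * (1 + y)) * inverse ((1 + y)\<^sup>2)) / 2) (at y)"
    by (rule DERIV_cdivide)
  moreover have "- (inverse ((1 + y)\<^sup>2) * (2 * (1 + y)) * inverse ((1 + y)\<^sup>2)) / 2 = - (1 / (1 + y) ^ 3)"
    using x unfolding x_def[symmetric] by (simp add: power2_eq_square power3_eq_cube field_simps)
  moreover have "(\<lambda>y. inverse ((1 + y)\<^sup>2) / 2) = (\<lambda>y :: real. 1 / (2 * (1 + y)\<^sup>2))"
    by (auto simp: inverse_eq_divide)
  ultimately show ?thesis by simp
qed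

context mechanism begin

text \<open>
  The increment in \<open>\<sigma>\<close> of the smeared sum is, by the evolution equation, the integral of the smeared
  \<open>\<psi>(i, v) - \<rho>(i, z)\<close>.  The generator has \<open>\<zeta>\<close> in place of \<open>z\<close>, because it lets the offspring join the
  second population.  The assumption \<open>hyp\<close> compares the two places for an offspring mass \<open>e\<close>; its
  derivative at \<open>e = 0\<close> handles the term with \<open>d\<close>, and its values handle the term with \<open>n\<close>.
\<close>

lemma generator_ineq_base:
  fixes c' \<zeta> :: "'k \<Rightarrow> real" and v z :: "'k \<Rightarrow> real \<Rightarrow> real"
  assumes fin: "finite S"
    and v0: "\<And>k \<sigma>. k \<in> S \<Longrightarrow> 0 \<le> v k \<sigma>" and z0: "\<And>k \<sigma>. k \<in> S \<Longrightarrow> 0 \<le> z k \<sigma>"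
    and \<zeta>0: "\<And>k. k \<in> S \<Longrightarrow> 0 \<le> \<zeta> k"
    and vc: "\<And>k. k \<in> S \<Longrightarrow> continuous_on UNIV (v k)" and zc: "\<And>k. k \<in> S \<Longrightarrow> continuous_on UNIV (z k)"
    and der: "\<And>k \<sigma>. k \<in> S \<Longrightarrow> \<sigma> \<in> {0..1} \<Longrightarrow>
        (v k has_real_derivative - (\<psi> i (v k \<sigma>) - \<rho> i (z k \<sigma>))) (at \<sigma> within {0..1})"
    and hyp: "\<And>\<sigma> a m e. \<sigma> \<in> {0..1} \<Longrightarrow> 0 \<le> a \<Longrightarrow> 0 \<le> m \<Longrightarrow> 0 \<le> e \<Longrightarrow>
        (\<Sum>k\<in>S. c' k * exp (- (a * v k \<sigma>) - (m + e) * \<zeta> k)) \<le> (\<Sum>k\<in>S. c' k * exp (- (a * v k \<sigma>) - m * \<zeta> k - e * z k \<sigma>))"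
    and bd: "\<And>\<sigma> a m. \<bar>\<Sum>k\<in>S. c' k * exp (- (max 0 a * v k \<sigma>) - max 0 m * \<zeta> k)\<bar> \<le> 1"
  defines "R \<equiv> \<lambda>\<sigma> a m. \<Sum>k\<in>S. c' k * exp (- (max 0 a * v k \<sigma>) - max 0 m * \<zeta> k)"
  shows "generator_ineq i R"
proof -
  have vm: "v k \<in> borel_measurable borel" if "k \<in> S" for k
    by (rule borel_measurable_continuous_onI[OF vc[OF that]])
  have m3: "bounded_meas3 R"
    unfolding bounded_meas3_def
  proof (intro conjI allI)
    have "(\<lambda>x. v k (fst x)) \<in> borel_measurable (borel \<Otimes>\<^sub>M borel \<Otimes>\<^sub>M (borel :: real measure))" if "k \<in> S" for k
      by (rule measurable_compose[OF measurable_fst vm[OF that]])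
    moreover have "(\<lambda>x. max 0 (fst (snd x))) \<in> borel_measurable ((borel :: real measure) \<Otimes>\<^sub>M (borel :: real measure) \<Otimes>\<^sub>M (borel :: real measure))"
      "(\<lambda>x. max 0 (snd (snd x))) \<in> borel_measurable ((borel :: real measure) \<Otimes>\<^sub>M (borel :: real measure) \<Otimes>\<^sub>M (borel :: real measure))"
      by measurable
    ultimately show "(\<lambda>x. R (fst x) (fst (snd x)) (snd (snd x))) \<in> borel_measurable (borel \<Otimes>\<^sub>M borel \<Otimes>\<^sub>M borel)"
      unfolding R_def
      by (intro borel_measurable_sum borel_measurable_times borel_measurable_const borel_measurable_diff
          borel_measurable_uminus measurable_compose[OF _ borel_measurable_exp]) auto
  qed (use bd in \<open>simp add: R_def\<close>)
  define h where "h k \<sigma> = 1 / (1 + v k \<sigma>) ^ 3" for k \<sigma>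
  define e where "e k m = exp (- (max 0 m * \<zeta> k))" for k m
  define E where "E k = (\<integral>m. e k m \<partial>unif01)" for k
  have Iint: "integrable (erlang p) (\<lambda>a. exp (- (max 0 a * v k \<sigma>)))" if "k \<in> S" for k \<sigma> p
    by (rule bounded_integrable[OF erlang_prob, where C = 1]) (use v0[OF that] in auto)
  have I: "smear p R r \<sigma> m = (\<Sum>k\<in>S. c' k * (1 / (1 + v k \<sigma>) ^ Suc p * exp (- (r * v k \<sigma>)) * e k m))"
    if r: "0 \<le> r" for p r \<sigma> m
  proof -
    have "smear p R r \<sigma> m = (\<integral>a. (\<Sum>k\<in>S. c' k * (exp (- (max 0 a * v k \<sigma>)) * exp (- (r * v k \<sigma>)) * e k m)) \<partial>erlang p)"
      unfolding smear_def R_def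
    proof (rule integral_cong_AE)
      show "AE a in erlang p. (\<Sum>k\<in>S. c' k * exp (- (max 0 (a + r) * v k \<sigma>) - max 0 m * \<zeta> k)) =
          (\<Sum>k\<in>S. c' k * (exp (- (max 0 a * v k \<sigma>)) * exp (- (r * v k \<sigma>)) * e k m))"
        using AE_erlang
      proof eventually_elim
        case (elim a)
        then have "max 0 (a + r) = max 0 a + r" using r by simp
        then show ?case unfolding e_def
          by (intro sum.cong refl) (simp add: exp_add[symmetric] algebra_simps)
      qed
    qed auto
    also have "\<dots> = (\<Sum>k\<in>S. c' k * ((\<integral>a. exp (- (max 0 a * v k \<sigma>)) \<partial>erlang p) * exp (- (r * v k \<sigma>)) * e k m))"
      using Iint by (subst Bochner_Integration.integral_sum) auto
    also have "\<dots> = (\<Sum>k\<in>S. c' k * (1 / (1 + v k \<sigma>) ^ Suc p * exp (- (r * v k \<sigma>)) * e k m))"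
    proof (intro sum.cong refl)
      fix k assume k: "k \<in> S"
      have "(\<integral>a. exp (- (max 0 a * v k \<sigma>)) \<partial>erlang p) = (\<integral>a. exp (- (a * v k \<sigma>)) \<partial>erlang p)"
        by (rule integral_cong_AE) (use AE_erlang[of p] in \<open>auto elim!: eventually_mono simp: max_def\<close>)
      then show "c' k * ((\<integral>a. exp (- (max 0 a * v k \<sigma>)) \<partial>erlang p) * exp (- (r * v k \<sigma>)) * e k m) =
         c' k * (1 / (1 + v k \<sigma>) ^ Suc p * exp (- (r * v k \<sigma>)) * e k m)"
        using laplace_erlang[OF v0[OF k], of p] by simp
    qed
    finally show ?thesis .
  qed
  have pw: "1 / (1 + v k \<sigma>) ^ Suc 2 = h k \<sigma>" "1 / (1 + v k \<sigma>) ^ Suc 1 = h k \<sigma> * (1 + v k \<sigma>)"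
     "1 / (1 + v k \<sigma>) ^ Suc 0 = h k \<sigma> * (1 + v k \<sigma>)\<^sup>2" if "k \<in> S" for k \<sigma>
    using inverse_powers_via_cube[of "1 + v k \<sigma>"] v0[OF that, of \<sigma>] unfolding h_def by simp_all
  have I2: "smear 2 R r \<sigma> m = (\<Sum>k\<in>S. c' k * (h k \<sigma> * exp (- (r * v k \<sigma>)) * e k m))"
    and I1: "smear 1 R r \<sigma> m = (\<Sum>k\<in>S. c' k * (h k \<sigma> * (1 + v k \<sigma>) * exp (- (r * v k \<sigma>)) * e k m))"
    and I0: "smear 0 R r \<sigma> m = (\<Sum>k\<in>S. c' k * (h k \<sigma> * (1 + v k \<sigma>)\<^sup>2 * exp (- (r * v k \<sigma>)) * e k m))"
    if "0 \<le> r" for r \<sigma> m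
    unfolding I[OF that] by (intro sum.cong refl; simp only: pw)+
  note I1 = I1[unfolded One_nat_def]
  have L: "jump_term R \<sigma> m u = (\<Sum>k\<in>S. c' k * e k m * h k \<sigma> * (exp (- (u * v k \<sigma>)) - 1 + u * v k \<sigma>))"
    if "0 < u" for \<sigma> m u
    unfolding jump_term_def using that
    by (simp add: I1 I2 sum_distrib_left sum_subtractf[symmetric] sum.distrib[symmetric])
      (intro sum.cong refl, simp add: algebra_simps)
  have Lb: "\<bar>jump_term R \<sigma> m u\<bar> \<le> 4 * min u (u\<^sup>2)" if u: "0 < u" for \<sigma> m u
    unfolding L[OF u]
  proof (rule exp_remainder_sum_bound[OF _ _ u])
    fix u :: real assume u: "0 \<le> u"
    have "(\<Sum>k\<in>S. c' k * e k m * h k \<sigma> * (v k \<sigma> * (1 - exp (- (u * v k \<sigma>)))))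
      = smear 1 R 0 \<sigma> m - smear 2 R 0 \<sigma> m - smear 1 R u \<sigma> m + smear 2 R u \<sigma> m"
      using u by (simp add: I1 I2 sum_subtractf[symmetric] sum.distrib[symmetric])
        (intro sum.cong refl, simp add: algebra_simps)
    then show "\<bar>\<Sum>k\<in>S. c' k * e k m * h k \<sigma> * (v k \<sigma> * (1 - exp (- (u * v k \<sigma>))))\<bar> \<le> 4"
      using smear_le[OF m3, of 1 0 \<sigma> m] smear_le[OF m3, of 2 0 \<sigma> m] smear_le[OF m3, of 1 u \<sigma> m] smear_le[OF m3, of 2 u \<sigma> m]
      by linarith
    have "(\<Sum>k\<in>S. c' k * e k m * h k \<sigma> * ((v k \<sigma>)\<^sup>2 * exp (- (u * v k \<sigma>))))
      = smear 0 R u \<sigma> m - 2 * smear 1 R u \<sigma> m + smear 2 R u \<sigma> m"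
      using u by (simp add: I0 I1 I2 sum_distrib_left sum_subtractf[symmetric] sum.distrib[symmetric])
        (intro sum.cong refl, simp add: algebra_simps power2_eq_square)
    then show "\<bar>\<Sum>k\<in>S. c' k * e k m * h k \<sigma> * ((v k \<sigma>)\<^sup>2 * exp (- (u * v k \<sigma>)))\<bar> \<le> 4"
      using smear_le[OF m3, of 0 u \<sigma> m] smear_le[OF m3, of 1 u \<sigma> m] smear_le[OF m3, of 2 u \<sigma> m] by linarith
  qed
  have psi_c: "continuous_on UNIV (\<lambda>\<sigma>. \<psi> i (v k \<sigma>))" if "k \<in> S" for k
    by (rule continuous_on_compose2[OF psi_continuous vc[OF that]]) (use v0[OF that] in auto)
  have rho_c: "continuous_on UNIV (\<lambda>\<sigma>. \<rho> i (z k \<sigma>))" if "k \<in> S" for k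
    by (rule continuous_on_compose2[OF rho_continuous zc[OF that]]) (use z0[OF that] in auto)
  have h_c: "continuous_on UNIV (h k)" if "k \<in> S" for k
  proof -
    have "1 + v k \<sigma> \<noteq> 0" for \<sigma> using v0[OF that, of \<sigma>] by linarith
    then show ?thesis unfolding h_def by (intro continuous_intros vc[OF that]) auto
  qed
  have Lint: "(\<integral>u. jump_term R \<sigma> m u \<partial>l i)
      = (\<Sum>k\<in>S. c' k * e k m * h k \<sigma> * (\<psi> i (v k \<sigma>) - b i * v k \<sigma> - c i * (v k \<sigma>)\<^sup>2))" for \<sigma> m
  proof -
    have "(\<integral>u. jump_term R \<sigma> m u \<partial>l i)
       = (\<integral>u. (\<Sum>k\<in>S. c' k * e k m * h k \<sigma> * (exp (- v k \<sigma> * u) - 1 + v k \<sigma> * u)) \<partial>l i)"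
      by (rule Bochner_Integration.integral_cong) (auto simp: space_l L mult.commute)
    also have "\<dots> = (\<Sum>k\<in>S. c' k * e k m * h k \<sigma> * (\<integral>u. (exp (- v k \<sigma> * u) - 1 + v k \<sigma> * u) \<partial>l i))"
      using integrable_exp_remainder[OF v0] by (subst Bochner_Integration.integral_sum) auto
    also have "\<dots> = (\<Sum>k\<in>S. c' k * e k m * h k \<sigma> * (\<psi> i (v k \<sigma>) - b i * v k \<sigma> - c i * (v k \<sigma>)\<^sup>2))"
      unfolding psi_def by simp
    finally show ?thesis .
  qed
  have weak_psi: "weak_psi i R \<sigma> m = (\<Sum>k\<in>S. c' k * h k \<sigma> * \<psi> i (v k \<sigma>) * e k m)" for \<sigma> m
    unfolding weak_psi_def Lint
    by (simp add: I0 I1 I2 sum_distrib_left sum_subtractf[symmetric] sum.distrib[symmetric])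
      (intro sum.cong refl, simp add: algebra_simps power2_eq_square)
  define Q where "Q k = (\<integral>u. (1 - exp (- u * \<zeta> k)) \<partial>n i)" for k
  have ei: "integrable unif01 (e k)" for k
    unfolding e_def by (rule continuous_integrable_unif01) (intro continuous_intros)
  have N: "offspring_term R \<sigma> u = (\<Sum>k\<in>S. c' k * h k \<sigma> * E k * (1 - exp (- u * \<zeta> k)))" if u: "0 < u" for \<sigma> u
  proof -
    have "offspring_term R \<sigma> u = (\<integral>m. (\<Sum>k\<in>S. c' k * h k \<sigma> * (1 - exp (- u * \<zeta> k)) * e k m) \<partial>unif01)"
      unfolding offspring_term_def
    proof (rule integral_cong_AE)
      show "AE m in unif01. smear 2 R 0 \<sigma> m - smear 2 R 0 \<sigma> (m + u) = (\<Sum>k\<in>S. c' k * h k \<sigma> * (1 - exp (- u * \<zeta> k)) * e k m)"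
        using AE_unif01
      proof eventually_elim
        case (elim m)
        have "e k (m + u) = exp (- u * \<zeta> k) * e k m" for k
          using elim u unfolding e_def by (simp add: exp_add[symmetric] algebra_simps)
        then show ?case
          by (simp add: I2 sum_subtractf[symmetric]) (intro sum.cong refl, simp add: algebra_simps)
      qed
      show "(\<lambda>m. smear 2 R 0 \<sigma> m - smear 2 R 0 \<sigma> (m + u)) \<in> borel_measurable unif01"
        by (intro borel_measurable_diff smear_meas[OF m3]) auto
    qed (auto intro!: borel_measurable_sum borel_measurable_times borel_measurable_integrable[OF ei])
    also have "\<dots> = (\<Sum>k\<in>S. c' k * h k \<sigma> * (1 - exp (- u * \<zeta> k)) * E k)"
      using ei unfolding E_def by (subst Bochner_Integration.integral_sum) auto
    finally show ?thesis by (simp add: mult_ac)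
  qed
  have Nint: "(\<integral>u. offspring_term R \<sigma> u \<partial>n i) = (\<Sum>k\<in>S. c' k * h k \<sigma> * E k * Q k)" for \<sigma>
  proof -
    have "(\<integral>u. offspring_term R \<sigma> u \<partial>n i) = (\<integral>u. (\<Sum>k\<in>S. c' k * h k \<sigma> * E k * (1 - exp (- u * \<zeta> k))) \<partial>n i)"
      by (rule Bochner_Integration.integral_cong) (auto simp: space_n N)
    also have "\<dots> = (\<Sum>k\<in>S. c' k * h k \<sigma> * E k * Q k)"
      unfolding Q_def using integrable_one_minus_exp[OF \<zeta>0] by (subst Bochner_Integration.integral_sum) auto
    finally show ?thesis .
  qed
  have EZ: "E k * \<zeta> k = 1 - exp (- \<zeta> k)" for k
  proof -
    have "E k = (\<integral>m. exp (- (m * \<zeta> k)) \<partial>unif01)"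
      unfolding E_def e_def
      by (rule integral_cong_AE) (use AE_unif01 in \<open>auto elim!: eventually_mono simp: max_def\<close>)
    then show ?thesis using laplace_unif01[of "\<zeta> k"] by simp
  qed
  have weak_gen: "weak_gen i R \<sigma> = (\<Sum>k\<in>S. c' k * E k * (h k \<sigma> * (\<psi> i (v k \<sigma>) - \<rho> i (\<zeta> k))))" for \<sigma>
  proof -
    have 1: "(\<integral>m. weak_psi i R \<sigma> m \<partial>unif01) = (\<Sum>k\<in>S. c' k * h k \<sigma> * \<psi> i (v k \<sigma>) * E k)"
      unfolding weak_psi E_def using ei by (subst Bochner_Integration.integral_sum) auto
    have 2: "smear 2 R 0 \<sigma> 1 - smear 2 R 0 \<sigma> 0 = (\<Sum>k\<in>S. - (c' k * h k \<sigma> * (E k * \<zeta> k)))"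
      unfolding EZ by (simp add: I2 e_def sum_subtractf[symmetric]) (intro sum.cong refl, simp add: algebra_simps)
    show ?thesis
      unfolding weak_gen_def 1 2 Nint \<rho>_def Q_def[symmetric]
      by (simp add: sum_distrib_left sum_subtractf[symmetric] sum.distrib[symmetric] sum_negf[symmetric] del: sum_negf)
        (intro sum.cong refl, simp add: algebra_simps)
  qed
  have rhs: "(\<integral>m. smear 1 R 0 1 m - smear 1 R 0 0 m \<partial>unif01) / 2
      = (\<integral>\<sigma>. (\<Sum>k\<in>S. c' k * E k * (h k \<sigma> * (\<psi> i (v k \<sigma>) - \<rho> i (z k \<sigma>)))) \<partial>unif01)"
  proof -
    define H where "H k \<sigma> = 1 / (2 * (1 + v k \<sigma>)\<^sup>2)" for k \<sigma>
    have hH: "h k \<sigma> * (1 + v k \<sigma>) = 2 * H k \<sigma>" if "k \<in> S" for k \<sigma>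
    proof -
      have "1 / y ^ 3 * y = 2 * (1 / (2 * y\<^sup>2))" if "y \<noteq> 0" for y :: real
        using that by (simp add: power2_eq_square power3_eq_cube)
      moreover have "1 + v k \<sigma> \<noteq> 0" using v0[OF that, of \<sigma>] by linarith
      ultimately show ?thesis unfolding h_def H_def by blast
    qed
    have "(\<integral>m. smear 1 R 0 1 m - smear 1 R 0 0 m \<partial>unif01)
        = (\<integral>m. (\<Sum>k\<in>S. c' k * (2 * H k 1 - 2 * H k 0) * e k m) \<partial>unif01)"
    proof (rule Bochner_Integration.integral_cong)
      show "smear 1 R 0 1 m - smear 1 R 0 0 m = (\<Sum>k\<in>S. c' k * (2 * H k 1 - 2 * H k 0) * e k m)" for m
        by (simp add: I1 hH sum_subtractf[symmetric] cong: sum.cong) (intro sum.cong refl, simp add: hH algebra_simps)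
    qed simp
    also have "\<dots> = (\<Sum>k\<in>S. c' k * (2 * H k 1 - 2 * H k 0) * E k)"
      unfolding E_def using ei by (subst Bochner_Integration.integral_sum) auto
    finally have d1: "(\<integral>m. smear 1 R 0 1 m - smear 1 R 0 0 m \<partial>unif01) = (\<Sum>k\<in>S. c' k * (2 * H k 1 - 2 * H k 0) * E k)" .
    have "(\<integral>m. smear 1 R 0 1 m - smear 1 R 0 0 m \<partial>unif01) / 2 = (\<Sum>k\<in>S. c' k * E k * H k 1) - (\<Sum>k\<in>S. c' k * E k * H k 0)"
    proof -
      have "c' k * (2 * H k 1 - 2 * H k 0) * E k / 2 = c' k * E k * H k 1 - c' k * E k * H k 0" for k
        by (simp add: algebra_simps diff_divide_distrib)
      then show ?thesis
        unfolding d1 sum_divide_distrib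
        by (simp only: sum_subtractf)
    qed
    also have "\<dots> = (\<integral>\<sigma>. (\<Sum>k\<in>S. c' k * E k * (h k \<sigma> * (\<psi> i (v k \<sigma>) - \<rho> i (z k \<sigma>)))) \<partial>unif01)"
    proof (rule FTC_unif01[symmetric])
      fix \<sigma> :: real assume \<sigma>: "\<sigma> \<in> {0..1}"
      have "(H k has_real_derivative h k \<sigma> * (\<psi> i (v k \<sigma>) - \<rho> i (z k \<sigma>))) (at \<sigma> within {0..1})" if k: "k \<in> S" for k
      proof -
        have "((\<lambda>\<sigma>. 1 / (2 * (1 + v k \<sigma>)\<^sup>2)) has_real_derivative
            - (1 / (1 + v k \<sigma>) ^ 3) * - (\<psi> i (v k \<sigma>) - \<rho> i (z k \<sigma>))) (at \<sigma> within {0..1})"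
          by (rule DERIV_chain2[OF deriv_half_inverse_square der[OF k \<sigma>]]) (use v0[OF k] in simp)
        then show ?thesis unfolding H_def h_def minus_mult_minus .
      qed
      then show "((\<lambda>\<sigma>. \<Sum>k\<in>S. c' k * E k * H k \<sigma>) has_real_derivative
          (\<Sum>k\<in>S. c' k * E k * (h k \<sigma> * (\<psi> i (v k \<sigma>) - \<rho> i (z k \<sigma>))))) (at \<sigma> within {0..1})"
        by (intro DERIV_sum DERIV_cmult)
    qed (intro continuous_intros h_c psi_c rho_c)
    finally show ?thesis .
  qed
  \<comment> \<open>The difference of the two sides is a nonnegative combination of the comparison for infinitesimal
    offspring and of the comparison for offspring of size \<open>u\<close>, integrated over \<open>n i\<close>.\<close>
  have key: "(\<Sum>k\<in>S. c' k * E k * (h k \<sigma> * (\<psi> i (v k \<sigma>) - \<rho> i (\<zeta> k))))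
      \<le> (\<Sum>k\<in>S. c' k * E k * (h k \<sigma> * (\<psi> i (v k \<sigma>) - \<rho> i (z k \<sigma>))))" if \<sigma>: "\<sigma> \<in> {0..1}" for \<sigma>
  proof -
    have 1: "0 \<le> (\<Sum>k\<in>S. (c' k * (\<zeta> k - z k \<sigma>)) * (h k \<sigma> * E k))"
      unfolding h_def E_def e_def
    proof (rule exp_sum_smear_nonneg[OF fin])
      fix a m :: real assume am: "0 \<le> a" "0 \<le> m"
      show "0 \<le> (\<Sum>k\<in>S. c' k * (\<zeta> k - z k \<sigma>) * exp (- (a * v k \<sigma>) - m * \<zeta> k))"
      proof (rule deriv_nonneg_at_0)
        let ?f = "\<lambda>e. (\<Sum>k\<in>S. c' k * exp (- (a * v k \<sigma>) - m * \<zeta> k - e * z k \<sigma>) - c' k * exp (- (a * v k \<sigma>) - (m + e) * \<zeta> k))"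
        show "DERIV ?f 0 :> (\<Sum>k\<in>S. c' k * (\<zeta> k - z k \<sigma>) * exp (- (a * v k \<sigma>) - m * \<zeta> k))"
          by (auto intro!: derivative_eq_intros sum.cong simp: algebra_simps)
        show "0 \<le> ?f e" if "0 \<le> e" for e
          using hyp[OF \<sigma> am that] by (simp add: sum_subtractf)
      qed simp
    qed (use v0 \<zeta>0 in auto)
    have 2: "0 \<le> (\<Sum>k\<in>S. (c' k * (exp (- u * z k \<sigma>) - exp (- u * \<zeta> k))) * (h k \<sigma> * E k))" if u: "0 < u" for u
      unfolding h_def E_def e_def
    proof (rule exp_sum_smear_nonneg[OF fin])
      fix a m :: real assume am: "0 \<le> a" "0 \<le> m"
      have "0 \<le> (\<Sum>k\<in>S. c' k * exp (- (a * v k \<sigma>) - m * \<zeta> k - u * z k \<sigma>) - c' k * exp (- (a * v k \<sigma>) - (m + u) * \<zeta> k))"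
        using hyp[OF \<sigma> am, of u] u by (simp add: sum_subtractf)
      also have "\<dots> = (\<Sum>k\<in>S. c' k * (exp (- u * z k \<sigma>) - exp (- u * \<zeta> k)) * exp (- (a * v k \<sigma>) - m * \<zeta> k))"
      proof (intro sum.cong refl)
        fix k
        have "exp (- (a * v k \<sigma>) - m * \<zeta> k - u * z k \<sigma>) = exp (- u * z k \<sigma>) * exp (- (a * v k \<sigma>) - m * \<zeta> k)"
          "exp (- (a * v k \<sigma>) - (m + u) * \<zeta> k) = exp (- u * \<zeta> k) * exp (- (a * v k \<sigma>) - m * \<zeta> k)"
          by (simp_all add: exp_add[symmetric] algebra_simps)
        then show "c' k * exp (- (a * v k \<sigma>) - m * \<zeta> k - u * z k \<sigma>) - c' k * exp (- (a * v k \<sigma>) - (m + u) * \<zeta> k)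
          = c' k * (exp (- u * z k \<sigma>) - exp (- u * \<zeta> k)) * exp (- (a * v k \<sigma>) - m * \<zeta> k)"
          by (simp only: algebra_simps)
      qed
      finally show "0 \<le> (\<Sum>k\<in>S. c' k * (exp (- u * z k \<sigma>) - exp (- u * \<zeta> k)) * exp (- (a * v k \<sigma>) - m * \<zeta> k))" .
    qed (use v0 \<zeta>0 in auto)
    have "0 \<le> (\<integral>u. (\<Sum>k\<in>S. c' k * h k \<sigma> * E k * ((1 - exp (- u * \<zeta> k)) - (1 - exp (- u * z k \<sigma>)))) \<partial>n i)"
    proof (rule integral_nonneg_AE[OF AE_I2])
      fix u assume "u \<in> space (n i)"
      then have u: "0 < u" by (simp add: space_n)
      from 2[OF u] show "0 \<le> (\<Sum>k\<in>S. c' k * h k \<sigma> * E k * ((1 - exp (- u * \<zeta> k)) - (1 - exp (- u * z k \<sigma>))))"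
        by (simp add: mult_ac)
    qed
    also have "\<dots> = (\<Sum>k\<in>S. c' k * h k \<sigma> * E k * (Q k - (\<integral>u. (1 - exp (- u * z k \<sigma>)) \<partial>n i)))"
    proof -
      note ii = integrable_one_minus_exp[OF \<zeta>0] integrable_one_minus_exp[OF z0]
      have d: "integrable (n i) (\<lambda>u. (1 - exp (- u * \<zeta> k)) - (1 - exp (- u * z k \<sigma>)))"
        "(\<integral>u. (1 - exp (- u * \<zeta> k)) - (1 - exp (- u * z k \<sigma>)) \<partial>n i) = Q k - (\<integral>u. (1 - exp (- u * z k \<sigma>)) \<partial>n i)"
        if "k \<in> S" for k
        unfolding Q_def by (rule Bochner_Integration.integrable_diff[OF ii[OF that]] Bochner_Integration.integral_diff[OF ii[OF that]])+
      have "(\<integral>u. (\<Sum>k\<in>S. c' k * h k \<sigma> * E k * ((1 - exp (- u * \<zeta> k)) - (1 - exp (- u * z k \<sigma>)))) \<partial>n i)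
        = (\<Sum>k\<in>S. (\<integral>u. c' k * h k \<sigma> * E k * ((1 - exp (- u * \<zeta> k)) - (1 - exp (- u * z k \<sigma>))) \<partial>n i))"
        by (rule Bochner_Integration.integral_sum) (rule integrable_mult_right, rule d(1))
      also have "\<dots> = (\<Sum>k\<in>S. c' k * h k \<sigma> * E k * (Q k - (\<integral>u. (1 - exp (- u * z k \<sigma>)) \<partial>n i)))"
        by (intro sum.cong refl) (simp only: d(2) integral_mult_right_zero)
      finally show ?thesis .
    qed
    finally have 3: "0 \<le> (\<Sum>k\<in>S. c' k * h k \<sigma> * E k * (Q k - (\<integral>u. (1 - exp (- u * z k \<sigma>)) \<partial>n i)))" .
    have "(\<Sum>k\<in>S. c' k * E k * (h k \<sigma> * (\<psi> i (v k \<sigma>) - \<rho> i (z k \<sigma>)))) - (\<Sum>k\<in>S. c' k * E k * (h k \<sigma> * (\<psi> i (v k \<sigma>) - \<rho> i (\<zeta> k))))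
      = \<beta> i * d i * (\<Sum>k\<in>S. (c' k * (\<zeta> k - z k \<sigma>)) * (h k \<sigma> * E k))
       + \<beta> i * (\<Sum>k\<in>S. c' k * h k \<sigma> * E k * (Q k - (\<integral>u. (1 - exp (- u * z k \<sigma>)) \<partial>n i)))"
      unfolding \<rho>_def Q_def[symmetric] sum_distrib_left sum_subtractf[symmetric] sum.distrib[symmetric]
      by (intro sum.cong refl) (simp add: algebra_simps)
    moreover have "0 \<le> \<beta> i * d i * (\<Sum>k\<in>S. (c' k * (\<zeta> k - z k \<sigma>)) * (h k \<sigma> * E k))"
      "0 \<le> \<beta> i * (\<Sum>k\<in>S. c' k * h k \<sigma> * E k * (Q k - (\<integral>u. (1 - exp (- u * z k \<sigma>)) \<partial>n i)))"
      using 1 3 \<beta>_pos[of i] d_pos[of i] by auto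
    ultimately show ?thesis by linarith
  qed
  have Gc: "continuous_on UNIV (\<lambda>\<sigma>. \<Sum>k\<in>S. c' k * E k * (h k \<sigma> * (\<psi> i (v k \<sigma>) - \<rho> i (\<zeta> k))))"
    by (intro continuous_intros h_c psi_c)
  show ?thesis
    unfolding generator_ineq_def
  proof (intro conjI allI impI m3)
    show "(\<integral>\<sigma>. weak_gen i R \<sigma> \<partial>unif01) \<le> (\<integral>m. smear 1 R 0 1 m - smear 1 R 0 0 m \<partial>unif01) / 2"
      unfolding rhs weak_gen
    proof (rule integral_mono_AE)
      show "AE \<sigma> in unif01. (\<Sum>k\<in>S. c' k * E k * (h k \<sigma> * (\<psi> i (v k \<sigma>) - \<rho> i (\<zeta> k))))
         \<le> (\<Sum>k\<in>S. c' k * E k * (h k \<sigma> * (\<psi> i (v k \<sigma>) - \<rho> i (z k \<sigma>))))"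
        using AE_unif01 by eventually_elim (rule key, simp)
    qed (rule continuous_integrable_unif01, (intro continuous_intros h_c psi_c rho_c; assumption))+
    show "(\<lambda>\<sigma>. \<integral>u. offspring_term R \<sigma> u \<partial>n i) \<in> borel_measurable borel"
      unfolding Nint by (intro borel_measurable_continuous_onI continuous_intros h_c)
    show "(\<lambda>x. \<integral>u. jump_term R (fst x) (snd x) u \<partial>l i) \<in> borel_measurable (borel \<Otimes>\<^sub>M borel)"
    proof -
      have 1: "(\<lambda>x. f (fst x)) \<in> borel_measurable (borel \<Otimes>\<^sub>M (borel :: real measure))" if "continuous_on UNIV f" for f :: "real \<Rightarrow> real"
        by (rule measurable_compose[OF measurable_fst borel_measurable_continuous_onI[OF that]])
      have 2: "(\<lambda>x. e k (snd x)) \<in> borel_measurable ((borel :: real measure) \<Otimes>\<^sub>M borel)" for k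
        unfolding e_def by measurable
      show ?thesis unfolding Lint
        by (intro borel_measurable_sum borel_measurable_times borel_measurable_diff borel_measurable_power
            borel_measurable_const 1 2 h_c psi_c vc)
    qed
  qed (rule Lb)
qed

end

lemma smear_product:
  assumes w: "0 \<le> w" and R: "\<And>\<sigma> a m. R \<sigma> a m = s * exp (- (max 0 a * w)) * g m" and r: "0 \<le> r"
  shows "smear p R r \<sigma> m = s * (1 / (1 + w) ^ Suc p) * exp (- (r * w)) * g m"
proof -
  have "smear p R r \<sigma> m = (\<integral>a. s * exp (- (r * w)) * g m * exp (- (a * w)) \<partial>erlang p)"
    unfolding smear_def R
  proof (rule integral_cong_AE)
    show "AE a in erlang p. s * exp (- (max 0 (a + r) * w)) * g m = s * exp (- (r * w)) * g m * exp (- (a * w))"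
      using AE_erlang
    proof eventually_elim
      case (elim a)
      then have "max 0 (a + r) = a + r" using r by simp
      then show ?case by (simp add: exp_add[symmetric] distrib_right)
    qed
  qed auto
  also have "\<dots> = s * exp (- (r * w)) * g m * (1 / (1 + w) ^ Suc p)"
    by (subst integral_mult_right_zero) (simp add: laplace_erlang[OF w])
  finally show ?thesis by simp
qed

lemma AE_unif01_pos: "AE x in unif01. 0 < x"
proof -
  have "AE x in unif01. x \<noteq> 0"
    unfolding unif01_def by (subst AE_density) (auto intro: AE_mp[OF AE_lborel_singleton[of 0]])
  with AE_unif01 show ?thesis by eventually_elim auto
qed

text \<open>
  Without dependence on \<open>\<sigma>\<close> the right-hand side of the inequality is \<open>0\<close>, and the smeared exponentials
  factor out with a positive constant.
\<close>

lemma (in mechanism) generator_ineq_product_finite: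
  assumes w: "0 \<le> w" and \<kappa>: "0 \<le> \<kappa>" and s: "s = 1 \<or> s = -1"
    and generator_ineq: "generator_ineq i (\<lambda>\<sigma> a m. s * exp (- (max 0 a * w)) * exp (- (max 0 m * \<kappa>)))"
  shows "s * (\<psi> i w - \<rho> i \<kappa>) \<le> 0"
proof -
  define R where "R = (\<lambda>(\<sigma>::real) a m. s * exp (- (max 0 a * w)) * exp (- (max 0 m * \<kappa>)))"
  have m3: "bounded_meas3 R" using generator_ineq unfolding generator_ineq_def R_def by blast
  define h where "h = 1 / (1 + w) ^ 3"
  have hp: "0 < h" using w unfolding h_def by simp
  have I: "smear 2 R r \<sigma> m = s * h * exp (- (r * w)) * exp (- (max 0 m * \<kappa>))"
    "smear 1 R r \<sigma> m = s * (h * (1 + w)) * exp (- (r * w)) * exp (- (max 0 m * \<kappa>))"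
    "smear 0 R r \<sigma> m = s * (h * (1 + w)\<^sup>2) * exp (- (r * w)) * exp (- (max 0 m * \<kappa>))" if "0 \<le> r" for r \<sigma> m
    using inverse_powers_via_cube[of "1 + w"] w unfolding h_def
    by (simp_all only: smear_product[OF w R_def[THEN fun_cong, THEN fun_cong, THEN fun_cong] that])
  note I = I[unfolded One_nat_def]
  define E where "E = (\<integral>m. exp (- (max 0 m * \<kappa>)) \<partial>unif01)"
  have E_eq: "E = (\<integral>m. exp (- (m * \<kappa>)) \<partial>unif01)"
    unfolding E_def by (rule integral_cong_AE) (use AE_unif01 in \<open>auto elim!: eventually_mono simp: max_def\<close>)
  then have EZ: "E * \<kappa> = 1 - exp (- \<kappa>)" using laplace_unif01[of \<kappa>] by simp
  have "E > 0"
  proof -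
    have "(\<integral>m. exp (- \<kappa>) \<partial>unif01) \<le> (\<integral>m. exp (- (m * \<kappa>)) \<partial>unif01)"
    proof (rule integral_mono_AE)
      show "AE m in unif01. exp (- \<kappa>) \<le> exp (- (m * \<kappa>))"
        using AE_unif01 by eventually_elim (use \<kappa> in \<open>simp add: mult_left_le_one_le\<close>)
    qed (intro continuous_integrable_unif01 continuous_intros)+
    moreover have "(\<integral>m. exp (- \<kappa>) \<partial>unif01) = exp (- \<kappa>)"
      using prob_space.prob_space[OF unif01_prob] by simp
    ultimately show ?thesis unfolding E_eq using exp_gt_zero[of "- \<kappa>"] by linarith
  qed
  have ei: "integrable unif01 (\<lambda>m. exp (- (max 0 m * \<kappa>)))"
    by (rule continuous_integrable_unif01) (intro continuous_intros)
  have Lint: "(\<integral>u. jump_term R \<sigma> m u \<partial>l i) = s * h * exp (- (max 0 m * \<kappa>)) * (\<psi> i w - b i * w - c i * w\<^sup>2)" for \<sigma> m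
  proof -
    have "(\<integral>u. jump_term R \<sigma> m u \<partial>l i) = (\<integral>u. s * h * exp (- (max 0 m * \<kappa>)) * (exp (- w * u) - 1 + w * u) \<partial>l i)"
      by (rule Bochner_Integration.integral_cong) (auto simp: space_l jump_term_def I algebra_simps)
    then show ?thesis unfolding psi_def by simp
  qed
  have weak_psi: "weak_psi i R \<sigma> m = s * h * \<psi> i w * exp (- (max 0 m * \<kappa>))" for \<sigma> m
    unfolding weak_psi_def Lint by (simp add: I algebra_simps power2_eq_square)
  have N: "offspring_term R \<sigma> u = s * h * E * (1 - exp (- u * \<kappa>))" if u: "0 < u" for \<sigma> u
  proof -
    have "offspring_term R \<sigma> u = (\<integral>m. s * h * (1 - exp (- u * \<kappa>)) * exp (- (max 0 m * \<kappa>)) \<partial>unif01)"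
      unfolding offspring_term_def
    proof (rule integral_cong_AE)
      show "AE m in unif01. smear 2 R 0 \<sigma> m - smear 2 R 0 \<sigma> (m + u) = s * h * (1 - exp (- u * \<kappa>)) * exp (- (max 0 m * \<kappa>))"
        using AE_unif01
      proof eventually_elim
        case (elim m)
        have "exp (- (max 0 (m + u) * \<kappa>)) = exp (- u * \<kappa>) * exp (- (max 0 m * \<kappa>))"
          using elim u by (simp add: exp_add[symmetric] algebra_simps)
        then show ?case by (simp add: I algebra_simps)
      qed
      show "(\<lambda>m. smear 2 R 0 \<sigma> m - smear 2 R 0 \<sigma> (m + u)) \<in> borel_measurable unif01"
        by (intro borel_measurable_diff smear_meas[OF m3]) auto
    qed auto
    then show ?thesis unfolding E_def by simp
  qed
  have Nint: "(\<integral>u. offspring_term R \<sigma> u \<partial>n i) = s * h * E * (\<integral>u. (1 - exp (- u * \<kappa>)) \<partial>n i)" for \<sigma>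
  proof -
    have "(\<integral>u. offspring_term R \<sigma> u \<partial>n i) = (\<integral>u. s * h * E * (1 - exp (- u * \<kappa>)) \<partial>n i)"
      by (rule Bochner_Integration.integral_cong) (auto simp: space_n N)
    then show ?thesis by simp
  qed
  have weak_gen: "weak_gen i R \<sigma> = s * h * E * (\<psi> i w - \<rho> i \<kappa>)" for \<sigma>
  proof -
    have "(\<integral>m. weak_psi i R \<sigma> m \<partial>unif01) = s * h * \<psi> i w * E" unfolding weak_psi E_def by simp
    moreover have 2: "smear 2 R 0 \<sigma> 1 - smear 2 R 0 \<sigma> 0 = - (s * h * (E * \<kappa>))"
      unfolding EZ by (simp add: I algebra_simps)
    ultimately show ?thesis
      unfolding weak_gen_def Nint \<rho>_def 2 by (simp add: algebra_simps)
  qed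
  have "(\<integral>\<sigma>. weak_gen i R \<sigma> \<partial>unif01) \<le> (\<integral>m. smear 1 R 0 1 m - smear 1 R 0 0 m \<partial>unif01) / 2"
    using generator_ineq unfolding generator_ineq_def R_def by blast
  also have "\<dots> = 0" by (simp add: I)
  finally have "s * h * E * (\<psi> i w - \<rho> i \<kappa>) \<le> 0"
    using prob_space.prob_space[OF unif01_prob] by (simp add: weak_gen)
  then have "(h * E) * (s * (\<psi> i w - \<rho> i \<kappa>)) \<le> 0" by (simp add: mult_ac)
  then show ?thesis using hp \<open>E > 0\<close> by (simp add: mult_le_0_iff)
qed

text \<open>
  For \<open>\<kappa> = \<infinity>\<close> the second factor is the indicator of \<open>m = 0\<close>.  It is invisible to all integrals over \<open>m\<close>,
  and only the boundary term at \<open>m = 0\<close> remains, whose coefficient \<open>\<beta> i * d i\<close> is positive.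
\<close>

lemma (in mechanism) generator_ineq_product_infinite:
  assumes w: "0 \<le> w"
    and generator_ineq: "generator_ineq i (\<lambda>\<sigma> a m. - 1 * exp (- (max 0 a * w)) * (if m \<le> 0 then 1 else 0))"
  shows False
proof -
  define R where "R = (\<lambda>(\<sigma>::real) a (m::real). - 1 * exp (- (max 0 a * w)) * (if m \<le> 0 then 1 else 0 :: real))"
  have m3: "bounded_meas3 R" using generator_ineq unfolding generator_ineq_def R_def by blast
  define h where "h = 1 / (1 + w) ^ 3"
  have hp: "0 < h" using w unfolding h_def by simp
  have I: "smear p R r \<sigma> m = - (1 / (1 + w) ^ Suc p) * exp (- (r * w)) * (if m \<le> 0 then 1 else 0)" if "0 \<le> r" for p r \<sigma> m
    using smear_product[OF w R_def[THEN fun_cong, THEN fun_cong, THEN fun_cong] that] by simp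
  have I_pos: "smear p R r \<sigma> m = 0" if "0 \<le> r" "0 < m" for p r \<sigma> m using that by (simp add: I)
  have mPsi: "(\<integral>m. weak_psi i R \<sigma> m \<partial>unif01) = 0" for \<sigma>
  proof -
    have "weak_psi i R \<sigma> m = 0" if m: "0 < m" for m
    proof -
      have "(\<integral>u. jump_term R \<sigma> m u \<partial>l i) = (\<integral>u. 0 \<partial>l i)"
        by (rule Bochner_Integration.integral_cong) (auto simp: space_l jump_term_def I_pos m)
      then show ?thesis unfolding weak_psi_def by (simp add: I_pos m)
    qed
    with AE_unif01_pos have "AE m in unif01. weak_psi i R \<sigma> m = 0" by (auto elim!: eventually_mono)
    then show ?thesis by (rule integral_eq_zero_AE)
  qed
  have Nint: "(\<integral>u. offspring_term R \<sigma> u \<partial>n i) = 0" for \<sigma>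
  proof -
    have "offspring_term R \<sigma> u = 0" if u: "0 < u" for u
      unfolding offspring_term_def
      by (rule integral_eq_zero_AE) (use AE_unif01_pos u in \<open>auto elim!: eventually_mono simp: I_pos\<close>)
    then have "(\<integral>u. offspring_term R \<sigma> u \<partial>n i) = (\<integral>u. 0 \<partial>n i)"
      by (intro Bochner_Integration.integral_cong) (auto simp: space_n)
    then show ?thesis by simp
  qed
  have weak_gen: "weak_gen i R \<sigma> = \<beta> i * d i * h" for \<sigma>
    unfolding weak_gen_def mPsi Nint h_def by (simp add: I numeral_3_eq_3 numeral_2_eq_2)
  have "(\<integral>\<sigma>. weak_gen i R \<sigma> \<partial>unif01) \<le> (\<integral>m. smear 1 R 0 1 m - smear 1 R 0 0 m \<partial>unif01) / 2"
    using generator_ineq unfolding generator_ineq_def R_def by blast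
  also have "\<dots> = 0" by (simp add: I)
  finally have "\<beta> i * d i * h \<le> 0"
    using prob_space.prob_space[OF unif01_prob] by (simp add: weak_gen)
  moreover have "0 < \<beta> i * d i * h" using hp \<beta>_pos[of i] d_pos[of i] by simp
  ultimately show False by simp
qed

section \<open>Pairings and cumulants\<close>

lemma exp_neg_ennreal: "0 \<le> r \<Longrightarrow> exp_neg (ennreal r) = exp (- r)"
  unfolding exp_neg_def by simp

lemma exp_neg_0 [simp]: "exp_neg 0 = 1"
  unfolding exp_neg_def by simp

lemma exp_neg_nonneg: "0 \<le> exp_neg x" and exp_neg_le_1: "exp_neg x \<le> 1" and exp_neg_abs_le_1: "\<bar>exp_neg x\<bar> \<le> 1"
  unfolding exp_neg_def by auto

lemma exp_neg_antimono: "x \<le> y \<Longrightarrow> exp_neg y \<le> exp_neg x"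
  unfolding exp_neg_def by (auto simp: enn2real_mono less_top[symmetric] top_unique)

lemma exp_neg_add: "exp_neg (x + y) = exp_neg x * exp_neg y"
  by (cases x; cases y) (auto simp: exp_neg_def enn2real_plus exp_add[symmetric] exp_diff simp flip: ennreal_plus)

lemma exp_neg_meas [measurable]: "exp_neg \<in> borel_measurable borel"
  unfolding exp_neg_def by measurable

lemma exp_neg_small_if_large:
  assumes "0 < e" obtains M :: real where "0 \<le> M" "\<And>x. ennreal M < x \<Longrightarrow> exp_neg x < e"
proof
  define M where "M = max 0 (- ln e)"
  show "0 \<le> M" unfolding M_def by simp
  fix x assume M: "ennreal M < x"
  show "exp_neg x < e"
  proof (cases x)
    case (real r)
    then have "M < r" using M \<open>0 \<le> M\<close> by (simp add: ennreal_less_iff)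
    then have "- r < ln e" unfolding M_def by linarith
    then have "exp (- r) < exp (ln e)" by simp
    then show ?thesis using real assms by (simp add: exp_neg_ennreal)
  qed (use assms in \<open>simp add: exp_neg_def\<close>)
qed

lemma exp_neg_tendsto:
  assumes "(f \<longlongrightarrow> L) F"
  shows "((\<lambda>x. exp_neg (f x)) \<longlongrightarrow> exp_neg L) F"
proof (cases L)
  case (real r)
  have ev: "eventually (\<lambda>x. f x < \<infinity>) F"
    by (rule order_tendstoD(2)[OF assms]) (simp add: real)
  have "((\<lambda>x. enn2real (f x)) \<longlongrightarrow> r) F"
    by (rule tendsto_enn2real) (rule assms[unfolded real(2)], rule real(1))
  then have "((\<lambda>x. exp (- enn2real (f x))) \<longlongrightarrow> exp (- r)) F" by (intro tendsto_exp tendsto_minus)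
  then show ?thesis
    using real by (subst tendsto_cong[OF eventually_mono[OF ev]]) (auto simp: exp_neg_def)
next
  case top
  show ?thesis
  proof (rule order_tendstoI)
    fix a assume "a < exp_neg L"
    then have "a < 0" using top by (simp add: exp_neg_def)
    then show "eventually (\<lambda>x. a < exp_neg (f x)) F" by (intro always_eventually allI less_le_trans[OF _ exp_neg_nonneg])
  next
    fix a assume "exp_neg L < a"
    then have "0 < a" using top by (simp add: exp_neg_def)
    then obtain M where M: "\<And>x. ennreal M < x \<Longrightarrow> exp_neg x < a" using exp_neg_small_if_large by blast
    have "eventually (\<lambda>x. ennreal M < f x) F"
      by (rule order_tendstoD(1)[OF assms]) (simp add: top)
    then show "eventually (\<lambda>x. exp_neg (f x) < a) F" by (rule eventually_mono) (rule M)
  qed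
qed

lemma pairing_meas [measurable]: "(\<lambda>x :: nat \<Rightarrow> real. pairing f x) \<in> borel_measurable borel"
proof -
  have [measurable]: "(\<lambda>x :: nat \<Rightarrow> real. x i) \<in> borel_measurable borel" for i
    by (rule borel_measurable_continuous_onI[OF continuous_on_product_coordinates])
  show ?thesis unfolding pairing_def by measurable
qed

lemma pairing_add: "pairing (\<lambda>j. f j + g j) x = pairing f x + pairing g x"
  unfolding pairing_def by (simp add: distrib_right suminf_add)

lemma pairing_mult: "pairing (\<lambda>j. a * f j) x = a * pairing f x"
  unfolding pairing_def by (simp add: mult.assoc ennreal_suminf_cmult)

lemma pairing_mono: "(\<And>j. f j \<le> g j) \<Longrightarrow> pairing f x \<le> pairing g x"
  unfolding pairing_def by (intro suminf_le mult_right_mono) auto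

text \<open>
  The real-valued pairing, for bounded functions and finite measures.
\<close>

definition lin :: "(nat \<Rightarrow> real) \<Rightarrow> (nat \<Rightarrow> real) \<Rightarrow> real" where
  "lin f \<mu> = (\<Sum>j. f j * \<mu> j)"

abbreviation mass :: "(nat \<Rightarrow> real) \<Rightarrow> ennreal" where
  "mass x \<equiv> pairing (\<lambda>_. 1) x"

lemma lin_summable:
  assumes "\<mu> \<in> finite_measures" "\<And>j. 0 \<le> f j" "\<And>j. f j \<le> F"
  shows "summable (\<lambda>j. f j * \<mu> j)"
  by (rule summable_comparison_test'[where g = "\<lambda>j. F * \<mu> j" and N = 0])
    (use assms in \<open>auto simp: finite_measures_def abs_mult intro!: summable_mult mult_right_mono\<close>)

lemma pairing_lin:
  assumes "\<mu> \<in> finite_measures" "\<And>j. 0 \<le> f j" "\<And>j. f j \<le> F"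
  shows "pairing (\<lambda>j. ennreal (f j)) \<mu> = ennreal (lin f \<mu>)"
proof -
  have "pairing (\<lambda>j. ennreal (f j)) \<mu> = (\<Sum>j. ennreal (f j * \<mu> j))"
    unfolding pairing_def using assms by (intro suminf_cong) (auto simp: finite_measures_def ennreal_mult)
  also have "\<dots> = ennreal (lin f \<mu>)"
    unfolding lin_def by (rule suminf_ennreal2[OF _ lin_summable[OF assms]])
      (use assms in \<open>auto simp: finite_measures_def\<close>)
  finally show ?thesis .
qed

lemma lin_nonneg:
  assumes "\<mu> \<in> finite_measures" "\<And>j. 0 \<le> f j" "\<And>j. f j \<le> F"
  shows "0 \<le> lin f \<mu>"
  unfolding lin_def by (rule suminf_nonneg[OF lin_summable[OF assms]]) (use assms in \<open>auto simp: finite_measures_def\<close>)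

lemma exp_neg_lin:
  assumes "\<mu> \<in> finite_measures" "\<And>j. 0 \<le> f j" "\<And>j. f j \<le> F"
  shows "exp_neg (pairing (\<lambda>j. ennreal (f j)) \<mu>) = exp (- lin f \<mu>)"
  using pairing_lin[OF assms] lin_nonneg[OF assms] by (simp add: exp_neg_ennreal)

lemma lin_tendsto:
  assumes \<mu>: "\<mu> \<in> finite_measures" and f: "\<And>k j. 0 \<le> f k j" "\<And>k j. f k j \<le> F"
    and lim: "\<And>j. (\<lambda>k. f k j) \<longlonglongrightarrow> g j"
  shows "(\<lambda>k. lin (f k) \<mu>) \<longlonglongrightarrow> lin g \<mu>"
  unfolding lin_def
proof (rule tannerys_theorem[THEN conjunct2, THEN conjunct2])
  show "(\<lambda>k. f k j * \<mu> j) \<longlonglongrightarrow> g j * \<mu> j" for j by (intro tendsto_intros lim)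
  show "\<forall>\<^sub>F (j, k) in at_top \<times>\<^sub>F sequentially. norm (f k j * \<mu> j) \<le> F * \<mu> j"
    using \<mu> f by (intro always_eventually) (auto simp: abs_mult finite_measures_def intro!: mult_right_mono)
  show "summable (\<lambda>j. F * \<mu> j)" using \<mu> by (auto simp: finite_measures_def intro!: summable_mult)
qed simp

lemma lin_mono:
  assumes "\<mu> \<in> finite_measures" "\<And>j. 0 \<le> f j" "\<And>j. f j \<le> g j" "\<And>j. g j \<le> G"
  shows "lin f \<mu> \<le> lin g \<mu>"
proof -
  have "0 \<le> g j" "f j \<le> G" for j using assms(2,3,4) order_trans by blast+
  then show ?thesis unfolding lin_def
    by (intro suminf_le lin_summable[where F = G]) (use assms in \<open>auto simp: finite_measures_def intro: mult_right_mono\<close>)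
qed

lemma lin_const: "\<mu> \<in> finite_measures \<Longrightarrow> lin (\<lambda>_. C) \<mu> = C * suminf \<mu>"
  unfolding lin_def finite_measures_def by (simp add: suminf_mult)

lemma unit_mass_finite: "unit_mass i \<in> finite_measures"
proof -
  have "summable (unit_mass i)"
    by (rule summable_finite[of "{i}"]) (auto simp: unit_mass_def)
  then show ?thesis by (auto simp: finite_measures_def unit_mass_def)
qed

lemma lin_scaled_unit: "lin f (\<lambda>j. a * unit_mass i j) = a * f i"
proof -
  have "(\<Sum>j. f j * (a * unit_mass i j)) = (\<Sum>j\<in>{i}. f j * (a * unit_mass i j))"
    by (rule suminf_finite) (auto simp: unit_mass_def)
  then show ?thesis unfolding lin_def by (simp add: unit_mass_def)
qed

lemma lin_unit: "lin f (unit_mass i) = f i"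
  using lin_scaled_unit[of f 1 i] by simp

lemma finite_measures_scale: "\<mu> \<in> finite_measures \<Longrightarrow> 0 \<le> a \<Longrightarrow> (\<lambda>j. a * \<mu> j) \<in> finite_measures"
  by (auto simp: finite_measures_def intro: summable_mult)

lemma finite_measures_add: "\<mu> \<in> finite_measures \<Longrightarrow> \<nu> \<in> finite_measures \<Longrightarrow> (\<lambda>j. \<mu> j + \<nu> j) \<in> finite_measures"
  by (auto simp: finite_measures_def intro: summable_add)

lemma
  fixes p :: "nat pmf"
  shows pmf_finite_measure: "pmf p \<in> finite_measures" and suminf_pmf: "suminf (pmf p) = 1"
proof -
  have "(\<Sum>j. ennreal (pmf p j)) = 1"
    using nn_integral_measure_pmf[of p "\<lambda>_. 1"] by (simp add: nn_integral_count_space_nat)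
  then have s: "summable (pmf p)"
    by (intro summable_suminf_not_top) auto
  then show "pmf p \<in> finite_measures" by (simp add: finite_measures_def)
  have "ennreal (suminf (pmf p)) = 1"
    using suminf_ennreal2[OF _ s] \<open>(\<Sum>j. ennreal (pmf p j)) = 1\<close> by simp
  then show "suminf (pmf p) = 1" by (simp add: suminf_nonneg[OF s])
qed

locale mcsbp = mechanism +
  fixes \<Omega> :: "'w measure" and X :: "real \<Rightarrow> 'w \<Rightarrow> nat \<Rightarrow> real"
    and P :: "(nat \<Rightarrow> real) \<Rightarrow> 'w measure"
  assumes mc: "is_mcsbp b c l \<beta> d \<pi> n \<Omega> X P"
begin

lemma strong_markov: "strong_markov_process \<Omega> X P"
  using mc unfolding is_mcsbp_def by blast

lemma X_meas [measurable]: "0 \<le> t \<Longrightarrow> X t \<in> \<Omega> \<rightarrow>\<^sub>M borel"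
  and X_right_continuous: "\<omega> \<in> space \<Omega> \<Longrightarrow> 0 \<le> t \<Longrightarrow> continuous (at_right t) (\<lambda>s. X s \<omega>)"
  and P_prob: "\<mu> \<in> finite_measures \<Longrightarrow> prob_space (P \<mu>)"
  and P_sets: "\<mu> \<in> finite_measures \<Longrightarrow> sets (P \<mu>) = sets \<Omega>"
  using strong_markov unfolding strong_markov_process_def by blast+

lemma P_space: "\<mu> \<in> finite_measures \<Longrightarrow> space (P \<mu>) = space \<Omega>"
  using sets_eq_imp_space_eq[OF P_sets] .

lemma X_meas_P [measurable]: "\<mu> \<in> finite_measures \<Longrightarrow> 0 \<le> t \<Longrightarrow> X t \<in> P \<mu> \<rightarrow>\<^sub>M borel"
  using X_meas by (simp add: measurable_cong_sets[OF P_sets refl])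

lemma X_finite:
  assumes "\<mu> \<in> finite_measures" "0 \<le> t"
  shows "AE \<omega> in P \<mu>. X t \<omega> \<in> finite_measures"
proof -
  have "AE \<omega> in P \<mu>. (ennreal t) < \<infinity> \<longrightarrow> X (enn2real (ennreal t)) \<omega> \<in> finite_measures"
    using strong_markov assms(1) stopping_time_const[of "natural_filtration \<Omega> X" "ennreal t"]
    unfolding strong_markov_process_def by blast
  then show ?thesis using assms(2) by simp
qed

text \<open>
  Read off from the Laplace functional of a single individual, the cumulant is also available for
  functions that may vanish, to which the defining property of the process does not refer.
\<close>

definition cumulant :: "real \<Rightarrow> (nat \<Rightarrow> real) \<Rightarrow> nat \<Rightarrow> real" where
  "cumulant t f i = - ln (\<integral>\<omega>. exp_neg (pairing (\<lambda>j. ennreal (f j)) (X t \<omega>)) \<partial>P (unit_mass i))"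

abbreviation offspring_mean :: "nat \<Rightarrow> (nat \<Rightarrow> real) \<Rightarrow> real" where
  "offspring_mean i f \<equiv> lin f (pmf (\<pi> i))"

definition rate :: "nat \<Rightarrow> (nat \<Rightarrow> real) \<Rightarrow> real" where
  "rate i f = \<psi> i (f i) - \<rho> i (offspring_mean i f)"

text \<open>
  The solution postulated for strictly positive functions is determined by the process, so it coincides
  with the cumulant.
\<close>

lemma pos_case:
  assumes f: "f \<in> bounded_pos_funs" and t: "0 \<le> t"
  shows "0 \<le> cumulant t f i" and "\<exists>K\<ge>0. \<forall>s\<in>{0..t}. \<forall>i. cumulant s f i \<le> K"
    and "set_integrable lborel {0..t} (\<lambda>s. rate i (cumulant s f))"
    and "cumulant t f i = f i - (LINT s:{0..t}|lborel. rate i (cumulant s f))"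
    and "\<mu> \<in> finite_measures \<Longrightarrow>
      (\<integral>\<omega>. exp_neg (pairing (\<lambda>j. ennreal (f j)) (X t \<omega>)) \<partial>P \<mu>) = exp (- lin (cumulant t f) \<mu>)"
proof -
  obtain V :: "real \<Rightarrow> (nat \<Rightarrow> real) \<Rightarrow> nat \<Rightarrow> real" where V: "\<forall>f\<in>bounded_pos_funs. \<forall>t\<ge>0.
        (\<forall>i. 0 \<le> V t f i) \<and>
        (\<exists>K. \<forall>s\<in>{0..t}. \<forall>i. V s f i \<le> K) \<and>
        (\<forall>i. set_integrable lborel {0..t}
               (\<lambda>s. psi b c l i (V s f i) + phi \<beta> d \<pi> n i (\<lambda>j. ennreal (V s f j)))) \<and>
        (\<forall>i. V t f i = f i - (LINT s:{0..t}|lborel.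
               psi b c l i (V s f i) + phi \<beta> d \<pi> n i (\<lambda>j. ennreal (V s f j)))) \<and>
        (\<forall>\<mu>\<in>finite_measures.
           (\<integral>\<omega>. exp_neg (pairing (\<lambda>j. ennreal (f j)) (X t \<omega>)) \<partial>P \<mu>)
             = exp_neg (pairing (\<lambda>j. ennreal (V t f j)) \<mu>))"
    using mc unfolding is_mcsbp_def by (elim conjE exE) (rule that, assumption)
  have V0: "0 \<le> V s f i" if "0 \<le> s" for s i using V f that by blast
  obtain K where K: "\<And>s i. 0 \<le> s \<Longrightarrow> s \<le> t \<Longrightarrow> V s f i \<le> K" using V f t by (metis atLeastAtMost_iff)
  have LT: "(\<integral>\<omega>. exp_neg (pairing (\<lambda>j. ennreal (f j)) (X s \<omega>)) \<partial>P \<mu>) = exp (- lin (V s f) \<mu>)"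
    if "\<mu> \<in> finite_measures" "0 \<le> s" "s \<le> t" for \<mu> s
  proof -
    have "(\<integral>\<omega>. exp_neg (pairing (\<lambda>j. ennreal (f j)) (X s \<omega>)) \<partial>P \<mu>)
             = exp_neg (pairing (\<lambda>j. ennreal (V s f j)) \<mu>)" using V f that by blast
    also have "\<dots> = exp (- lin (V s f) \<mu>)"
      by (rule exp_neg_lin[OF that(1), where F = K]) (use V0 K that in auto)
    finally show ?thesis .
  qed
  have cumulant: "cumulant s f i = V s f i" if "0 \<le> s" "s \<le> t" for s i
    unfolding cumulant_def LT[OF unit_mass_finite that] by (simp add: lin_unit)
  have VV': "cumulant s f = V s f" if "0 \<le> s" "s \<le> t" for s using cumulant[OF that] by auto
  have rate: "psi b c l i (V s f i) + phi \<beta> d \<pi> n i (\<lambda>j. ennreal (V s f j)) = rate i (cumulant s f)"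
    if "0 \<le> s" "s \<le> t" for s i
    using pairing_lin[OF pmf_finite_measure, of "V s f" K "\<pi> i"] lin_nonneg[OF pmf_finite_measure, of "V s f" K "\<pi> i"] V0 K that
    by (simp add: rate_def phi_eq VV')
  show "0 \<le> cumulant t f i" using V0 cumulant t by auto
  have "V 0 f i \<le> K" "0 \<le> V 0 f i" for i using K V0 t by auto
  then have "0 \<le> K" by (rule order_trans[rotated])
  then show "\<exists>K\<ge>0. \<forall>s\<in>{0..t}. \<forall>i. cumulant s f i \<le> K" using K cumulant by auto
  have "set_integrable lborel {0..t} (\<lambda>s. psi b c l i (V s f i) + phi \<beta> d \<pi> n i (\<lambda>j. ennreal (V s f j)))"
    using V f t by blast
  then show "set_integrable lborel {0..t} (\<lambda>s. rate i (cumulant s f))"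
    by (rule set_integrable_cong[OF refl refl, THEN iffD1, rotated]) (simp add: rate)
  have "V t f i = f i - (LINT s:{0..t}|lborel.
               psi b c l i (V s f i) + phi \<beta> d \<pi> n i (\<lambda>j. ennreal (V s f j)))" using V f t by blast
  also have "(LINT s:{0..t}|lborel. psi b c l i (V s f i) + phi \<beta> d \<pi> n i (\<lambda>j. ennreal (V s f j)))
     = (LINT s:{0..t}|lborel. rate i (cumulant s f))"
    by (rule set_lebesgue_integral_cong) (auto simp: rate)
  finally show "cumulant t f i = f i - (LINT s:{0..t}|lborel. rate i (cumulant s f))" using cumulant t by simp
  show "(\<integral>\<omega>. exp_neg (pairing (\<lambda>j. ennreal (f j)) (X t \<omega>)) \<partial>P \<mu>) = exp (- lin (cumulant t f) \<mu>)"
    if "\<mu> \<in> finite_measures" using LT[OF that t] VV'[OF t] by simp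
qed

lemma offspring_mean_bounds:
  assumes "\<And>j. 0 \<le> f j" "\<And>j. f j \<le> F"
  shows "0 \<le> offspring_mean i f" "offspring_mean i f \<le> F"
proof -
  show "0 \<le> offspring_mean i f" by (rule lin_nonneg[OF pmf_finite_measure assms])
  have "offspring_mean i f \<le> lin (\<lambda>_. F) (pmf (\<pi> i))"
    by (rule lin_mono[OF pmf_finite_measure assms, of F]) simp
  then show "offspring_mean i f \<le> F" by (simp add: lin_const[OF pmf_finite_measure] suminf_pmf)
qed

lemma rate_bounds:
  assumes "\<And>j. 0 \<le> f j" "\<And>j. f j \<le> F"
  shows "- (2 * B * F) \<le> rate i f" "rate i f \<le> 2 * B * (F + F\<^sup>2)"
proof -
  have F: "0 \<le> F" using assms order_trans by blast
  note m = offspring_mean_bounds[of f F i, OF assms] and p = psi_bounds[OF assms(1)[of i], of i]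
  note r = rho_bounds[OF m(1), of i]
  have "B * f i \<le> B * F" "B * offspring_mean i f \<le> B * F" using assms m(2) B_pos by simp_all
  then show "- (2 * B * F) \<le> rate i f" unfolding rate_def using p r by linarith
  have "(f i)\<^sup>2 \<le> F\<^sup>2" by (rule power_mono) (use assms in auto)
  then have "f i + (f i)\<^sup>2 \<le> F + F\<^sup>2" using assms(2)[of i] by linarith
  then have "2 * B * (f i + (f i)\<^sup>2) \<le> 2 * B * (F + F\<^sup>2)" using B_pos by simp
  then show "rate i f \<le> 2 * B * (F + F\<^sup>2)" unfolding rate_def using p r by linarith
qed

text \<open>
  The bound of a Gronwall argument in a norm with weight \<open>exp (- lam * t)\<close>; the denominator absorbs the
  contraction constant \<open>2 * B / lam\<close>.
\<close>

definition growth :: "real \<Rightarrow> real \<Rightarrow> real" where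
  "growth lam t = exp (lam * t) / (1 - 2 * B / lam)"

text \<open>
  Let \<open>M\<close> be the supremum of \<open>exp (- lam * s) * cumulant s f i\<close> over all types and all \<open>s\<close> up to \<open>t\<close>, which
  is finite by assumption on the solution.  The evolution equation gives \<open>M \<le> F + 2 * B * M / lam\<close>.
\<close>

lemma cumulant_upper_pos:
  assumes f: "f \<in> bounded_pos_funs" and F: "\<And>j. f j \<le> F" and t: "0 \<le> t" and lam: "2 * B < lam"
  shows "cumulant t f i \<le> F * growth lam t"
proof -
  have lp: "0 < lam" using lam B_pos by linarith
  obtain K where K: "\<And>s i. 0 \<le> s \<Longrightarrow> s \<le> t \<Longrightarrow> cumulant s f i \<le> K" using pos_case(2)[OF f t] by (metis atLeastAtMost_iff)
  define A where "A = (\<lambda>(s, i). exp (- (lam * s)) * cumulant s f i) ` ({0..t} \<times> UNIV)"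
  define M where "M = Sup A"
  have ne: "A \<noteq> {}" unfolding A_def using t by auto
  have K0: "0 \<le> K" using K[of 0 0] pos_case(1)[OF f, of 0 0] t by linarith
  have bdd: "bdd_above A"
  proof (rule bdd_aboveI)
    fix x assume "x \<in> A"
    then obtain s i where s: "0 \<le> s" "s \<le> t" "x = exp (- (lam * s)) * cumulant s f i" unfolding A_def by auto
    have "exp (- (lam * s)) * cumulant s f i \<le> 1 * K"
      using s lp K[OF s(1,2)] pos_case(1)[OF f s(1)] by (intro mult_mono) auto
    then show "x \<le> K" using s by simp
  qed
  have VM: "cumulant s f i \<le> M * exp (lam * s)" if "0 \<le> s" "s \<le> t" for s i
  proof -
    have "exp (- (lam * s)) * cumulant s f i \<le> M" unfolding M_def A_def
      by (rule cSup_upper) (use that bdd in \<open>auto simp: A_def\<close>)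
    then have "exp (lam * s) * (exp (- (lam * s)) * cumulant s f i) \<le> exp (lam * s) * M" by (intro mult_left_mono) auto
    moreover have "exp (lam * s) * (exp (- (lam * s)) * cumulant s f i) = cumulant s f i"
      unfolding mult.assoc[symmetric] exp_minus_inverse by simp
    ultimately show ?thesis by (simp add: mult.commute)
  qed
  have M0: "0 \<le> M" using VM[of 0 0] pos_case(1)[OF f, of 0 0] t by simp
  have step: "cumulant s f i \<le> F + 2 * B * M * exp (lam * s) / lam" if s: "0 \<le> s" "s \<le> t" for s i
  proof -
    have cont: "continuous_on {0..s} (\<lambda>r. - (2 * B * (M * exp (lam * r))))" by (intro continuous_intros)
    have int: "set_integrable lborel {0..s} (\<lambda>r. - (2 * B * (M * exp (lam * r))))"
      by (rule borel_integrable_atLeastAtMost') (rule cont)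
    have "(LINT r:{0..s}|lborel. - (2 * B * (M * exp (lam * r)))) \<le> (LINT r:{0..s}|lborel. rate i (cumulant r f))"
    proof (rule set_integral_mono[OF int pos_case(3)[OF f s(1)]])
      fix r assume "r \<in> {0..s}"
      then show "- (2 * B * (M * exp (lam * r))) \<le> rate i (cumulant r f)"
        using s by (intro rate_bounds(1) VM pos_case(1)[OF f]) auto
    qed
    moreover have "(LINT r:{0..s}|lborel. - (2 * B * (M * exp (lam * r))))
       = - (2 * B * (M * exp (lam * s))) / lam - (- (2 * B * (M * exp (lam * 0))) / lam)"
      unfolding set_lebesgue_integral_def
    proof (rule integral_FTC_Icc[OF s(1) _ cont])
      fix r :: real
      show "((\<lambda>r. - (2 * B * (M * exp (lam * r))) / lam) has_vector_derivative - (2 * B * (M * exp (lam * r)))) (at r within {0..s})"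
        unfolding has_real_derivative_iff_has_vector_derivative[symmetric]
        using lp by (auto intro!: derivative_eq_intros simp: field_simps)
    qed
    moreover have "0 \<le> 2 * B * (M * exp (lam * 0)) / lam" using B_pos M0 lp by simp
    ultimately show ?thesis
      using pos_case(4)[OF f s(1), of i] F[of i] by (simp add: mult.assoc)
  qed
  have F0: "0 \<le> F" using f F[of 0] unfolding bounded_pos_funs_def by (auto intro: less_imp_le order_trans)
  have "M \<le> F + 2 * B * M / lam" unfolding M_def
  proof (rule cSup_least[OF ne])
    fix x assume "x \<in> A"
    then obtain s i where s: "0 \<le> s" "s \<le> t" "x = exp (- (lam * s)) * cumulant s f i" unfolding A_def by auto
    have "exp (- (lam * s)) * cumulant s f i \<le> exp (- (lam * s)) * (F + 2 * B * M * exp (lam * s) / lam)"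
      by (intro mult_left_mono step s) auto
    also have "\<dots> = exp (- (lam * s)) * F + 2 * B * M / lam * (exp (lam * s) * exp (- (lam * s)))"
      by (simp add: algebra_simps)
    also have "\<dots> \<le> 1 * F + 2 * B * M / lam * 1"
      unfolding exp_minus_inverse using F0 lp s by (intro add_mono mult_right_mono) auto
    finally show "x \<le> F + 2 * B * Sup A / lam" using s(3) unfolding M_def by simp
  qed
  then have "M * (1 - 2 * B / lam) \<le> F" by (simp add: algebra_simps)
  moreover have "0 < 1 - 2 * B / lam" using lam lp by simp
  ultimately have "M \<le> F / (1 - 2 * B / lam)" by (simp add: pos_le_divide_eq)
  then have "M * exp (lam * t) \<le> F / (1 - 2 * B / lam) * exp (lam * t)" by (intro mult_right_mono) auto
  with VM[of t i] t show ?thesis unfolding growth_def by simp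
qed

end

context mcsbp begin

lemma rate_abs:
  assumes "\<And>j. 0 \<le> f j" "\<And>j. f j \<le> F"
  shows "\<bar>rate i f\<bar> \<le> 2 * B * (F + F\<^sup>2)"
proof -
  have "2 * B * F \<le> 2 * B * (F + F\<^sup>2)" using B_pos by simp
  then show ?thesis using rate_bounds[of f F i, OF assms] by (simp add: abs_le_iff)
qed

lemma growth_mono: "2 * B < lam \<Longrightarrow> s \<le> t \<Longrightarrow> growth lam s \<le> growth lam t"
  and growth_pos: "2 * B < lam \<Longrightarrow> 0 < growth lam t"
  unfolding growth_def using B_pos by (auto intro!: divide_right_mono divide_pos_pos mult_left_mono)

lemma exp_neg_pairing_meas [measurable]:
  "\<mu> \<in> finite_measures \<Longrightarrow> 0 \<le> t \<Longrightarrow> (\<lambda>\<omega>. exp_neg (pairing f (X t \<omega>))) \<in> borel_measurable (P \<mu>)"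
  by (rule measurable_compose[OF X_meas_P]) measurable

lemma exp_neg_pairing_integrable:
  assumes "\<mu> \<in> finite_measures" "0 \<le> t"
  shows "integrable (P \<mu>) (\<lambda>\<omega>. exp_neg (pairing f (X t \<omega>)))"
  by (rule bounded_integrable[OF P_prob, where C = 1]) (use assms in \<open>auto simp: exp_neg_abs_le_1\<close>)

lemma laplace_tendsto:
  assumes \<mu>: "\<mu> \<in> finite_measures" and t: "0 \<le> t"
    and f: "\<And>k j. 0 \<le> f k j" "\<And>k j. f k j \<le> F" and lim: "\<And>j. (\<lambda>k. f k j) \<longlonglongrightarrow> g j"
  shows "(\<lambda>k. \<integral>\<omega>. exp_neg (pairing (\<lambda>j. ennreal (f k j)) (X t \<omega>)) \<partial>P \<mu>)
     \<longlonglongrightarrow> (\<integral>\<omega>. exp_neg (pairing (\<lambda>j. ennreal (g j)) (X t \<omega>)) \<partial>P \<mu>)"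
proof -
  interpret prob_space "P \<mu>" by (rule P_prob[OF \<mu>])
  have g: "0 \<le> g j" "g j \<le> F" for j
    using LIMSEQ_le_const[OF lim] LIMSEQ_le_const2[OF lim] f by blast+
  show ?thesis
  proof (rule integral_dominated_convergence[where w = "\<lambda>_. 1"])
    show "AE \<omega> in P \<mu>. (\<lambda>k. exp_neg (pairing (\<lambda>j. ennreal (f k j)) (X t \<omega>)))
        \<longlonglongrightarrow> exp_neg (pairing (\<lambda>j. ennreal (g j)) (X t \<omega>))"
      using X_finite[OF \<mu> t]
    proof eventually_elim
      case (elim \<omega>)
      show ?case
        unfolding exp_neg_lin[OF elim f] exp_neg_lin[OF elim g]
        by (intro tendsto_intros lin_tendsto[OF elim f lim])
    qed
  qed (use \<mu> t in \<open>auto simp: exp_neg_abs_le_1\<close>)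
qed

text \<open>
  Everything passes to nonnegative functions along \<open>f + 1 / (k + 1)\<close>, since the bounds are uniform in \<open>k\<close>.
\<close>

lemma cumulant_main:
  assumes f: "\<And>j. 0 \<le> f j" "\<And>j. f j \<le> F" and t: "0 \<le> t"
  shows cumulant_nonneg: "0 \<le> cumulant t f i"
    and cumulant_upper: "2 * B < lam \<Longrightarrow> cumulant t f i \<le> F * growth lam t"
    and laplace: "\<mu> \<in> finite_measures \<Longrightarrow>
      (\<integral>\<omega>. exp_neg (pairing (\<lambda>j. ennreal (f j)) (X t \<omega>)) \<partial>P \<mu>) = exp (- lin (cumulant t f) \<mu>)"
    and cumulant_integrable: "set_integrable lborel {0..t} (\<lambda>s. rate i (cumulant s f))"
    and cumulant_eq: "cumulant t f i = f i - (LINT s:{0..t}|lborel. rate i (cumulant s f))"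
proof -
  define fk where "fk k j = f j + 1 / real (Suc k)" for k j
  have F0: "0 \<le> F" using f order_trans by blast
  have fk0: "0 < fk k j" for k j unfolding fk_def using f(1)[of j] by (simp add: add_nonneg_pos)
  have fkF: "fk k j \<le> F + 1 / real (Suc k)" for k j unfolding fk_def using f(2)[of j] by simp
  have fkF': "fk k j \<le> F + 1" for k j using fkF[of k j] by (smt (verit) divide_le_eq_1 of_nat_0_less_iff of_nat_Suc zero_less_Suc of_nat_0_le_iff)
  have fk: "fk k \<in> bounded_pos_funs" for k
    unfolding bounded_pos_funs_def bounded_funs_def bounded_iff
    using fk0[of k] fkF'[of k] by (auto intro!: exI[of _ "F + 1"] simp: abs_of_pos)
  have fk_lim: "(\<lambda>k. fk k j) \<longlonglongrightarrow> f j" for j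
    unfolding fk_def using tendsto_add[OF tendsto_const[of "f j"] LIMSEQ_inverse_real_of_nat]
    by (simp add: inverse_eq_divide)
  have Vk0: "0 \<le> cumulant s (fk k) j" if "0 \<le> s" for s k j by (rule pos_case(1)[OF fk that])
  have VkG: "cumulant s (fk k) j \<le> (F + 1) * growth (4 * B) t" if "0 \<le> s" "s \<le> t" for s k j
  proof -
    have "cumulant s (fk k) j \<le> (F + 1) * growth (4 * B) s"
      by (rule cumulant_upper_pos[OF fk fkF' that(1)]) (use B_pos in simp)
    also have "\<dots> \<le> (F + 1) * growth (4 * B) t"
      by (intro mult_left_mono growth_mono that) (use B_pos F0 in auto)
    finally show ?thesis .
  qed
  define C where "C = (F + 1) * growth (4 * B) t"
  have V_lim: "(\<lambda>k. cumulant s (fk k) j) \<longlonglongrightarrow> cumulant s f j" if s: "0 \<le> s" "s \<le> t" for s j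
  proof -
    let ?E = "\<lambda>g. \<integral>\<omega>. exp_neg (pairing (\<lambda>j. ennreal (g j)) (X s \<omega>)) \<partial>P (unit_mass j)"
    have lim: "(\<lambda>k. ?E (fk k)) \<longlonglongrightarrow> ?E f"
      by (rule laplace_tendsto[OF unit_mass_finite s(1) less_imp_le[OF fk0] fkF' fk_lim])
    have Ek: "?E (fk k) = exp (- cumulant s (fk k) j)" for k
      using pos_case(5)[OF fk s(1) unit_mass_finite, of j k] by (simp add: lin_unit)
    have "exp (- C) \<le> ?E f"
      by (rule LIMSEQ_le_const[OF lim]) (use VkG[OF s] in \<open>auto simp: Ek C_def\<close>)
    then have "0 < ?E f" using exp_gt_zero[of "- C"] by linarith
    then have "(\<lambda>k. - ln (?E (fk k))) \<longlonglongrightarrow> - ln (?E f)"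
      by (intro tendsto_intros lim) auto
    then show ?thesis unfolding cumulant_def .
  qed
  have V0: "0 \<le> cumulant s f j" if "0 \<le> s" "s \<le> t" for s j
    by (rule LIMSEQ_le_const[OF V_lim[OF that]]) (use Vk0 that in auto)
  show "0 \<le> cumulant t f i" using V0 t by auto
  show "cumulant t f i \<le> F * growth lam t" if lam: "2 * B < lam"
  proof (rule LIMSEQ_le[OF V_lim[OF t order_refl]])
    show "(\<lambda>k. (F + 1 / real (Suc k)) * growth lam t) \<longlonglongrightarrow> F * growth lam t"
      using tendsto_mult[OF tendsto_add[OF tendsto_const[of F] LIMSEQ_inverse_real_of_nat] tendsto_const[of "growth lam t"]]
      by (simp add: inverse_eq_divide)
    show "\<exists>N. \<forall>k\<ge>N. cumulant t (fk k) i \<le> (F + 1 / real (Suc k)) * growth lam t"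
      using cumulant_upper_pos[OF fk fkF t lam] by blast
  qed
  show "(\<integral>\<omega>. exp_neg (pairing (\<lambda>j. ennreal (f j)) (X t \<omega>)) \<partial>P \<mu>) = exp (- lin (cumulant t f) \<mu>)"
    if \<mu>: "\<mu> \<in> finite_measures"
  proof (rule LIMSEQ_unique)
    show "(\<lambda>k. \<integral>\<omega>. exp_neg (pairing (\<lambda>j. ennreal (fk k j)) (X t \<omega>)) \<partial>P \<mu>)
       \<longlonglongrightarrow> (\<integral>\<omega>. exp_neg (pairing (\<lambda>j. ennreal (f j)) (X t \<omega>)) \<partial>P \<mu>)"
      by (rule laplace_tendsto[OF \<mu> t less_imp_le[OF fk0] fkF' fk_lim])
    show "(\<lambda>k. \<integral>\<omega>. exp_neg (pairing (\<lambda>j. ennreal (fk k j)) (X t \<omega>)) \<partial>P \<mu>) \<longlonglongrightarrow> exp (- lin (cumulant t f) \<mu>)"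
      unfolding pos_case(5)[OF fk t \<mu>]
      by (intro tendsto_intros lin_tendsto[where F = C, OF \<mu> _ _ V_lim[OF t order_refl]]) (use Vk0 VkG t in \<open>auto simp: C_def\<close>)
  qed
  have rate_lim: "(\<lambda>k. rate i (cumulant s (fk k))) \<longlonglongrightarrow> rate i (cumulant s f)" if s: "0 \<le> s" "s \<le> t" for s
    unfolding rate_def
  proof (intro tendsto_intros)
    show "(\<lambda>k. \<psi> i (cumulant s (fk k) i)) \<longlonglongrightarrow> \<psi> i (cumulant s f i)"
      by (rule continuous_on_tendsto_compose[OF psi_continuous V_lim[OF s]]) (use V0 Vk0 s in auto)
    have m: "(\<lambda>k. offspring_mean i (cumulant s (fk k))) \<longlonglongrightarrow> offspring_mean i (cumulant s f)"
      by (rule lin_tendsto[where F = C, OF pmf_finite_measure _ _ V_lim[OF s]]) (use Vk0 VkG s in \<open>auto simp: C_def\<close>)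
    have nn: "0 \<le> offspring_mean i (cumulant s (fk k))" for k
      by (rule offspring_mean_bounds(1)[where F = C]) (use Vk0 VkG s in \<open>auto simp: C_def\<close>)
    have nn': "0 \<le> offspring_mean i (cumulant s f)" by (rule LIMSEQ_le_const[OF m]) (use nn in auto)
    show "(\<lambda>k. \<rho> i (offspring_mean i (cumulant s (fk k)))) \<longlonglongrightarrow> \<rho> i (offspring_mean i (cumulant s f))"
      by (rule continuous_on_tendsto_compose[OF rho_continuous m]) (use nn nn' in auto)
  qed
  have lim_pt: "(\<lambda>k. indicator {0..t} s *\<^sub>R rate i (cumulant s (fk k))) \<longlonglongrightarrow> indicator {0..t} s *\<^sub>R rate i (cumulant s f)" for s
    using rate_lim[of s] by (auto split: split_indicator)
  have meas_k: "(\<lambda>s. indicator {0..t} s *\<^sub>R rate i (cumulant s (fk k))) \<in> borel_measurable lborel" for k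
    using pos_case(3)[OF fk t, of i k] unfolding set_integrable_def by (rule borel_measurable_integrable)
  have meas: "(\<lambda>s. indicator {0..t} s *\<^sub>R rate i (cumulant s f)) \<in> borel_measurable lborel"
    by (rule borel_measurable_LIMSEQ_real[OF lim_pt meas_k])
  have bound: "AE s in lborel. norm (indicator {0..t} s *\<^sub>R rate i (cumulant s (fk k))) \<le> indicator {0..t} s *\<^sub>R (2 * B * (C + C\<^sup>2))" for k
    using rate_abs[of "cumulant _ (fk k)" C i] Vk0 VkG by (intro AE_I2) (auto split: split_indicator simp: C_def)
  have w: "integrable lborel (\<lambda>s. indicator {0..t} s *\<^sub>R (2 * B * (C + C\<^sup>2)))"
    using t by (intro integrable_scaleR_left integrable_real_indicator) auto
  show "set_integrable lborel {0..t} (\<lambda>s. rate i (cumulant s f))"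
    unfolding set_integrable_def
    by (rule integrable_dominated_convergence[OF meas meas_k w _ bound]) (rule AE_I2, rule lim_pt)
  have "(\<lambda>k. LINT s:{0..t}|lborel. rate i (cumulant s (fk k))) \<longlonglongrightarrow> (LINT s:{0..t}|lborel. rate i (cumulant s f))"
    unfolding set_lebesgue_integral_def
    by (rule integral_dominated_convergence[OF meas meas_k w _ bound]) (rule AE_I2, rule lim_pt)
  then have "(\<lambda>k. fk k i - (LINT s:{0..t}|lborel. rate i (cumulant s (fk k)))) \<longlonglongrightarrow> f i - (LINT s:{0..t}|lborel. rate i (cumulant s f))"
    by (intro tendsto_diff fk_lim)
  then have "(\<lambda>k. cumulant t (fk k) i) \<longlonglongrightarrow> f i - (LINT s:{0..t}|lborel. rate i (cumulant s f))"
    by (subst pos_case(4)[OF fk t])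
  then show "cumulant t f i = f i - (LINT s:{0..t}|lborel. rate i (cumulant s f))"
    by (rule LIMSEQ_unique[OF V_lim[OF t order_refl]])
qed

lemma cumulant_upper': 
  assumes f: "\<And>j. 0 \<le> f j" "\<And>j. f j \<le> F" and t: "0 \<le> t" "t \<le> T"
  shows "cumulant t f i \<le> F * growth (4 * B) T"
proof -
  have "0 \<le> F" using f order_trans by blast
  have "cumulant t f i \<le> F * growth (4 * B) t" by (rule cumulant_upper[OF f t(1)]) (use B_pos in simp)
  also have "\<dots> \<le> F * growth (4 * B) T"
    by (intro mult_left_mono growth_mono t \<open>0 \<le> F\<close>) (use B_pos in auto)
  finally show ?thesis .
qed

lemma cumulant_eq': 
  assumes f: "\<And>j. 0 \<le> f j" "\<And>j. f j \<le> F" and t: "0 \<le> t"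
  shows "(\<lambda>s. rate i (cumulant s f)) integrable_on {0..t}" "cumulant t f i = f i - integral {0..t} (\<lambda>s. rate i (cumulant s f))"
  using cumulant_eq[of f F t i, OF f t] set_borel_integral_eq_integral[OF cumulant_integrable[of f F t i, OF f t]] by auto

lemma cumulant_continuous:
  assumes f: "\<And>j. 0 \<le> f j" "\<And>j. f j \<le> F"
  shows "continuous_on {0..T} (\<lambda>t. cumulant t f i)" "continuous_on {0..T} (\<lambda>t. offspring_mean i (cumulant t f))"
    "continuous_on {0..T} (\<lambda>t. rate i (cumulant t f))"
proof -
  show 1: "continuous_on {0..T} (\<lambda>t. cumulant t f i)" for i
  proof (cases "0 \<le> T")
    case True
    have "continuous_on {0..T} (\<lambda>t. f i - integral {0..t} (\<lambda>s. rate i (cumulant s f)))"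
      by (intro continuous_intros indefinite_integral_continuous_1 cumulant_eq'(1)[OF f True])
    then show ?thesis
      by (rule continuous_on_eq) (use cumulant_eq'(2)[of f F, OF f] in auto)
  qed auto
  show 2: "continuous_on {0..T} (\<lambda>t. offspring_mean i (cumulant t f))"
  proof (rule continuous_on_sequentiallyI)
    fix u :: "nat \<Rightarrow> real" and a assume u: "\<forall>k. u k \<in> {0..T}" "a \<in> {0..T}" "u \<longlonglongrightarrow> a"
    show "(\<lambda>k. offspring_mean i (cumulant (u k) f)) \<longlonglongrightarrow> offspring_mean i (cumulant a f)"
    proof (rule lin_tendsto[OF pmf_finite_measure])
      show "(\<lambda>k. cumulant (u k) f j) \<longlonglongrightarrow> cumulant a f j" for j
        by (rule continuous_on_tendsto_compose[OF 1 u(3)]) (use u in auto)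
      show "0 \<le> cumulant (u k) f j" for k j by (rule cumulant_nonneg[OF f]) (use u in auto)
      show "cumulant (u k) f j \<le> F * growth (4 * B) T" for k j by (rule cumulant_upper'[OF f]) (use u in auto)
    qed
  qed
  show "continuous_on {0..T} (\<lambda>t. rate i (cumulant t f))"
    unfolding rate_def
  proof (intro continuous_intros)
    show "continuous_on {0..T} (\<lambda>t. \<psi> i (cumulant t f i))"
      by (rule continuous_on_compose2[OF psi_continuous 1]) (use cumulant_nonneg[OF f] in auto)
    show "continuous_on {0..T} (\<lambda>t. \<rho> i (offspring_mean i (cumulant t f)))"
      by (rule continuous_on_compose2[OF rho_continuous 2])
        (use offspring_mean_bounds(1)[OF cumulant_nonneg[OF f] cumulant_upper'[OF f]] in auto)
  qed
qed

text \<open>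
  Freezes the time outside \<open>[0,1]\<close>, so that functions of time are continuous on the whole line.
\<close>

definition clip :: "real \<Rightarrow> real" where "clip \<sigma> = max 0 (min 1 \<sigma>)"

lemma clip_range: "0 \<le> clip \<sigma>" "clip \<sigma> \<le> 1" and clip_id: "\<sigma> \<in> {0..1} \<Longrightarrow> clip \<sigma> = \<sigma>"
  unfolding clip_def by auto

lemma clip_continuous: "continuous_on A clip"
  unfolding clip_def by (intro continuous_intros)

lemma cumulant_clip_continuous:
  assumes f: "\<And>j. 0 \<le> f j" "\<And>j. f j \<le> F"
  shows "continuous_on UNIV (\<lambda>t. cumulant (clip t) f i)" "continuous_on UNIV (\<lambda>t. offspring_mean i (cumulant (clip t) f))"
  by (rule continuous_on_compose2[OF cumulant_continuous(1)[OF f, where T = 1] clip_continuous]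
      continuous_on_compose2[OF cumulant_continuous(2)[OF f, where T = 1] clip_continuous]; use clip_range in auto)+

lemma cumulant_clip_deriv:
  assumes f: "\<And>j. 0 \<le> f j" "\<And>j. f j \<le> F" and \<sigma>: "\<sigma> \<in> {0..1}"
  shows "((\<lambda>t. cumulant (clip t) f i) has_real_derivative - (\<psi> i (cumulant (clip \<sigma>) f i) - \<rho> i (offspring_mean i (cumulant (clip \<sigma>) f)))) (at \<sigma> within {0..1})"
proof -
  have "((\<lambda>t. integral {0..t} (\<lambda>s. rate i (cumulant s f))) has_real_derivative rate i (cumulant \<sigma> f)) (at \<sigma> within {0..1})"
    by (rule integral_has_real_derivative[OF cumulant_continuous(3)[OF f] \<sigma>])
  then have "((\<lambda>t. f i - integral {0..t} (\<lambda>s. rate i (cumulant s f))) has_real_derivative - rate i (cumulant \<sigma> f)) (at \<sigma> within {0..1})"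
    by (auto intro!: derivative_eq_intros)
  then have "((\<lambda>t. cumulant (clip t) f i) has_real_derivative - rate i (cumulant \<sigma> f)) (at \<sigma> within {0..1})"
    by (rule has_field_derivative_transform_within[OF _ zero_less_one \<sigma>])
      (use cumulant_eq'(2)[of f F, OF f] in \<open>auto simp: clip_id\<close>)
  then show ?thesis using \<sigma> by (simp add: rate_def clip_id)
qed

text \<open>
  The cumulant moves with bounded speed, uniformly over the types.
\<close>

lemma cumulant_lower:
  fixes L :: real
  assumes L: "0 < L"
  obtains r0 where "0 < r0" "r0 \<le> 1" "\<And>s i. 0 \<le> s \<Longrightarrow> s \<le> r0 \<Longrightarrow> L / 2 \<le> cumulant s (\<lambda>_. L) i"
proof
  define C where "C = L * growth (4 * B) 1"
  define D where "D = 2 * B * (C + C\<^sup>2)"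
  have C: "0 < C" unfolding C_def using L growth_pos[of "4 * B" 1] B_pos by simp
  have D: "0 < D" unfolding D_def using B_pos C by (simp add: add_pos_pos)
  define r0 where "r0 = min 1 (L / (2 * D))"
  show "0 < r0" "r0 \<le> 1" unfolding r0_def using L D by auto
  fix s i assume s: "0 \<le> s" "s \<le> r0"
  have s1: "s \<le> 1" using s unfolding r0_def by simp
  have "norm (integral {0..s} (\<lambda>s. rate i (cumulant s (\<lambda>_. L)))) \<le> D * (s - 0)"
  proof (rule integral_bound[OF s(1)])
    show "continuous_on {0..s} (\<lambda>s. rate i (cumulant s (\<lambda>_. L)))"
      by (rule cumulant_continuous(3)[where F = L]) (use L in auto)
    fix r assume r: "r \<in> {0..s}"
    have "\<bar>rate i (cumulant r (\<lambda>_. L))\<bar> \<le> 2 * B * (C + C\<^sup>2)"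
      by (rule rate_abs) (use r s1 L cumulant_nonneg[of "\<lambda>_. L" L r] cumulant_upper'[of "\<lambda>_. L" L r 1] in \<open>auto simp: C_def\<close>)
    then show "norm (rate i (cumulant r (\<lambda>_. L))) \<le> D" unfolding D_def by simp
  qed
  moreover have "D * s \<le> L / 2"
  proof -
    have "s \<le> L / (2 * D)" using s unfolding r0_def by simp
    then have "D * s \<le> D * (L / (2 * D))" using D by (intro mult_left_mono) auto
    then show ?thesis using D by simp
  qed
  moreover have "cumulant s (\<lambda>_. L) i = L - integral {0..s} (\<lambda>s. rate i (cumulant s (\<lambda>_. L)))"
    by (rule cumulant_eq'(2)[where F = L]) (use L s in auto)
  ultimately show "L / 2 \<le> cumulant s (\<lambda>_. L) i" by (simp add: abs_le_iff)
qed

lemma mass_meas [measurable]: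
  "\<mu> \<in> finite_measures \<Longrightarrow> 0 \<le> t \<Longrightarrow> (\<lambda>\<omega>. mass (X t \<omega>)) \<in> borel_measurable (P \<mu>)"
  by (rule measurable_compose[OF X_meas_P]) measurable

lemma mass_finite_measure: "\<mu> \<in> finite_measures \<Longrightarrow> mass \<mu> = ennreal (suminf \<mu>)"
  using pairing_lin[of \<mu> "\<lambda>_. 1" 1] by (simp add: lin_const)

text \<open>
  The mean of \<open>\<langle>1, X\<^sub>t\<rangle>\<close> is the limit of \<open>(1 - E exp (- \<epsilon> \<langle>1, X\<^sub>t\<rangle>)) / \<epsilon>\<close> as \<open>\<epsilon>\<close> tends to \<open>0\<close>, and the
  cumulant of the constant \<open>\<epsilon>\<close> is at most \<open>\<epsilon>\<close> times the growth factor.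
\<close>

lemma expected_mass_le:
  assumes \<mu>: "\<mu> \<in> finite_measures" and t: "0 \<le> t" and lam: "2 * B < lam"
  shows "(\<integral>\<^sup>+\<omega>. mass (X t \<omega>) \<partial>P \<mu>) \<le> ennreal (growth lam t * suminf \<mu>)"
proof -
  interpret prob_space "P \<mu>" by (rule P_prob[OF \<mu>])
  define q where "q k = 1 / real (Suc k)" for k
  have q: "0 < q k" for k unfolding q_def by simp
  have q0: "q \<longlonglongrightarrow> 0" unfolding q_def using LIMSEQ_inverse_real_of_nat by (simp add: inverse_eq_divide)
  let ?Z = "\<lambda>k \<omega>. ennreal ((1 - exp_neg (pairing (\<lambda>_. ennreal (q k)) (X t \<omega>))) / q k)"
  have "(\<integral>\<^sup>+\<omega>. mass (X t \<omega>) \<partial>P \<mu>) = (\<integral>\<^sup>+\<omega>. liminf (\<lambda>k. ?Z k \<omega>) \<partial>P \<mu>)"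
  proof (rule nn_integral_cong_AE)
    show "AE \<omega> in P \<mu>. mass (X t \<omega>) = liminf (\<lambda>k. ?Z k \<omega>)"
      using X_finite[OF \<mu> t]
    proof eventually_elim
      case (elim \<omega>)
      let ?m = "suminf (X t \<omega>)"
      have m0: "0 \<le> ?m" using elim by (auto simp: finite_measures_def intro: suminf_nonneg)
      have Z: "?Z k \<omega> = ennreal ((1 - exp (- (q k * ?m))) / q k)" for k
        using exp_neg_lin[OF elim, of "\<lambda>_. q k" "q k"] q[of k] by (simp add: lin_const[OF elim])
      have der: "((\<lambda>x. 1 - exp (- (x * ?m))) has_real_derivative ?m) (at 0)"
        by (auto intro!: derivative_eq_intros)
      have "((\<lambda>x. (1 - exp (- (x * ?m))) / x) \<longlongrightarrow> ?m) (at 0)"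
        using der[unfolded DERIV_def] by simp
      then have "(\<lambda>k. (1 - exp (- (q k * ?m))) / q k) \<longlonglongrightarrow> ?m"
        by (rule filterlim_compose) (use q q0 in \<open>auto simp: filterlim_at less_imp_neq[THEN not_sym] intro!: always_eventually\<close>)
      then have "(\<lambda>k. ?Z k \<omega>) \<longlonglongrightarrow> ennreal ?m" unfolding Z by (rule tendsto_ennrealI)
      then have "liminf (\<lambda>k. ?Z k \<omega>) = ennreal ?m" by (intro lim_imp_Liminf) auto
      then show ?case using mass_finite_measure[OF elim] by simp
    qed
  qed
  also have "\<dots> \<le> liminf (\<lambda>k. \<integral>\<^sup>+\<omega>. ?Z k \<omega> \<partial>P \<mu>)"
    by (rule nn_integral_liminf) (use \<mu> t in measurable)
  also have "\<dots> \<le> liminf (\<lambda>k. ennreal (growth lam t * suminf \<mu>))"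
  proof (intro Liminf_mono always_eventually allI)
    fix k
    have Vb: "0 \<le> cumulant t (\<lambda>_. q k) j" "cumulant t (\<lambda>_. q k) j \<le> q k * growth lam t" for j
      using cumulant_nonneg[of "\<lambda>_. q k" "q k" t j] cumulant_upper[of "\<lambda>_. q k" "q k" t lam j] q[of k] t lam by auto
    have int: "integrable (P \<mu>) (\<lambda>\<omega>. exp_neg (pairing (\<lambda>_. ennreal (q k)) (X t \<omega>)))"
      by (rule exp_neg_pairing_integrable[OF \<mu> t])
    have Z: "(\<integral>\<^sup>+\<omega>. ?Z k \<omega> \<partial>P \<mu>) = ennreal (\<integral>\<omega>. (1 - exp_neg (pairing (\<lambda>_. ennreal (q k)) (X t \<omega>))) / q k \<partial>P \<mu>)"
      using q[of k] int by (intro nn_integral_eq_integral) (auto simp: exp_neg_le_1)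
    have "(\<integral>\<omega>. (1 - exp_neg (pairing (\<lambda>_. ennreal (q k)) (X t \<omega>))) / q k \<partial>P \<mu>)
       = (1 - exp (- lin (cumulant t (\<lambda>_. q k)) \<mu>)) / q k"
      using int laplace[of "\<lambda>_. q k" "q k" t \<mu>] q[of k] t \<mu> prob_space by (simp add: Bochner_Integration.integral_diff)
    also have "\<dots> \<le> lin (cumulant t (\<lambda>_. q k)) \<mu> / q k"
    proof (rule divide_right_mono)
      show "1 - exp (- lin (cumulant t (\<lambda>_. q k)) \<mu>) \<le> lin (cumulant t (\<lambda>_. q k)) \<mu>"
        using exp_ge_add_one_self[of "- lin (cumulant t (\<lambda>_. q k)) \<mu>"] by linarith
    qed (use q[of k] in simp)
    also have "\<dots> \<le> (q k * growth lam t) * suminf \<mu> / q k"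
      using lin_mono[OF \<mu> Vb order_refl] q[of k] by (intro divide_right_mono) (simp_all add: lin_const[OF \<mu>])
    also have "\<dots> = growth lam t * suminf \<mu>" using q[of k] by simp
    finally show "(\<integral>\<^sup>+\<omega>. ?Z k \<omega> \<partial>P \<mu>) \<le> ennreal (growth lam t * suminf \<mu>)"
      unfolding Z by (rule ennreal_leI)
  qed
  also have "\<dots> = ennreal (growth lam t * suminf \<mu>)" by (rule Liminf_const) simp
  finally show ?thesis .
qed

end

section \<open>The Markov property\<close>

lemma finite_measures_eq: "finite_measures = (\<Inter>i. {x. 0 \<le> x i}) \<inter> {x. mass x < \<infinity>}"
proof -
  have "summable x \<longleftrightarrow> mass x < \<infinity>" if x: "\<And>i. 0 \<le> x i" for x :: "nat \<Rightarrow> real"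
  proof
    assume "summable x"
    then show "mass x < \<infinity>" unfolding pairing_def using x by (simp add: suminf_ennreal2)
  next
    assume "mass x < \<infinity>"
    then show "summable x" unfolding pairing_def using x
      by (intro summable_suminf_not_top) (auto simp: less_top)
  qed
  then show ?thesis unfolding finite_measures_def by auto
qed

lemma finite_measures_borel [measurable]: "finite_measures \<in> sets borel"
proof -
  have [measurable]: "(\<lambda>x :: nat \<Rightarrow> real. x i) \<in> borel_measurable borel" for i
    by (rule borel_measurable_continuous_onI[OF continuous_on_product_coordinates])
  have "{x \<in> space borel. \<forall>i. 0 \<le> (x :: nat \<Rightarrow> real) i} \<in> sets borel" by measurable
  moreover have "{x \<in> space borel. mass x < \<infinity>} \<in> sets borel" by measurable
  ultimately have "{x \<in> space borel. \<forall>i. 0 \<le> (x :: nat \<Rightarrow> real) i} \<inter> {x \<in> space borel. mass x < \<infinity>} \<in> sets borel"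
    by (rule sets.Int)
  also have "{x \<in> space borel. \<forall>i. 0 \<le> x i} \<inter> {x \<in> space borel. mass x < \<infinity>} = finite_measures"
    unfolding finite_measures_eq by auto
  finally show ?thesis .
qed

text \<open>
  Jensen's inequality for the exponential, in a form that allows the value \<open>\<infinity>\<close>.
\<close>

lemma integral_exp_neg_ge:
  assumes M: "prob_space M" and [measurable]: "S \<in> borel_measurable M" and le: "(\<integral>\<^sup>+\<omega>. S \<omega> \<partial>M) \<le> ennreal m" and m: "0 \<le> m"
  shows "exp (- m) \<le> (\<integral>\<omega>. exp_neg (S \<omega>) \<partial>M)"
proof -
  interpret prob_space M by fact
  have fin: "(\<integral>\<^sup>+\<omega>. S \<omega> \<partial>M) < \<infinity>" using le by (rule le_less_trans) simp
  then have AE: "AE \<omega> in M. S \<omega> \<noteq> \<infinity>" by (intro nn_integral_PInf_AE) auto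
  have eq: "(\<integral>\<^sup>+\<omega>. ennreal (enn2real (S \<omega>)) \<partial>M) = (\<integral>\<^sup>+\<omega>. S \<omega> \<partial>M)"
    by (rule nn_integral_cong_AE) (use AE in \<open>auto elim!: eventually_mono simp: less_top\<close>)
  have int: "integrable M (\<lambda>\<omega>. enn2real (S \<omega>))"
    by (rule integrableI_nonneg) (use fin eq in auto)
  have "ennreal (\<integral>\<omega>. enn2real (S \<omega>) \<partial>M) \<le> ennreal m"
    using le eq nn_integral_eq_integral[OF int] by simp
  then have Em: "(\<integral>\<omega>. enn2real (S \<omega>) \<partial>M) \<le> m" using m by (simp add: ennreal_le_iff)
  have "exp (- m) \<le> exp (- m) * (1 + m - (\<integral>\<omega>. enn2real (S \<omega>) \<partial>M))" using Em by simp
  also have "\<dots> = (\<integral>\<omega>. exp (- m) * (1 + m - enn2real (S \<omega>)) \<partial>M)"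
    using int prob_space by simp
  also have "\<dots> \<le> (\<integral>\<omega>. exp_neg (S \<omega>) \<partial>M)"
  proof (rule integral_mono_AE)
    show "AE \<omega> in M. exp (- m) * (1 + m - enn2real (S \<omega>)) \<le> exp_neg (S \<omega>)"
      using AE
    proof eventually_elim
      case (elim \<omega>)
      have "exp (- m) * (1 + (m - enn2real (S \<omega>))) \<le> exp (- m) * exp (m - enn2real (S \<omega>))"
        by (intro mult_left_mono exp_ge_add_one_self) auto
      also have "\<dots> = exp (- enn2real (S \<omega>))" by (simp add: exp_add[symmetric])
      finally show ?case using elim by (simp add: exp_neg_def algebra_simps)
    qed
    show "integrable M (\<lambda>\<omega>. exp_neg (S \<omega>))"
      by (rule bounded_integrable[OF M, where C = 1]) (auto simp: exp_neg_abs_le_1)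
  qed (use int in auto)
  finally show ?thesis .
qed

context mcsbp begin

abbreviation "\<F> \<equiv> natural_filtration \<Omega> X"

lemma space_F: "space (\<F> u) = space \<Omega>"
  and sets_F: "sets (\<F> u) = sigma_sets (space \<Omega>) {X s -` B \<inter> space \<Omega> | s B. 0 \<le> s \<and> ennreal s \<le> u \<and> B \<in> sets borel}"
  unfolding natural_filtration_def by (auto intro!: space_measure_of sets_measure_of)

lemma sets_F_mono: "u \<le> v \<Longrightarrow> sets (\<F> u) \<subseteq> sets (\<F> v)"
  unfolding sets_F by (rule sigma_sets_mono') (auto intro: order_trans)

lemma sets_F_subset: "sets (\<F> u) \<subseteq> sets \<Omega>"
  unfolding sets_F by (rule sets.sigma_sets_subset) (auto intro: measurable_sets[OF X_meas])

lemma X_meas_F: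
  assumes "0 \<le> s" "s \<le> t"
  shows "X s \<in> \<F> (ennreal t) \<rightarrow>\<^sub>M borel"
proof (rule measurableI)
  fix B :: "(nat \<Rightarrow> real) set" assume "B \<in> sets borel"
  then show "X s -` B \<inter> space (\<F> (ennreal t)) \<in> sets (\<F> (ennreal t))"
    unfolding sets_F space_F using assms by (intro sigma_sets.Basic) (auto intro: ennreal_leI)
qed simp

lemma filtration_F: "filtration (space \<Omega>) \<F>"
  by (rule filtration.intro) (auto simp: space_F intro: sets_F_mono[THEN subsetD])

text \<open>
  The transition operator.  Outside the finite measures the laws are arbitrary, and the value \<open>0\<close> keeps the
  function measurable.
\<close>

definition kern :: "real \<Rightarrow> ((nat \<Rightarrow> real) \<Rightarrow> ennreal) \<Rightarrow> (nat \<Rightarrow> real) \<Rightarrow> ennreal" where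
  "kern s \<phi> x = (if x \<in> finite_measures then \<integral>\<^sup>+\<omega>. \<phi> (X s \<omega>) \<partial>P x else 0)"

lemma kern_indicator:
  assumes s: "0 \<le> s" and C: "C \<in> sets borel"
  shows "kern s (indicator C) x = ennreal (if x \<in> finite_measures then measure (P x) {\<omega>\<in>space \<Omega>. X s \<omega> \<in> C} else 0)"
    and "kern s (indicator C) \<in> borel_measurable borel"
proof -
  show eq: "kern s (indicator C) x = ennreal (if x \<in> finite_measures then measure (P x) {\<omega>\<in>space \<Omega>. X s \<omega> \<in> C} else 0)" for x
  proof (cases "x \<in> finite_measures")
    case True
    interpret prob_space "P x" by (rule P_prob[OF True])
    have "(\<integral>\<^sup>+\<omega>. indicator C (X s \<omega>) \<partial>P x) = (\<integral>\<^sup>+\<omega>. indicator {\<omega>\<in>space \<Omega>. X s \<omega> \<in> C} \<omega> \<partial>P x)"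
      by (rule nn_integral_cong) (auto simp: P_space[OF True] split: split_indicator)
    also have "\<dots> = emeasure (P x) {\<omega>\<in>space \<Omega>. X s \<omega> \<in> C}"
    proof (rule nn_integral_indicator)
      show "{\<omega>\<in>space \<Omega>. X s \<omega> \<in> C} \<in> sets (P x)"
        unfolding P_sets[OF True] using measurable_sets[OF X_meas C, of s] s by (simp add: vimage_def Int_def conj_commute)
    qed
    finally show ?thesis using True by (simp add: kern_def emeasure_eq_measure)
  qed (simp add: kern_def)
  have "(\<lambda>x. if x \<in> finite_measures then measure (P x) {\<omega>\<in>space \<Omega>. X s \<omega> \<in> C} else 0) \<in> borel_measurable borel"
    using strong_markov s C unfolding strong_markov_process_def
    by (subst measurable_restrict_space_iff[symmetric]) auto
  then show "kern s (indicator C) \<in> borel_measurable borel"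
    unfolding eq[abs_def] by measurable
qed

text \<open>
  The strong Markov property at a deterministic time, with the conditional expectation integrated over an
  event of the past.
\<close>

lemma markov_indicator:
  assumes \<mu>: "\<mu> \<in> finite_measures" and t: "0 \<le> t" and s: "0 \<le> s"
    and A: "A \<in> sets (\<F> (ennreal t))" and C: "C \<in> sets borel"
  shows "(\<integral>\<^sup>+\<omega>. indicator A \<omega> * indicator C (X (t + s) \<omega>) \<partial>P \<mu>) = (\<integral>\<^sup>+\<omega>. indicator A \<omega> * kern s (indicator C) (X t \<omega>) \<partial>P \<mu>)"
proof -
  interpret prob_space "P \<mu>" by (rule P_prob[OF \<mu>])
  interpret fil: filtration "space \<Omega>" \<F> by (rule filtration_F)
  define T :: "'w \<Rightarrow> ennreal" where "T = (\<lambda>_. ennreal t)"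
  have st: "stopping_time \<F> T" unfolding T_def by (rule stopping_time_const)
  define G where "G = fil.pre_sigma T"
  have sub: "subalgebra (P \<mu>) G"
    unfolding subalgebra_def
  proof
    show "space G = space (P \<mu>)" unfolding G_def fil.space_pre_sigma P_space[OF \<mu>] ..
    show "sets G \<subseteq> sets (P \<mu>)"
    proof
      fix D assume "D \<in> sets G"
      then have "{\<omega>\<in>D. T \<omega> \<le> top} \<in> sets (\<F> top)" unfolding G_def by (rule fil.sets_pre_sigmaD[OF st])
      then show "D \<in> sets (P \<mu>)" using sets_F_subset[of top] by (auto simp: P_sets[OF \<mu>])
    qed
  qed
  interpret fs: finite_measure_subalgebra "P \<mu>" G by unfold_locales (rule sub)
  have AG: "A \<in> sets G"
    unfolding G_def
  proof (rule fil.sets_pre_sigmaI[OF st])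
    fix u
    show "{\<omega>\<in>A. T \<omega> \<le> u} \<in> sets (\<F> u)"
      using A sets_F_mono[of "ennreal t" u] by (cases "ennreal t \<le> u") (auto simp: T_def)
  qed
  let ?I = "{\<omega>\<in>space \<Omega>. X (t + s) \<omega> \<in> C}"
  have I: "?I \<in> sets (P \<mu>)"
    unfolding P_sets[OF \<mu>] using measurable_sets[OF X_meas C, of "t + s"] t s by (simp add: vimage_def Int_def conj_commute)
  have int: "integrable (P \<mu>) (indicator ?I :: 'w \<Rightarrow> real)"
    using I by (simp add: integrable_real_indicator emeasure_eq_measure)
  have "AE \<omega> in P \<mu>. T \<omega> < \<infinity> \<longrightarrow>
             real_cond_exp (P \<mu>) G (indicator {\<omega>\<in>space \<Omega>. T \<omega> < \<infinity> \<and> X (enn2real (T \<omega>) + s) \<omega> \<in> C}) \<omega>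
             = measure (P (X (enn2real (T \<omega>)) \<omega>)) {\<omega>'\<in>space \<Omega>. X s \<omega>' \<in> C}"
    using strong_markov \<mu> st s C unfolding strong_markov_process_def G_def by blast
  then have AE: "AE \<omega> in P \<mu>. real_cond_exp (P \<mu>) G (indicator ?I) \<omega> = measure (P (X t \<omega>)) {\<omega>'\<in>space \<Omega>. X s \<omega>' \<in> C}"
    using t by (simp add: T_def)
  define k where "k x = (if x \<in> finite_measures then measure (P x) {\<omega>\<in>space \<Omega>. X s \<omega> \<in> C} else 0)" for x
  have km: "k \<in> borel_measurable borel"
    using strong_markov s C unfolding strong_markov_process_def k_def
    by (subst measurable_restrict_space_iff[symmetric]) auto
  have kX [measurable]: "(\<lambda>\<omega>. k (X t \<omega>)) \<in> borel_measurable (P \<mu>)"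
    by (rule measurable_compose[OF X_meas_P[OF \<mu> t] km])
  have k01: "0 \<le> k x" "k x \<le> 1" for x
    using prob_space.prob_le_1[OF P_prob] by (auto simp: k_def)
  have AP [measurable]: "A \<in> sets (P \<mu>)" using AG sub unfolding subalgebra_def by blast
  have I' [measurable]: "?I \<in> sets (P \<mu>)" by (rule I)
  have "(\<integral>\<omega>\<in>A. indicator ?I \<omega> \<partial>P \<mu>) = (\<integral>\<omega>\<in>A. real_cond_exp (P \<mu>) G (indicator ?I) \<omega> \<partial>P \<mu>)"
    by (rule fs.real_cond_exp_intA[OF int AG])
  also have "\<dots> = (\<integral>\<omega>\<in>A. k (X t \<omega>) \<partial>P \<mu>)"
    unfolding set_lebesgue_integral_def
  proof (rule integral_cong_AE)
    show "AE \<omega> in P \<mu>. indicator A \<omega> *\<^sub>R real_cond_exp (P \<mu>) G (indicator ?I) \<omega> = indicator A \<omega> *\<^sub>R k (X t \<omega>)"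
      using AE X_finite[OF \<mu> t] by eventually_elim (simp add: k_def)
  qed auto
  finally have real: "(\<integral>\<omega>. indicator A \<omega> * indicator ?I \<omega> \<partial>P \<mu>) = (\<integral>\<omega>. indicator A \<omega> * k (X t \<omega>) \<partial>P \<mu>)"
    unfolding set_lebesgue_integral_def by simp
  have "(\<integral>\<^sup>+\<omega>. indicator A \<omega> * indicator C (X (t + s) \<omega>) \<partial>P \<mu>) = (\<integral>\<^sup>+\<omega>. ennreal (indicator A \<omega> * indicator ?I \<omega>) \<partial>P \<mu>)"
    by (rule nn_integral_cong) (auto simp: P_space[OF \<mu>] split: split_indicator)
  also have "\<dots> = ennreal (\<integral>\<omega>. indicator A \<omega> * indicator ?I \<omega> \<partial>P \<mu>)"
    by (intro nn_integral_eq_integral bounded_integrable[where C = 1] prob_space_axioms) (auto split: split_indicator)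
  also have "\<dots> = ennreal (\<integral>\<omega>. indicator A \<omega> * k (X t \<omega>) \<partial>P \<mu>)" by (simp only: real)
  also have "\<dots> = (\<integral>\<^sup>+\<omega>. ennreal (indicator A \<omega> * k (X t \<omega>)) \<partial>P \<mu>)"
    by (intro nn_integral_eq_integral[symmetric] bounded_integrable[where C = 1] prob_space_axioms)
      (use k01 in \<open>auto split: split_indicator\<close>)
  also have "\<dots> = (\<integral>\<^sup>+\<omega>. indicator A \<omega> * kern s (indicator C) (X t \<omega>) \<partial>P \<mu>)"
    unfolding kern_indicator(1)[OF s C] k_def[symmetric]
    by (rule nn_integral_cong) (auto split: split_indicator)
  finally show ?thesis .
qed

lemma kern_meas_markov:
  fixes \<phi> :: "(nat \<Rightarrow> real) \<Rightarrow> ennreal"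
  assumes \<phi>: "\<phi> \<in> borel_measurable borel" and s: "0 \<le> s"
  shows "kern s \<phi> \<in> borel_measurable borel \<and>
    (\<forall>\<mu>\<in>finite_measures. \<forall>t\<ge>0. \<forall>A\<in>sets (\<F> (ennreal t)).
      (\<integral>\<^sup>+\<omega>. indicator A \<omega> * \<phi> (X (t + s) \<omega>) \<partial>P \<mu>) = (\<integral>\<^sup>+\<omega>. indicator A \<omega> * kern s \<phi> (X t \<omega>) \<partial>P \<mu>))"
  using \<phi>
proof (induction rule: borel_measurable_induct)
  case (cong f g)
  then have "f = g" by auto
  then show ?case using cong by simp
next
  case (set C)
  then show ?case using kern_indicator(2)[OF s] markov_indicator[OF _ _ s] by blast
next
  case (mult u a)
  have k: "kern s (\<lambda>x. a * u x) x = a * kern s u x" for x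
    unfolding kern_def using mult.hyps s
    by (auto intro!: nn_integral_cmult measurable_compose[OF X_meas_P])
  show ?case
  proof (intro conjI ballI allI impI)
    show "kern s (\<lambda>x. a * u x) \<in> borel_measurable borel" unfolding k[abs_def]
      by (intro borel_measurable_times_ennreal borel_measurable_const) (use mult in blast)
    fix \<mu> t A assume \<mu>: "\<mu> \<in> finite_measures" and t: "0 \<le> t" and A: "A \<in> sets (\<F> (ennreal t))"
    have [measurable]: "A \<in> sets (P \<mu>)" using A sets_F_subset P_sets[OF \<mu>] by blast
    have [measurable]: "(\<lambda>\<omega>. u (X (t + s) \<omega>)) \<in> borel_measurable (P \<mu>)" "(\<lambda>\<omega>. kern s u (X t \<omega>)) \<in> borel_measurable (P \<mu>)"
      using mult t s by (auto intro!: measurable_compose[OF X_meas_P[OF \<mu>]])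
    have eq: "(\<integral>\<^sup>+\<omega>. indicator A \<omega> * u (X (t + s) \<omega>) \<partial>P \<mu>) = (\<integral>\<^sup>+\<omega>. indicator A \<omega> * kern s u (X t \<omega>) \<partial>P \<mu>)"
      using mult \<mu> t A by blast
    have "(\<integral>\<^sup>+\<omega>. indicator A \<omega> * (a * u (X (t + s) \<omega>)) \<partial>P \<mu>) = a * (\<integral>\<^sup>+\<omega>. indicator A \<omega> * u (X (t + s) \<omega>) \<partial>P \<mu>)"
      by (subst nn_integral_cmult[symmetric]) (auto simp: mult_ac)
    also have "\<dots> = (\<integral>\<^sup>+\<omega>. indicator A \<omega> * (a * kern s u (X t \<omega>)) \<partial>P \<mu>)"
      unfolding eq by (subst nn_integral_cmult[symmetric]) (auto simp: mult_ac)
    finally show "(\<integral>\<^sup>+\<omega>. indicator A \<omega> * (a * u (X (t + s) \<omega>)) \<partial>P \<mu>) = (\<integral>\<^sup>+\<omega>. indicator A \<omega> * kern s (\<lambda>x. a * u x) (X t \<omega>) \<partial>P \<mu>)"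
      unfolding k .
  qed
next
  case (add u v)
  have k: "kern s (\<lambda>x. v x + u x) x = kern s v x + kern s u x" for x
    unfolding kern_def using add.hyps s
    by (auto intro!: nn_integral_add measurable_compose[OF X_meas_P])
  show ?case
  proof (intro conjI ballI allI impI)
    show "kern s (\<lambda>x. v x + u x) \<in> borel_measurable borel" unfolding k[abs_def]
      by (intro borel_measurable_add) (use add in blast)+
    fix \<mu> t A assume \<mu>: "\<mu> \<in> finite_measures" and t: "0 \<le> t" and A: "A \<in> sets (\<F> (ennreal t))"
    have [measurable]: "A \<in> sets (P \<mu>)" using A sets_F_subset P_sets[OF \<mu>] by blast
    have [measurable]: "(\<lambda>\<omega>. u (X (t + s) \<omega>)) \<in> borel_measurable (P \<mu>)" "(\<lambda>\<omega>. kern s u (X t \<omega>)) \<in> borel_measurable (P \<mu>)"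
      "(\<lambda>\<omega>. v (X (t + s) \<omega>)) \<in> borel_measurable (P \<mu>)" "(\<lambda>\<omega>. kern s v (X t \<omega>)) \<in> borel_measurable (P \<mu>)"
      using add t s by (auto intro!: measurable_compose[OF X_meas_P[OF \<mu>]])
    show "(\<integral>\<^sup>+\<omega>. indicator A \<omega> * (v (X (t + s) \<omega>) + u (X (t + s) \<omega>)) \<partial>P \<mu>) = (\<integral>\<^sup>+\<omega>. indicator A \<omega> * kern s (\<lambda>x. v x + u x) (X t \<omega>) \<partial>P \<mu>)"
      unfolding k distrib_left using add \<mu> t A by (simp add: nn_integral_add)
  qed
next
  case (seq U)
  have inc: "incseq (\<lambda>k. U k x)" for x using seq.hyps by (auto simp: incseq_def le_fun_def)
  have k: "kern s (SUP i. U i) x = (SUP i. kern s (U i) x)" for x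
  proof (cases "x \<in> finite_measures")
    case True
    have "(\<integral>\<^sup>+\<omega>. (SUP i. U i (X s \<omega>)) \<partial>P x) = (SUP i. \<integral>\<^sup>+\<omega>. U i (X s \<omega>) \<partial>P x)"
      using seq.hyps s True inc
      by (intro nn_integral_monotone_convergence_SUP) (auto simp: incseq_def le_fun_def intro!: measurable_compose[OF X_meas_P])
    then show ?thesis using True by (simp add: kern_def image_comp)
  qed (simp add: kern_def)
  have kinc: "incseq (\<lambda>i. kern s (U i) x)" for x
    using inc unfolding kern_def incseq_def by (auto intro!: nn_integral_mono)
  show ?case
  proof (intro conjI ballI allI impI)
    show "kern s (SUP i. U i) \<in> borel_measurable borel" unfolding k[abs_def]
      by (intro borel_measurable_SUP) (use seq in auto)
    fix \<mu> t A assume \<mu>: "\<mu> \<in> finite_measures" and t: "0 \<le> t" and A: "A \<in> sets (\<F> (ennreal t))"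
    have [measurable]: "A \<in> sets (P \<mu>)" using A sets_F_subset P_sets[OF \<mu>] by blast
    have [measurable]: "(\<lambda>\<omega>. U i (X (t + s) \<omega>)) \<in> borel_measurable (P \<mu>)" "(\<lambda>\<omega>. kern s (U i) (X t \<omega>)) \<in> borel_measurable (P \<mu>)" for i
      using seq t s by (auto intro!: measurable_compose[OF X_meas_P[OF \<mu>]])
    have "(\<integral>\<^sup>+\<omega>. indicator A \<omega> * (SUP i. U i) (X (t + s) \<omega>) \<partial>P \<mu>) = (\<integral>\<^sup>+\<omega>. (SUP i. indicator A \<omega> * U i (X (t + s) \<omega>)) \<partial>P \<mu>)"
      by (simp add: SUP_mult_left_ennreal image_comp)
    also have "\<dots> = (SUP i. \<integral>\<^sup>+\<omega>. indicator A \<omega> * U i (X (t + s) \<omega>) \<partial>P \<mu>)"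
      using inc by (intro nn_integral_monotone_convergence_SUP) (auto simp: incseq_def le_fun_def intro!: mult_left_mono)
    also have "\<dots> = (SUP i. \<integral>\<^sup>+\<omega>. indicator A \<omega> * kern s (U i) (X t \<omega>) \<partial>P \<mu>)"
      using seq \<mu> t A by (intro SUP_cong refl) blast
    also have "\<dots> = (\<integral>\<^sup>+\<omega>. (SUP i. indicator A \<omega> * kern s (U i) (X t \<omega>)) \<partial>P \<mu>)"
      using kinc by (intro nn_integral_monotone_convergence_SUP[symmetric]) (auto simp: incseq_def le_fun_def intro!: mult_left_mono)
    also have "\<dots> = (\<integral>\<^sup>+\<omega>. indicator A \<omega> * kern s (SUP i. U i) (X t \<omega>) \<partial>P \<mu>)"
      unfolding k by (simp add: SUP_mult_left_ennreal)
    finally show "(\<integral>\<^sup>+\<omega>. indicator A \<omega> * (SUP i. U i) (X (t + s) \<omega>) \<partial>P \<mu>) = (\<integral>\<^sup>+\<omega>. indicator A \<omega> * kern s (SUP i. U i) (X t \<omega>) \<partial>P \<mu>)" .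
  qed
qed

lemma kern_meas: "\<phi> \<in> borel_measurable borel \<Longrightarrow> 0 \<le> s \<Longrightarrow> kern s \<phi> \<in> borel_measurable borel"
  using kern_meas_markov by blast

lemma meas_F_P:
  fixes Z :: "'w \<Rightarrow> 'z::topological_space"
  assumes "\<mu> \<in> finite_measures" and "Z \<in> borel_measurable (\<F> u)"
  shows "Z \<in> borel_measurable (P \<mu>)"
proof (rule measurableI)
  fix A :: "'z set" assume A: "A \<in> sets borel"
  have "Z -` A \<inter> space (\<F> u) \<in> sets (\<F> u)" using assms(2) A by (rule measurable_sets)
  then show "Z -` A \<inter> space (P \<mu>) \<in> sets (P \<mu>)"
    using sets_F_subset[of u] by (auto simp: space_F P_space[OF assms(1)] P_sets[OF assms(1)])
qed simp

lemma markov: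
  fixes \<phi> :: "(nat \<Rightarrow> real) \<Rightarrow> ennreal" and Z :: "'w \<Rightarrow> ennreal"
  assumes Z: "Z \<in> borel_measurable (\<F> (ennreal t))" and \<phi>: "\<phi> \<in> borel_measurable borel"
    and \<mu>: "\<mu> \<in> finite_measures" and t: "0 \<le> t" and s: "0 \<le> s"
  shows "(\<integral>\<^sup>+\<omega>. Z \<omega> * \<phi> (X (t + s) \<omega>) \<partial>P \<mu>) = (\<integral>\<^sup>+\<omega>. Z \<omega> * kern s \<phi> (X t \<omega>) \<partial>P \<mu>)"
proof -
  have m [measurable]: "(\<lambda>\<omega>. \<phi> (X (t + s) \<omega>)) \<in> borel_measurable (P \<mu>)" "(\<lambda>\<omega>. kern s \<phi> (X t \<omega>)) \<in> borel_measurable (P \<mu>)"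
    using t s kern_meas[OF \<phi> s] \<phi> by (auto intro!: measurable_compose[OF X_meas_P[OF \<mu>]])
  note mP = meas_F_P[OF \<mu>]
  show ?thesis
    using Z
  proof (induction rule: borel_measurable_induct)
    case (cong f g)
    have "(\<integral>\<^sup>+\<omega>. g \<omega> * h \<omega> \<partial>P \<mu>) = (\<integral>\<^sup>+\<omega>. f \<omega> * h \<omega> \<partial>P \<mu>)" for h
      using cong.hyps by (intro nn_integral_cong) (auto simp: space_F P_space[OF \<mu>])
    then show ?case using cong by simp
  next
    case (set A)
    then show ?case using kern_meas_markov[OF \<phi> s] \<mu> t by blast
  next
    case (mult u a)
    have [measurable]: "u \<in> borel_measurable (P \<mu>)" using mult.hyps by (intro mP)
    show ?case unfolding mult.assoc using mult.IH by (simp add: nn_integral_cmult)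
  next
    case (add u v)
    have [measurable]: "u \<in> borel_measurable (P \<mu>)" "v \<in> borel_measurable (P \<mu>)" using add.hyps by (auto intro: mP)
    show ?case unfolding distrib_right using add.IH by (simp add: nn_integral_add)
  next
    case (seq U)
    have [measurable]: "U i \<in> borel_measurable (P \<mu>)" for i using seq.hyps by (auto intro: mP)
    have inc: "incseq (\<lambda>k \<omega>. U k \<omega> * h \<omega>)" for h :: "'w \<Rightarrow> ennreal"
      using seq.hyps by (auto simp: incseq_def le_fun_def intro!: mult_right_mono)
    have "(\<integral>\<^sup>+\<omega>. (SUP i. U i) \<omega> * h \<omega> \<partial>P \<mu>) = (SUP i. \<integral>\<^sup>+\<omega>. U i \<omega> * h \<omega> \<partial>P \<mu>)"
      if [measurable]: "h \<in> borel_measurable (P \<mu>)" for h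
    proof -
      have "(\<integral>\<^sup>+\<omega>. (SUP i. U i) \<omega> * h \<omega> \<partial>P \<mu>) = (\<integral>\<^sup>+\<omega>. (SUP i. U i \<omega> * h \<omega>) \<partial>P \<mu>)"
        by (simp add: SUP_mult_right_ennreal image_comp)
      also have "\<dots> = (SUP i. \<integral>\<^sup>+\<omega>. U i \<omega> * h \<omega> \<partial>P \<mu>)"
        by (rule nn_integral_monotone_convergence_SUP[OF inc]) measurable
      finally show ?thesis .
    qed
    then show ?case using seq.IH by simp
  qed
qed

lemma kern_laplace:
  assumes f: "\<And>j. 0 \<le> f j" "\<And>j. f j \<le> F" and s: "0 \<le> s" and x: "x \<in> finite_measures"
  shows "kern s (\<lambda>x. ennreal (exp_neg (pairing (\<lambda>j. ennreal (f j)) x))) x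
    = ennreal (exp_neg (pairing (\<lambda>j. ennreal (cumulant s f j)) x))"
proof -
  have "kern s (\<lambda>x. ennreal (exp_neg (pairing (\<lambda>j. ennreal (f j)) x))) x
     = ennreal (\<integral>\<omega>. exp_neg (pairing (\<lambda>j. ennreal (f j)) (X s \<omega>)) \<partial>P x)"
    unfolding kern_def using x by (auto intro!: nn_integral_eq_integral exp_neg_pairing_integrable s simp: exp_neg_nonneg)
  also have "\<dots> = ennreal (exp (- lin (cumulant s f) x))" by (simp add: laplace[OF f s x])
  also have "\<dots> = ennreal (exp_neg (pairing (\<lambda>j. ennreal (cumulant s f j)) x))"
    by (subst exp_neg_lin[OF x cumulant_nonneg[OF f s] cumulant_upper'[OF f s order_refl]]) simp
  finally show ?thesis .
qed

lemma markov_laplace: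
  assumes f: "\<And>j. 0 \<le> f j" "\<And>j. f j \<le> F" and Z: "Z \<in> borel_measurable (\<F> (ennreal t))" and Z01: "\<And>\<omega>. 0 \<le> Z \<omega>" "\<And>\<omega>. Z \<omega> \<le> 1"
    and \<mu>: "\<mu> \<in> finite_measures" and t: "0 \<le> t" and s: "0 \<le> s"
  shows "(\<integral>\<omega>. Z \<omega> * exp_neg (pairing (\<lambda>j. ennreal (f j)) (X (t + s) \<omega>)) \<partial>P \<mu>)
    = (\<integral>\<omega>. Z \<omega> * exp_neg (pairing (\<lambda>j. ennreal (cumulant s f j)) (X t \<omega>)) \<partial>P \<mu>)"
proof -
  have [measurable]: "Z \<in> borel_measurable (P \<mu>)" by (rule meas_F_P[OF \<mu> Z])
  have int: "integrable (P \<mu>) (\<lambda>\<omega>. Z \<omega> * exp_neg (pairing h (X u \<omega>)))" if "0 \<le> u" for h u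
    by (rule bounded_integrable[OF P_prob[OF \<mu>], where C = 1])
      (use \<mu> that Z01 in \<open>auto simp: abs_mult exp_neg_nonneg exp_neg_le_1 intro!: mult_le_one\<close>)
  have nn: "ennreal (\<integral>\<omega>. Z \<omega> * exp_neg (pairing h (X u \<omega>)) \<partial>P \<mu>) = (\<integral>\<^sup>+\<omega>. ennreal (Z \<omega>) * ennreal (exp_neg (pairing h (X u \<omega>))) \<partial>P \<mu>)" if "0 \<le> u" for h u
    using nn_integral_eq_integral[OF int[OF that, of h]] Z01 by (simp add: exp_neg_nonneg ennreal_mult)
  have "ennreal (\<integral>\<omega>. Z \<omega> * exp_neg (pairing (\<lambda>j. ennreal (f j)) (X (t + s) \<omega>)) \<partial>P \<mu>)
     = (\<integral>\<^sup>+\<omega>. ennreal (Z \<omega>) * kern s (\<lambda>x. ennreal (exp_neg (pairing (\<lambda>j. ennreal (f j)) x))) (X t \<omega>) \<partial>P \<mu>)"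
    unfolding nn[OF add_nonneg_nonneg[OF t s]] by (rule markov[OF _ _ \<mu> t s]) (use Z in measurable)
  also have "\<dots> = (\<integral>\<^sup>+\<omega>. ennreal (Z \<omega>) * ennreal (exp_neg (pairing (\<lambda>j. ennreal (cumulant s f j)) (X t \<omega>))) \<partial>P \<mu>)"
    by (rule nn_integral_cong_AE) (use X_finite[OF \<mu> t] in \<open>auto elim!: eventually_mono simp: kern_laplace[OF f s]\<close>)
  also have "\<dots> = ennreal (\<integral>\<omega>. Z \<omega> * exp_neg (pairing (\<lambda>j. ennreal (cumulant s f j)) (X t \<omega>)) \<partial>P \<mu>)"
    by (rule nn[OF t, symmetric])
  finally show ?thesis
    by (subst (asm) ennreal_inj) (auto intro!: integral_nonneg_AE AE_I2 simp: Z01 exp_neg_nonneg)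
qed

lemma cumulant_0:
  assumes f: "\<And>j. 0 \<le> f j" "\<And>j. f j \<le> F"
  shows "cumulant 0 f = f"
  using cumulant_eq'(2)[of f F 0, OF f] by auto

text \<open>
  Condition on the last grid point and absorb it: by the Markov property its contribution is replaced by a
  cumulant at the previous grid point.  The function \<open>g\<close> depends neither on the starting time nor on the
  initial measure.
\<close>

lemma grid_laplace:
  fixes a :: "nat \<Rightarrow> real"
  assumes a: "\<And>k. 0 \<le> a k" and \<delta>: "0 \<le> \<delta>"
  shows "(\<And>j. 0 \<le> f j) \<Longrightarrow> (\<And>j. f j \<le> F) \<Longrightarrow> \<exists>g G. (\<forall>j. 0 \<le> g j \<and> g j \<le> G) \<and> (\<forall>\<sigma>\<ge>0. \<forall>\<mu>\<in>finite_measures.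
     (\<integral>\<omega>. exp_neg ((\<Sum>k<N. ennreal (a k) * mass (X (\<sigma> + real k * \<delta>) \<omega>)) + pairing (\<lambda>j. ennreal (f j)) (X (\<sigma> + real N * \<delta>) \<omega>)) \<partial>P \<mu>)
       = exp (- lin (cumulant \<sigma> g) \<mu>))"
proof (induction N arbitrary: f F)
  case 0
  show ?case
    by (intro exI[of _ f] exI[of _ F]) (use 0 laplace[of f F] in auto)
next
  case (Suc N)
  define f' where "f' j = a N + cumulant \<delta> f j" for j
  have f': "0 \<le> f' j" "f' j \<le> a N + F * growth (4 * B) \<delta>" for j
    unfolding f'_def using a[of N] cumulant_nonneg[of f F \<delta> j, OF Suc.prems \<delta>] cumulant_upper'[of f F \<delta> \<delta> j, OF Suc.prems \<delta>] by auto
  from Suc.IH[of f', OF f'] obtain g G where g: "\<forall>j. 0 \<le> g j \<and> g j \<le> G"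
    and eq: "\<And>\<sigma> \<mu>. 0 \<le> \<sigma> \<Longrightarrow> \<mu> \<in> finite_measures \<Longrightarrow>
     (\<integral>\<omega>. exp_neg ((\<Sum>k<N. ennreal (a k) * mass (X (\<sigma> + real k * \<delta>) \<omega>)) + pairing (\<lambda>j. ennreal (f' j)) (X (\<sigma> + real N * \<delta>) \<omega>)) \<partial>P \<mu>)
       = exp (- lin (cumulant \<sigma> g) \<mu>)" by blast
  show ?case
  proof (intro exI[of _ g] exI[of _ G] conjI g allI impI ballI)
    fix \<sigma> \<mu> assume \<sigma>: "(0::real) \<le> \<sigma>" and \<mu>: "\<mu> \<in> finite_measures"
    define t where "t = \<sigma> + real N * \<delta>"
    have t: "0 \<le> t" "t + \<delta> = \<sigma> + real (Suc N) * \<delta>" unfolding t_def using \<sigma> \<delta> by (auto simp: algebra_simps)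
    define Z where "Z \<omega> = exp_neg (\<Sum>k<Suc N. ennreal (a k) * mass (X (\<sigma> + real k * \<delta>) \<omega>))" for \<omega>
    have Zm: "Z \<in> borel_measurable (\<F> (ennreal t))"
    proof -
      have "(\<lambda>\<omega>. mass (X (\<sigma> + real k * \<delta>) \<omega>)) \<in> borel_measurable (\<F> (ennreal t))" if "k < Suc N" for k
      proof (rule measurable_compose[OF X_meas_F pairing_meas])
        show "0 \<le> \<sigma> + real k * \<delta>" using \<sigma> \<delta> by simp
        show "\<sigma> + real k * \<delta> \<le> t" unfolding t_def using that \<delta> by (auto intro!: mult_right_mono)
      qed
      then show ?thesis unfolding Z_def
        by (intro measurable_compose[OF _ exp_neg_meas] borel_measurable_sum borel_measurable_times_ennreal) auto
    qed
    have "(\<integral>\<omega>. exp_neg ((\<Sum>k<Suc N. ennreal (a k) * mass (X (\<sigma> + real k * \<delta>) \<omega>)) + pairing (\<lambda>j. ennreal (f j)) (X (\<sigma> + real (Suc N) * \<delta>) \<omega>)) \<partial>P \<mu>)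
      = (\<integral>\<omega>. Z \<omega> * exp_neg (pairing (\<lambda>j. ennreal (f j)) (X (t + \<delta>) \<omega>)) \<partial>P \<mu>)"
      unfolding Z_def t(2) exp_neg_add ..
    also have "\<dots> = (\<integral>\<omega>. Z \<omega> * exp_neg (pairing (\<lambda>j. ennreal (cumulant \<delta> f j)) (X t \<omega>)) \<partial>P \<mu>)"
      by (rule markov_laplace[OF Suc.prems Zm _ _ \<mu> t(1) \<delta>]) (auto simp: Z_def exp_neg_nonneg exp_neg_le_1)
    also have "\<dots> = (\<integral>\<omega>. exp_neg ((\<Sum>k<N. ennreal (a k) * mass (X (\<sigma> + real k * \<delta>) \<omega>)) + pairing (\<lambda>j. ennreal (f' j)) (X (\<sigma> + real N * \<delta>) \<omega>)) \<partial>P \<mu>)"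
    proof (rule Bochner_Integration.integral_cong[OF refl])
      fix \<omega>
      have "pairing (\<lambda>j. ennreal (f' j)) (X t \<omega>) = ennreal (a N) * mass (X t \<omega>) + pairing (\<lambda>j. ennreal (cumulant \<delta> f j)) (X t \<omega>)"
        unfolding f'_def using a[of N] cumulant_nonneg[OF Suc.prems \<delta>]
        by (simp add: pairing_add pairing_mult[of _ "\<lambda>_. 1", simplified, symmetric])
      then show "Z \<omega> * exp_neg (pairing (\<lambda>j. ennreal (cumulant \<delta> f j)) (X t \<omega>)) = exp_neg ((\<Sum>k<N. ennreal (a k) * mass (X (\<sigma> + real k * \<delta>) \<omega>)) + pairing (\<lambda>j. ennreal (f' j)) (X (\<sigma> + real N * \<delta>) \<omega>))"
        unfolding Z_def t_def by (simp add: exp_neg_add[symmetric] add.assoc)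
    qed
    also have "\<dots> = exp (- lin (cumulant \<sigma> g) \<mu>)" by (rule eq[OF \<sigma> \<mu>])
    finally show "(\<integral>\<omega>. exp_neg ((\<Sum>k<Suc N. ennreal (a k) * mass (X (\<sigma> + real k * \<delta>) \<omega>)) + pairing (\<lambda>j. ennreal (f j)) (X (\<sigma> + real (Suc N) * \<delta>) \<omega>)) \<partial>P \<mu>)
      = exp (- lin (cumulant \<sigma> g) \<mu>)" .
  qed
qed

end

section \<open>Laplace functionals of the integrated mass\<close>

lemma exp_minus_lipschitz:
  fixes x y :: real
  assumes "0 \<le> x" "0 \<le> y"
  shows "\<bar>exp (- x) - exp (- y)\<bar> \<le> x + y - 2 * min x y"
proof -
  have *: "exp (- a) - exp (- b) \<le> b - a" if "0 \<le> a" "a \<le> b" for a b :: real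
  proof -
    have "exp (- a) - exp (- b) = exp (- a) * (1 - exp (- (b - a)))"
      by (simp add: algebra_simps exp_add[symmetric])
    also have "\<dots> \<le> 1 * (b - a)"
      using exp_ge_add_one_self[of "a - b"] that by (intro mult_mono) (auto simp del: exp_ge_add_one_self)
    finally show ?thesis by simp
  qed
  show ?thesis
    using *[of x y] *[of y x] assms by (cases "x \<le> y") (auto simp: abs_if min_def)
qed

text \<open>
  The liminf bound and the convergence of the means together force convergence in mean, as in Scheffe's
  lemma, and \<open>exp_neg\<close> is Lipschitz.
\<close>

lemma exp_neg_scheffe:
  fixes S :: "nat \<Rightarrow> 'x \<Rightarrow> ennreal" and T :: "'x \<Rightarrow> ennreal"
  assumes M: "prob_space M" and [measurable]: "\<And>k. S k \<in> borel_measurable M" "T \<in> borel_measurable M"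
    and lsc: "\<And>\<omega>. \<omega> \<in> space M \<Longrightarrow> T \<omega> \<le> liminf (\<lambda>k. S k \<omega>)"
    and fin: "(\<integral>\<^sup>+\<omega>. T \<omega> \<partial>M) < \<infinity>"
    and le: "\<And>k. (\<integral>\<^sup>+\<omega>. S k \<omega> \<partial>M) \<le> ennreal (\<gamma> k) * (\<integral>\<^sup>+\<omega>. T \<omega> \<partial>M)" and \<gamma>: "\<gamma> \<longlonglongrightarrow> 1" "\<And>k. 0 \<le> \<gamma> k"
  shows "(\<lambda>k. \<integral>\<omega>. exp_neg (S k \<omega>) \<partial>M) \<longlonglongrightarrow> (\<integral>\<omega>. exp_neg (T \<omega>) \<partial>M)"
proof -
  interpret prob_space M by fact
  have finS: "(\<integral>\<^sup>+\<omega>. S k \<omega> \<partial>M) < \<infinity>" for k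
    by (rule le_less_trans[OF le]) (use fin in \<open>simp add: ennreal_mult_less_top\<close>)
  define s where "s k \<omega> = enn2real (S k \<omega>)" for k \<omega>
  define a where "a \<omega> = enn2real (T \<omega>)" for \<omega>
  have [measurable]: "s k \<in> borel_measurable M" "a \<in> borel_measurable M" for k unfolding s_def a_def by measurable
  have AET: "AE \<omega> in M. T \<omega> = ennreal (a \<omega>)"
    using nn_integral_PInf_AE[OF _ less_imp_neq[OF fin]] unfolding a_def by (auto elim!: eventually_mono simp: less_top)
  have AES: "AE \<omega> in M. \<forall>k. S k \<omega> = ennreal (s k \<omega>)"
    unfolding AE_all_countable
  proof
    fix k
    have "AE \<omega> in M. S k \<omega> \<noteq> \<infinity>" by (rule nn_integral_PInf_AE[OF _ less_imp_neq[OF finS]]) measurable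
    then show "AE \<omega> in M. S k \<omega> = ennreal (s k \<omega>)"
      unfolding s_def by eventually_elim (simp add: less_top)
  qed
  have nns: "0 \<le> s k \<omega>" "0 \<le> a \<omega>" for k \<omega> unfolding s_def a_def by auto
  have eqT: "(\<integral>\<^sup>+\<omega>. ennreal (a \<omega>) \<partial>M) = (\<integral>\<^sup>+\<omega>. T \<omega> \<partial>M)"
    by (rule nn_integral_cong_AE) (use AET in \<open>auto elim!: eventually_mono\<close>)
  have eqS: "(\<integral>\<^sup>+\<omega>. ennreal (s k \<omega>) \<partial>M) = (\<integral>\<^sup>+\<omega>. S k \<omega> \<partial>M)" for k
    by (rule nn_integral_cong_AE) (use AES in \<open>auto elim!: eventually_mono\<close>)
  have ia: "integrable M a" by (rule integrableI_nonneg) (use fin eqT nns in auto)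
  have is': "integrable M (s k)" for k by (rule integrableI_nonneg) (use finS eqS nns in auto)
  define A where "A = (\<integral>\<omega>. a \<omega> \<partial>M)"
  have A: "(\<integral>\<^sup>+\<omega>. T \<omega> \<partial>M) = ennreal A" "0 \<le> A"
    unfolding A_def using eqT nn_integral_eq_integral[OF ia] nns by (auto intro: integral_nonneg_AE)
  have sA: "(\<integral>\<omega>. s k \<omega> \<partial>M) \<le> \<gamma> k * A" for k
  proof -
    have "ennreal (\<integral>\<omega>. s k \<omega> \<partial>M) \<le> ennreal (\<gamma> k * A)"
      using le[of k] eqS[of k] nn_integral_eq_integral[OF is'] nns A \<gamma>(2)[of k] by (simp add: ennreal_mult)
    then show ?thesis using A \<gamma>(2)[of k] by (subst (asm) ennreal_le_iff) auto
  qed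
  have im: "integrable M (\<lambda>\<omega>. min (s k \<omega>) (a \<omega>))" for k
    by (rule Bochner_Integration.integrable_bound[OF ia]) (use nns in \<open>auto simp: min_def\<close>)
  have m_lim: "(\<lambda>k. \<integral>\<omega>. min (s k \<omega>) (a \<omega>) \<partial>M) \<longlonglongrightarrow> A"
    unfolding A_def
  proof (rule integral_dominated_convergence[where w = a])
    show "AE \<omega> in M. (\<lambda>k. min (s k \<omega>) (a \<omega>)) \<longlonglongrightarrow> a \<omega>"
      using AET AES AE_space
    proof eventually_elim
      case (elim \<omega>)
      show ?case
      proof (rule order_tendstoI)
        fix e assume e: "e < a \<omega>"
        show "eventually (\<lambda>k. e < min (s k \<omega>) (a \<omega>)) sequentially"
        proof (cases "e < 0")
          case True
          have "e < min (s k \<omega>) (a \<omega>)" for k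
            using less_le_trans[OF True nns(1)[of k \<omega>]] e by simp
          then show ?thesis by simp
        next
          case False
          have "ennreal e < liminf (\<lambda>k. S k \<omega>)"
            by (rule less_le_trans[OF _ lsc[OF elim(3)]]) (use elim(1) e False in \<open>simp add: ennreal_less_iff\<close>)
          then have "eventually (\<lambda>k. ennreal e < S k \<omega>) sequentially" by (rule less_LiminfD)
          then show ?thesis
            by eventually_elim (use elim(2) e False in \<open>auto simp: ennreal_less_iff\<close>)
        qed
      next
        fix e assume "a \<omega> < e"
        then show "eventually (\<lambda>k. min (s k \<omega>) (a \<omega>) < e) sequentially" by (auto simp: min_less_iff_disj)
      qed
    qed
  qed (use nns ia in \<open>auto simp: min_def\<close>)
  have ie: "integrable M (\<lambda>\<omega>. exp_neg (h \<omega>))" if [measurable]: "h \<in> borel_measurable M" for h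
    by (rule bounded_integrable[OF M, where C = 1]) (auto simp: exp_neg_abs_le_1)
  have bound: "\<bar>(\<integral>\<omega>. exp_neg (S k \<omega>) \<partial>M) - (\<integral>\<omega>. exp_neg (T \<omega>) \<partial>M)\<bar> \<le> \<gamma> k * A + A - 2 * (\<integral>\<omega>. min (s k \<omega>) (a \<omega>) \<partial>M)" for k
  proof -
    have "(\<integral>\<omega>. exp_neg (S k \<omega>) \<partial>M) - (\<integral>\<omega>. exp_neg (T \<omega>) \<partial>M) = (\<integral>\<omega>. exp_neg (S k \<omega>) - exp_neg (T \<omega>) \<partial>M)"
      by (rule Bochner_Integration.integral_diff[symmetric]) (auto intro: ie)
    also have "\<bar>\<dots>\<bar> \<le> (\<integral>\<omega>. \<bar>exp_neg (S k \<omega>) - exp_neg (T \<omega>)\<bar> \<partial>M)" by (rule integral_abs_bound)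
    also have "\<dots> \<le> (\<integral>\<omega>. s k \<omega> + a \<omega> - 2 * min (s k \<omega>) (a \<omega>) \<partial>M)"
    proof (rule integral_mono_AE)
      show "AE \<omega> in M. \<bar>exp_neg (S k \<omega>) - exp_neg (T \<omega>)\<bar> \<le> s k \<omega> + a \<omega> - 2 * min (s k \<omega>) (a \<omega>)"
        using AET AES
      proof eventually_elim
        case (elim \<omega>)
        then show ?case using exp_minus_lipschitz[OF nns(1)[of k \<omega>] nns(2)[of \<omega>]] nns by (simp add: exp_neg_ennreal)
      qed
      show "integrable M (\<lambda>\<omega>. \<bar>exp_neg (S k \<omega>) - exp_neg (T \<omega>)\<bar>)"
        by (rule integrable_abs, rule Bochner_Integration.integrable_diff; rule ie; rule assms)
      show "integrable M (\<lambda>\<omega>. s k \<omega> + a \<omega> - 2 * min (s k \<omega>) (a \<omega>))"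
        by (intro Bochner_Integration.integrable_diff Bochner_Integration.integrable_add integrable_mult_right ia is' im)
    qed
    also have "\<dots> = (\<integral>\<omega>. s k \<omega> \<partial>M) + A - 2 * (\<integral>\<omega>. min (s k \<omega>) (a \<omega>) \<partial>M)"
      unfolding A_def using ia is' im by simp
    finally show ?thesis using sA[of k] by linarith
  qed
  have "(\<lambda>k. \<gamma> k * A + A - 2 * (\<integral>\<omega>. min (s k \<omega>) (a \<omega>) \<partial>M)) \<longlonglongrightarrow> 1 * A + A - 2 * A"
    by (intro tendsto_intros \<gamma>(1) m_lim)
  then have lim: "(\<lambda>k. \<gamma> k * A + A - 2 * (\<integral>\<omega>. min (s k \<omega>) (a \<omega>) \<partial>M)) \<longlonglongrightarrow> 0" by simp
  have "(\<lambda>k. (\<integral>\<omega>. exp_neg (S k \<omega>) \<partial>M) - (\<integral>\<omega>. exp_neg (T \<omega>) \<partial>M)) \<longlonglongrightarrow> 0"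
  proof (rule Lim_null_comparison[OF _ lim])
    show "eventually (\<lambda>k. norm ((\<integral>\<omega>. exp_neg (S k \<omega>) \<partial>M) - (\<integral>\<omega>. exp_neg (T \<omega>) \<partial>M))
        \<le> \<gamma> k * A + A - 2 * (\<integral>\<omega>. min (s k \<omega>) (a \<omega>) \<partial>M)) sequentially"
      unfolding real_norm_def by (rule always_eventually) (rule allI, rule bound)
  qed
  then show ?thesis by (rule LIM_zero_cancel)
qed

text \<open>
  The first multiple of \<open>1 / (k + 1)\<close> strictly after \<open>r\<close>.  Strictness makes the paths, which are only
  right-continuous, converge along it.
\<close>

definition grid_above :: "nat \<Rightarrow> real \<Rightarrow> real" where
  "grid_above k r = (of_int \<lfloor>r * real (Suc k)\<rfloor> + 1) / real (Suc k)"

lemma grid_above_bounds: "r < grid_above k r" "grid_above k r \<le> r + 1 / real (Suc k)"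
proof -
  have "r * real (Suc k) < of_int \<lfloor>r * real (Suc k)\<rfloor> + 1" by linarith
  then show "r < grid_above k r" unfolding grid_above_def by (subst pos_less_divide_eq) auto
  have "(of_int \<lfloor>r * real (Suc k)\<rfloor> + 1) / real (Suc k) \<le> (r * real (Suc k) + 1) / real (Suc k)"
    by (intro divide_right_mono) auto
  then show "grid_above k r \<le> r + 1 / real (Suc k)" unfolding grid_above_def by (simp add: add_divide_distrib)
qed

lemma grid_above_at_right: "filterlim (\<lambda>k. t + grid_above k r) (at_right (t + r)) sequentially"
proof -
  have "(\<lambda>k. grid_above k r) \<longlonglongrightarrow> r"
  proof (rule tendsto_sandwich[of "\<lambda>_. r" _ _ "\<lambda>k. r + 1 / real (Suc k)"])
    show "(\<lambda>k. r + 1 / real (Suc k)) \<longlonglongrightarrow> r"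
      using tendsto_add[OF tendsto_const[of r] LIMSEQ_inverse_real_of_nat] by (simp add: inverse_eq_divide)
  qed (use grid_above_bounds in \<open>auto intro!: always_eventually less_imp_le\<close>)
  then have "(\<lambda>k. t + grid_above k r) \<longlonglongrightarrow> t + r" by (intro tendsto_intros)
  then show ?thesis
    unfolding filterlim_at by (auto intro!: always_eventually simp: grid_above_bounds less_imp_neq[OF grid_above_bounds(1), THEN not_sym])
qed

lemma grid_above_meas [measurable]: "grid_above k \<in> borel_measurable borel"
  unfolding grid_above_def by measurable

context mcsbp begin

lemma X_coord_right:
  assumes "\<omega> \<in> space \<Omega>" "0 \<le> r" "filterlim u (at_right r) F"
  shows "((\<lambda>k. X (u k) \<omega> i) \<longlongrightarrow> X r \<omega> i) F"
proof -
  have "((\<lambda>s. X s \<omega> i) \<longlongrightarrow> X r \<omega> i) (at_right r)"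
    using continuous_on_tendsto_compose[OF continuous_on_product_coordinates
          X_right_continuous[OF assms(1,2), unfolded continuous_within]] by simp
  then show ?thesis by (rule filterlim_compose[OF _ assms(3)])
qed

text \<open>
  The coordinates converge, but mass may escape to infinity in the type space; only lower
  semicontinuity remains.
\<close>

lemma mass_lsc:
  assumes \<omega>: "\<omega> \<in> space \<Omega>" and r: "0 \<le> r" and u: "filterlim u (at_right r) sequentially"
  shows "ennreal c' * mass (X r \<omega>) \<le> liminf (\<lambda>k. ennreal c' * mass (X (u k) \<omega>))"
proof -
  have eq: "ennreal c' * mass x = (\<Sum>i. ennreal c' * ennreal (x i))" for x :: "nat \<Rightarrow> real"
    using pairing_mult[of "ennreal c'" "\<lambda>_. 1" x] unfolding pairing_def by simp
  show ?thesis
    unfolding eq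
  proof (rule suminf_le_const[OF summableI])
    fix m
    have "(\<lambda>k. \<Sum>i<m. ennreal c' * ennreal (X (u k) \<omega> i)) \<longlonglongrightarrow> (\<Sum>i<m. ennreal c' * ennreal (X r \<omega> i))"
      by (intro tendsto_sum ennreal_tendsto_cmult tendsto_ennrealI X_coord_right[OF \<omega> r u]) auto
    then have "(\<Sum>i<m. ennreal c' * ennreal (X r \<omega> i)) = liminf (\<lambda>k. \<Sum>i<m. ennreal c' * ennreal (X (u k) \<omega> i))"
      by (rule lim_imp_Liminf[OF sequentially_bot, symmetric])
    also have "\<dots> \<le> liminf (\<lambda>k. \<Sum>i. ennreal c' * ennreal (X (u k) \<omega> i))"
      by (intro Liminf_mono always_eventually allI sum_le_suminf) auto
    finally show "(\<Sum>i<m. ennreal c' * ennreal (X r \<omega> i)) \<le> liminf (\<lambda>k. \<Sum>i. ennreal c' * ennreal (X (u k) \<omega> i))" .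
  qed
qed

text \<open>
  Each coordinate is a pointwise limit of its values at the next grid time, which are jointly
  measurable because they depend on countably many times.
\<close>

lemma mass_joint_meas:
  fixes \<tau> :: "real \<Rightarrow> real"
  assumes [measurable]: "\<tau> \<in> borel_measurable borel"
  shows "(\<lambda>p. mass (X (max 0 (\<tau> (fst p))) (snd p))) \<in> borel_measurable (borel \<Otimes>\<^sub>M \<Omega>)"
proof -
  have coord: "(\<lambda>\<omega>. X t \<omega> i) \<in> borel_measurable \<Omega>" if "0 \<le> t" for t i
    by (rule measurable_compose[OF X_meas[OF that]
          borel_measurable_continuous_onI[OF continuous_on_product_coordinates]])
  have step: "(\<lambda>p. X (max 0 (grid_above k (max 0 (\<tau> (fst p))))) (snd p) i) \<in> borel_measurable (borel \<Otimes>\<^sub>M \<Omega>)" for k i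
    unfolding grid_above_def
  proof (rule measurable_compose_countable[where f = "\<lambda>z (p :: real \<times> 'w). X (max 0 ((of_int z + 1) / real (Suc k))) (snd p) i"
        and g = "\<lambda>p :: real \<times> 'w. \<lfloor>max 0 (\<tau> (fst p)) * real (Suc k)\<rfloor>"])
    show "(\<lambda>p. X (max 0 ((of_int z + 1) / real (Suc k))) (snd p) i) \<in> borel_measurable (borel \<Otimes>\<^sub>M \<Omega>)" for z
      by (rule measurable_compose[OF measurable_snd coord]) simp
  qed measurable
  have "(\<lambda>p. X (max 0 (\<tau> (fst p))) (snd p) i) \<in> borel_measurable (borel \<Otimes>\<^sub>M \<Omega>)" for i
  proof (rule borel_measurable_LIMSEQ_metric[OF step])
    fix p :: "real \<times> 'w" assume "p \<in> space (borel \<Otimes>\<^sub>M \<Omega>)"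
    then have "snd p \<in> space \<Omega>" by (auto simp: space_pair_measure)
    moreover have "max 0 (grid_above k (max 0 r)) = 0 + grid_above k (max 0 r)" for k r
      using grid_above_bounds(1)[of "max 0 r" k] by linarith
    ultimately show "(\<lambda>k. X (max 0 (grid_above k (max 0 (\<tau> (fst p))))) (snd p) i) \<longlonglongrightarrow> X (max 0 (\<tau> (fst p))) (snd p) i"
      using grid_above_at_right[of 0 "max 0 (\<tau> (fst p))"] by (auto intro!: X_coord_right)
  qed
  then show ?thesis unfolding pairing_def by measurable
qed

lemma mass_joint_meas_P:
  fixes \<tau> :: "real \<Rightarrow> real"
  assumes "\<mu> \<in> finite_measures" and \<tau>: "\<tau> \<in> borel_measurable borel" "\<And>r. 0 \<le> \<tau> r"
  shows "(\<lambda>p. mass (X (\<tau> (fst p)) (snd p))) \<in> borel_measurable (lborel \<Otimes>\<^sub>M P \<mu>)"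
proof -
  have "max 0 (\<tau> r) = \<tau> r" for r using \<tau>(2)[of r] by simp
  then have "(\<lambda>p. mass (X (\<tau> (fst p)) (snd p))) \<in> borel_measurable (borel \<Otimes>\<^sub>M \<Omega>)"
    using mass_joint_meas[OF \<tau>(1)] by simp
  also have "borel_measurable (borel \<Otimes>\<^sub>M \<Omega>) = borel_measurable (lborel \<Otimes>\<^sub>M P \<mu>)"
    by (intro measurable_cong_sets sets_pair_measure_cong) (auto simp: P_sets[OF assms(1)])
  finally show ?thesis .
qed

lemma mass_path_meas:
  fixes \<tau> :: "real \<Rightarrow> real"
  assumes \<omega>: "\<omega> \<in> space \<Omega>" and \<tau>: "\<tau> \<in> borel_measurable borel" "\<And>r. 0 \<le> \<tau> r"
  shows "(\<lambda>r. mass (X (\<tau> r) \<omega>)) \<in> borel_measurable borel"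
proof -
  have "max 0 (\<tau> r) = \<tau> r" for r using \<tau>(2)[of r] by simp
  then show ?thesis
    using measurable_compose[OF measurable_Pair2'[OF \<omega>, of borel] mass_joint_meas[OF \<tau>(1)]] by simp
qed

text \<open>
  The maximum only makes the integrand meaningful at negative \<open>r\<close>, where it is cut off.
\<close>

definition future_mass :: "(real \<Rightarrow> real) \<Rightarrow> real \<Rightarrow> 'w \<Rightarrow> ennreal" where
  "future_mass g t \<omega> = (\<integral>\<^sup>+r. ennreal (g r) * indicator {0..} r * mass (X (t + max 0 r) \<omega>) \<partial>lborel)"

lemma future_mass_meas_Omega:
  assumes [measurable]: "g \<in> borel_measurable borel" and t: "0 \<le> t"
  shows "future_mass g t \<in> borel_measurable \<Omega>"
proof -
  have eq: "max 0 (t + max 0 r) = t + max 0 r" for r using t by simp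
  have [measurable]: "(\<lambda>p. mass (X (t + max 0 (fst p)) (snd p))) \<in> borel_measurable (borel \<Otimes>\<^sub>M \<Omega>)"
    using mass_joint_meas[of "\<lambda>r. t + max 0 r"] by (simp add: eq)
  have "(\<lambda>(\<omega>, r). ennreal (g r) * indicator {0..} r * mass (X (t + max 0 r) \<omega>)) \<in> borel_measurable (\<Omega> \<Otimes>\<^sub>M lborel)"
  proof -
    have "(\<lambda>q. mass (X (t + max 0 (fst (snd q, fst q))) (snd (snd q, fst q)))) \<in> borel_measurable (\<Omega> \<Otimes>\<^sub>M lborel)"
      by (rule measurable_compose[of "\<lambda>q. (snd q, fst q)" _ "borel \<Otimes>\<^sub>M \<Omega>"]) measurable
    then show ?thesis by (simp add: split_beta') 
  qed
  then show ?thesis unfolding future_mass_def[abs_def]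
    by (rule lborel.borel_measurable_nn_integral)
qed

lemma future_mass_meas: "\<mu> \<in> finite_measures \<Longrightarrow> g \<in> borel_measurable borel \<Longrightarrow> 0 \<le> t \<Longrightarrow> future_mass g t \<in> borel_measurable (P \<mu>)"
  using future_mass_meas_Omega by (simp add: measurable_cong_sets[OF P_sets refl])

lemma expected_time_integral:
  fixes \<tau> :: "real \<Rightarrow> real"
  assumes \<mu>: "\<mu> \<in> finite_measures" and w [measurable]: "w \<in> borel_measurable borel" and \<tau>: "\<tau> \<in> borel_measurable borel" "\<And>r. 0 \<le> \<tau> r"
  shows "(\<lambda>\<omega>. \<integral>\<^sup>+r. w r * mass (X (\<tau> r) \<omega>) \<partial>lborel) \<in> borel_measurable (P \<mu>)"
    and "(\<integral>\<^sup>+\<omega>. (\<integral>\<^sup>+r. w r * mass (X (\<tau> r) \<omega>) \<partial>lborel) \<partial>P \<mu>) = (\<integral>\<^sup>+r. w r * (\<integral>\<^sup>+\<omega>. mass (X (\<tau> r) \<omega>) \<partial>P \<mu>) \<partial>lborel)"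
proof -
  interpret p: prob_space "P \<mu>" by (rule P_prob[OF \<mu>])
  interpret pair_sigma_finite lborel "P \<mu>" ..
  have [measurable]: "(\<lambda>p. mass (X (\<tau> (fst p)) (snd p))) \<in> borel_measurable (lborel \<Otimes>\<^sub>M P \<mu>)"
    by (rule mass_joint_meas_P[OF \<mu> \<tau>])
  have m: "(\<lambda>(r, \<omega>). w r * mass (X (\<tau> r) \<omega>)) \<in> borel_measurable (lborel \<Otimes>\<^sub>M P \<mu>)"
    unfolding split_beta' by measurable
  show "(\<lambda>\<omega>. \<integral>\<^sup>+r. w r * mass (X (\<tau> r) \<omega>) \<partial>lborel) \<in> borel_measurable (P \<mu>)"
  proof (rule lborel.borel_measurable_nn_integral)
    have "(\<lambda>q. (snd q, fst q)) \<in> P \<mu> \<Otimes>\<^sub>M lborel \<rightarrow>\<^sub>M lborel \<Otimes>\<^sub>M P \<mu>" by measurable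
    from measurable_compose[OF this m]
    show "(\<lambda>(\<omega>, r). w r * mass (X (\<tau> r) \<omega>)) \<in> borel_measurable (P \<mu> \<Otimes>\<^sub>M lborel)"
      unfolding split_beta' fst_conv snd_conv .
  qed
  have "(\<integral>\<^sup>+\<omega>. (\<integral>\<^sup>+r. w r * mass (X (\<tau> r) \<omega>) \<partial>lborel) \<partial>P \<mu>) = (\<integral>\<^sup>+r. (\<integral>\<^sup>+\<omega>. w r * mass (X (\<tau> r) \<omega>) \<partial>P \<mu>) \<partial>lborel)"
    using Fubini'[OF m] by simp
  also have "\<dots> = (\<integral>\<^sup>+r. w r * (\<integral>\<^sup>+\<omega>. mass (X (\<tau> r) \<omega>) \<partial>P \<mu>) \<partial>lborel)"
    by (intro nn_integral_cong nn_integral_cmult mass_meas \<mu> \<tau>(2))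
  finally show "(\<integral>\<^sup>+\<omega>. (\<integral>\<^sup>+r. w r * mass (X (\<tau> r) \<omega>) \<partial>lborel) \<partial>P \<mu>) = (\<integral>\<^sup>+r. w r * (\<integral>\<^sup>+\<omega>. mass (X (\<tau> r) \<omega>) \<partial>P \<mu>) \<partial>lborel)" .
qed

lemma expected_mass_step:
  assumes \<mu>: "\<mu> \<in> finite_measures" and u: "0 \<le> u" and h: "0 \<le> h" and lam: "2 * B < lam"
  shows "(\<integral>\<^sup>+\<omega>. mass (X (u + h) \<omega>) \<partial>P \<mu>) \<le> ennreal (growth lam h) * (\<integral>\<^sup>+\<omega>. mass (X u \<omega>) \<partial>P \<mu>)"
proof -
  have "(\<integral>\<^sup>+\<omega>. 1 * mass (X (u + h) \<omega>) \<partial>P \<mu>) = (\<integral>\<^sup>+\<omega>. 1 * kern h mass (X u \<omega>) \<partial>P \<mu>)"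
    by (rule markov[OF _ _ \<mu> u h]) auto
  also have "\<dots> \<le> (\<integral>\<^sup>+\<omega>. ennreal (growth lam h) * mass (X u \<omega>) \<partial>P \<mu>)"
  proof (rule nn_integral_mono_AE)
    show "AE \<omega> in P \<mu>. 1 * kern h mass (X u \<omega>) \<le> ennreal (growth lam h) * mass (X u \<omega>)"
      using X_finite[OF \<mu> u]
    proof eventually_elim
      case (elim \<omega>)
      have "0 \<le> suminf (X u \<omega>)" using elim by (auto simp: finite_measures_def intro: suminf_nonneg)
      then show ?case
        using expected_mass_le[OF elim h lam] elim growth_pos[OF lam, of h]
        by (simp add: kern_def mass_finite_measure ennreal_mult)
    qed
  qed
  also have "\<dots> = ennreal (growth lam h) * (\<integral>\<^sup>+\<omega>. mass (X u \<omega>) \<partial>P \<mu>)"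
    by (rule nn_integral_cmult[OF mass_meas[OF \<mu> u]])
  finally show ?thesis by simp
qed

text \<open>
  The rate \<open>2 * B + sqrt (k + 1)\<close> tends to infinity, but its product with the mesh tends to \<open>0\<close>; both are
  needed for \<open>grid_factor_tendsto\<close>, since \<open>growth lam 0\<close> exceeds \<open>1\<close>.
\<close>

definition grid_factor :: "nat \<Rightarrow> real" where
  "grid_factor k = growth (2 * B + sqrt (real (Suc k))) (1 / real (Suc k))"

lemma grid_factor_pos: "0 < grid_factor k"
  unfolding grid_factor_def by (rule growth_pos) simp

lemma grid_factor_tendsto: "grid_factor \<longlonglongrightarrow> 1"
proof -
  have s: "filterlim (\<lambda>k. sqrt (real (Suc k))) at_top sequentially"
    by (intro filterlim_compose[OF sqrt_at_top] filterlim_compose[OF filterlim_real_sequentially] filterlim_Suc)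
  have l: "filterlim (\<lambda>k. 2 * B + sqrt (real (Suc k))) at_top sequentially"
    by (rule filterlim_tendsto_add_at_top[OF tendsto_const s])
  have 1: "(\<lambda>k. 2 * B / (2 * B + sqrt (real (Suc k)))) \<longlonglongrightarrow> 0"
    by (rule tendsto_divide_0[OF tendsto_const filterlim_at_top_imp_at_infinity[OF l]])
  have 2: "(\<lambda>k. (2 * B + sqrt (real (Suc k))) * (1 / real (Suc k))) \<longlonglongrightarrow> 0"
  proof -
    have "(\<lambda>k. 2 * B * inverse (real (Suc k)) + inverse (sqrt (real (Suc k)))) \<longlonglongrightarrow> 2 * B * 0 + 0"
      by (intro tendsto_intros LIMSEQ_inverse_real_of_nat tendsto_inverse_0_at_top s)
    moreover have "2 * B * inverse x + inverse (sqrt x) = (2 * B + sqrt x) * (1 / x)" if "x > 0" for x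
      using that real_sqrt_mult_self[of x] by (simp add: field_simps)
    ultimately show ?thesis by simp
  qed
  have "(\<lambda>k. exp ((2 * B + sqrt (real (Suc k))) * (1 / real (Suc k))) / (1 - 2 * B / (2 * B + sqrt (real (Suc k))))) \<longlonglongrightarrow> exp 0 / (1 - 0)"
    by (intro tendsto_intros 1 2) simp
  then show ?thesis unfolding grid_factor_def[abs_def] growth_def by simp
qed

text \<open>
  This is the only control in time available without regularity of the total mass: expectations cannot
  increase by more than a factor close to \<open>1\<close> within one mesh.
\<close>

lemma expected_mass_grid_above:
  assumes \<mu>: "\<mu> \<in> finite_measures" and t: "0 \<le> t" and r: "0 \<le> r"
  shows "(\<integral>\<^sup>+\<omega>. mass (X (t + grid_above k r) \<omega>) \<partial>P \<mu>) \<le> ennreal (grid_factor k) * (\<integral>\<^sup>+\<omega>. mass (X (t + r) \<omega>) \<partial>P \<mu>)"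
proof -
  define h where "h = grid_above k r - r"
  have h: "0 \<le> h" "h \<le> 1 / real (Suc k)" unfolding h_def using grid_above_bounds(1)[of r k] grid_above_bounds(2)[of k r] by auto
  have lam: "2 * B < 2 * B + sqrt (real (Suc k))" by simp
  have "(\<integral>\<^sup>+\<omega>. mass (X (t + grid_above k r) \<omega>) \<partial>P \<mu>) = (\<integral>\<^sup>+\<omega>. mass (X ((t + r) + h) \<omega>) \<partial>P \<mu>)"
    unfolding h_def by simp
  also have "\<dots> \<le> ennreal (growth (2 * B + sqrt (real (Suc k))) h) * (\<integral>\<^sup>+\<omega>. mass (X (t + r) \<omega>) \<partial>P \<mu>)"
    using t r by (intro expected_mass_step[OF \<mu> _ h(1) lam]) simp
  also have "\<dots> \<le> ennreal (grid_factor k) * (\<integral>\<^sup>+\<omega>. mass (X (t + r) \<omega>) \<partial>P \<mu>)"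
    unfolding grid_factor_def by (intro mult_right_mono ennreal_leI growth_mono lam h) auto
  finally show ?thesis .
qed

lemma expected_future_mass:
  assumes \<mu>: "\<mu> \<in> finite_measures" and g [measurable]: "g \<in> borel_measurable borel" and t: "0 \<le> t"
    and g0: "\<And>r. 0 \<le> g r" and gC: "\<And>r. g r \<le> C * exp (- (8 * B * r))"
  shows "(\<integral>\<^sup>+\<omega>. future_mass g t \<omega> \<partial>P \<mu>) \<le> ennreal (C * exp (4 * B * t) / (2 * B) * suminf \<mu>)"
proof -
  define K where "K = 2 * C * exp (4 * B * t) * suminf \<mu>"
  have C: "0 \<le> C" using order_trans[OF g0 gC, of 0] by simp
  have m: "0 \<le> suminf \<mu>" using \<mu> by (auto simp: finite_measures_def intro: suminf_nonneg)
  have "(\<integral>\<^sup>+\<omega>. future_mass g t \<omega> \<partial>P \<mu>) = (\<integral>\<^sup>+r. ennreal (g r) * indicator {0..} r * (\<integral>\<^sup>+\<omega>. mass (X (t + max 0 r) \<omega>) \<partial>P \<mu>) \<partial>lborel)"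
    unfolding future_mass_def by (rule expected_time_integral(2)[OF \<mu>]) (use t in auto)
  also have "\<dots> \<le> (\<integral>\<^sup>+r. ennreal (2 * C * exp (4 * B * t) * suminf \<mu> * exp (- (4 * B * r))) * indicator {0..} r \<partial>lborel)"
  proof (rule nn_integral_mono)
    fix r :: real
    show "ennreal (g r) * indicator {0..} r * (\<integral>\<^sup>+\<omega>. mass (X (t + max 0 r) \<omega>) \<partial>P \<mu>) \<le> ennreal (2 * C * exp (4 * B * t) * suminf \<mu> * exp (- (4 * B * r))) * indicator {0..} r"
    proof (cases "0 \<le> r")
      case True
      have "(\<integral>\<^sup>+\<omega>. mass (X (t + r) \<omega>) \<partial>P \<mu>) \<le> ennreal (growth (4 * B) (t + r) * suminf \<mu>)"
        by (rule expected_mass_le[OF \<mu>]) (use t True B_pos in auto)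
      then have "ennreal (g r) * (\<integral>\<^sup>+\<omega>. mass (X (t + r) \<omega>) \<partial>P \<mu>) \<le> ennreal (C * exp (- (8 * B * r))) * ennreal (growth (4 * B) (t + r) * suminf \<mu>)"
        by (intro mult_mono ennreal_leI gC) auto
      also have "\<dots> = ennreal (C * exp (- (8 * B * r)) * (growth (4 * B) (t + r) * suminf \<mu>))"
        using C by (simp add: ennreal_mult')
      also have "C * exp (- (8 * B * r)) * (growth (4 * B) (t + r) * suminf \<mu>) = 2 * C * exp (4 * B * t) * suminf \<mu> * exp (- (4 * B * r))"
      proof -
        have "growth (4 * B) (t + r) = 2 * exp (4 * B * t) * exp (4 * B * r)"
          unfolding growth_def using B_pos by (simp add: distrib_left exp_add)
        moreover have "exp (- (8 * B * r)) * exp (4 * B * r) = exp (- (4 * B * r))" by (simp add: exp_add[symmetric])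
        moreover have "C * e8 * (2 * u * e4 * M) = 2 * C * u * M * (e8 * e4)" for e8 e4 u M :: real
          by (simp only: mult_ac)
        ultimately show ?thesis by (simp only:)
      qed
      finally show ?thesis using True by simp
    qed simp
  qed
  also have "\<dots> = ennreal (0 - - (K / (4 * B)) * exp (- (4 * B * 0)))"
    unfolding K_def[symmetric]
  proof (rule nn_integral_FTC_atLeast[where F = "\<lambda>r. - (K / (4 * B)) * exp (- (4 * B * r))"])
    show "DERIV (\<lambda>r. - (K / (4 * B)) * exp (- (4 * B * r))) r :> K * exp (- (4 * B * r))" for r
      using B_pos by (auto intro!: derivative_eq_intros)
    have "((\<lambda>r. exp (- (4 * B * r))) \<longlongrightarrow> 0) at_top"
      using B_pos by (intro filterlim_compose[OF exp_at_bot] filterlim_uminus_at_bot_at_top[THEN filterlim_compose]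
        filterlim_tendsto_pos_mult_at_top[OF tendsto_const] filterlim_ident) auto
    from tendsto_mult_right_zero[OF this] show "((\<lambda>r. - (K / (4 * B)) * exp (- (4 * B * r))) \<longlongrightarrow> 0) at_top" .
  qed (use C m K_def in auto)
  also have "0 - - (K / (4 * B)) * exp (- (4 * B * 0)) = C * exp (4 * B * t) / (2 * B) * suminf \<mu>"
    unfolding K_def by simp
  finally show ?thesis .
qed

definition grid_sum :: "(real \<Rightarrow> real) \<Rightarrow> nat \<Rightarrow> real \<Rightarrow> 'w \<Rightarrow> ennreal" where
  "grid_sum g k t \<omega> = (\<integral>\<^sup>+r. ennreal (g r) * indicator {0..<real (Suc k)} r * mass (X (t + grid_above k (max 0 r)) \<omega>) \<partial>lborel)"

text \<open>
  On each cell of the grid the evaluation time is constant, so the integral is a finite sum.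
\<close>

lemma grid_sum_eq:
  assumes g [measurable]: "g \<in> borel_measurable borel" and g0: "\<And>r. 0 \<le> g r" and gC: "\<And>r. 0 \<le> r \<Longrightarrow> g r \<le> C"
  shows "\<exists>a :: nat \<Rightarrow> real. (\<forall>j. 0 \<le> a j) \<and>
    (\<forall>t \<omega>. grid_sum g k t \<omega> = (\<Sum>j<Suc (Suc k * Suc k). ennreal (a j) * mass (X (t + real j * (1 / real (Suc k))) \<omega>)))"
proof -
  define N where "N = Suc (Suc k * Suc k)"
  define J where "J j r = (indicator {0..<real (Suc k)} r * (if \<lfloor>max 0 r * real (Suc k)\<rfloor> + 1 = int j then 1 else 0) :: ennreal)" for j r
  have [measurable]: "J j \<in> borel_measurable borel" for j unfolding J_def by measurable
  define a where "a j = enn2real (\<integral>\<^sup>+r. ennreal (g r) * J j r \<partial>lborel)" for j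
  have a: "ennreal (a j) = (\<integral>\<^sup>+r. ennreal (g r) * J j r \<partial>lborel)" for j
  proof -
    have "(\<integral>\<^sup>+r. ennreal (g r) * J j r \<partial>lborel) \<le> (\<integral>\<^sup>+r. ennreal C * indicator {0..<real (Suc k)} r \<partial>lborel)"
      by (rule nn_integral_mono) (use gC in \<open>auto simp: J_def intro!: ennreal_leI split: split_indicator\<close>)
    also have "\<dots> < \<infinity>" by (simp add: nn_integral_cmult ennreal_mult_less_top)
    finally show ?thesis unfolding a_def by (simp add: less_top)
  qed
  have "grid_sum g k t \<omega> = (\<Sum>j<Suc (Suc k * Suc k). ennreal (a j) * mass (X (t + real j * (1 / real (Suc k))) \<omega>))" for t \<omega>
  proof -
    have pt: "ennreal (g r) * indicator {0..<real (Suc k)} r * mass (X (t + grid_above k (max 0 r)) \<omega>)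
        = (\<Sum>j<N. ennreal (g r) * J j r * mass (X (t + real j * (1 / real (Suc k))) \<omega>))" for r
    proof (cases "r \<in> {0..<real (Suc k)}")
      case True
      define j0 where "j0 = nat (\<lfloor>max 0 r * real (Suc k)\<rfloor> + 1)"
      have fl: "0 \<le> \<lfloor>max 0 r * real (Suc k)\<rfloor>" by simp
      then have j0: "int j0 = \<lfloor>max 0 r * real (Suc k)\<rfloor> + 1" unfolding j0_def by simp
      have "max 0 r * real (Suc k) < real (Suc k) * real (Suc k)" using True by (intro mult_strict_right_mono) auto
      also have "real (Suc k) * real (Suc k) = of_int (int (Suc k * Suc k))"
        by (metis of_int_of_nat_eq of_nat_mult)
      finally have "\<lfloor>max 0 r * real (Suc k)\<rfloor> < int (Suc k * Suc k)" by (simp only: floor_less_iff)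
      then have jN: "j0 < N" unfolding N_def using j0 by linarith
      have D: "grid_above k (max 0 r) = real j0 * (1 / real (Suc k))"
      proof -
        have "of_int \<lfloor>max 0 r * real (Suc k)\<rfloor> + 1 = real j0" using j0 by (metis of_int_1 of_int_add of_int_of_nat_eq)
        then show ?thesis unfolding grid_above_def by simp
      qed
      have "(\<Sum>j<N. ennreal (g r) * J j r * mass (X (t + real j * (1 / real (Suc k))) \<omega>))
        = (\<Sum>j<N. if j = j0 then ennreal (g r) * mass (X (t + real j * (1 / real (Suc k))) \<omega>) else 0)"
        using True j0 by (intro sum.cong) (auto simp: J_def)
      also have "\<dots> = ennreal (g r) * mass (X (t + real j0 * (1 / real (Suc k))) \<omega>)"
        using jN by (simp add: sum.delta)
      finally show ?thesis using True D by simp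
    qed (auto simp: J_def)
    have "grid_sum g k t \<omega> = (\<Sum>j<N. \<integral>\<^sup>+r. ennreal (g r) * J j r * mass (X (t + real j * (1 / real (Suc k))) \<omega>) \<partial>lborel)"
      unfolding grid_sum_def pt by (rule nn_integral_sum) measurable
    also have "\<dots> = (\<Sum>j<N. ennreal (a j) * mass (X (t + real j * (1 / real (Suc k))) \<omega>))"
      unfolding a by (intro sum.cong refl nn_integral_multc) measurable
    finally show ?thesis unfolding N_def .
  qed
  moreover have "0 \<le> a j" for j unfolding a_def by simp
  ultimately show ?thesis by (intro exI[of _ a] conjI allI)
qed

lemma grid_sum_meas:
  assumes "\<mu> \<in> finite_measures" and [measurable]: "g \<in> borel_measurable borel" and "0 \<le> t"
  shows "grid_sum g k t \<in> borel_measurable (P \<mu>)"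
  unfolding grid_sum_def[abs_def]
  by (rule expected_time_integral(1)[OF assms(1)])
    (use assms(3) grid_above_bounds(1)[of "max 0 _" k] in \<open>auto intro: add_nonneg_nonneg less_imp_le order_trans[OF max.cobounded1]\<close>)

lemma grid_sum_expect:
  assumes \<mu>: "\<mu> \<in> finite_measures" and [measurable]: "g \<in> borel_measurable borel" and t: "0 \<le> t"
  shows "(\<integral>\<^sup>+\<omega>. grid_sum g k t \<omega> \<partial>P \<mu>) \<le> ennreal (grid_factor k) * (\<integral>\<^sup>+\<omega>. future_mass g t \<omega> \<partial>P \<mu>)"
proof -
  have Dp: "0 \<le> grid_above k (max 0 r)" for r using grid_above_bounds(1)[of "max 0 r" k] by linarith
  have mE: "(\<lambda>r. \<integral>\<^sup>+\<omega>. mass (X (t + max 0 r) \<omega>) \<partial>P \<mu>) \<in> borel_measurable borel"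
  proof -
    interpret p: prob_space "P \<mu>" by (rule P_prob[OF \<mu>])
    have "(\<lambda>p. mass (X (t + max 0 (fst p)) (snd p))) \<in> borel_measurable (lborel \<Otimes>\<^sub>M P \<mu>)"
      by (rule mass_joint_meas_P[OF \<mu>]) (use t in auto)
    then have "(\<lambda>(r, \<omega>). mass (X (t + max 0 r) \<omega>)) \<in> borel_measurable (lborel \<Otimes>\<^sub>M P \<mu>)" by (simp add: split_beta')
    from p.borel_measurable_nn_integral[OF this] show ?thesis by simp
  qed
  have "(\<integral>\<^sup>+\<omega>. grid_sum g k t \<omega> \<partial>P \<mu>) = (\<integral>\<^sup>+r. ennreal (g r) * indicator {0..<real (Suc k)} r * (\<integral>\<^sup>+\<omega>. mass (X (t + grid_above k (max 0 r)) \<omega>) \<partial>P \<mu>) \<partial>lborel)"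
    unfolding grid_sum_def by (rule expected_time_integral(2)[OF \<mu>]) (use t Dp in auto)
  also have "\<dots> \<le> (\<integral>\<^sup>+r. ennreal (grid_factor k) * (ennreal (g r) * indicator {0..} r * (\<integral>\<^sup>+\<omega>. mass (X (t + max 0 r) \<omega>) \<partial>P \<mu>)) \<partial>lborel)"
  proof (rule nn_integral_mono)
    fix r :: real
    have "ennreal (g r) * indicator {0..<real (Suc k)} r * (\<integral>\<^sup>+\<omega>. mass (X (t + grid_above k (max 0 r)) \<omega>) \<partial>P \<mu>)
        \<le> ennreal (g r) * indicator {0..} r * (ennreal (grid_factor k) * (\<integral>\<^sup>+\<omega>. mass (X (t + max 0 r) \<omega>) \<partial>P \<mu>))"
      by (intro mult_mono expected_mass_grid_above \<mu> t) (auto split: split_indicator)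
    then show "ennreal (g r) * indicator {0..<real (Suc k)} r * (\<integral>\<^sup>+\<omega>. mass (X (t + grid_above k (max 0 r)) \<omega>) \<partial>P \<mu>)
        \<le> ennreal (grid_factor k) * (ennreal (g r) * indicator {0..} r * (\<integral>\<^sup>+\<omega>. mass (X (t + max 0 r) \<omega>) \<partial>P \<mu>))"
      by (simp add: mult_ac)
  qed
  also have "\<dots> = ennreal (grid_factor k) * (\<integral>\<^sup>+r. ennreal (g r) * indicator {0..} r * (\<integral>\<^sup>+\<omega>. mass (X (t + max 0 r) \<omega>) \<partial>P \<mu>) \<partial>lborel)"
    using mE by (intro nn_integral_cmult) measurable
  also have "(\<integral>\<^sup>+r. ennreal (g r) * indicator {0..} r * (\<integral>\<^sup>+\<omega>. mass (X (t + max 0 r) \<omega>) \<partial>P \<mu>) \<partial>lborel) = (\<integral>\<^sup>+\<omega>. future_mass g t \<omega> \<partial>P \<mu>)"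
    unfolding future_mass_def by (rule expected_time_integral(2)[OF \<mu>, symmetric]) (use t in auto)
  finally show ?thesis .
qed

lemma future_mass_le_liminf:
  assumes \<omega>: "\<omega> \<in> space \<Omega>" and [measurable]: "g \<in> borel_measurable borel" and t: "0 \<le> t"
  shows "future_mass g t \<omega> \<le> liminf (\<lambda>k. grid_sum g k t \<omega>)"
proof -
  have Dp: "0 \<le> grid_above k (max 0 r)" for k r using grid_above_bounds(1)[of "max 0 r" k] by linarith
  have "future_mass g t \<omega> \<le> (\<integral>\<^sup>+r. liminf (\<lambda>k. ennreal (g r) * indicator {0..<real (Suc k)} r * mass (X (t + grid_above k (max 0 r)) \<omega>)) \<partial>lborel)"
    unfolding future_mass_def
  proof (rule nn_integral_mono)
    fix r :: real
    show "ennreal (g r) * indicator {0..} r * mass (X (t + max 0 r) \<omega>) \<le> liminf (\<lambda>k. ennreal (g r) * indicator {0..<real (Suc k)} r * mass (X (t + grid_above k (max 0 r)) \<omega>))"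
    proof (cases "0 \<le> r")
      case True
      obtain N where N: "r < real N" using reals_Archimedean2 by blast
      have "ennreal (g r) * mass (X (t + r) \<omega>) \<le> liminf (\<lambda>k. ennreal (g r) * mass (X (t + grid_above k r) \<omega>))"
        by (rule mass_lsc[OF \<omega> _ grid_above_at_right]) (use t True in simp)
      also have "\<dots> = liminf (\<lambda>k. ennreal (g r) * indicator {0..<real (Suc k)} r * mass (X (t + grid_above k (max 0 r)) \<omega>))"
        by (rule Liminf_eq) (use True N in \<open>auto intro!: eventually_sequentiallyI[of N] split: split_indicator\<close>)
      finally show ?thesis using True by simp
    qed simp
  qed
  also have "\<dots> \<le> liminf (\<lambda>k. grid_sum g k t \<omega>)"
    unfolding grid_sum_def
  proof (rule nn_integral_liminf)
    fix k
    have "(\<lambda>r. mass (X (t + grid_above k (max 0 r)) \<omega>)) \<in> borel_measurable borel" 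
      by (rule mass_path_meas[OF \<omega>]) (use t Dp in auto)
    then show "(\<lambda>r. ennreal (g r) * indicator {0..<real (Suc k)} r * mass (X (t + grid_above k (max 0 r)) \<omega>)) \<in> borel_measurable lborel"
      by measurable
  qed
  finally show ?thesis .
qed

text \<open>
  The grid sums have Laplace functionals given by cumulants of functions \<open>f k\<close>.  These functions are
  uniformly bounded, because the means are, and they converge to \<open>F\<close>, because the functionals of the grid sums do.
\<close>

lemma future_mass_laplace:
  assumes g [measurable]: "g \<in> borel_measurable borel"
    and g0: "\<And>r. 0 \<le> g r" and gC: "\<And>r. g r \<le> C * exp (- (8 * B * r))"
  shows "\<exists>F G. (\<forall>j. 0 \<le> F j \<and> F j \<le> G) \<and>
    (\<forall>\<sigma>\<ge>0. \<forall>\<mu>\<in>finite_measures. (\<integral>\<omega>. exp_neg (future_mass g \<sigma> \<omega>) \<partial>P \<mu>) = exp (- lin (cumulant \<sigma> F) \<mu>))"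
proof -
  have C: "0 \<le> C" using order_trans[OF g0 gC, of 0] by simp
  have gC': "g r \<le> C" if "0 \<le> r" for r
  proof -
    have "C * exp (- (8 * B * r)) \<le> C * 1" using C that B_pos by (intro mult_left_mono) auto
    then show ?thesis using gC[of r] by simp
  qed
  define Q where "Q k f G \<longleftrightarrow> (\<forall>j. 0 \<le> f j \<and> f j \<le> G) \<and> (\<forall>\<sigma>\<ge>0. \<forall>\<mu>\<in>finite_measures.
     (\<integral>\<omega>. exp_neg (grid_sum g k \<sigma> \<omega>) \<partial>P \<mu>) = exp (- lin (cumulant \<sigma> f) \<mu>))" for k f G
  have "\<forall>k. \<exists>f G. Q k f G"
  proof
    fix k
    obtain a where a: "\<forall>j. 0 \<le> a j" and eq: "\<forall>t \<omega>. grid_sum g k t \<omega> = (\<Sum>j<Suc (Suc k * Suc k). ennreal (a j) * mass (X (t + real j * (1 / real (Suc k))) \<omega>))"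
      using grid_sum_eq[of g C k] g g0 gC' by blast
    show "\<exists>f G. Q k f G"
      using grid_laplace[of a "1 / real (Suc k)" "\<lambda>_. 0" 0 "Suc (Suc k * Suc k)", OF a[rule_format]]
      unfolding Q_def eq[rule_format] by (simp add: pairing_def)
  qed
  then obtain f GG where Q: "\<And>k. Q k (f k) (GG k)" by metis
  have f0: "0 \<le> f k j" and fG: "f k j \<le> GG k" for k j
    using Q[of k] unfolding Q_def by simp_all
  have fk: "(\<integral>\<omega>. exp_neg (grid_sum g k \<sigma> \<omega>) \<partial>P \<mu>) = exp (- lin (cumulant \<sigma> (f k)) \<mu>)"
    if "0 \<le> \<sigma>" "\<mu> \<in> finite_measures" for k \<sigma> \<mu>
    using Q[of k] that unfolding Q_def by simp
  have conv: "(\<lambda>k. \<integral>\<omega>. exp_neg (grid_sum g k \<sigma> \<omega>) \<partial>P \<mu>) \<longlonglongrightarrow> (\<integral>\<omega>. exp_neg (future_mass g \<sigma> \<omega>) \<partial>P \<mu>)"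
    if \<sigma>: "0 \<le> \<sigma>" and \<mu>: "\<mu> \<in> finite_measures" for \<sigma> \<mu>
  proof (rule exp_neg_scheffe[OF P_prob[OF \<mu>] grid_sum_meas[OF \<mu> g \<sigma>] future_mass_meas[OF \<mu> g \<sigma>] _ _ grid_sum_expect[OF \<mu> g \<sigma>] grid_factor_tendsto])
    show "future_mass g \<sigma> \<omega> \<le> liminf (\<lambda>k. grid_sum g k \<sigma> \<omega>)" if "\<omega> \<in> space (P \<mu>)" for \<omega>
      by (rule future_mass_le_liminf[OF _ g \<sigma>]) (use that P_space[OF \<mu>] in simp)
    show "(\<integral>\<^sup>+\<omega>. future_mass g \<sigma> \<omega> \<partial>P \<mu>) < \<infinity>"
      by (rule le_less_trans[OF expected_future_mass[OF \<mu> g \<sigma> g0 gC]]) simp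
    show "0 \<le> grid_factor k" for k using grid_factor_pos[of k] by simp
  qed
  have fi: "(\<integral>\<omega>. exp_neg (grid_sum g k 0 \<omega>) \<partial>P (unit_mass i)) = exp (- f k i)" for k i
  proof -
    have "cumulant 0 (f k) = f k" by (rule cumulant_0[OF f0 fG])
    then show ?thesis using fk[OF order_refl unit_mass_finite, of i k] by (simp add: lin_unit)
  qed
  obtain \<Gamma> where \<Gamma>: "\<And>k. grid_factor k \<le> \<Gamma>"
    using convergent_imp_Bseq[of grid_factor] grid_factor_tendsto by (auto simp: convergent_def Bseq_def abs_le_iff)
  have \<Gamma>0: "0 \<le> \<Gamma>" using grid_factor_pos[of 0] \<Gamma>[of 0] by linarith
  define G where "G = \<Gamma> * (C / (2 * B))"
  have G0: "0 \<le> G" unfolding G_def using \<Gamma>0 C B_pos by simp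
  have sum1: "suminf (unit_mass i) = 1" for i using lin_unit[of "\<lambda>_. 1" i] by (simp add: lin_def)
  have ge: "exp (- G) \<le> exp (- f k i)" for k i
  proof -
    have "(\<integral>\<^sup>+\<omega>. grid_sum g k 0 \<omega> \<partial>P (unit_mass i)) \<le> ennreal (grid_factor k) * (\<integral>\<^sup>+\<omega>. future_mass g 0 \<omega> \<partial>P (unit_mass i))"
      by (rule grid_sum_expect[OF unit_mass_finite g order_refl])
    also have "\<dots> \<le> ennreal \<Gamma> * ennreal (C * exp (4 * B * 0) / (2 * B) * suminf (unit_mass i))"
      by (intro mult_mono ennreal_leI \<Gamma> expected_future_mass unit_mass_finite g g0 gC) auto
    also have "\<dots> = ennreal G" unfolding G_def sum1 using \<Gamma>0 by (subst ennreal_mult'[symmetric]) auto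
    finally have "exp (- G) \<le> (\<integral>\<omega>. exp_neg (grid_sum g k 0 \<omega>) \<partial>P (unit_mass i))"
      by (intro integral_exp_neg_ge P_prob grid_sum_meas unit_mass_finite g G0) auto
    then show ?thesis unfolding fi .
  qed
  then have fG': "f k i \<le> G" for k i by simp
  define F where "F i = - ln (\<integral>\<omega>. exp_neg (future_mass g 0 \<omega>) \<partial>P (unit_mass i))" for i
  have Flim: "(\<lambda>k. f k i) \<longlonglongrightarrow> F i" for i
  proof -
    have lim: "(\<lambda>k. exp (- f k i)) \<longlonglongrightarrow> (\<integral>\<omega>. exp_neg (future_mass g 0 \<omega>) \<partial>P (unit_mass i))"
      using conv[OF order_refl unit_mass_finite, of i] unfolding fi .
    have "exp (- G) \<le> (\<integral>\<omega>. exp_neg (future_mass g 0 \<omega>) \<partial>P (unit_mass i))"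
      by (rule LIMSEQ_le_const[OF lim]) (use ge in blast)
    then have "(\<integral>\<omega>. exp_neg (future_mass g 0 \<omega>) \<partial>P (unit_mass i)) \<noteq> 0" using exp_gt_zero[of "- G"] by linarith
    then have "(\<lambda>k. - ln (exp (- f k i))) \<longlonglongrightarrow> F i" unfolding F_def by (intro tendsto_intros lim)
    then show ?thesis by simp
  qed
  have F: "0 \<le> F i" "F i \<le> G" for i
    using LIMSEQ_le_const[OF Flim] LIMSEQ_le_const2[OF Flim] f0 fG' by blast+
  show ?thesis
  proof (intro exI[of _ F] exI[of _ G] conjI allI impI ballI F)
    fix \<sigma> \<mu> assume \<sigma>: "(0::real) \<le> \<sigma>" and \<mu>: "\<mu> \<in> finite_measures"
    have "(\<integral>\<omega>. exp_neg (grid_sum g k \<sigma> \<omega>) \<partial>P \<mu>) = (\<integral>\<omega>. exp_neg (pairing (\<lambda>j. ennreal (f k j)) (X \<sigma> \<omega>)) \<partial>P \<mu>)" for k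
      unfolding fk[OF \<sigma> \<mu>] laplace[OF f0 fG' \<sigma> \<mu>] ..
    then have "(\<lambda>k. \<integral>\<omega>. exp_neg (grid_sum g k \<sigma> \<omega>) \<partial>P \<mu>) \<longlonglongrightarrow> (\<integral>\<omega>. exp_neg (pairing (\<lambda>j. ennreal (F j)) (X \<sigma> \<omega>)) \<partial>P \<mu>)"
      using laplace_tendsto[OF \<mu> \<sigma> f0 fG' Flim] by simp
    then have "(\<integral>\<omega>. exp_neg (future_mass g \<sigma> \<omega>) \<partial>P \<mu>) = (\<integral>\<omega>. exp_neg (pairing (\<lambda>j. ennreal (F j)) (X \<sigma> \<omega>)) \<partial>P \<mu>)"
      by (rule LIMSEQ_unique[OF conv[OF \<sigma> \<mu>]])
    also have "\<dots> = exp (- lin (cumulant \<sigma> F) \<mu>)" by (rule laplace[OF F \<sigma> \<mu>])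
    finally show "(\<integral>\<omega>. exp_neg (future_mass g \<sigma> \<omega>) \<partial>P \<mu>) = exp (- lin (cumulant \<sigma> F) \<mu>)" .
  qed
qed

end

section \<open>The discounted potential\<close>

lemma nn_integral_exp_halfline:
  assumes a: "0 < a"
  shows "(\<integral>\<^sup>+r. ennreal (exp (- (a * r))) * indicator {0..} r \<partial>lborel) = ennreal (1 / a)"
proof -
  have "((\<lambda>r. exp (- (a * r))) \<longlongrightarrow> 0) at_top"
    using a by (intro filterlim_compose[OF exp_at_bot] filterlim_uminus_at_bot_at_top[THEN filterlim_compose]
      filterlim_tendsto_pos_mult_at_top[OF tendsto_const] filterlim_ident) auto
  from tendsto_mult[OF tendsto_const[of "- 1 / a"] this]
  have lim: "((\<lambda>r. - (exp (- (a * r)) / a)) \<longlongrightarrow> 0) at_top" by simp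
  have "(\<integral>\<^sup>+r. ennreal (exp (- (a * r))) * indicator {0..} r \<partial>lborel) = ennreal (0 - - (exp (- (a * 0)) / a))"
    by (rule nn_integral_FTC_atLeast[OF _ _ _ lim]) (use a in \<open>auto intro!: derivative_eq_intros\<close>)
  then show ?thesis by simp
qed

context mcsbp begin

text \<open>
  The discount rate \<open>8 * B\<close> beats the growth rate \<open>4 * B\<close> of the mean mass.  Unlike the mass itself,
  the potential cannot jump upwards: when its starting time increases by \<open>s\<close>, it grows at most by the
  factor \<open>exp (8 * B * s)\<close>.
\<close>

definition potential :: "real \<Rightarrow> 'w \<Rightarrow> ennreal" where
  "potential = future_mass (\<lambda>r. exp (- (8 * B * r)))"

lemma potential_meas_Omega [measurable]: "0 \<le> t \<Longrightarrow> potential t \<in> borel_measurable \<Omega>"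
  unfolding potential_def by (rule future_mass_meas_Omega) auto

lemma potential_meas [measurable]: "\<mu> \<in> finite_measures \<Longrightarrow> 0 \<le> t \<Longrightarrow> potential t \<in> borel_measurable (P \<mu>)"
  unfolding potential_def by (rule future_mass_meas) auto

text \<open>
  Written with integration variable counted from \<open>t\<close>, a finite combination of potentials becomes a single
  integral of the mass against a weight.
\<close>

lemma weighted_potential:
  assumes \<omega>: "\<omega> \<in> space \<Omega>" and t: "0 \<le> t" and s: "0 \<le> s" and a: "0 \<le> a"
  shows "ennreal a * potential (t + s) \<omega> = (\<integral>\<^sup>+r. ennreal (a * exp (- (8 * B * (r - s))) * indicator {s..} r) * indicator {0..} r * mass (X (t + max 0 r) \<omega>) \<partial>lborel)"
proof -
  have [measurable]: "(\<lambda>r. mass (X (t + max 0 r) \<omega>)) \<in> borel_measurable borel"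
    "(\<lambda>r. mass (X (t + s + max 0 r) \<omega>)) \<in> borel_measurable borel"
    by (rule mass_path_meas[OF \<omega>]; use t s in simp)+
  let ?f = "\<lambda>r. ennreal (a * exp (- (8 * B * (r - s))) * indicator {s..} r) * indicator {0..} r * mass (X (t + max 0 r) \<omega>)"
  have "(\<integral>\<^sup>+r. ?f r \<partial>lborel) = ennreal \<bar>1\<bar> * (\<integral>\<^sup>+r. ?f (s + 1 * r) \<partial>lborel)"
    by (rule nn_integral_real_affine) auto
  also have "\<dots> = (\<integral>\<^sup>+r. ennreal a * (ennreal (exp (- (8 * B * r))) * indicator {0..} r * mass (X (t + s + max 0 r) \<omega>)) \<partial>lborel)"
  proof -
    have "?f (s + 1 * r) = ennreal a * (ennreal (exp (- (8 * B * r))) * indicator {0..} r * mass (X (t + s + max 0 r) \<omega>))" for r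
    proof (cases "0 \<le> r")
      case True
      then have "t + max 0 (s + r) = t + s + max 0 r" using s by simp
      then show ?thesis using True s a by (simp add: ennreal_mult mult.assoc add.assoc)
    qed simp
    then show ?thesis by simp
  qed
  also have "\<dots> = ennreal a * potential (t + s) \<omega>"
    unfolding potential_def future_mass_def by (rule nn_integral_cmult) measurable
  finally show ?thesis ..
qed

lemma potential_shift:
  assumes \<omega>: "\<omega> \<in> space \<Omega>" and t: "0 \<le> t" and s: "0 \<le> s"
  shows "potential (t + s) \<omega> \<le> ennreal (exp (8 * B * s)) * potential t \<omega>"
proof -
  have [measurable]: "(\<lambda>r. mass (X (t + max 0 r) \<omega>)) \<in> borel_measurable borel"
    by (rule mass_path_meas[OF \<omega>]; use t in simp)+
  have "potential (t + s) \<omega> = ennreal 1 * potential (t + s) \<omega>" by simp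
  also have "\<dots> = (\<integral>\<^sup>+r. ennreal (1 * exp (- (8 * B * (r - s))) * indicator {s..} r) * indicator {0..} r * mass (X (t + max 0 r) \<omega>) \<partial>lborel)"
    by (rule weighted_potential[OF \<omega> t s]) simp
  also have "\<dots> \<le> (\<integral>\<^sup>+r. ennreal (exp (8 * B * s)) * (ennreal (exp (- (8 * B * r))) * indicator {0..} r * mass (X (t + max 0 r) \<omega>)) \<partial>lborel)"
  proof (rule nn_integral_mono)
    fix r :: real
    have "1 * exp (- (8 * B * (r - s))) * indicator {s..} r \<le> exp (8 * B * s) * exp (- (8 * B * r))"
      by (auto split: split_indicator simp: exp_add[symmetric] algebra_simps)
    then have "ennreal (1 * exp (- (8 * B * (r - s))) * indicator {s..} r) \<le> ennreal (exp (8 * B * s)) * ennreal (exp (- (8 * B * r)))"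
      by (subst ennreal_mult[symmetric]) (auto intro: ennreal_leI)
    then show "ennreal (1 * exp (- (8 * B * (r - s))) * indicator {s..} r) * indicator {0..} r * mass (X (t + max 0 r) \<omega>)
       \<le> ennreal (exp (8 * B * s)) * (ennreal (exp (- (8 * B * r))) * indicator {0..} r * mass (X (t + max 0 r) \<omega>))"
      unfolding mult.assoc[symmetric] by (intro mult_right_mono) auto
  qed
  also have "\<dots> = ennreal (exp (8 * B * s)) * potential t \<omega>"
    unfolding potential_def future_mass_def by (rule nn_integral_cmult) measurable
  finally show ?thesis .
qed

lemma potential_laplace:
  assumes \<theta>: "\<And>j. 0 \<le> \<theta> j"
  shows "\<exists>F G. (\<forall>j. 0 \<le> F j \<and> F j \<le> G) \<and> (\<forall>\<sigma>\<ge>0. \<forall>\<mu>\<in>finite_measures.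
      (\<integral>\<omega>. exp_neg (\<Sum>j<M. ennreal (\<theta> j) * potential (\<sigma> + real j) \<omega>) \<partial>P \<mu>) = exp (- lin (cumulant \<sigma> F) \<mu>))"
proof -
  define g where "g r = (\<Sum>j<M. \<theta> j * exp (- (8 * B * (r - real j))) * indicator {real j..} r)" for r
  have [measurable]: "g \<in> borel_measurable borel" unfolding g_def by measurable
  have t0: "0 \<le> \<theta> j * exp (- (8 * B * (r - real j))) * indicator {real j..} r" for r j
    using \<theta>[of j] by (auto split: split_indicator)
  have g0: "0 \<le> g r" for r unfolding g_def by (intro sum_nonneg t0)
  have gC: "g r \<le> (\<Sum>j<M. \<theta> j * exp (8 * B * real j)) * exp (- (8 * B * r))" for r
    unfolding g_def sum_distrib_right
  proof (rule sum_mono)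
    fix j
    have "exp (- (8 * B * (r - real j))) = exp (8 * B * real j) * exp (- (8 * B * r))"
      by (simp add: exp_add[symmetric] algebra_simps)
    then show "\<theta> j * exp (- (8 * B * (r - real j))) * indicator {real j..} r \<le> \<theta> j * exp (8 * B * real j) * exp (- (8 * B * r))"
      using \<theta>[of j] by (auto split: split_indicator)
  qed
  have eq: "(\<Sum>j<M. ennreal (\<theta> j) * potential (\<sigma> + real j) \<omega>) = future_mass g \<sigma> \<omega>" if \<sigma>: "0 \<le> \<sigma>" and \<omega>: "\<omega> \<in> space \<Omega>" for \<sigma> \<omega>
  proof -
    have [measurable]: "(\<lambda>r. mass (X (\<sigma> + max 0 r) \<omega>)) \<in> borel_measurable borel"
      by (rule mass_path_meas[OF \<omega>]; use \<sigma> in simp)+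
    have "future_mass g \<sigma> \<omega> = (\<integral>\<^sup>+r. (\<Sum>j<M. ennreal (\<theta> j * exp (- (8 * B * (r - real j))) * indicator {real j..} r) * indicator {0..} r * mass (X (\<sigma> + max 0 r) \<omega>)) \<partial>lborel)"
      unfolding future_mass_def g_def sum_distrib_right[symmetric] by (simp only: sum_ennreal[OF t0])
    also have "\<dots> = (\<Sum>j<M. \<integral>\<^sup>+r. ennreal (\<theta> j * exp (- (8 * B * (r - real j))) * indicator {real j..} r) * indicator {0..} r * mass (X (\<sigma> + max 0 r) \<omega>) \<partial>lborel)"
      by (rule nn_integral_sum) measurable
    also have "\<dots> = (\<Sum>j<M. ennreal (\<theta> j) * potential (\<sigma> + real j) \<omega>)"
      by (intro sum.cong refl weighted_potential[symmetric] \<omega> \<sigma> \<theta>) auto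
    finally show ?thesis ..
  qed
  obtain F G where FG: "\<forall>j. 0 \<le> F j \<and> F j \<le> G"
    and L: "\<forall>\<sigma>\<ge>0. \<forall>\<mu>\<in>finite_measures. (\<integral>\<omega>. exp_neg (future_mass g \<sigma> \<omega>) \<partial>P \<mu>) = exp (- lin (cumulant \<sigma> F) \<mu>)"
    using future_mass_laplace[OF \<open>g \<in> borel_measurable borel\<close> g0 gC] by (elim exE conjE) (rule that)
  have F: "0 \<le> F j" "F j \<le> G" for j using FG by simp_all
  show ?thesis
  proof (intro exI[of _ F] exI[of _ G] conjI allI impI ballI F)
    fix \<sigma> \<mu> assume \<sigma>: "(0::real) \<le> \<sigma>" and \<mu>: "\<mu> \<in> finite_measures"
    have "(\<integral>\<omega>. exp_neg (\<Sum>j<M. ennreal (\<theta> j) * potential (\<sigma> + real j) \<omega>) \<partial>P \<mu>) = (\<integral>\<omega>. exp_neg (future_mass g \<sigma> \<omega>) \<partial>P \<mu>)"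
      by (rule Bochner_Integration.integral_cong) (auto simp: eq[OF \<sigma>] P_space[OF \<mu>])
    then show "(\<integral>\<omega>. exp_neg (\<Sum>j<M. ennreal (\<theta> j) * potential (\<sigma> + real j) \<omega>) \<partial>P \<mu>) = exp (- lin (cumulant \<sigma> F) \<mu>)"
      using L \<sigma> \<mu> by simp
  qed
qed

text \<open>
  Along integer times this is the event that the potential tends to \<open>0\<close>, by \<open>potential_shift\<close>.
\<close>

definition potential_extinction :: "'w set" where
  "potential_extinction = {\<omega>\<in>space \<Omega>. (\<lambda>k. potential (real k) \<omega>) \<longlonglongrightarrow> 0}"

lemma potential_extinction_iff:
  assumes "\<omega> \<in> space \<Omega>"
  shows "\<omega> \<in> potential_extinction \<longleftrightarrow> (\<forall>j. \<exists>m. \<forall>k\<ge>m. potential (real k) \<omega> \<le> ennreal (1 / Suc j))"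
proof
  assume "\<omega> \<in> potential_extinction"
  then have l: "(\<lambda>k. potential (real k) \<omega>) \<longlonglongrightarrow> 0" unfolding potential_extinction_def by simp
  show "\<forall>j. \<exists>m. \<forall>k\<ge>m. potential (real k) \<omega> \<le> ennreal (1 / Suc j)"
  proof
    fix j
    have "eventually (\<lambda>k. potential (real k) \<omega> < ennreal (1 / Suc j)) sequentially"
      by (rule order_tendstoD(2)[OF l]) simp
    then show "\<exists>m. \<forall>k\<ge>m. potential (real k) \<omega> \<le> ennreal (1 / Suc j)"
      unfolding eventually_sequentially by (auto intro: less_imp_le)
  qed
next
  assume r: "\<forall>j. \<exists>m. \<forall>k\<ge>m. potential (real k) \<omega> \<le> ennreal (1 / Suc j)"
  have "(\<lambda>k. potential (real k) \<omega>) \<longlonglongrightarrow> 0"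
  proof (rule order_tendstoI)
    fix e :: ennreal assume e: "0 < e"
    have "(\<lambda>j. ennreal (1 / real (Suc j))) \<longlonglongrightarrow> ennreal 0"
      using LIMSEQ_inverse_real_of_nat by (intro tendsto_ennrealI) (simp add: inverse_eq_divide)
    then have "eventually (\<lambda>j. ennreal (1 / real (Suc j)) < e) sequentially"
      by (rule order_tendstoD(2)) (use e in simp)
    then obtain j where j: "ennreal (1 / Suc j) < e" by (auto simp: eventually_sequentially)
    obtain m where "\<forall>k\<ge>m. potential (real k) \<omega> \<le> ennreal (1 / Suc j)" using r by blast
    then show "eventually (\<lambda>k. potential (real k) \<omega> < e) sequentially"
      unfolding eventually_sequentially using j by (auto intro: le_less_trans)
  qed simp
  then show "\<omega> \<in> potential_extinction" using assms unfolding potential_extinction_def by simp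
qed

lemma potential_extinction_sets [measurable]: "potential_extinction \<in> sets \<Omega>"
proof -
  have "potential_extinction = {\<omega>\<in>space \<Omega>. \<forall>j. \<exists>m. \<forall>k\<in>{m..}. potential (real k) \<omega> \<le> ennreal (1 / Suc j)}"
  proof -
    have *: "(\<forall>k\<in>{m..}. Q k) \<longleftrightarrow> (\<forall>k\<ge>m. Q k)" for Q :: "nat \<Rightarrow> bool" and m by auto
    have "potential_extinction \<subseteq> space \<Omega>" unfolding potential_extinction_def by auto
    then show ?thesis unfolding * using potential_extinction_iff by blast
  qed
  also have "\<dots> \<in> sets \<Omega>" by measurable
  finally show ?thesis .
qed

lemma extinction_subset: "extinction \<Omega> X \<subseteq> potential_extinction"
proof
  fix \<omega> assume "\<omega> \<in> extinction \<Omega> X"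
  then have \<omega>: "\<omega> \<in> space \<Omega>" and l: "((\<lambda>t. mass (X t \<omega>)) \<longlongrightarrow> 0) at_top" unfolding extinction_def by auto
  show "\<omega> \<in> potential_extinction"
    unfolding potential_extinction_iff[OF \<omega>]
  proof
    fix j
    have "eventually (\<lambda>t. mass (X t \<omega>) < ennreal (1 / Suc j)) at_top"
      by (rule order_tendstoD(2)[OF l]) simp
    then obtain N where N: "\<And>t. N \<le> t \<Longrightarrow> mass (X t \<omega>) < ennreal (1 / Suc j)"
      by (auto simp: eventually_at_top_linorder)
    obtain m where m: "N \<le> real m" using real_arch_simple by blast
    show "\<exists>m. \<forall>k\<ge>m. potential (real k) \<omega> \<le> ennreal (1 / Suc j)"
    proof (intro exI[of _ m] allI impI)
      fix k assume k: "m \<le> k"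
      have "potential (real k) \<omega> \<le> (\<integral>\<^sup>+r. ennreal (1 / Suc j) * (ennreal (exp (- (8 * B * r))) * indicator {0..} r) \<partial>lborel)"
        unfolding potential_def future_mass_def
      proof (rule nn_integral_mono)
        fix r :: real
        have "real m \<le> real k" using k by simp
        then have "N \<le> real k + max 0 r" using m by linarith
        then have "mass (X (real k + max 0 r) \<omega>) \<le> ennreal (1 / Suc j)"
          by (rule less_imp_le[OF N])
        then have "ennreal (exp (- (8 * B * r))) * indicator {0..} r * mass (X (real k + max 0 r) \<omega>) \<le> ennreal (exp (- (8 * B * r))) * indicator {0..} r * ennreal (1 / Suc j)"
          by (rule mult_left_mono) simp
        then show "ennreal (exp (- (8 * B * r))) * indicator {0..} r * mass (X (real k + max 0 r) \<omega>) \<le> ennreal (1 / Suc j) * (ennreal (exp (- (8 * B * r))) * indicator {0..} r)"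
          by (simp add: mult_ac)
      qed
      also have "\<dots> = ennreal (1 / Suc j) * ennreal (1 / (8 * B))"
        using nn_integral_exp_halfline[of "8 * B"] B_pos by (subst nn_integral_cmult) auto
      also have "\<dots> \<le> ennreal (1 / Suc j) * 1"
        using B_ge_1 by (intro mult_left_mono) (auto simp: ennreal_le_1 divide_le_eq_1)
      finally show "potential (real k) \<omega> \<le> ennreal (1 / Suc j)" by simp
    qed
  qed
qed

lemma integral_mass_le_potential:
  assumes \<omega>: "\<omega> \<in> space \<Omega>" and k: "real k \<le> q" "q \<le> real k + 1" and r0: "0 \<le> r0"
  shows "(\<integral>\<^sup>+r. indicator {0..r0} r * mass (X (q + max 0 r) \<omega>) \<partial>lborel) \<le> ennreal (exp (8 * B * (r0 + 1))) * potential (real k) \<omega>"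
proof -
  have q: "0 \<le> q" using k(1) by (rule order_trans[rotated]) simp
  have [measurable]: "(\<lambda>r. mass (X (q + max 0 r) \<omega>)) \<in> borel_measurable borel"
    by (rule mass_path_meas[OF \<omega>]; use q in simp)+
  have "(\<integral>\<^sup>+r. indicator {0..r0} r * mass (X (q + max 0 r) \<omega>) \<partial>lborel)
     \<le> (\<integral>\<^sup>+r. ennreal (exp (8 * B * r0)) * (ennreal (exp (- (8 * B * r))) * indicator {0..} r * mass (X (q + max 0 r) \<omega>)) \<partial>lborel)"
  proof (rule nn_integral_mono)
    fix r :: real
    have "indicator {0..r0} r \<le> ennreal (exp (8 * B * r0)) * (ennreal (exp (- (8 * B * r))) * indicator {0..} r)"
    proof (cases "r \<in> {0..r0}")
      case True
      then have "1 \<le> exp (8 * B * r0) * exp (- (8 * B * r))" using B_pos by (simp add: exp_add[symmetric])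
      then have "1 \<le> ennreal (exp (8 * B * r0) * exp (- (8 * B * r)))" by (simp add: ennreal_ge_1)
      then show ?thesis using True by (simp add: ennreal_mult)
    qed simp
    then show "indicator {0..r0} r * mass (X (q + max 0 r) \<omega>) \<le> ennreal (exp (8 * B * r0)) * (ennreal (exp (- (8 * B * r))) * indicator {0..} r * mass (X (q + max 0 r) \<omega>))"
      unfolding mult.assoc[symmetric] by (intro mult_right_mono) (auto simp: mult.assoc)
  qed
  also have "\<dots> = ennreal (exp (8 * B * r0)) * potential q \<omega>"
    unfolding potential_def future_mass_def by (rule nn_integral_cmult) measurable
  also have "potential q \<omega> \<le> ennreal (exp (8 * B * (q - real k))) * potential (real k) \<omega>"
    using potential_shift[OF \<omega>, of "real k" "q - real k"] k by simp
  also have "ennreal (exp (8 * B * r0)) * (ennreal (exp (8 * B * (q - real k))) * potential (real k) \<omega>)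
     \<le> ennreal (exp (8 * B * r0)) * (ennreal (exp (8 * B * 1)) * potential (real k) \<omega>)"
    using k B_pos by (intro mult_left_mono mult_right_mono ennreal_leI) auto
  also have "\<dots> = ennreal (exp (8 * B * (r0 + 1))) * potential (real k) \<omega>"
    by (simp add: distrib_left exp_add ennreal_mult mult.assoc)
  finally show ?thesis by (simp add: mult_left_mono)
qed

lemma one_le_exp_neg_plus: "1 \<le> ennreal (exp_neg x) + x"
proof (cases x)
  case (real r)
  then show ?thesis using exp_ge_add_one_self[of "- r"]
    by (simp add: exp_neg_ennreal ennreal_plus[symmetric] ennreal_ge_1 del: ennreal_plus)
qed (simp add: exp_neg_def)

text \<open>A large mass at time q is unlikely to be followed by a small time average.\<close>

text \<open>
  If the mass at time \<open>q\<close> is at least \<open>\<eta>\<close>, then at every time shortly after \<open>q\<close> the transform at \<open>L\<close> has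
  conditional mean at most \<open>exp (- \<eta> * L / 2)\<close>.  On the other hand, if the integral of the mass over
  \<open>[q, q + r0]\<close> is at most \<open>r0 / (2 * L)\<close>, the transform has time average at least \<open>1 / 2\<close>.  Both happen
  together only with small probability.
\<close>

lemma large_mass_persists:
  assumes \<mu>: "\<mu> \<in> finite_measures" and q: "0 \<le> q" and A: "A \<in> sets (\<F> (ennreal q))"
    and L: "0 < L" and \<eta>: "0 \<le> \<eta>" and big: "\<And>\<omega>. \<omega> \<in> A \<Longrightarrow> ennreal \<eta> \<le> mass (X q \<omega>)"
    and r0: "0 < r0" and low: "\<And>s i. 0 \<le> s \<Longrightarrow> s \<le> r0 \<Longrightarrow> L / 2 \<le> cumulant s (\<lambda>_. L) i"
    and D: "D \<in> sets \<Omega>" and small: "\<And>\<omega>. \<omega> \<in> D \<Longrightarrow> (\<integral>\<^sup>+r. indicator {0..r0} r * mass (X (q + max 0 r) \<omega>) \<partial>lborel) \<le> ennreal (r0 / (2 * L))"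
  shows "measure (P \<mu>) (A \<inter> D) \<le> 2 * exp (- (\<eta> * L / 2)) * measure (P \<mu>) A"
proof -
  interpret prob_space "P \<mu>" by (rule P_prob[OF \<mu>])
  interpret pair_sigma_finite lborel "P \<mu>" ..
  have A' [measurable]: "A \<in> sets (P \<mu>)" using A sets_F_subset[of "ennreal q"] by (auto simp: P_sets[OF \<mu>])
  have D' [measurable]: "D \<in> sets (P \<mu>)" using D by (simp add: P_sets[OF \<mu>])
  have [measurable]: "(\<lambda>p. mass (X (q + max 0 (fst p)) (snd p))) \<in> borel_measurable (lborel \<Otimes>\<^sub>M P \<mu>)"
    by (rule mass_joint_meas_P[OF \<mu>]) (use q in auto)
  let ?h = "\<lambda>r \<omega>. ennreal (exp_neg (ennreal L * mass (X (q + max 0 r) \<omega>)))"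
  have lower: "ennreal (r0 / 2) \<le> (\<integral>\<^sup>+r. indicator {0..r0} r * ?h r \<omega> \<partial>lborel)" if \<omega>: "\<omega> \<in> A \<inter> D" for \<omega>
  proof -
    have sp: "\<omega> \<in> space \<Omega>" using \<omega> sets.sets_into_space[OF D] by auto
    have [measurable]: "(\<lambda>r. mass (X (q + max 0 r) \<omega>)) \<in> borel_measurable borel"
      by (rule mass_path_meas[OF sp]; use q in simp)+
    have "ennreal (r0 / 2) + ennreal (r0 / 2) = (\<integral>\<^sup>+r. indicator {0..r0} r \<partial>lborel)"
      using r0 by (simp add: ennreal_plus[symmetric] del: ennreal_plus)
    also have "\<dots> \<le> (\<integral>\<^sup>+r. indicator {0..r0} r * ?h r \<omega> + ennreal L * (indicator {0..r0} r * mass (X (q + max 0 r) \<omega>)) \<partial>lborel)"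
    proof (rule nn_integral_mono)
      fix r :: real
      show "indicator {0..r0} r \<le> indicator {0..r0} r * ?h r \<omega> + ennreal L * (indicator {0..r0} r * mass (X (q + max 0 r) \<omega>))"
        using one_le_exp_neg_plus[of "ennreal L * mass (X (q + max 0 r) \<omega>)"] by (auto split: split_indicator)
    qed
    also have "\<dots> = (\<integral>\<^sup>+r. indicator {0..r0} r * ?h r \<omega> \<partial>lborel) + ennreal L * (\<integral>\<^sup>+r. indicator {0..r0} r * mass (X (q + max 0 r) \<omega>) \<partial>lborel)"
      by (simp add: nn_integral_add nn_integral_cmult)
    also have "\<dots> \<le> (\<integral>\<^sup>+r. indicator {0..r0} r * ?h r \<omega> \<partial>lborel) + ennreal L * ennreal (r0 / (2 * L))"
      using \<omega> by (intro add_left_mono mult_left_mono small) auto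
    also have "ennreal L * ennreal (r0 / (2 * L)) = ennreal (r0 / 2)"
      using L r0 by (subst ennreal_mult[symmetric]) auto
    also have "(\<integral>\<^sup>+r. indicator {0..r0} r * ?h r \<omega> \<partial>lborel) + ennreal (r0 / 2) = ennreal (r0 / 2) + (\<integral>\<^sup>+r. indicator {0..r0} r * ?h r \<omega> \<partial>lborel)"
      by (rule add.commute)
    finally show ?thesis unfolding ennreal_add_left_cancel_le by simp
  qed
  have step: "(\<integral>\<^sup>+\<omega>. indicator A \<omega> * ?h r \<omega> \<partial>P \<mu>) \<le> ennreal (exp (- (\<eta> * L / 2)) * measure (P \<mu>) A)" if r: "r \<in> {0..r0}" for r
  proof -
    have r': "0 \<le> r" "r \<le> r0" using r by auto
    have "(\<integral>\<^sup>+\<omega>. indicator A \<omega> * ?h r \<omega> \<partial>P \<mu>) = (\<integral>\<^sup>+\<omega>. indicator A \<omega> * (\<lambda>x. ennreal (exp_neg (pairing (\<lambda>_. ennreal L) x))) (X (q + r) \<omega>) \<partial>P \<mu>)"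
      using r' pairing_mult[of "ennreal L" "\<lambda>_. 1"] by simp
    also have "\<dots> = (\<integral>\<^sup>+\<omega>. indicator A \<omega> * kern r (\<lambda>x. ennreal (exp_neg (pairing (\<lambda>_. ennreal L) x))) (X q \<omega>) \<partial>P \<mu>)"
      by (rule markov[OF _ _ \<mu> q r'(1)]) (use A in measurable)
    also have "\<dots> \<le> (\<integral>\<^sup>+\<omega>. ennreal (exp (- (\<eta> * L / 2))) * indicator A \<omega> \<partial>P \<mu>)"
    proof (rule nn_integral_mono_AE)
      show "AE \<omega> in P \<mu>. indicator A \<omega> * kern r (\<lambda>x. ennreal (exp_neg (pairing (\<lambda>_. ennreal L) x))) (X q \<omega>) \<le> ennreal (exp (- (\<eta> * L / 2))) * indicator A \<omega>"
        using X_finite[OF \<mu> q]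
      proof eventually_elim
        case (elim \<omega>)
        show ?case
        proof (cases "\<omega> \<in> A")
          case True
          have k: "kern r (\<lambda>x. ennreal (exp_neg (pairing (\<lambda>_. ennreal L) x))) (X q \<omega>) = ennreal (exp_neg (pairing (\<lambda>j. ennreal (cumulant r (\<lambda>_. L) j)) (X q \<omega>)))"
            by (rule kern_laplace[where f = "\<lambda>_. L" and F = L]) (use L r' elim in auto)
          have "ennreal (\<eta> * L / 2) = ennreal (L / 2) * ennreal \<eta>" using L \<eta> by (simp add: ennreal_mult[symmetric] mult.commute)
          also have "\<dots> \<le> ennreal (L / 2) * mass (X q \<omega>)" by (intro mult_left_mono big True) simp
          also have "\<dots> = pairing (\<lambda>_. ennreal (L / 2)) (X q \<omega>)" using pairing_mult[of "ennreal (L / 2)" "\<lambda>_. 1"] by simp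
          also have "\<dots> \<le> pairing (\<lambda>j. ennreal (cumulant r (\<lambda>_. L) j)) (X q \<omega>)"
            by (intro pairing_mono ennreal_leI low r')
          finally have "exp_neg (pairing (\<lambda>j. ennreal (cumulant r (\<lambda>_. L) j)) (X q \<omega>)) \<le> exp_neg (ennreal (\<eta> * L / 2))"
            by (rule exp_neg_antimono)
          also have "\<dots> = exp (- (\<eta> * L / 2))" using L \<eta> by (intro exp_neg_ennreal) simp
          finally show ?thesis using True k by (simp add: ennreal_leI)
        qed simp
      qed
    qed
    also have "\<dots> = ennreal (exp (- (\<eta> * L / 2)) * measure (P \<mu>) A)"
      by (simp add: nn_integral_cmult emeasure_eq_measure ennreal_mult)
    finally show ?thesis .
  qed
  have m: "(\<lambda>(r, \<omega>). indicator {0..r0} r * (indicator A \<omega> * ?h r \<omega>)) \<in> borel_measurable (lborel \<Otimes>\<^sub>M P \<mu>)"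
    unfolding split_beta' by measurable
  have "ennreal (r0 / 2 * measure (P \<mu>) (A \<inter> D)) = ennreal (r0 / 2) * emeasure (P \<mu>) (A \<inter> D)"
    using r0 by (simp add: emeasure_eq_measure ennreal_mult[symmetric])
  also have "\<dots> = (\<integral>\<^sup>+\<omega>. ennreal (r0 / 2) * indicator (A \<inter> D) \<omega> \<partial>P \<mu>)"
    by (simp add: nn_integral_cmult)
  also have "\<dots> \<le> (\<integral>\<^sup>+\<omega>. (\<integral>\<^sup>+r. indicator {0..r0} r * (indicator A \<omega> * ?h r \<omega>) \<partial>lborel) \<partial>P \<mu>)"
    by (rule nn_integral_mono) (use lower in \<open>auto split: split_indicator\<close>)
  also have "\<dots> = (\<integral>\<^sup>+r. (\<integral>\<^sup>+\<omega>. indicator {0..r0} r * (indicator A \<omega> * ?h r \<omega>) \<partial>P \<mu>) \<partial>lborel)"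
    using Fubini'[OF m] by simp
  also have "\<dots> \<le> (\<integral>\<^sup>+r. ennreal (exp (- (\<eta> * L / 2)) * measure (P \<mu>) A) * indicator {0..r0} r \<partial>lborel)"
  proof (rule nn_integral_mono)
    fix r :: real
    show "(\<integral>\<^sup>+\<omega>. indicator {0..r0} r * (indicator A \<omega> * ?h r \<omega>) \<partial>P \<mu>) \<le> ennreal (exp (- (\<eta> * L / 2)) * measure (P \<mu>) A) * indicator {0..r0} r"
      using step[of r] by (cases "r \<in> {0..r0}") auto
  qed
  also have "\<dots> = ennreal (exp (- (\<eta> * L / 2)) * measure (P \<mu>) A * r0)"
    using r0 by (simp add: nn_integral_cmult ennreal_mult)
  finally have "ennreal (r0 / 2 * measure (P \<mu>) (A \<inter> D)) \<le> ennreal (exp (- (\<eta> * L / 2)) * measure (P \<mu>) A * r0)" .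
  then have "r0 / 2 * measure (P \<mu>) (A \<inter> D) \<le> exp (- (\<eta> * L / 2)) * measure (P \<mu>) A * r0"
    using r0 by (subst (asm) ennreal_le_iff) auto
  then have "r0 * measure (P \<mu>) (A \<inter> D) \<le> r0 * (2 * exp (- (\<eta> * L / 2)) * measure (P \<mu>) A)" by (simp add: mult_ac)
  then show ?thesis using r0 by simp
qed

end

section \<open>Exponential polynomials and null sequences\<close>

definition exp_mono :: "nat \<Rightarrow> (nat \<Rightarrow> real) \<Rightarrow> (nat \<Rightarrow> ennreal) \<Rightarrow> real" where
  "exp_mono M \<theta> y = exp_neg (\<Sum>j<M. ennreal (\<theta> j) * y j)"

inductive exp_poly :: "((nat \<Rightarrow> ennreal) \<Rightarrow> real) \<Rightarrow> bool" where
  exp_poly_zero: "exp_poly (\<lambda>y. 0)"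
| exp_poly_step: "exp_poly G \<Longrightarrow> (\<And>j. 0 \<le> \<theta> j) \<Longrightarrow> exp_poly (\<lambda>y. a * exp_mono M \<theta> y + G y)"

lemma exp_poly_add: "exp_poly F \<Longrightarrow> exp_poly G \<Longrightarrow> exp_poly (\<lambda>y. F y + G y)"
proof (induction rule: exp_poly.induct)
  case (exp_poly_step F \<theta> a M)
  have "exp_poly (\<lambda>y. a * exp_mono M \<theta> y + (F y + G y))" using exp_poly_step by (intro exp_poly.exp_poly_step) auto
  then show ?case by (simp add: add.assoc)
qed simp

lemma exp_poly_exp_mono: "(\<And>j. 0 \<le> \<theta> j) \<Longrightarrow> exp_poly (\<lambda>y. a * exp_mono M \<theta> y)"
  using exp_poly_step[OF exp_poly_zero, of \<theta> a M] by simp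

lemma exp_mono_0 [simp]: "exp_mono 0 \<theta> y = 1"
  unfolding exp_mono_def by simp

lemma exp_poly_const: "exp_poly (\<lambda>y. a)"
  using exp_poly_exp_mono[of "\<lambda>_. 0" a 0] by simp

lemma exp_mono_mult:
  assumes "\<And>j. 0 \<le> \<theta> j" "\<And>j. 0 \<le> \<theta>' j"
  shows "exp_mono M \<theta> y * exp_mono M' \<theta>' y = exp_mono (max M M') (\<lambda>j. (if j < M then \<theta> j else 0) + (if j < M' then \<theta>' j else 0)) y"
proof -
  have 1: "(\<Sum>j<max M M'. ennreal (if j < M then \<theta> j else 0) * y j) = (\<Sum>j<M. ennreal (\<theta> j) * y j)"
    by (rule sum.mono_neutral_cong_right) auto
  have 2: "(\<Sum>j<max M M'. ennreal (if j < M' then \<theta>' j else 0) * y j) = (\<Sum>j<M'. ennreal (\<theta>' j) * y j)"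
    by (rule sum.mono_neutral_cong_right) auto
  have "(\<Sum>j<max M M'. ennreal ((if j < M then \<theta> j else 0) + (if j < M' then \<theta>' j else 0)) * y j)
    = (\<Sum>j<max M M'. ennreal (if j < M then \<theta> j else 0) * y j + ennreal (if j < M' then \<theta>' j else 0) * y j)"
    using assms by (intro sum.cong refl) (simp add: ennreal_plus distrib_right)
  then show ?thesis unfolding exp_mono_def exp_neg_add[symmetric] sum.distrib 1 2 by simp
qed

lemma exp_poly_mult: "exp_poly F \<Longrightarrow> exp_poly G \<Longrightarrow> exp_poly (\<lambda>y. F y * G y)"
proof (induction rule: exp_poly.induct)
  case exp_poly_zero
  then show ?case by (simp add: exp_poly.exp_poly_zero)
next
  case (exp_poly_step F \<theta> a M)
  have "exp_poly (\<lambda>y. a * exp_mono M \<theta> y * G y)" using exp_poly_step.prems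
  proof (induction rule: exp_poly.induct)
    case exp_poly_zero
    then show ?case by (simp add: exp_poly.exp_poly_zero)
  next
    case (exp_poly_step G' \<theta>' a' M')
    have "exp_poly (\<lambda>y. (a * a') * exp_mono (max M M') (\<lambda>j. (if j < M then \<theta> j else 0) + (if j < M' then \<theta>' j else 0)) y + a * exp_mono M \<theta> y * G' y)"
      by (rule exp_poly.exp_poly_step) (use exp_poly_step \<open>\<And>j. 0 \<le> \<theta> j\<close> in auto)
    then show ?case
      unfolding exp_mono_mult[of \<theta> \<theta>', OF \<open>\<And>j. 0 \<le> \<theta> j\<close> exp_poly_step.hyps(2), symmetric] by (simp add: algebra_simps)
  qed
  from exp_poly_add[OF this exp_poly_step.IH[OF exp_poly_step.prems]] show ?case by (simp add: algebra_simps)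
qed

lemma exp_poly_diff: "exp_poly F \<Longrightarrow> exp_poly G \<Longrightarrow> exp_poly (\<lambda>y. F y - G y)"
  using exp_poly_add[of F "\<lambda>y. -1 * G y"] exp_poly_mult[OF exp_poly_const[of "-1"], of G] by simp

lemma exp_poly_power: "exp_poly F \<Longrightarrow> exp_poly (\<lambda>y. F y ^ p)"
  by (induction p) (auto intro: exp_poly_const exp_poly_mult)

lemma exp_poly_prod: "finite S \<Longrightarrow> (\<And>k. k \<in> S \<Longrightarrow> exp_poly (F k)) \<Longrightarrow> exp_poly (\<lambda>y. \<Prod>k\<in>S. F k y)"
  by (induction rule: finite_induct) (auto intro: exp_poly_const exp_poly_mult)

lemma exp_poly_rep:
  "exp_poly G \<Longrightarrow> \<exists>N a M \<theta>. (\<forall>k j. 0 \<le> \<theta> k j) \<and> G = (\<lambda>y. \<Sum>k<(N::nat). a k * exp_mono (M k) (\<theta> k) y)"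
proof (induction rule: exp_poly.induct)
  case exp_poly_zero
  show ?case by (intro exI[of _ 0] exI[of _ "\<lambda>_ _. 0"]) auto
next
  case (exp_poly_step G \<theta> a M)
  then obtain N a' M' \<theta>' where rep: "\<And>k j. 0 \<le> \<theta>' k j" "G = (\<lambda>y. \<Sum>k<(N::nat). a' k * exp_mono (M' k) (\<theta>' k) y)" by blast
  show ?case
  proof (intro exI conjI allI)
    show "0 \<le> (case k of 0 \<Rightarrow> \<theta> | Suc k \<Rightarrow> \<theta>' k) j" for k j
      using rep(1) exp_poly_step by (auto split: nat.split)
    show "(\<lambda>y. a * exp_mono M \<theta> y + G y) = (\<lambda>y. \<Sum>k<Suc N. (case k of 0 \<Rightarrow> a | Suc k \<Rightarrow> a' k) * exp_mono (case k of 0 \<Rightarrow> M | Suc k \<Rightarrow> M' k) (case k of 0 \<Rightarrow> \<theta> | Suc k \<Rightarrow> \<theta>' k) y)"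
      unfolding rep(2) by (simp add: sum.lessThan_Suc_shift del: sum.lessThan_Suc)
  qed
qed

lemma exp_poly_meas: "exp_poly G \<Longrightarrow> G \<in> borel_measurable (Pi\<^sub>M UNIV (\<lambda>_. borel))"
proof (induction rule: exp_poly.induct)
  case (exp_poly_step G \<theta> a M)
  note [measurable] = exp_poly_step.IH
  show ?case unfolding exp_mono_def by measurable
qed simp

text \<open>
  The class on which the generator inequality can be established: the base functions are
  monotone, the limits need no relation to each other.
\<close>

inductive antitone_test :: "((nat \<Rightarrow> ennreal) \<Rightarrow> real) \<Rightarrow> bool" where
  antitone_test_base: "exp_poly G \<Longrightarrow> (\<And>y. 0 \<le> G y) \<Longrightarrow> (\<And>y. G y \<le> 1) \<Longrightarrow> (\<And>y z. (\<And>j. y j \<le> z j) \<Longrightarrow> G z \<le> G y) \<Longrightarrow> antitone_test G"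
| antitone_test_lim: "(\<And>k. antitone_test (G k)) \<Longrightarrow> (\<And>y. (\<lambda>k::nat. G k y) \<longlonglongrightarrow> H y) \<Longrightarrow> antitone_test H"

lemma antitone_test_bounds: "antitone_test G \<Longrightarrow> 0 \<le> G y \<and> G y \<le> 1"
proof (induction rule: antitone_test.induct)
  case (antitone_test_lim G H)
  then show ?case using LIMSEQ_le_const[OF antitone_test_lim.hyps(2)] LIMSEQ_le_const2[OF antitone_test_lim.hyps(2)] by blast
qed auto

lemma antitone_test_meas: "antitone_test G \<Longrightarrow> G \<in> borel_measurable (Pi\<^sub>M UNIV (\<lambda>_. borel))"
proof (induction rule: antitone_test.induct)
  case (antitone_test_lim G H)
  show ?case by (rule borel_measurable_LIMSEQ_real[OF antitone_test_lim.hyps(2) antitone_test_lim.IH])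
qed (rule exp_poly_meas)

text \<open>
  A polynomial in \<open>exp (- x)\<close> that tends to the indicator of \<open>a * x \<le> ln 2\<close>.  The exponent \<open>J * 2 ^ J\<close> lies
  between the scales \<open>2 ^ J\<close>, below which the power would not tend to \<open>0\<close> inside the interval, and
  \<open>exp (J * a * x)\<close>, above which it would not tend to \<open>1\<close> outside.
\<close>

definition soft_step :: "real \<Rightarrow> nat \<Rightarrow> ennreal \<Rightarrow> real" where
  "soft_step a J x = 1 - (1 - exp_neg (ennreal (real J * a) * x)) ^ (J * 2 ^ J)"

lemma soft_step_range: "0 \<le> soft_step a J x" "soft_step a J x \<le> 1"
  unfolding soft_step_def using exp_neg_nonneg[of "ennreal (real J * a) * x"] exp_neg_le_1[of "ennreal (real J * a) * x"]
  by (auto simp: power_le_one)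

lemma soft_step_antimono: "x \<le> y \<Longrightarrow> soft_step a J y \<le> soft_step a J x"
  unfolding soft_step_def
  by (intro diff_left_mono power_mono exp_neg_antimono mult_left_mono) (auto simp: exp_neg_le_1)

lemma soft_step_tendsto:
  assumes a: "0 < a"
  shows "(\<lambda>J. soft_step a J x) \<longlonglongrightarrow> (if ennreal a * x \<le> ennreal (ln 2) then 1 else 0)"
proof (cases x)
  case top
  have "soft_step a (Suc J) x = 0" for J
    using a top unfolding soft_step_def by (simp add: exp_neg_def ennreal_mult_top)
  then have "(\<lambda>J. soft_step a (Suc J) x) \<longlonglongrightarrow> 0" by simp
  from LIMSEQ_imp_Suc[OF this] show ?thesis using top a by (simp add: ennreal_mult_top top_unique)
next
  case (real r)
  define e where "e J = exp (- (real J * (a * r)))" for J :: nat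
  have soft_step: "soft_step a J x = 1 - (1 - e J) ^ (J * 2 ^ J)" for J
    unfolding soft_step_def e_def using real a by (simp add: ennreal_mult[symmetric] exp_neg_ennreal mult.assoc)
  have e01: "0 < e J" "e J \<le> 1" for J unfolding e_def using a real by auto
  have iff: "ennreal a * x \<le> ennreal (ln 2) \<longleftrightarrow> a * r \<le> ln 2"
    using real a by (simp add: ennreal_mult[symmetric] ennreal_le_iff)
  show ?thesis
  proof (cases "a * r \<le> ln 2")
    case True
    have le: "(1 - e J) ^ (J * 2 ^ J) \<le> exp (- real J)" for J
    proof -
      have "exp (- real J * ln 2) \<le> e J" unfolding e_def using True by (simp add: mult_left_mono)
      moreover have "exp (- real J * ln 2) = 1 / 2 ^ J"
        by (simp add: exp_minus exp_of_nat_mult inverse_eq_divide)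
      ultimately have ge: "1 / 2 ^ J \<le> e J" by simp
      have "(1 - e J) ^ (J * 2 ^ J) \<le> exp (- e J) ^ (J * 2 ^ J)"
        using e01[of J] exp_ge_add_one_self[of "- e J"] by (intro power_mono) auto
      also have "\<dots> = exp (- (real J * (2 ^ J * e J)))" by (simp add: exp_of_nat_mult[symmetric])
      also have "\<dots> \<le> exp (- real J)"
      proof -
        have "1 \<le> 2 ^ J * e J" using ge by (simp add: field_simps)
        then have "real J * 1 \<le> real J * (2 ^ J * e J)" by (intro mult_left_mono) auto
        then show ?thesis by simp
      qed
      finally show ?thesis .
    qed
    have ge0: "0 \<le> (1 - e J) ^ (J * 2 ^ J)" for J using e01[of J] by simp
    have "(\<lambda>J. exp (- real J)) \<longlonglongrightarrow> 0"
      by (intro filterlim_compose[OF exp_at_bot] filterlim_compose[OF filterlim_uminus_at_bot_at_top filterlim_real_sequentially])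
    then have "(\<lambda>J. (1 - e J) ^ (J * 2 ^ J)) \<longlonglongrightarrow> 0"
      by (rule tendsto_sandwich[OF _ _ tendsto_const, rotated 2]) (use le ge0 in auto)
    from tendsto_diff[OF tendsto_const[of 1] this] show ?thesis unfolding soft_step iff using True by simp
  next
    case False
    define q where "q = 2 * exp (- (a * r))"
    have q: "0 < q" "q < 1"
    proof -
      have "exp (- (a * r)) < exp (- ln 2)" using False by simp
      also have "exp (- ln 2) = (1 / 2 :: real)" by (simp add: exp_minus)
      finally show "q < 1" unfolding q_def by simp
    qed (simp add: q_def)
    have le: "soft_step a J x \<le> real J * q ^ J" for J
    proof -
      have "1 + real (J * 2 ^ J) * (- e J) \<le> (1 + (- e J)) ^ (J * 2 ^ J)"
        by (rule Bernoulli_inequality) (use e01[of J] in simp)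
      then have "soft_step a J x \<le> real (J * 2 ^ J) * e J" unfolding soft_step by simp
      also have "\<dots> = real J * q ^ J"
        unfolding q_def e_def by (simp add: power_mult_distrib exp_of_nat_mult[symmetric])
      finally show ?thesis .
    qed
    have "(\<lambda>J. real J * q ^ J) \<longlonglongrightarrow> 0" using q by (intro powser_times_n_limit_0) simp
    then have "(\<lambda>J. soft_step a J x) \<longlonglongrightarrow> 0"
      by (rule tendsto_sandwich[OF _ _ tendsto_const, rotated 2]) (use le soft_step_range in auto)
    then show ?thesis unfolding iff using False by simp
  qed
qed

lemma vanishing_iff:
  fixes y :: "nat \<Rightarrow> ennreal"
  shows "y \<longlonglongrightarrow> 0 \<longleftrightarrow> (\<forall>k. \<exists>m. \<forall>j\<ge>m. ennreal (real (Suc k)) * y j \<le> ennreal (ln 2))"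
proof
  assume y: "y \<longlonglongrightarrow> 0"
  show "\<forall>k. \<exists>m. \<forall>j\<ge>m. ennreal (real (Suc k)) * y j \<le> ennreal (ln 2)"
  proof
    fix k
    have "(\<lambda>j. ennreal (real (Suc k)) * y j) \<longlonglongrightarrow> ennreal (real (Suc k)) * 0"
      by (rule ennreal_tendsto_cmult[OF _ y]) simp
    then have "eventually (\<lambda>j. ennreal (real (Suc k)) * y j < ennreal (ln 2)) sequentially"
      by (rule order_tendstoD(2)) simp
    then show "\<exists>m. \<forall>j\<ge>m. ennreal (real (Suc k)) * y j \<le> ennreal (ln 2)"
      unfolding eventually_sequentially by (auto intro: less_imp_le)
  qed
next
  assume r: "\<forall>k. \<exists>m. \<forall>j\<ge>m. ennreal (real (Suc k)) * y j \<le> ennreal (ln 2)"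
  show "y \<longlonglongrightarrow> 0"
  proof (rule order_tendstoI)
    fix e :: ennreal assume e: "0 < e"
    have "(\<lambda>k. ennreal (ln 2 * (1 / real (Suc k)))) \<longlonglongrightarrow> ennreal (ln 2 * 0)"
      using LIMSEQ_inverse_real_of_nat by (intro tendsto_ennrealI tendsto_intros) (simp add: inverse_eq_divide)
    then have "eventually (\<lambda>k. ennreal (ln 2 * (1 / real (Suc k))) < e) sequentially"
      by (rule order_tendstoD(2)) (use e in simp)
    then obtain k where k: "ennreal (ln 2 * (1 / real (Suc k))) < e" by (auto simp: eventually_sequentially)
    obtain m where m: "\<And>j. j \<ge> m \<Longrightarrow> ennreal (real (Suc k)) * y j \<le> ennreal (ln 2)" using r by blast
    have "y j < e" if "j \<ge> m" for j
    proof -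
      have "y j = ennreal (1 / real (Suc k)) * (ennreal (real (Suc k)) * y j)"
        unfolding mult.assoc[symmetric] by (subst ennreal_mult[symmetric]) auto
      also have "\<dots> \<le> ennreal (1 / real (Suc k)) * ennreal (ln 2)" by (intro mult_left_mono m that) simp
      also have "\<dots> = ennreal (ln 2 * (1 / real (Suc k)))" by (subst ennreal_mult[symmetric]) (auto simp: mult.commute)
      finally show ?thesis using k by simp
    qed
    then show "eventually (\<lambda>j. y j < e) sequentially" unfolding eventually_sequentially by blast
  qed simp
qed

lemma tendsto_indicator_eventually:
  fixes G :: "nat \<Rightarrow> bool"
  assumes "eventually (\<lambda>k. G k \<longleftrightarrow> H) sequentially"
  shows "(\<lambda>k. if G k then 1 else 0 :: real) \<longlonglongrightarrow> (if H then 1 else 0)"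
  by (rule tendsto_eventually) (use assms in \<open>auto elim!: eventually_mono\<close>)

text \<open>
  The condition \<open>\<forall>k. \<exists>m. \<forall>j\<ge>m. (k + 1) * y j \<le> ln 2\<close> is resolved from inside to outside; at each stage the
  indicators converge because they are monotone in the index of the quantifier.
\<close>

lemma antitone_test_vanishing: "antitone_test (\<lambda>y. if y \<longlonglongrightarrow> 0 then 1 else 0)"
proof -
  let ?Q = "\<lambda>k y j. ennreal (real (Suc k)) * y j \<le> ennreal (ln 2)"
  have 1: "antitone_test (\<lambda>y. \<Prod>j\<in>{m..<m'}. soft_step (real (Suc k)) J (y j))" for k m m' J
  proof (rule antitone_test_base)
    have "exp_poly (\<lambda>y. exp_mono (Suc j) (\<lambda>i. if i = j then real J * real (Suc k) else 0) y)" for j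
      using exp_poly_exp_mono[of "\<lambda>i. if i = j then real J * real (Suc k) else 0" 1 "Suc j"] by simp
    moreover have "exp_mono (Suc j) (\<lambda>i. if i = j then real J * real (Suc k) else 0) y = exp_neg (ennreal (real J * real (Suc k)) * y j)" for j y
    proof -
      have "(\<Sum>i<Suc j. ennreal (if i = j then real J * real (Suc k) else 0) * y i)
        = (\<Sum>i<Suc j. if i = j then ennreal (real J * real (Suc k)) * y i else 0)"
        by (intro sum.cong) auto
      then show ?thesis unfolding exp_mono_def by simp
    qed
    ultimately have "exp_poly (\<lambda>y. exp_neg (ennreal (real J * real (Suc k)) * y j))" for j by simp
    then show "exp_poly (\<lambda>y. \<Prod>j\<in>{m..<m'}. soft_step (real (Suc k)) J (y j))"
      unfolding soft_step_def by (intro exp_poly_prod exp_poly_diff exp_poly_const exp_poly_power) auto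
  qed (auto intro!: prod_nonneg prod_le_1 prod_mono soft_step_range soft_step_antimono)
  have 2: "antitone_test (\<lambda>y. if \<forall>j\<in>{m..<m'}. ?Q k y j then 1 else 0)" for k m m'
  proof (rule antitone_test_lim[OF 1])
    fix y
    have "(\<lambda>J. \<Prod>j\<in>{m..<m'}. soft_step (real (Suc k)) J (y j)) \<longlonglongrightarrow> (\<Prod>j\<in>{m..<m'}. if ?Q k y j then 1 else 0)"
      by (intro tendsto_prod soft_step_tendsto) simp
    moreover have "(\<Prod>j\<in>{m..<m'}. if ?Q k y j then 1 else 0 :: real) = (if \<forall>j\<in>{m..<m'}. ?Q k y j then 1 else 0)"
      by (auto intro!: prod.neutral prod_zero)
    ultimately show "(\<lambda>J. \<Prod>j\<in>{m..<m'}. soft_step (real (Suc k)) J (y j)) \<longlonglongrightarrow> (if \<forall>j\<in>{m..<m'}. ?Q k y j then 1 else 0)"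
      by (simp only:)
  qed
  have 3: "antitone_test (\<lambda>y. if \<forall>j\<ge>m. ?Q k y j then 1 else 0)" for k m
  proof (rule antitone_test_lim[OF 2[of m _ k]])
    fix y
    show "(\<lambda>m'. if \<forall>j\<in>{m..<m'}. ?Q k y j then 1 else 0 :: real) \<longlonglongrightarrow> (if \<forall>j\<ge>m. ?Q k y j then 1 else 0)"
    proof (rule tendsto_indicator_eventually, cases "\<forall>j\<ge>m. ?Q k y j")
      case False
      then obtain j where j: "j \<ge> m" "\<not> ?Q k y j" by blast
      show "eventually (\<lambda>m'. (\<forall>j\<in>{m..<m'}. ?Q k y j) \<longleftrightarrow> (\<forall>j\<ge>m. ?Q k y j)) sequentially"
        using j by (intro eventually_sequentiallyI[of "Suc j"]) force
    qed auto
  qed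
  have 4: "antitone_test (\<lambda>y. if \<exists>m. \<forall>j\<ge>m. ?Q k y j then 1 else 0)" for k
  proof (rule antitone_test_lim[OF 3[of _ k]])
    fix y
    show "(\<lambda>m. if \<forall>j\<ge>m. ?Q k y j then 1 else 0 :: real) \<longlonglongrightarrow> (if \<exists>m. \<forall>j\<ge>m. ?Q k y j then 1 else 0)"
    proof (rule tendsto_indicator_eventually, cases "\<exists>m. \<forall>j\<ge>m. ?Q k y j")
      case True
      then obtain m where m: "\<forall>j\<ge>m. ?Q k y j" by blast
      show "eventually (\<lambda>m. (\<forall>j\<ge>m. ?Q k y j) \<longleftrightarrow> (\<exists>m. \<forall>j\<ge>m. ?Q k y j)) sequentially"
        using m by (intro eventually_sequentiallyI[of m]) (meson order_trans)
    next
      case False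
      then show "eventually (\<lambda>m. (\<forall>j\<ge>m. ?Q k y j) \<longleftrightarrow> (\<exists>m. \<forall>j\<ge>m. ?Q k y j)) sequentially"
        by (intro always_eventually allI) blast
    qed
  qed
  show ?thesis
  proof (rule antitone_test_lim[OF 4])
    fix y :: "nat \<Rightarrow> ennreal"
    show "(\<lambda>k. if \<exists>m. \<forall>j\<ge>m. ?Q k y j then 1 else 0 :: real) \<longlonglongrightarrow> (if y \<longlonglongrightarrow> 0 then 1 else 0)"
    proof (rule tendsto_indicator_eventually, cases "y \<longlonglongrightarrow> 0")
      case True
      then show "eventually (\<lambda>k. (\<exists>m. \<forall>j\<ge>m. ?Q k y j) \<longleftrightarrow> y \<longlonglongrightarrow> 0) sequentially"
        using vanishing_iff[of y] by simp
    next
      case False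
      then obtain k0 where k0: "\<not> (\<exists>m. \<forall>j\<ge>m. ?Q k0 y j)" using vanishing_iff[of y] by blast
      have "\<not> (\<exists>m. \<forall>j\<ge>m. ?Q k y j)" if k: "k0 \<le> k" for k
      proof
        assume "\<exists>m. \<forall>j\<ge>m. ?Q k y j"
        then obtain m where m: "\<And>j. j \<ge> m \<Longrightarrow> ?Q k y j" by blast
        have "?Q k0 y j" if "j \<ge> m" for j
        proof -
          have "ennreal (real (Suc k0)) * y j \<le> ennreal (real (Suc k)) * y j"
            by (intro mult_right_mono ennreal_leI) (use k in auto)
          then show ?thesis using m[OF that] by (rule order_trans)
        qed
        then show False using k0 by blast
      qed
      then show "eventually (\<lambda>k. (\<exists>m. \<forall>j\<ge>m. ?Q k y j) \<longleftrightarrow> y \<longlonglongrightarrow> 0) sequentially"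
        using False by (intro eventually_sequentiallyI[of k0]) blast
    qed
  qed
qed

lemma vanishing_add_iff:
  fixes y z :: "nat \<Rightarrow> ennreal"
  assumes a: "0 < a" and b: "0 < b"
  shows "(\<lambda>j. ennreal a * y j + ennreal b * z j) \<longlonglongrightarrow> 0 \<longleftrightarrow> y \<longlonglongrightarrow> 0 \<and> z \<longlonglongrightarrow> 0"
proof
  have *: "u \<longlonglongrightarrow> 0" if l: "v \<longlonglongrightarrow> 0" and le: "\<And>j. ennreal a * u j \<le> v j" and a: "0 < a" for u v :: "nat \<Rightarrow> ennreal" and a
  proof (rule tendsto_sandwich[OF _ _ tendsto_const])
    show "(\<lambda>j. ennreal (1 / a) * v j) \<longlonglongrightarrow> 0"
      using ennreal_tendsto_cmult[OF _ l, of "ennreal (1 / a)"] by simp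
    have "u j = ennreal (1 / a) * (ennreal a * u j)" for j
      unfolding mult.assoc[symmetric] using a by (subst ennreal_mult[symmetric]) auto
    then show "eventually (\<lambda>j. u j \<le> ennreal (1 / a) * v j) sequentially"
      using le by (intro always_eventually allI) (metis mult_left_mono zero_le)
  qed auto
  assume l: "(\<lambda>j. ennreal a * y j + ennreal b * z j) \<longlonglongrightarrow> 0"
  have "ennreal a * y j \<le> ennreal a * y j + ennreal b * z j" "ennreal b * z j \<le> ennreal a * y j + ennreal b * z j" for j
    by simp_all
  then show "y \<longlonglongrightarrow> 0 \<and> z \<longlonglongrightarrow> 0"
    using *[OF l _ a, of y] *[OF l _ b, of z] by blast
next
  assume r: "y \<longlonglongrightarrow> 0 \<and> z \<longlonglongrightarrow> 0"
  have "(\<lambda>j. ennreal a * y j + ennreal b * z j) \<longlonglongrightarrow> ennreal a * 0 + ennreal b * 0"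
    using r by (intro tendsto_add ennreal_tendsto_cmult) auto
  then show "(\<lambda>j. ennreal a * y j + ennreal b * z j) \<longlonglongrightarrow> 0" by simp
qed

section \<open>Extinction and vanishing potential\<close>

context mcsbp begin

lemma mass_meas_Omega [measurable]: "0 \<le> t \<Longrightarrow> (\<lambda>\<omega>. mass (X t \<omega>)) \<in> borel_measurable \<Omega>"
  by (rule measurable_compose[OF X_meas]) measurable

text \<open>
  Rational times suffice, because the total mass is lower semicontinuous from the right.
\<close>

definition recurrent_mass :: "real \<Rightarrow> 'w set" where
  "recurrent_mass \<eta> = {\<omega>\<in>space \<Omega>. \<forall>k::nat. \<exists>q\<in>\<rat> \<inter> {real k<..}. ennreal \<eta> < mass (X q \<omega>)}"

lemma late_large_mass_sets:
  "{\<omega>\<in>space \<Omega>. \<exists>q\<in>\<rat> \<inter> {real k<..}. ennreal \<eta> < mass (X q \<omega>)} \<in> sets \<Omega>"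
proof (rule sets.sets_Collect_countable_Ex')
  show "countable (\<rat> \<inter> {real k<..})" by (rule countable_Int1[OF countable_rat])
  show "{\<omega> \<in> space \<Omega>. ennreal \<eta> < mass (X q \<omega>)} \<in> sets \<Omega>" if "q \<in> \<rat> \<inter> {real k<..}" for q
  proof -
    have "0 \<le> q" using that by (auto intro: order_trans[OF of_nat_0_le_iff less_imp_le])
    then show ?thesis by measurable
  qed
qed

lemma recurrent_mass_sets [measurable]: "recurrent_mass \<eta> \<in> sets \<Omega>"
  unfolding recurrent_mass_def by (rule sets.sets_Collect_countable_All) (rule late_large_mass_sets)

lemma not_extinct_recurrent:
  assumes \<omega>: "\<omega> \<in> space \<Omega>" "\<omega> \<notin> extinction \<Omega> X"
  shows "\<exists>j. \<omega> \<in> recurrent_mass (1 / real (Suc j))"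
proof (rule ccontr)
  assume c: "\<nexists>j. \<omega> \<in> recurrent_mass (1 / real (Suc j))"
  have "((\<lambda>t. mass (X t \<omega>)) \<longlongrightarrow> 0) at_top"
  proof (rule order_tendstoI)
    fix e :: ennreal assume e: "0 < e"
    have "(\<lambda>j. ennreal (1 / real (Suc j))) \<longlonglongrightarrow> ennreal 0"
      using LIMSEQ_inverse_real_of_nat by (intro tendsto_ennrealI) (simp add: inverse_eq_divide)
    then have "eventually (\<lambda>j. ennreal (1 / real (Suc j)) < e) sequentially"
      by (rule order_tendstoD(2)) (use e in simp)
    then obtain j where j: "ennreal (1 / real (Suc j)) < e" by (auto simp: eventually_sequentially)
    obtain k :: nat where k: "\<And>q. q \<in> \<rat> \<Longrightarrow> real k < q \<Longrightarrow> mass (X q \<omega>) \<le> ennreal (1 / real (Suc j))"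
      using c \<omega>(1) unfolding recurrent_mass_def by (force simp: not_less)
    have "mass (X t \<omega>) < e" if t: "real k \<le> t" for t
    proof -
      have "mass (X t \<omega>) \<le> ennreal (1 / real (Suc j))"
        by (rule total_mass_le_if_rational[where X = "\<lambda>s. X s \<omega>", OF X_right_continuous[OF \<omega>(1)]])
          (use k t in \<open>auto intro: order_trans[OF of_nat_0_le_iff t]\<close>)
      then show ?thesis using j by (rule le_less_trans)
    qed
    then show "eventually (\<lambda>t. mass (X t \<omega>) < e) at_top" unfolding eventually_at_top_linorder by blast
  qed simp
  then show False using \<omega> unfolding extinction_def by simp
qed

text \<open>
  Let \<open>D k\<close> be the event that the potential stays below \<open>\<epsilon>\<close> from time \<open>k\<close> on.  For a finite set of
  times after \<open>k\<close>, decompose by the first one at which the mass exceeds \<open>\<eta>\<close>; on \<open>D k\<close> the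
  integral of the mass over the following interval is small, so \<open>large_mass_persists\<close> applies to each
  piece.  Since \<open>L\<close> is arbitrary, the probability is in fact \<open>0\<close>.
\<close>

lemma recurrent_extinct_bound:
  assumes \<mu>: "\<mu> \<in> finite_measures" and \<eta>: "0 \<le> \<eta>" and L: "0 < L"
  shows "measure (P \<mu>) (potential_extinction \<inter> recurrent_mass \<eta>) \<le> 2 * exp (- (\<eta> * L / 2))"
proof -
  interpret prob_space "P \<mu>" by (rule P_prob[OF \<mu>])
  let ?\<delta> = "2 * exp (- (\<eta> * L / 2))"
  obtain r0 where r0: "0 < r0" "r0 \<le> 1" and low: "\<And>s i. 0 \<le> s \<Longrightarrow> s \<le> r0 \<Longrightarrow> L / 2 \<le> cumulant s (\<lambda>_. L) i"
    using cumulant_lower[OF L] by blast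
  define \<epsilon> where "\<epsilon> = r0 / (2 * L) * exp (- (8 * B * (r0 + 1)))"
  have \<epsilon>: "0 < \<epsilon>" unfolding \<epsilon>_def using r0 L by simp
  define D where "D k = {\<omega>\<in>space \<Omega>. \<forall>j\<in>{k..}. potential (real j) \<omega> \<le> ennreal \<epsilon>}" for k :: nat
  have D [measurable]: "D k \<in> sets \<Omega>" for k unfolding D_def by measurable
  have setP: "A \<in> sets \<Omega> \<Longrightarrow> A \<in> events" for A by (simp add: P_sets[OF \<mu>])
  have small: "(\<integral>\<^sup>+r. indicator {0..r0} r * mass (X (q + max 0 r) \<omega>) \<partial>lborel) \<le> ennreal (r0 / (2 * L))"
    if \<omega>: "\<omega> \<in> D k" and q: "real k < q" for k q \<omega>
  proof -
    define j where "j = nat \<lfloor>q\<rfloor>"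
    have "0 \<le> q" using q by (meson less_imp_le of_nat_0_le_iff order_trans)
    then have j: "real j \<le> q" "q \<le> real j + 1" "k \<le> j" unfolding j_def using q by (auto simp: le_nat_iff le_floor_iff)
    have "(\<integral>\<^sup>+r. indicator {0..r0} r * mass (X (q + max 0 r) \<omega>) \<partial>lborel) \<le> ennreal (exp (8 * B * (r0 + 1))) * potential (real j) \<omega>"
      by (rule integral_mass_le_potential[OF _ j(1,2)]) (use \<omega> r0 in \<open>auto simp: D_def\<close>)
    also have "\<dots> \<le> ennreal (exp (8 * B * (r0 + 1))) * ennreal \<epsilon>"
      using \<omega> j(3) by (intro mult_left_mono) (auto simp: D_def)
    also have "\<dots> = ennreal (r0 / (2 * L))"
      using r0 L \<epsilon> unfolding \<epsilon>_def by (subst ennreal_mult[symmetric]) (auto simp: exp_minus)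
    finally show ?thesis .
  qed
  have fin: "prob ({\<omega>\<in>space \<Omega>. \<exists>q\<in>Q. ennreal \<eta> < mass (X q \<omega>)} \<inter> D k) \<le> ?\<delta>"
    if Q: "finite Q" "Q \<subseteq> {real k<..}" for Q k
  proof -
    have Q0: "0 \<le> q" if "q \<in> Q" for q using that Q(2) by (auto intro: order_trans[OF of_nat_0_le_iff less_imp_le])
    define A where "A q = {\<omega>\<in>space \<Omega>. ennreal \<eta> < mass (X q \<omega>) \<and> (\<forall>p\<in>{p\<in>Q. p < q}. mass (X p \<omega>) \<le> ennreal \<eta>)}" for q
    have AF: "A q \<in> sets (\<F> (ennreal q))" if q: "q \<in> Q" for q
    proof -
      have m: "(\<lambda>\<omega>. mass (X p \<omega>)) \<in> borel_measurable (\<F> (ennreal q))" if "p \<in> Q" "p \<le> q" for p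
        by (rule measurable_compose[OF X_meas_F[OF Q0[OF that(1)] that(2)] pairing_meas])
      have m1: "{\<omega>\<in>space (\<F> (ennreal q)). ennreal \<eta> < mass (X q \<omega>)} \<in> sets (\<F> (ennreal q))"
        using m[OF q order_refl] by measurable
      have m2: "{\<omega>\<in>space (\<F> (ennreal q)). \<forall>p\<in>{p\<in>Q. p < q}. mass (X p \<omega>) \<le> ennreal \<eta>} \<in> sets (\<F> (ennreal q))"
      proof (rule sets.sets_Collect_countable_All')
        fix p assume "p \<in> {p\<in>Q. p < q}"
        then have "(\<lambda>\<omega>. mass (X p \<omega>)) \<in> borel_measurable (\<F> (ennreal q))" by (intro m) auto
        then show "{\<omega>\<in>space (\<F> (ennreal q)). mass (X p \<omega>) \<le> ennreal \<eta>} \<in> sets (\<F> (ennreal q))" by measurable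
      qed (use Q(1) in \<open>auto intro: countable_finite\<close>)
      have "A q = {\<omega>\<in>space (\<F> (ennreal q)). ennreal \<eta> < mass (X q \<omega>)} \<inter> {\<omega>\<in>space (\<F> (ennreal q)). \<forall>p\<in>{p\<in>Q. p < q}. mass (X p \<omega>) \<le> ennreal \<eta>}"
        unfolding A_def space_F by auto
      then show ?thesis using sets.Int[OF m1 m2] by (simp only:)
    qed
    have AP: "A q \<in> events" if "q \<in> Q" for q using AF[OF that] sets_F_subset[of "ennreal q"] setP by blast
    have union: "{\<omega>\<in>space \<Omega>. \<exists>q\<in>Q. ennreal \<eta> < mass (X q \<omega>)} \<subseteq> (\<Union>q\<in>Q. A q)"
    proof
      fix \<omega> assume "\<omega> \<in> {\<omega>\<in>space \<Omega>. \<exists>q\<in>Q. ennreal \<eta> < mass (X q \<omega>)}"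
      then have \<omega>: "\<omega> \<in> space \<Omega>" and ne: "{q\<in>Q. ennreal \<eta> < mass (X q \<omega>)} \<noteq> {}" by auto
      define q where "q = Min {q\<in>Q. ennreal \<eta> < mass (X q \<omega>)}"
      have q: "q \<in> Q" "ennreal \<eta> < mass (X q \<omega>)"
        using Min_in[OF _ ne] Q(1) unfolding q_def by auto
      have "mass (X p \<omega>) \<le> ennreal \<eta>" if p: "p \<in> Q" "p < q" for p
      proof (rule ccontr)
        assume "\<not> mass (X p \<omega>) \<le> ennreal \<eta>"
        then have "q \<le> p" unfolding q_def using Q(1) p by (intro Min_le) auto
        then show False using p by simp
      qed
      then show "\<omega> \<in> (\<Union>q\<in>Q. A q)" using q \<omega> by (auto simp: A_def)
    qed
    have disj: "disjoint_family_on A Q"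
      unfolding disjoint_family_on_def
    proof (intro ballI impI)
      fix p q assume "p \<in> Q" "q \<in> Q" "p \<noteq> q"
      then show "A p \<inter> A q = {}" unfolding A_def by (cases "p < q") (force simp: not_less)+
    qed
    have one: "prob (A q \<inter> D k) \<le> ?\<delta> * prob (A q)" if q: "q \<in> Q" for q
    proof (rule large_mass_persists[OF \<mu> Q0[OF q] AF[OF q] L \<eta> _ r0(1) low D])
      show "ennreal \<eta> \<le> mass (X q \<omega>)" if "\<omega> \<in> A q" for \<omega> using that unfolding A_def by auto
      show "(\<integral>\<^sup>+r. indicator {0..r0} r * mass (X (q + max 0 r) \<omega>) \<partial>lborel) \<le> ennreal (r0 / (2 * L))" if "\<omega> \<in> D k" for \<omega>
        by (rule small[OF that]) (use q Q(2) in auto)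
    qed
    have "prob ({\<omega>\<in>space \<Omega>. \<exists>q\<in>Q. ennreal \<eta> < mass (X q \<omega>)} \<inter> D k) \<le> prob (\<Union>q\<in>Q. A q \<inter> D k)"
      using union AP setP[OF D] Q(1) by (intro finite_measure_mono) (auto intro!: sets.finite_UN)
    also have "\<dots> \<le> (\<Sum>q\<in>Q. prob (A q \<inter> D k))"
      using AP setP[OF D] Q(1) by (intro finite_measure_subadditive_finite) auto
    also have "\<dots> \<le> (\<Sum>q\<in>Q. ?\<delta> * prob (A q))" by (intro sum_mono one)
    also have "\<dots> = ?\<delta> * prob (\<Union>q\<in>Q. A q)"
      using finite_measure_finite_Union[OF Q(1) _ disj] AP by (simp add: sum_distrib_left image_subset_iff)
    also have "\<dots> \<le> ?\<delta> * 1" by (intro mult_left_mono) auto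
    finally show ?thesis by simp
  qed
  have ctb: "prob ({\<omega>\<in>space \<Omega>. \<exists>q\<in>\<rat> \<inter> {real k<..}. ennreal \<eta> < mass (X q \<omega>)} \<inter> D k) \<le> ?\<delta>" for k
  proof -
    have ctbl: "countable (\<rat> \<inter> {real k<..})" by (rule countable_Int1[OF countable_rat])
    have ne: "\<rat> \<inter> {real k<..} \<noteq> {}"
      using Rats_dense_in_real[of "real k" "real k + 1"] by auto
    define u where "u = from_nat_into (\<rat> \<inter> {real k<..})"
    have u: "range u = \<rat> \<inter> {real k<..}" unfolding u_def by (rule range_from_nat_into[OF ne ctbl])
    define U where "U m = {\<omega>\<in>space \<Omega>. \<exists>q\<in>u ` {..<m}. ennreal \<eta> < mass (X q \<omega>)} \<inter> D k" for m :: nat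
    have uk: "u i \<in> {real k<..}" for i using u by auto
    have u0: "0 \<le> u i" for i using uk[of i] by (auto intro: order_trans[OF of_nat_0_le_iff less_imp_le])
    have Um: "U m \<in> events" for m
    proof (rule setP)
      have "{\<omega>\<in>space \<Omega>. \<exists>q\<in>u ` {..<m}. ennreal \<eta> < mass (X q \<omega>)} = (\<Union>i<m. {\<omega>\<in>space \<Omega>. ennreal \<eta> < mass (X (u i) \<omega>)})" by auto
      moreover have "{\<omega>\<in>space \<Omega>. ennreal \<eta> < mass (X (u i) \<omega>)} \<in> sets \<Omega>" for i using u0[of i] by measurable
      ultimately show "U m \<in> sets \<Omega>" unfolding U_def by auto
    qed
    have "incseq U" unfolding U_def incseq_def by fastforce
    have "(\<lambda>m. prob (U m)) \<longlonglongrightarrow> prob (\<Union>m. U m)"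
      by (rule finite_Lim_measure_incseq[OF _ \<open>incseq U\<close>]) (use Um in auto)
    moreover have "prob (U m) \<le> ?\<delta>" for m
      unfolding U_def by (rule fin) (use uk in auto)
    ultimately have "prob (\<Union>m. U m) \<le> ?\<delta>" by (intro LIMSEQ_le_const2) auto
    moreover have "(\<Union>m. U m) = {\<omega>\<in>space \<Omega>. \<exists>q\<in>\<rat> \<inter> {real k<..}. ennreal \<eta> < mass (X q \<omega>)} \<inter> D k"
      unfolding U_def u[symmetric] by auto
    ultimately show ?thesis by simp
  qed
  define W where "W k = D k \<inter> recurrent_mass \<eta>" for k
  have Wm: "W k \<in> events" for k unfolding W_def using setP[OF D] setP[OF recurrent_mass_sets] by auto
  have "incseq W" unfolding W_def D_def incseq_def by auto
  have "(\<lambda>k. prob (W k)) \<longlonglongrightarrow> prob (\<Union>k. W k)"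
    by (rule finite_Lim_measure_incseq[OF _ \<open>incseq W\<close>]) (use Wm in auto)
  moreover have "prob (W k) \<le> ?\<delta>" for k
  proof -
    have "prob (W k) \<le> prob ({\<omega>\<in>space \<Omega>. \<exists>q\<in>\<rat> \<inter> {real k<..}. ennreal \<eta> < mass (X q \<omega>)} \<inter> D k)"
      using setP[OF D] setP[OF late_large_mass_sets]
      by (intro finite_measure_mono) (auto simp: W_def recurrent_mass_def)
    then show ?thesis using ctb[of k] by simp
  qed
  ultimately have "prob (\<Union>k. W k) \<le> ?\<delta>" by (intro LIMSEQ_le_const2) auto
  moreover have "prob (potential_extinction \<inter> recurrent_mass \<eta>) \<le> prob (\<Union>k. W k)"
  proof (rule finite_measure_mono)
    show "potential_extinction \<inter> recurrent_mass \<eta> \<subseteq> (\<Union>k. W k)"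
    proof
      fix \<omega> assume \<omega>: "\<omega> \<in> potential_extinction \<inter> recurrent_mass \<eta>"
      then have l: "(\<lambda>k. potential (real k) \<omega>) \<longlonglongrightarrow> 0" and sp: "\<omega> \<in> space \<Omega>" unfolding potential_extinction_def by auto
      have "eventually (\<lambda>k. potential (real k) \<omega> < ennreal \<epsilon>) sequentially"
        by (rule order_tendstoD(2)[OF l]) (use \<epsilon> in simp)
      then obtain k where "\<And>j. k \<le> j \<Longrightarrow> potential (real j) \<omega> < ennreal \<epsilon>" unfolding eventually_sequentially by blast
      then have "\<omega> \<in> D k" unfolding D_def using sp by (auto intro: less_imp_le)
      then show "\<omega> \<in> (\<Union>k. W k)" using \<omega> unfolding W_def by auto
    qed
  qed (use Wm in auto)
  ultimately show ?thesis by simp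
qed

lemma prob_potential_extinction:
  assumes \<mu>: "\<mu> \<in> finite_measures"
  shows "measure (P \<mu>) (extinction \<Omega> X) = measure (P \<mu>) potential_extinction"
proof -
  interpret prob_space "P \<mu>" by (rule P_prob[OF \<mu>])
  have setP: "A \<in> sets \<Omega> \<Longrightarrow> A \<in> events" for A by (simp add: P_sets[OF \<mu>])
  have null: "potential_extinction \<inter> recurrent_mass (1 / real (Suc j)) \<in> null_sets (P \<mu>)" for j
  proof -
    define \<eta> where "\<eta> = 1 / real (Suc j)"
    have "prob (potential_extinction \<inter> recurrent_mass \<eta>) \<le> 0"
    proof (rule LIMSEQ_le_const)
      have "filterlim (\<lambda>m. \<eta> / 2 * real (Suc m)) at_top sequentially"
        by (rule filterlim_tendsto_pos_mult_at_top[OF tendsto_const _ filterlim_compose[OF filterlim_real_sequentially filterlim_Suc]])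
          (simp add: \<eta>_def)
      then have "(\<lambda>m. exp (- (\<eta> / 2 * real (Suc m)))) \<longlonglongrightarrow> 0"
        by (intro filterlim_compose[OF exp_at_bot] filterlim_compose[OF filterlim_uminus_at_bot_at_top])
      from tendsto_mult[OF tendsto_const[of 2] this]
      show "(\<lambda>m. 2 * exp (- (\<eta> / 2 * real (Suc m)))) \<longlonglongrightarrow> 0" by simp
      show "\<exists>N. \<forall>m\<ge>N. prob (potential_extinction \<inter> recurrent_mass \<eta>) \<le> 2 * exp (- (\<eta> / 2 * real (Suc m)))"
        using recurrent_extinct_bound[OF \<mu>, of \<eta> "real (Suc _)"] by (auto simp: \<eta>_def)
    qed
    then have "prob (potential_extinction \<inter> recurrent_mass \<eta>) = 0" by (simp add: measure_le_0_iff)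
    then show ?thesis unfolding \<eta>_def
      by (intro null_setsI) (auto simp: emeasure_eq_measure intro!: setP)
  qed
  have "(\<Union>j. potential_extinction \<inter> recurrent_mass (1 / real (Suc j))) \<in> null_sets (P \<mu>)"
    by (rule null_sets_UN) (rule null)
  then have "AE \<omega> in P \<mu>. \<omega> \<notin> (\<Union>j. potential_extinction \<inter> recurrent_mass (1 / real (Suc j)))" by (rule AE_not_in)
  then have "AE \<omega> in P \<mu>. \<omega> \<in> extinction \<Omega> X \<longleftrightarrow> \<omega> \<in> potential_extinction"
    using AE_space
  proof eventually_elim
    case (elim \<omega>)
    then show ?case
      using not_extinct_recurrent[of \<omega>] extinction_subset P_space[OF \<mu>] by blast
  qed
  then show ?thesis
    by (rule finite_measure_eq_AE) (auto intro!: setP extinction_in_sets[OF strong_markov])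
qed

end

section \<open>The branching property of the potential\<close>

abbreviation seqs :: "(nat \<Rightarrow> ennreal) measure" where
  "seqs \<equiv> Pi\<^sub>M UNIV (\<lambda>_. borel)"

lemma exp_mono_plus: "exp_mono M \<theta> (\<lambda>j. y j + z j) = exp_mono M \<theta> y * exp_mono M \<theta> z"
  unfolding exp_mono_def by (simp add: distrib_left sum.distrib exp_neg_add)

lemma exp_mono_range: "0 \<le> exp_mono M \<theta> y" "exp_mono M \<theta> y \<le> 1" "\<bar>exp_mono M \<theta> y\<bar> \<le> 1"
  unfolding exp_mono_def by (rule exp_neg_nonneg exp_neg_le_1 exp_neg_abs_le_1)+

lemma exp_mono_meas: "exp_mono M \<theta> \<in> borel_measurable seqs"
  unfolding exp_mono_def by measurable

lemma plus_seqs_meas: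
  assumes "Z1 \<in> M \<rightarrow>\<^sub>M seqs" "Z2 \<in> N \<rightarrow>\<^sub>M seqs"
  shows "(\<lambda>p j. Z1 (fst p) j + Z2 (snd p) j) \<in> M \<Otimes>\<^sub>M N \<rightarrow>\<^sub>M seqs"
proof (rule measurable_abs_UNIV)
  fix j
  have "(\<lambda>x. x j) \<in> seqs \<rightarrow>\<^sub>M borel" by (rule measurable_component_singleton) simp
  then have [measurable]: "(\<lambda>x. Z1 x j) \<in> borel_measurable M" "(\<lambda>x. Z2 x j) \<in> borel_measurable N"
    using measurable_compose[OF assms(1)] measurable_compose[OF assms(2)] by blast+
  show "(\<lambda>p. Z1 (fst p) j + Z2 (snd p) j) \<in> borel_measurable (M \<Otimes>\<^sub>M N)" by measurable
qed

lemma prob_pair: "prob_space M \<Longrightarrow> prob_space N \<Longrightarrow> prob_space (M \<Otimes>\<^sub>M N)"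
  by (simp add: prob_space_pair)

lemma integral_independent:
  fixes f g :: "_ \<Rightarrow> real"
  assumes M: "prob_space M" and N: "prob_space N"
    and f: "f \<in> borel_measurable M" "\<And>x. \<bar>f x\<bar> \<le> 1" and g: "g \<in> borel_measurable N" "\<And>x. \<bar>g x\<bar> \<le> 1"
  shows "(\<integral>p. f (fst p) * g (snd p) \<partial>(M \<Otimes>\<^sub>M N)) = (\<integral>x. f x \<partial>M) * (\<integral>y. g y \<partial>N)"
proof -
  interpret M: prob_space M by fact
  interpret N: prob_space N by fact
  interpret pair_sigma_finite M N ..
  note [measurable] = f(1) g(1)
  have "integrable (M \<Otimes>\<^sub>M N) (\<lambda>p. f (fst p) * g (snd p))"
  proof (rule bounded_integrable[OF prob_pair[OF M N], where C = 1])
    show "\<bar>f (fst p) * g (snd p)\<bar> \<le> 1" for p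
      unfolding abs_mult by (intro mult_le_one f(2) g(2)) auto
  qed measurable
  from integral_fst'[OF this] show ?thesis by simp
qed

lemma exp_poly_independent:
  assumes M: "prob_space M" and N: "prob_space N"
    and Z: "Z1 \<in> M \<rightarrow>\<^sub>M seqs" "Z2 \<in> N \<rightarrow>\<^sub>M seqs"
  shows "(\<integral>p. (\<Sum>k\<in>S. a k * exp_mono (m k) (\<theta> k) (\<lambda>j. Z1 (fst p) j + Z2 (snd p) j)) \<partial>(M \<Otimes>\<^sub>M N))
    = (\<Sum>k\<in>S. a k * ((\<integral>x. exp_mono (m k) (\<theta> k) (Z1 x) \<partial>M) * (\<integral>x. exp_mono (m k) (\<theta> k) (Z2 x) \<partial>N)))"
proof -
  note me = measurable_compose[OF Z(1) exp_mono_meas] measurable_compose[OF Z(2) exp_mono_meas]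
  have "(\<integral>p. (\<Sum>k\<in>S. a k * exp_mono (m k) (\<theta> k) (\<lambda>j. Z1 (fst p) j + Z2 (snd p) j)) \<partial>(M \<Otimes>\<^sub>M N))
    = (\<Sum>k\<in>S. \<integral>p. a k * exp_mono (m k) (\<theta> k) (\<lambda>j. Z1 (fst p) j + Z2 (snd p) j) \<partial>(M \<Otimes>\<^sub>M N))"
    by (intro Bochner_Integration.integral_sum integrable_mult_right
        bounded_integrable[OF prob_pair[OF M N], where C = 1] exp_mono_range
        measurable_compose[OF plus_seqs_meas[OF Z] exp_mono_meas])
  also have "\<dots> = (\<Sum>k\<in>S. a k * (\<integral>p. exp_mono (m k) (\<theta> k) (Z1 (fst p)) * exp_mono (m k) (\<theta> k) (Z2 (snd p)) \<partial>(M \<Otimes>\<^sub>M N)))"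
    by (simp add: exp_mono_plus)
  also have "\<dots> = (\<Sum>k\<in>S. a k * ((\<integral>x. exp_mono (m k) (\<theta> k) (Z1 x) \<partial>M) * (\<integral>x. exp_mono (m k) (\<theta> k) (Z2 x) \<partial>N)))"
    by (simp only: integral_independent[OF M N me(1) exp_mono_range(3) me(2) exp_mono_range(3)])
  finally show ?thesis .
qed

lemma lin_scale:
  assumes "\<mu> \<in> finite_measures" "\<And>j. 0 \<le> f j" "\<And>j. f j \<le> F"
  shows "lin f (\<lambda>j. a * \<mu> j) = a * lin f \<mu>"
  unfolding lin_def using suminf_mult[OF lin_summable[OF assms], of a] by (simp add: mult.left_commute)

lemma lin_plus:
  assumes "\<mu> \<in> finite_measures" "\<nu> \<in> finite_measures" "\<And>j. 0 \<le> f j" "\<And>j. f j \<le> F"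
  shows "lin f (\<lambda>j. \<mu> j + \<nu> j) = lin f \<mu> + lin f \<nu>"
  unfolding lin_def using suminf_add[OF lin_summable[OF assms(1,3,4)] lin_summable[OF assms(2-4)]]
  by (simp add: distrib_left)

text \<open>
  Functions for which an identity between laws can be verified on exponentials alone.
\<close>

inductive exp_closure :: "((nat \<Rightarrow> ennreal) \<Rightarrow> real) \<Rightarrow> bool" where
  exp_closure_base: "exp_poly G \<Longrightarrow> exp_closure G"
| exp_closure_lim: "(\<And>k. exp_closure (G k)) \<Longrightarrow> (\<And>k y. \<bar>G k y\<bar> \<le> C) \<Longrightarrow> (\<And>y. (\<lambda>k::nat. G k y) \<longlonglongrightarrow> H y) \<Longrightarrow> exp_closure H"

lemma exp_closure_meas: "exp_closure G \<Longrightarrow> G \<in> borel_measurable seqs"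
proof (induction rule: exp_closure.induct)
  case (exp_closure_lim G C H)
  show ?case by (rule borel_measurable_LIMSEQ_real[OF exp_closure_lim.hyps(3) exp_closure_lim.IH])
qed (rule exp_poly_meas)

lemma antitone_test_exp_closure: "antitone_test G \<Longrightarrow> exp_closure G"
proof (induction rule: antitone_test.induct)
  case (antitone_test_lim G H)
  show ?case
    by (rule exp_closure_lim[OF antitone_test_lim.IH _ antitone_test_lim.hyps(2), where C = 1]) (use antitone_test_bounds[OF antitone_test_lim.hyps(1)] in \<open>auto simp: abs_le_iff\<close>)
qed (rule exp_closure_base)

lemma exp_poly_bounded: "exp_poly G \<Longrightarrow> \<exists>K. \<forall>y. \<bar>G y\<bar> \<le> K"
proof (induction rule: exp_poly.induct)
  case (exp_poly_step G \<theta> a M)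
  then obtain K where K: "\<And>y. \<bar>G y\<bar> \<le> K" by blast
  have "\<bar>a * exp_mono M \<theta> y + G y\<bar> \<le> \<bar>a\<bar> + K" for y
  proof -
    have "\<bar>a * exp_mono M \<theta> y\<bar> \<le> \<bar>a\<bar> * 1" unfolding abs_mult by (intro mult_left_mono exp_mono_range) simp
    then show ?thesis using K[of y] by linarith
  qed
  then show ?case by blast
qed auto

lemma exp_closure_square_diff: "exp_closure F \<Longrightarrow> exp_poly G \<Longrightarrow> exp_closure (\<lambda>y. (F y - G y)\<^sup>2)"
proof (induction rule: exp_closure.induct)
  case (exp_closure_base F)
  then show ?case by (intro exp_closure.exp_closure_base exp_poly_power exp_poly_diff)
next
  case (exp_closure_lim F C H)
  obtain K where K: "\<And>y. \<bar>G y\<bar> \<le> K" using exp_poly_bounded[OF exp_closure_lim.prems] by blast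
  show ?case
  proof (rule exp_closure.exp_closure_lim[OF exp_closure_lim.IH[OF exp_closure_lim.prems]])
    show "\<bar>(F k y - G y)\<^sup>2\<bar> \<le> (C + K)\<^sup>2" for k y
    proof -
      have "\<bar>F k y - G y\<bar> \<le> C + K" using exp_closure_lim.hyps(2)[of k y] K[of y] by linarith
      then have "\<bar>F k y - G y\<bar>\<^sup>2 \<le> (C + K)\<^sup>2" by (rule power_mono) simp
      then show ?thesis by simp
    qed
    show "(\<lambda>k. (F k y - G y)\<^sup>2) \<longlonglongrightarrow> (H y - G y)\<^sup>2" for y
      by (intro tendsto_intros exp_closure_lim.hyps(3))
  qed
qed

text \<open>
  Mean square approximation passes through the iterated limits, whereas no sequence need converge
  pointwise.
\<close>

lemma antitone_test_approx:
  assumes "antitone_test F" "prob_space M" and Z: "Z \<in> M \<rightarrow>\<^sub>M seqs" and \<epsilon>: "0 < \<epsilon>"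
  shows "\<exists>G. exp_poly G \<and> (\<integral>x. (F (Z x) - G (Z x))\<^sup>2 \<partial>M) \<le> \<epsilon>"
  using assms(1) \<epsilon>
proof (induction arbitrary: \<epsilon> rule: antitone_test.induct)
  case (antitone_test_base G)
  then show ?case by (intro exI[of _ G]) auto
next
  case (antitone_test_lim F H)
  have r: "0 \<le> F k y" "F k y \<le> 1" "0 \<le> H y" "H y \<le> 1" for k y
    using antitone_test_bounds[OF antitone_test_lim.hyps(1)] antitone_test_bounds[OF antitone_test.antitone_test_lim[OF antitone_test_lim.hyps]] by auto
  note meas = measurable_compose[OF Z antitone_test_meas[OF antitone_test_lim.hyps(1)]] measurable_compose[OF Z antitone_test_meas[OF antitone_test.antitone_test_lim[OF antitone_test_lim.hyps]]]
  have "(\<lambda>k. \<integral>x. (H (Z x) - F k (Z x))\<^sup>2 \<partial>M) \<longlonglongrightarrow> (\<integral>x. (H (Z x) - H (Z x))\<^sup>2 \<partial>M)"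
  proof (rule prob_tendsto_integral[OF assms(2), where C = 1])
    show "\<bar>(H (Z x) - F k (Z x))\<^sup>2\<bar> \<le> 1" for k x
    proof -
      have "\<bar>H (Z x) - F k (Z x)\<bar> \<le> 1" using r(1,2)[of k "Z x"] r(3,4)[of "Z x"] by linarith
      then show ?thesis by (simp add: abs_square_le_1)
    qed
    show "(\<lambda>k. (H (Z x) - F k (Z x))\<^sup>2) \<longlonglongrightarrow> (H (Z x) - H (Z x))\<^sup>2" for x
      by (intro tendsto_intros antitone_test_lim.hyps(2))
  qed (use meas in simp)
  then have "eventually (\<lambda>k. (\<integral>x. (H (Z x) - F k (Z x))\<^sup>2 \<partial>M) < \<epsilon> / 4) sequentially"
    by (intro order_tendstoD(2)) (use antitone_test_lim.prems in auto)
  then obtain k where k: "(\<integral>x. (H (Z x) - F k (Z x))\<^sup>2 \<partial>M) < \<epsilon> / 4" by (auto simp: eventually_sequentially)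
  obtain G where G: "exp_poly G" "(\<integral>x. (F k (Z x) - G (Z x))\<^sup>2 \<partial>M) \<le> \<epsilon> / 4"
    using antitone_test_lim.IH[of "\<epsilon> / 4" k] antitone_test_lim.prems by auto
  obtain K where K: "\<And>y. \<bar>G y\<bar> \<le> K" using exp_poly_bounded[OF G(1)] by blast
  have K0: "0 \<le> K" using K[of "\<lambda>_. 0"] by linarith
  note mG = measurable_compose[OF Z exp_poly_meas[OF G(1)]]
  have sq: "\<bar>(u - v)\<^sup>2\<bar> \<le> (1 + K)\<^sup>2" if "\<bar>u - v\<bar> \<le> 1 + K" for u v :: real
    using power_mono[OF that, of 2] by simp
  have d: "\<bar>H y - F k y\<bar> \<le> 1 + K" "\<bar>F k y - G y\<bar> \<le> 1 + K" "\<bar>H y - G y\<bar> \<le> 1 + K" for y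
    using r(1,2)[of k y] r(3,4)[of y] K[of y] K0 by linarith+
  have int: "integrable M (\<lambda>x. (H (Z x) - F k (Z x))\<^sup>2)" "integrable M (\<lambda>x. (F k (Z x) - G (Z x))\<^sup>2)"
    "integrable M (\<lambda>x. (H (Z x) - G (Z x))\<^sup>2)"
    by (rule bounded_integrable[OF assms(2) _ sq]; use meas mG d in simp)+
  have "(\<integral>x. (H (Z x) - G (Z x))\<^sup>2 \<partial>M) \<le> (\<integral>x. 2 * (H (Z x) - F k (Z x))\<^sup>2 + 2 * (F k (Z x) - G (Z x))\<^sup>2 \<partial>M)"
  proof (rule integral_mono)
    show "(H (Z x) - G (Z x))\<^sup>2 \<le> 2 * (H (Z x) - F k (Z x))\<^sup>2 + 2 * (F k (Z x) - G (Z x))\<^sup>2" for x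
      using zero_le_power2[of "(H (Z x) - F k (Z x)) - (F k (Z x) - G (Z x))"] by (simp add: power2_eq_square algebra_simps)
  qed (intro int Bochner_Integration.integrable_add integrable_mult_right)+
  also have "\<dots> = 2 * (\<integral>x. (H (Z x) - F k (Z x))\<^sup>2 \<partial>M) + 2 * (\<integral>x. (F k (Z x) - G (Z x))\<^sup>2 \<partial>M)"
    using int by simp
  also have "\<dots> \<le> \<epsilon>" using k G(2) by linarith
  finally show ?case using G(1) by blast
qed

definition null_ind :: "(nat \<Rightarrow> ennreal) \<Rightarrow> real" where
  "null_ind y = (if y \<longlonglongrightarrow> 0 then 1 else 0)"

lemma antitone_test_null_ind: "antitone_test null_ind"
  using antitone_test_vanishing unfolding null_ind_def[abs_def] .

lemma null_ind_meas: "null_ind \<in> borel_measurable seqs"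
  by (rule antitone_test_meas[OF antitone_test_null_ind])

lemma null_ind_plus: "null_ind (\<lambda>j. y j + z j) = null_ind y * null_ind z"
  using vanishing_add_iff[of 1 1 y z] unfolding null_ind_def by simp

lemma null_ind_range: "0 \<le> null_ind y" "null_ind y \<le> 1" "\<bar>null_ind y\<bar> \<le> 1"
  unfolding null_ind_def by auto

lemma null_ind_scale:
  assumes "0 < a" shows "null_ind (\<lambda>j. ennreal a * y j) = null_ind y"
  using vanishing_add_iff[of a 1 y "\<lambda>_. 0"] assms unfolding null_ind_def by simp

text \<open>
  A multiplicative function with values in \<open>[0,1]\<close> is decreasing, hence exponential; comparison with
  multiples of \<open>1\<close> replaces any continuity assumption.
\<close>

lemma multiplicative_bounded:
  fixes h :: "real \<Rightarrow> real"
  assumes mult: "\<And>a b. 0 \<le> a \<Longrightarrow> 0 \<le> b \<Longrightarrow> h (a + b) = h a * h b"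
    and range: "\<And>a. 0 \<le> a \<Longrightarrow> 0 \<le> h a" "\<And>a. 0 \<le> a \<Longrightarrow> h a \<le> 1" and h0: "h 0 = 1" and a: "0 \<le> a"
  shows "h a = exp_neg (neg_log (h 1) * ennreal a)"
proof -
  have anti: "h y \<le> h x" if "0 \<le> x" "x \<le> y" for x y
  proof -
    have "h y = h x * h (y - x)" using mult[of x "y - x"] that by simp
    also have "\<dots> \<le> h x * 1" using that range by (intro mult_left_mono) auto
    finally show ?thesis by simp
  qed
  have pow: "h (real k * x) = h x ^ k" if "0 \<le> x" for k x
  proof (induction k)
    case (Suc k)
    have "h (real (Suc k) * x) = h (x + real k * x)" by (simp add: algebra_simps)
    also have "\<dots> = h x * h x ^ k" using that Suc by (subst mult) auto
    finally show ?case by simp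
  qed (simp add: h0)
  show ?thesis
  proof (cases "h 1 = 0")
    case True
    show ?thesis
    proof (cases "a = 0")
      case False
      obtain k :: nat where "1 / a < real k" using reals_Archimedean2 by blast
      then have "1 \<le> real k * a" using a False by (simp add: field_simps)
      then have "h a ^ k \<le> 0" using pow[OF a, of k] anti[of 1 "real k * a"] True by simp
      then have "h a = 0" using range(1)[OF a] by (metis zero_less_power less_le not_le)
      then show ?thesis using True False a by (simp add: neg_log_def exp_neg_def ennreal_top_mult)
    qed (simp add: h0)
  next
    case False
    then have h1: "0 < h 1" using range(1)[of 1] by simp
    have pos: "0 < h x" if "0 \<le> x" for x
    proof -
      obtain k :: nat where k: "x \<le> real k" using real_arch_simple by blast
      have "0 < h 1 ^ k" using h1 by simp
      also have "\<dots> = h (real k)" using pow[of 1 k] by simp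
      also have "\<dots> \<le> h x" by (rule anti[OF that k])
      finally show ?thesis .
    qed
    define g where "g x = - ln (h x)" for x
    have g_mono: "g x \<le> g y" if "0 \<le> x" "x \<le> y" for x y
      unfolding g_def using anti[OF that] pos[of y] that by simp
    have g_pow: "g (real k * x) = real k * g x" if "0 \<le> x" for k x
      unfolding g_def pow[OF that] using pos[OF that] by (simp add: ln_realpow)
    have g1: "0 \<le> g 1" unfolding g_def using range(2)[of 1] h1 by simp
    have dist: "real k * \<bar>g a - a * g 1\<bar> \<le> g 1" for k
    proof -
      define q where "q = nat \<lfloor>real k * a\<rfloor>"
      have q: "real q \<le> real k * a" "real k * a \<le> real (Suc q)"
        unfolding q_def using a by (auto simp: of_nat_nat) linarith
      have "real q * g 1 \<le> real k * g a"
        using g_mono[of "real q * 1" "real k * a"] q(1) g_pow[of 1 q] g_pow[OF a, of k] by simp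
      moreover have "real k * g a \<le> real (Suc q) * g 1"
        using g_mono[of "real k * a" "real (Suc q) * 1"] q(2) g_pow[of 1 "Suc q"] g_pow[OF a, of k] a by simp
      moreover have "real q * g 1 \<le> real k * a * g 1" "real k * a * g 1 \<le> real (Suc q) * g 1"
        using q g1 by (auto intro: mult_right_mono)
      ultimately have "\<bar>real k * g a - real k * a * g 1\<bar> \<le> g 1" by (simp add: algebra_simps abs_le_iff)
      moreover have "real k * \<bar>g a - a * g 1\<bar> = \<bar>real k * g a - real k * a * g 1\<bar>"
        using abs_mult[of "real k" "g a - a * g 1"] by (simp add: right_diff_distrib mult.assoc)
      ultimately show ?thesis by simp
    qed
    have "g a = a * g 1"
    proof (rule ccontr)
      assume "g a \<noteq> a * g 1"
      then have "0 < \<bar>g a - a * g 1\<bar>" by simp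
      from reals_Archimedean3[OF this] obtain k where "g 1 < real k * \<bar>g a - a * g 1\<bar>" by blast
      then show False using dist[of k] by simp
    qed
    then have "h a = exp (- (a * - ln (h 1)))" unfolding g_def using pos[OF a] by (metis exp_ln minus_minus)
    moreover have "neg_log (h 1) * ennreal a = ennreal (a * - ln (h 1))"
      using h1 range(2)[of 1] a unfolding neg_log_def by (simp add: ennreal_mult[symmetric] mult.commute)
    moreover have "0 \<le> a * - ln (h 1)" using a g1 unfolding g_def by (rule mult_nonneg_nonneg)
    ultimately show ?thesis by (simp only: exp_neg_ennreal)
  qed
qed

context mcsbp begin

text \<open>
  The factor \<open>lam\<close> compensates for the change of the potential when its starting time is moved within
  \<open>[0,1]\<close>.
\<close>

definition potential_path :: "real \<Rightarrow> real \<Rightarrow> 'w \<Rightarrow> nat \<Rightarrow> ennreal" where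
  "potential_path lam \<sigma> \<omega> j = ennreal lam * potential (\<sigma> + real j) \<omega>"

lemma potential_path_meas:
  assumes "\<mu> \<in> finite_measures" "0 \<le> \<sigma>"
  shows "potential_path lam \<sigma> \<in> P \<mu> \<rightarrow>\<^sub>M seqs"
proof -
  have "(\<lambda>\<omega> j. potential_path lam \<sigma> \<omega> j) \<in> P \<mu> \<rightarrow>\<^sub>M seqs"
  proof (rule measurable_abs_UNIV)
    fix j
    have [measurable]: "potential (\<sigma> + real j) \<in> borel_measurable (P \<mu>)" by (rule potential_meas[OF assms(1)]) (use assms in simp)
    show "(\<lambda>\<omega>. potential_path lam \<sigma> \<omega> j) \<in> borel_measurable (P \<mu>)" unfolding potential_path_def by measurable
  qed
  then show ?thesis by simp
qed

lemma potential_path_laplace: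
  assumes \<theta>: "\<And>j. 0 \<le> \<theta> j" and lam: "0 \<le> lam"
  shows "\<exists>F G. (\<forall>j. 0 \<le> F j \<and> F j \<le> G) \<and>
    (\<forall>\<sigma>\<ge>0. \<forall>\<mu>\<in>finite_measures. (\<integral>\<omega>. exp_mono M \<theta> (potential_path lam \<sigma> \<omega>) \<partial>P \<mu>) = exp (- lin (cumulant \<sigma> F) \<mu>))"
proof -
  have "0 \<le> lam * \<theta> j" for j using \<theta> lam by simp
  then obtain F G where FG: "\<forall>j. 0 \<le> F j \<and> F j \<le> G" and L: "\<forall>\<sigma>\<ge>0. \<forall>\<mu>\<in>finite_measures.
      (\<integral>\<omega>. exp_neg (\<Sum>j<M. ennreal (lam * \<theta> j) * potential (\<sigma> + real j) \<omega>) \<partial>P \<mu>) = exp (- lin (cumulant \<sigma> F) \<mu>)"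
    using potential_laplace[of "\<lambda>j. lam * \<theta> j" M] by blast
  have "(\<Sum>j<M. ennreal (lam * \<theta> j) * potential (\<sigma> + real j) \<omega>) = (\<Sum>j<M. ennreal (\<theta> j) * potential_path lam \<sigma> \<omega> j)" for \<sigma> \<omega>
    unfolding potential_path_def using \<theta> lam by (intro sum.cong refl) (simp add: ennreal_mult mult_ac)
  then have "(\<integral>\<omega>. exp_mono M \<theta> (potential_path lam \<sigma> \<omega>) \<partial>P \<mu>) = exp (- lin (cumulant \<sigma> F) \<mu>)" if "0 \<le> \<sigma>" "\<mu> \<in> finite_measures" for \<sigma> \<mu>
    using L that unfolding exp_mono_def by simp
  then show ?thesis using FG by (intro exI[of _ F] exI[of _ G]) simp
qed

lemma potential_path_laplace_0:
  assumes \<theta>: "\<And>j. 0 \<le> \<theta> j"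
  shows "\<exists>F G. (\<forall>j. 0 \<le> F j \<and> F j \<le> G) \<and>
    (\<forall>\<mu>\<in>finite_measures. (\<integral>\<omega>. exp_mono M \<theta> (potential_path 1 0 \<omega>) \<partial>P \<mu>) = exp (- lin F \<mu>))"
proof -
  obtain F G where FG: "\<forall>j. 0 \<le> F j \<and> F j \<le> G" and L: "\<forall>\<sigma>\<ge>0. \<forall>\<mu>\<in>finite_measures.
      (\<integral>\<omega>. exp_mono M \<theta> (potential_path 1 \<sigma> \<omega>) \<partial>P \<mu>) = exp (- lin (cumulant \<sigma> F) \<mu>)"
    using potential_path_laplace[of \<theta> 1 M, OF \<theta> zero_le_one] by (elim exE conjE) (rule that)
  have F: "0 \<le> F j" "F j \<le> G" for j using FG by simp_all
  have "(\<integral>\<omega>. exp_mono M \<theta> (potential_path 1 0 \<omega>) \<partial>P \<mu>) = exp (- lin F \<mu>)" if "\<mu> \<in> finite_measures" for \<mu>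
    using L[rule_format, OF order_refl that] unfolding cumulant_0[OF F] .
  with FG show ?thesis by (intro exI[of _ F] exI[of _ G] conjI ballI)
qed

lemma null_ind_potential_path:
  assumes \<omega>: "\<omega> \<in> space \<Omega>" and \<sigma>: "0 \<le> \<sigma>" and lam: "0 < lam"
  shows "null_ind (potential_path lam \<sigma> \<omega>) = indicator potential_extinction \<omega>"
proof -
  have le: "v \<longlonglongrightarrow> 0 \<Longrightarrow> u \<longlonglongrightarrow> 0" if "\<And>j. u j \<le> ennreal C * v j" for u v :: "nat \<Rightarrow> ennreal" and C
  proof (rule tendsto_sandwich[OF _ _ tendsto_const])
    show "v \<longlonglongrightarrow> 0 \<Longrightarrow> (\<lambda>j. ennreal C * v j) \<longlonglongrightarrow> 0"
      using ennreal_tendsto_cmult[of "ennreal C" v 0] by simp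
  qed (use that in auto)
  have "(\<lambda>j. potential (\<sigma> + real j) \<omega>) \<longlonglongrightarrow> 0 \<longleftrightarrow> (\<lambda>k. potential (real k) \<omega>) \<longlonglongrightarrow> 0"
  proof
    assume "(\<lambda>k. potential (real k) \<omega>) \<longlonglongrightarrow> 0"
    then show "(\<lambda>j. potential (\<sigma> + real j) \<omega>) \<longlonglongrightarrow> 0"
      by (rule le[rotated]) (use potential_shift[OF \<omega> _ \<sigma>, of "real _"] in \<open>simp add: add.commute\<close>)
  next
    assume l: "(\<lambda>j. potential (\<sigma> + real j) \<omega>) \<longlonglongrightarrow> 0"
    obtain q :: nat where q: "\<sigma> \<le> real q" using real_arch_simple by blast
    have "potential (real (j + q)) \<omega> \<le> ennreal (exp (8 * B * (real q - \<sigma>))) * potential (\<sigma> + real j) \<omega>" for j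
      using potential_shift[OF \<omega>, of "\<sigma> + real j" "real q - \<sigma>"] \<sigma> q by (simp add: algebra_simps)
    from le[OF this l] show "(\<lambda>k. potential (real k) \<omega>) \<longlonglongrightarrow> 0" by (rule LIMSEQ_offset)
  qed
  moreover have "null_ind (potential_path lam \<sigma> \<omega>) = null_ind (\<lambda>j. potential (\<sigma> + real j) \<omega>)"
    using null_ind_scale[OF lam, of "\<lambda>j. potential (\<sigma> + real j) \<omega>"] unfolding potential_path_def[abs_def] by simp
  ultimately show ?thesis using \<omega> unfolding null_ind_def potential_extinction_def by (simp add: indicator_def)
qed

lemma integral_null_ind_potential_path:
  assumes \<mu>: "\<mu> \<in> finite_measures" and \<sigma>: "0 \<le> \<sigma>" and lam: "0 < lam"
  shows "(\<integral>\<omega>. null_ind (potential_path lam \<sigma> \<omega>) \<partial>P \<mu>) = measure (P \<mu>) potential_extinction"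
proof -
  have "(\<integral>\<omega>. null_ind (potential_path lam \<sigma> \<omega>) \<partial>P \<mu>) = (\<integral>\<omega>. indicator potential_extinction \<omega> \<partial>P \<mu>)"
    by (rule Bochner_Integration.integral_cong) (use null_ind_potential_path[OF _ \<sigma> lam] P_space[OF \<mu>] in auto)
  then show ?thesis
    using sets.sets_into_space[OF potential_extinction_sets] P_space[OF \<mu>] by (simp add: Int_absorb2)
qed

lemma two_null_ind:
  assumes \<mu>: "\<mu> \<in> finite_measures" and \<nu>: "\<nu> \<in> finite_measures" and "0 \<le> \<sigma>" "0 \<le> \<tau>" "0 < lam" "0 < lam'"
  shows "(\<integral>p. null_ind (\<lambda>j. potential_path lam \<sigma> (fst p) j + potential_path lam' \<tau> (snd p) j) \<partial>(P \<mu> \<Otimes>\<^sub>M P \<nu>)) = measure (P \<mu>) potential_extinction * measure (P \<nu>) potential_extinction"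
proof -
  have "(\<integral>p. null_ind (\<lambda>j. potential_path lam \<sigma> (fst p) j + potential_path lam' \<tau> (snd p) j) \<partial>(P \<mu> \<Otimes>\<^sub>M P \<nu>)) = (\<integral>\<omega>. null_ind (potential_path lam \<sigma> \<omega>) \<partial>P \<mu>) * (\<integral>\<omega>. null_ind (potential_path lam' \<tau> \<omega>) \<partial>P \<nu>)"
    unfolding null_ind_plus using assms
    by (intro integral_independent P_prob measurable_compose[OF potential_path_meas null_ind_meas] null_ind_range)
  then show ?thesis using assms by (simp add: integral_null_ind_potential_path)
qed

text \<open>
  Laplace functionals of the form \<open>exp (- \<langle>F, \<mu>\<rangle>)\<close> are multiplicative in \<open>\<mu>\<close>.
\<close>

lemma sum_law:
  assumes \<mu>: "\<mu> \<in> finite_measures" and \<nu>: "\<nu> \<in> finite_measures" and "exp_closure H"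
  shows "(\<integral>\<omega>. H (potential_path 1 0 \<omega>) \<partial>P (\<lambda>j. \<mu> j + \<nu> j)) = (\<integral>p. H (\<lambda>j. potential_path 1 0 (fst p) j + potential_path 1 0 (snd p) j) \<partial>(P \<mu> \<Otimes>\<^sub>M P \<nu>))"
  using assms(3)
proof (induction rule: exp_closure.induct)
  case (exp_closure_base H)
  have \<mu>\<nu>: "(\<lambda>j. \<mu> j + \<nu> j) \<in> finite_measures" using \<mu> \<nu> by (rule finite_measures_add)
  obtain N a M \<theta> where \<theta>: "\<And>k j. 0 \<le> \<theta> k j" and H: "H = (\<lambda>y. \<Sum>k<(N::nat). a k * exp_mono (M k) (\<theta> k) y)"
    using exp_poly_rep[OF exp_closure_base] by blast
  have "(\<integral>\<omega>. exp_mono (M k) (\<theta> k) (potential_path 1 0 \<omega>) \<partial>P (\<lambda>j. \<mu> j + \<nu> j))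
     = (\<integral>\<omega>. exp_mono (M k) (\<theta> k) (potential_path 1 0 \<omega>) \<partial>P \<mu>) * (\<integral>\<omega>. exp_mono (M k) (\<theta> k) (potential_path 1 0 \<omega>) \<partial>P \<nu>)" for k
  proof -
    obtain F G where FG: "\<forall>j. 0 \<le> F j \<and> F j \<le> G" and L: "\<forall>\<mu>\<in>finite_measures.
        (\<integral>\<omega>. exp_mono (M k) (\<theta> k) (potential_path 1 0 \<omega>) \<partial>P \<mu>) = exp (- lin F \<mu>)"
      using potential_path_laplace_0[of "\<theta> k" "M k", OF \<theta>] by (elim exE conjE) (rule that)
    have F: "0 \<le> F j" "F j \<le> G" for j using FG by simp_all
    show ?thesis
      using bspec[OF L \<mu>] bspec[OF L \<nu>] bspec[OF L \<mu>\<nu>] lin_plus[OF \<mu> \<nu> F] by (simp add: exp_add[symmetric])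
  qed
  moreover have "(\<integral>\<omega>. H (potential_path 1 0 \<omega>) \<partial>P (\<lambda>j. \<mu> j + \<nu> j)) = (\<Sum>k<N. a k * (\<integral>\<omega>. exp_mono (M k) (\<theta> k) (potential_path 1 0 \<omega>) \<partial>P (\<lambda>j. \<mu> j + \<nu> j)))"
    unfolding H
    by (subst Bochner_Integration.integral_sum)
      (auto intro!: bounded_integrable[OF P_prob[OF \<mu>\<nu>], where C = 1] measurable_compose[OF potential_path_meas[OF \<mu>\<nu>] exp_mono_meas] exp_mono_range)
  ultimately show ?case
    unfolding H using \<mu> \<nu> by (subst exp_poly_independent) (auto intro!: P_prob potential_path_meas)
next
  case (exp_closure_lim G C H)
  have \<mu>\<nu>: "(\<lambda>j. \<mu> j + \<nu> j) \<in> finite_measures" using \<mu> \<nu> by (rule finite_measures_add)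
  have "(\<lambda>k. \<integral>\<omega>. G k (potential_path 1 0 \<omega>) \<partial>P (\<lambda>j. \<mu> j + \<nu> j)) \<longlonglongrightarrow> (\<integral>\<omega>. H (potential_path 1 0 \<omega>) \<partial>P (\<lambda>j. \<mu> j + \<nu> j))"
    by (rule prob_tendsto_integral[OF P_prob[OF \<mu>\<nu>] measurable_compose[OF potential_path_meas[OF \<mu>\<nu>] exp_closure_meas[OF exp_closure_lim.hyps(1)]]])
      (auto intro: exp_closure_lim.hyps)
  moreover have "(\<lambda>k. \<integral>p. G k (\<lambda>j. potential_path 1 0 (fst p) j + potential_path 1 0 (snd p) j) \<partial>(P \<mu> \<Otimes>\<^sub>M P \<nu>)) \<longlonglongrightarrow> (\<integral>p. H (\<lambda>j. potential_path 1 0 (fst p) j + potential_path 1 0 (snd p) j) \<partial>(P \<mu> \<Otimes>\<^sub>M P \<nu>))"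
    by (rule prob_tendsto_integral[OF prob_pair[OF P_prob[OF \<mu>] P_prob[OF \<nu>]] measurable_compose[OF plus_seqs_meas[OF potential_path_meas[OF \<mu>] potential_path_meas[OF \<nu>]] exp_closure_meas[OF exp_closure_lim.hyps(1)]]])
      (auto intro: exp_closure_lim.hyps)
  ultimately show ?case unfolding exp_closure_lim.IH by (rule LIMSEQ_unique)
qed

lemma potential_extinction_add:
  assumes "\<mu> \<in> finite_measures" "\<nu> \<in> finite_measures"
  shows "measure (P (\<lambda>j. \<mu> j + \<nu> j)) potential_extinction = measure (P \<mu>) potential_extinction * measure (P \<nu>) potential_extinction"
  using sum_law[OF assms antitone_test_exp_closure[OF antitone_test_null_ind]] two_null_ind[OF assms, of 0 0 1 1] integral_null_ind_potential_path[OF finite_measures_add[OF assms], of 0 1]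
  by simp

lemma zero_finite: "(\<lambda>j. 0) \<in> finite_measures"
  unfolding finite_measures_def by simp

lemma potential_extinction_zero: "measure (P (\<lambda>j. 0)) potential_extinction = 1"
proof -
  have "(\<integral>\<omega>. H (potential_path 1 0 \<omega>) \<partial>P (\<lambda>j. 0)) = H (\<lambda>j. 0)" if "antitone_test H" for H
    using that
  proof (induction rule: antitone_test.induct)
    case (antitone_test_base H)
    obtain N a M \<theta> where \<theta>: "\<And>k j. 0 \<le> \<theta> k j" and H: "H = (\<lambda>y. \<Sum>k<(N::nat). a k * exp_mono (M k) (\<theta> k) y)"
      using exp_poly_rep[OF antitone_test_base(1)] by blast
    have one: "(\<integral>\<omega>. exp_mono (M k) (\<theta> k) (potential_path 1 0 \<omega>) \<partial>P (\<lambda>j. 0)) = 1" for k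
    proof -
      obtain F where L: "\<forall>\<mu>\<in>finite_measures. (\<integral>\<omega>. exp_mono (M k) (\<theta> k) (potential_path 1 0 \<omega>) \<partial>P \<mu>) = exp (- lin F \<mu>)"
        using potential_path_laplace_0[of "\<theta> k" "M k", OF \<theta>] by (elim exE conjE) (rule that)
      from bspec[OF L zero_finite] show ?thesis by (simp add: lin_def)
    qed
    have "(\<integral>\<omega>. H (potential_path 1 0 \<omega>) \<partial>P (\<lambda>j. 0)) = (\<Sum>k<N. a k * (\<integral>\<omega>. exp_mono (M k) (\<theta> k) (potential_path 1 0 \<omega>) \<partial>P (\<lambda>j. 0)))"
      unfolding H
      by (subst Bochner_Integration.integral_sum)
        (auto intro!: bounded_integrable[OF P_prob[OF zero_finite], where C = 1] measurable_compose[OF potential_path_meas[OF zero_finite] exp_mono_meas] exp_mono_range)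
    then show ?case unfolding one H by (simp add: exp_mono_def)
  next
    case (antitone_test_lim G H)
    have le: "\<bar>G k y\<bar> \<le> 1" for k y using antitone_test_bounds[OF antitone_test_lim.hyps(1)[of k], of y] by simp
    have "(\<lambda>k. \<integral>\<omega>. G k (potential_path 1 0 \<omega>) \<partial>P (\<lambda>j. 0)) \<longlonglongrightarrow> (\<integral>\<omega>. H (potential_path 1 0 \<omega>) \<partial>P (\<lambda>j. 0))"
      by (rule prob_tendsto_integral[OF P_prob[OF zero_finite] measurable_compose[OF potential_path_meas[OF zero_finite] antitone_test_meas[OF antitone_test_lim.hyps(1)]] antitone_test_lim.hyps(2) le]) simp
    then show ?case unfolding antitone_test_lim.IH by (rule LIMSEQ_unique[OF _ antitone_test_lim.hyps(2)])
  qed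
  from this[OF antitone_test_null_ind] show ?thesis
    using integral_null_ind_potential_path[OF zero_finite, of 0 1] by (simp add: null_ind_def)
qed

lemma potential_extinction_scale:
  assumes \<mu>: "\<mu> \<in> finite_measures" and a: "0 \<le> a"
  shows "measure (P (\<lambda>j. a * \<mu> j)) potential_extinction = exp_neg (neg_log (measure (P \<mu>) potential_extinction) * ennreal a)"
proof -
  define h where "h a = measure (P (\<lambda>j. a * \<mu> j)) potential_extinction" for a
  have "h a = exp_neg (neg_log (h 1) * ennreal a)"
  proof (rule multiplicative_bounded[OF _ _ _ _ a])
    show "h (a + b) = h a * h b" if "0 \<le> a" "0 \<le> b" for a b
      unfolding h_def using potential_extinction_add[OF finite_measures_scale[OF \<mu> that(1)] finite_measures_scale[OF \<mu> that(2)]] by (simp add: distrib_right)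
    show "h a \<le> 1" if "0 \<le> a" for a
      unfolding h_def by (rule prob_space.prob_le_1[OF P_prob[OF finite_measures_scale[OF \<mu> that]]])
  qed (auto simp: h_def potential_extinction_zero)
  then show ?thesis unfolding h_def by simp
qed

end

section \<open>The extinction equation\<close>

lemma exp_mono_independent:
  assumes M: "prob_space M" and N: "prob_space N"
    and Z: "Z1 \<in> M \<rightarrow>\<^sub>M seqs" "Z2 \<in> N \<rightarrow>\<^sub>M seqs"
  shows "(\<integral>p. exp_mono m \<theta> (\<lambda>j. Z1 (fst p) j + Z2 (snd p) j) \<partial>(M \<Otimes>\<^sub>M N))
    = (\<integral>x. exp_mono m \<theta> (Z1 x) \<partial>M) * (\<integral>x. exp_mono m \<theta> (Z2 x) \<partial>N)"
  using exp_poly_independent[OF M N Z, where S = "{()}" and a = "\<lambda>_. 1" and m = "\<lambda>_. m" and \<theta> = "\<lambda>_. \<theta>"] by simp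

lemma exp_neg_scaled: "0 \<le> w \<Longrightarrow> 0 \<le> a \<Longrightarrow> exp_neg (ennreal w * ennreal a) = exp (- (a * w))"
  by (simp add: ennreal_mult[symmetric] exp_neg_ennreal mult.commute)

lemma exp_neg_product:
  fixes x y z :: real
  shows "exp (- x) * exp (- y) * exp (- z) = exp (- x - (y + z))" "exp (- x) * exp (- y) * exp (- z) = exp (- x - y - z)"
  by (simp_all add: mult_exp_exp)

context mcsbp begin

lemma potential_path_laplace_family:
  fixes M :: "nat \<Rightarrow> nat"
  assumes \<theta>: "\<And>k j. 0 \<le> \<theta> k j" and lam: "0 \<le> lam"
  shows "\<exists>F K. \<forall>k. (\<forall>j. 0 \<le> F k j \<and> F k j \<le> K k) \<and>
    (\<forall>\<sigma>\<ge>0. \<forall>\<mu>\<in>finite_measures. (\<integral>\<omega>. exp_mono (M k) (\<theta> k) (potential_path lam \<sigma> \<omega>) \<partial>P \<mu>) = exp (- lin (cumulant \<sigma> (F k)) \<mu>))"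
proof -
  define Q where "Q k F K \<longleftrightarrow> (\<forall>j. 0 \<le> F j \<and> F j \<le> K) \<and>
    (\<forall>\<sigma>\<ge>0. \<forall>\<mu>\<in>finite_measures. (\<integral>\<omega>. exp_mono (M k) (\<theta> k) (potential_path lam \<sigma> \<omega>) \<partial>P \<mu>) = exp (- lin (cumulant \<sigma> F) \<mu>))" for k F K
  have "\<forall>k. \<exists>F K. Q k F K" unfolding Q_def by (intro allI) (rule potential_path_laplace[OF \<theta> lam])
  then have "\<exists>F K. \<forall>k. Q k (F k) (K k)" by metis
  then show ?thesis unfolding Q_def .
qed

text \<open>
  The assumption \<open>dom\<close> says on which side the potential of the offspring is larger; the sign \<open>s\<close> adapts the
  decreasing function \<open>G\<close> to it.
\<close>

lemma generator_ineq_two: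
  assumes G: "antitone_test G" and lam: "0 \<le> lam" "0 \<le> lam'" and \<tau>: "0 \<le> \<tau>"
    and dom: "(s = 1 \<and> (\<forall>\<sigma>\<in>{0..1}. \<forall>\<omega>\<in>space \<Omega>. \<forall>j. potential_path lam \<sigma> \<omega> j \<le> potential_path lam' \<tau> \<omega> j))
      \<or> (s = - 1 \<and> (\<forall>\<sigma>\<in>{0..1}. \<forall>\<omega>\<in>space \<Omega>. \<forall>j. potential_path lam' \<tau> \<omega> j \<le> potential_path lam \<sigma> \<omega> j))"
  shows "generator_ineq i (\<lambda>\<sigma> a m. s * (\<integral>p. G (\<lambda>j. potential_path lam (clip \<sigma>) (fst p) j + potential_path lam' \<tau> (snd p) j)
           \<partial>(P (\<lambda>j. max 0 a * unit_mass i j) \<Otimes>\<^sub>M P (\<lambda>j. max 0 m * pmf (\<pi> i) j))))"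
  using G
proof (induction rule: antitone_test.induct)
  case (antitone_test_base G)
  have fmd: "(\<lambda>j. a * unit_mass i j) \<in> finite_measures" if "0 \<le> a" for a
    by (rule finite_measures_scale[OF unit_mass_finite that])
  have fmp: "(\<lambda>j. a * pmf (\<pi> i) j) \<in> finite_measures" if "0 \<le> a" for a
    by (rule finite_measures_scale[OF pmf_finite_measure that])
  obtain N a' M \<theta> where \<theta>: "\<And>k j. 0 \<le> \<theta> k j" and G: "G = (\<lambda>y. \<Sum>k<(N::nat). a' k * exp_mono (M k) (\<theta> k) y)"
    using exp_poly_rep[OF antitone_test_base(1)] by blast
  obtain F1 K1 where Q1: "\<forall>k. (\<forall>j. 0 \<le> F1 k j \<and> F1 k j \<le> K1 k) \<and>
    (\<forall>\<sigma>\<ge>0. \<forall>\<mu>\<in>finite_measures. (\<integral>\<omega>. exp_mono (M k) (\<theta> k) (potential_path lam \<sigma> \<omega>) \<partial>P \<mu>) = exp (- lin (cumulant \<sigma> (F1 k)) \<mu>))"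
    using potential_path_laplace_family[of \<theta> lam M, OF \<theta> lam(1)] by (elim exE) (rule that)
  have F1: "0 \<le> F1 k j" "F1 k j \<le> K1 k" for k j
    using Q1[rule_format, of k, THEN conjunct1] by simp_all
  have L1: "(\<integral>\<omega>. exp_mono (M k) (\<theta> k) (potential_path lam \<sigma> \<omega>) \<partial>P \<mu>) = exp (- lin (cumulant \<sigma> (F1 k)) \<mu>)"
    if "0 \<le> \<sigma>" "\<mu> \<in> finite_measures" for k \<sigma> \<mu>
    using Q1[rule_format, of k, THEN conjunct2] that by simp
  obtain F2 K2 where Q2: "\<forall>k. (\<forall>j. 0 \<le> F2 k j \<and> F2 k j \<le> K2 k) \<and>
    (\<forall>\<sigma>\<ge>0. \<forall>\<mu>\<in>finite_measures. (\<integral>\<omega>. exp_mono (M k) (\<theta> k) (potential_path lam' \<sigma> \<omega>) \<partial>P \<mu>) = exp (- lin (cumulant \<sigma> (F2 k)) \<mu>))"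
    using potential_path_laplace_family[of \<theta> lam' M, OF \<theta> lam(2)] by (elim exE) (rule that)
  have F2: "0 \<le> F2 k j" "F2 k j \<le> K2 k" for k j
    using Q2[rule_format, of k, THEN conjunct1] by simp_all
  have L2: "(\<integral>\<omega>. exp_mono (M k) (\<theta> k) (potential_path lam' \<sigma> \<omega>) \<partial>P \<mu>) = exp (- lin (cumulant \<sigma> (F2 k)) \<mu>)"
    if "0 \<le> \<sigma>" "\<mu> \<in> finite_measures" for k \<sigma> \<mu>
    using Q2[rule_format, of k, THEN conjunct2] that by simp
  define v where "v k \<sigma> = cumulant (clip \<sigma>) (F1 k) i" for k \<sigma>
  define z where "z k \<sigma> = offspring_mean i (cumulant (clip \<sigma>) (F1 k))" for k \<sigma>
  define \<zeta> where "\<zeta> k = offspring_mean i (cumulant \<tau> (F2 k))" for k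
  note V1 = cumulant_nonneg[OF F1 clip_range(1)] cumulant_upper'[OF F1 clip_range(1) clip_range(2)]
  note V2 = cumulant_nonneg[OF F2 \<tau>] cumulant_upper'[OF F2 \<tau> order_refl]
  have E1: "(\<integral>\<omega>. exp_mono (M k) (\<theta> k) (potential_path lam (clip \<sigma>) \<omega>) \<partial>P (\<lambda>j. a * unit_mass i j)) = exp (- (a * v k \<sigma>))" if "0 \<le> a" for k \<sigma> a
    using L1[OF clip_range(1) fmd[OF that]] by (simp add: lin_scaled_unit v_def)
  have E2: "(\<integral>\<omega>. exp_mono (M k) (\<theta> k) (potential_path lam' \<tau> \<omega>) \<partial>P (\<lambda>j. m * pmf (\<pi> i) j)) = exp (- (m * \<zeta> k))" if "0 \<le> m" for k m
    using L2[OF \<tau> fmp[OF that]] lin_scale[OF pmf_finite_measure V2] by (simp add: \<zeta>_def)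
  have E3: "(\<integral>\<omega>. exp_mono (M k) (\<theta> k) (potential_path lam (clip \<sigma>) \<omega>) \<partial>P (\<lambda>j. e * pmf (\<pi> i) j)) = exp (- (e * z k \<sigma>))" if "0 \<le> e" for k \<sigma> e
    using L1[OF clip_range(1) fmp[OF that]] lin_scale[OF pmf_finite_measure V1] by (simp add: z_def)
  have val: "(\<integral>p. G (\<lambda>j. potential_path lam (clip \<sigma>) (fst p) j + potential_path lam' \<tau> (snd p) j) \<partial>(P (\<lambda>j. a * unit_mass i j) \<Otimes>\<^sub>M P (\<lambda>j. m * pmf (\<pi> i) j)))
     = (\<Sum>k<N. a' k * exp (- (a * v k \<sigma>) - m * \<zeta> k))" if "0 \<le> a" "0 \<le> m" for \<sigma> a m
    unfolding G
    by (subst exp_poly_independent[OF P_prob[OF fmd[OF that(1)]] P_prob[OF fmp[OF that(2)]] potential_path_meas[OF fmd[OF that(1)] clip_range(1)] potential_path_meas[OF fmp[OF that(2)] \<tau>]])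
      (simp add: E1[OF that(1)] E2[OF that(2)] mult_exp_exp)
  have val': "s * (\<integral>p. G (\<lambda>j. potential_path lam (clip \<sigma>) (fst p) j + potential_path lam' \<tau> (snd p) j) \<partial>(P (\<lambda>j. max 0 a * unit_mass i j) \<Otimes>\<^sub>M P (\<lambda>j. max 0 m * pmf (\<pi> i) j)))
     = (\<Sum>k<N. (s * a' k) * exp (- (max 0 a * v k \<sigma>) - max 0 m * \<zeta> k))" for \<sigma> a m
    using val[of "max 0 a" "max 0 m" \<sigma>] by (simp add: sum_distrib_left mult.assoc)
  have s1: "\<bar>s\<bar> = 1" using dom by auto
  have G1: "\<bar>G y\<bar> \<le> 1" for y using antitone_test_base(2)[of y] antitone_test_base(3)[of y] by linarith
  note Gm = exp_poly_meas[OF antitone_test_base(1)]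
  show ?case
    unfolding val'
  proof (rule generator_ineq_base[where z = z])
    show "0 \<le> v k \<sigma>" for k \<sigma> unfolding v_def by (rule V1)
    show "0 \<le> z k \<sigma>" for k \<sigma> unfolding z_def by (rule offspring_mean_bounds(1)[OF V1])
    show "0 \<le> \<zeta> k" for k unfolding \<zeta>_def by (rule offspring_mean_bounds(1)[OF V2])
    show "continuous_on UNIV (v k)" "continuous_on UNIV (z k)" for k
      unfolding v_def[abs_def] z_def[abs_def] by (rule cumulant_clip_continuous[OF F1])+
    show "(v k has_real_derivative - (\<psi> i (v k \<sigma>) - \<rho> i (z k \<sigma>))) (at \<sigma> within {0..1})" if "\<sigma> \<in> {0..1}" for k \<sigma>
      unfolding v_def[abs_def] z_def[abs_def] by (rule cumulant_clip_deriv[OF F1 that])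
    show "\<bar>\<Sum>k<N. s * a' k * exp (- (max 0 a * v k \<sigma>) - max 0 m * \<zeta> k)\<bar> \<le> 1" for \<sigma> a m
      unfolding val'[symmetric] abs_mult s1
      using integral_abs_le_bound[OF prob_pair[OF P_prob[OF fmd] P_prob[OF fmp]] G1, of "max 0 a" "max 0 m"] by simp
  next
    fix \<sigma> a m e :: real
    assume \<sigma>: "\<sigma> \<in> {0..1}" and a: "0 \<le> a" and m: "0 \<le> m" and e: "0 \<le> e"
    \<comment> \<open>The offspring of mass \<open>e\<close> form a third independent population \<open>?R\<close>, counted with either of the two
      factors.\<close>
    define Q where "Q = P (\<lambda>j. a * unit_mass i j) \<Otimes>\<^sub>M P (\<lambda>j. m * pmf (\<pi> i) j)"
    define Z where "Z p j = potential_path lam \<sigma> (fst p) j + potential_path lam' \<tau> (snd p) j" for p j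
    let ?R = "P (\<lambda>j. e * pmf (\<pi> i) j)"
    have \<sigma>0: "0 \<le> \<sigma>" using \<sigma> by simp
    have c: "clip \<sigma> = \<sigma>" by (rule clip_id[OF \<sigma>])
    have Q: "prob_space Q" unfolding Q_def by (rule prob_pair[OF P_prob[OF fmd[OF a]] P_prob[OF fmp[OF m]]])
    have Z: "Z \<in> Q \<rightarrow>\<^sub>M seqs" unfolding Q_def Z_def[abs_def]
      by (rule plus_seqs_meas[OF potential_path_meas[OF fmd[OF a] \<sigma>0] potential_path_meas[OF fmp[OF m] \<tau>]])
    have EZ: "(\<integral>p. exp_mono (M k) (\<theta> k) (Z p) \<partial>Q) = exp (- (a * v k \<sigma>)) * exp (- (m * \<zeta> k))" for k
      unfolding Q_def Z_def[abs_def]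
      using exp_mono_independent[OF P_prob[OF fmd[OF a]] P_prob[OF fmp[OF m]] potential_path_meas[OF fmd[OF a] \<sigma>0] potential_path_meas[OF fmp[OF m] \<tau>], of "M k" "\<theta> k" lam lam']
        E1[OF a, of k \<sigma>] E2[OF m, of k] c by simp
    note Ym = potential_path_meas[OF fmp[OF e] \<sigma>0, of lam] potential_path_meas[OF fmp[OF e] \<tau>, of lam']
    note R = P_prob[OF fmp[OF e]]
    have I1: "(\<integral>p. G (\<lambda>j. Z (fst p) j + potential_path lam' \<tau> (snd p) j) \<partial>(Q \<Otimes>\<^sub>M ?R)) = (\<Sum>k<N. a' k * exp (- (a * v k \<sigma>) - (m + e) * \<zeta> k))"
      unfolding G exp_poly_independent[OF Q R Z Ym(2)] EZ E2[OF e] exp_neg_product(1) distrib_right ..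
    have I2: "(\<integral>p. G (\<lambda>j. Z (fst p) j + potential_path lam \<sigma> (snd p) j) \<partial>(Q \<Otimes>\<^sub>M ?R)) = (\<Sum>k<N. a' k * exp (- (a * v k \<sigma>) - m * \<zeta> k - e * z k \<sigma>))"
      unfolding G exp_poly_independent[OF Q R Z Ym(1)] EZ E3[OF e, of k \<sigma> for k, unfolded c] exp_neg_product(2) ..
    have int: "integrable (Q \<Otimes>\<^sub>M ?R) (\<lambda>p. G (\<lambda>j. Z (fst p) j + potential_path lam' \<tau> (snd p) j))"
      "integrable (Q \<Otimes>\<^sub>M ?R) (\<lambda>p. G (\<lambda>j. Z (fst p) j + potential_path lam \<sigma> (snd p) j))"
      by (rule bounded_integrable[OF prob_pair[OF Q R] measurable_compose[OF plus_seqs_meas[OF Z Ym(2)] Gm] G1])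
        (rule bounded_integrable[OF prob_pair[OF Q R] measurable_compose[OF plus_seqs_meas[OF Z Ym(1)] Gm] G1])
    have "s * (\<integral>p. G (\<lambda>j. Z (fst p) j + potential_path lam' \<tau> (snd p) j) \<partial>(Q \<Otimes>\<^sub>M ?R)) \<le> s * (\<integral>p. G (\<lambda>j. Z (fst p) j + potential_path lam \<sigma> (snd p) j) \<partial>(Q \<Otimes>\<^sub>M ?R))"
      using dom
    proof (elim disjE conjE)
      assume s: "s = 1" and le: "\<forall>\<sigma>\<in>{0..1}. \<forall>\<omega>\<in>space \<Omega>. \<forall>j. potential_path lam \<sigma> \<omega> j \<le> potential_path lam' \<tau> \<omega> j"
      have "G (\<lambda>j. Z (fst p) j + potential_path lam' \<tau> (snd p) j) \<le> G (\<lambda>j. Z (fst p) j + potential_path lam \<sigma> (snd p) j)" if "p \<in> space (Q \<Otimes>\<^sub>M ?R)" for p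
        by (rule antitone_test_base(4)) (use le \<sigma> that P_space[OF fmp[OF e]] in \<open>auto simp: space_pair_measure intro!: add_left_mono\<close>)
      then show ?thesis unfolding s by (simp add: integral_mono[OF int])
    next
      assume s: "s = - 1" and le: "\<forall>\<sigma>\<in>{0..1}. \<forall>\<omega>\<in>space \<Omega>. \<forall>j. potential_path lam' \<tau> \<omega> j \<le> potential_path lam \<sigma> \<omega> j"
      have "G (\<lambda>j. Z (fst p) j + potential_path lam \<sigma> (snd p) j) \<le> G (\<lambda>j. Z (fst p) j + potential_path lam' \<tau> (snd p) j)" if "p \<in> space (Q \<Otimes>\<^sub>M ?R)" for p
        by (rule antitone_test_base(4)) (use le \<sigma> that P_space[OF fmp[OF e]] in \<open>auto simp: space_pair_measure intro!: add_left_mono\<close>)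
      then show ?thesis unfolding s by (simp add: integral_mono[OF int(2,1)])
    qed
    then show "(\<Sum>k<N. s * a' k * exp (- (a * v k \<sigma>) - (m + e) * \<zeta> k)) \<le> (\<Sum>k<N. s * a' k * exp (- (a * v k \<sigma>) - m * \<zeta> k - e * z k \<sigma>))"
      unfolding I1 I2 by (simp add: sum_distrib_left mult.assoc)
  qed simp
next
  case (antitone_test_lim G H)
  show ?case
  proof (rule generator_ineq_limit[OF antitone_test_lim.IH])
    fix \<sigma> a m :: real
    have 1: "(\<lambda>j. max 0 a * unit_mass i j) \<in> finite_measures" "(\<lambda>j. max 0 m * pmf (\<pi> i) j) \<in> finite_measures"
      by (intro finite_measures_scale unit_mass_finite pmf_finite_measure; simp)+
    have le: "\<bar>G k y\<bar> \<le> 1" for k y using antitone_test_bounds[OF antitone_test_lim.hyps(1)[of k], of y] by simp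
    show "(\<lambda>k. s * (\<integral>p. G k (\<lambda>j. potential_path lam (clip \<sigma>) (fst p) j + potential_path lam' \<tau> (snd p) j)
           \<partial>(P (\<lambda>j. max 0 a * unit_mass i j) \<Otimes>\<^sub>M P (\<lambda>j. max 0 m * pmf (\<pi> i) j))))
      \<longlonglongrightarrow> s * (\<integral>p. H (\<lambda>j. potential_path lam (clip \<sigma>) (fst p) j + potential_path lam' \<tau> (snd p) j)
           \<partial>(P (\<lambda>j. max 0 a * unit_mass i j) \<Otimes>\<^sub>M P (\<lambda>j. max 0 m * pmf (\<pi> i) j)))"
      by (intro tendsto_mult tendsto_const prob_tendsto_integral[OF prob_pair[OF P_prob[OF 1(1)] P_prob[OF 1(2)]]
            measurable_compose[OF plus_seqs_meas[OF potential_path_meas[OF 1(1) clip_range(1)] potential_path_meas[OF 1(2) \<tau>]] antitone_test_meas[OF antitone_test_lim.hyps(1)]]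
            antitone_test_lim.hyps(2) le])
  qed
qed

text \<open>
  Moving the starting time within \<open>[0,1]\<close> changes the potential by a factor of at most \<open>exp (8 * B)\<close>, so the
  factors \<open>1\<close> and \<open>exp (8 * B)\<close> realise both orders.  In the limit the factors have no influence.
\<close>

lemma generator_ineq_extinction:
  assumes s: "s = 1 \<or> s = - 1"
  shows "generator_ineq i (\<lambda>\<sigma> a m. s * (exp_neg (neg_log (measure (P (unit_mass i)) potential_extinction) * ennreal (max 0 a))
     * exp_neg (neg_log (measure (P (pmf (\<pi> i))) potential_extinction) * ennreal (max 0 m))))"
proof -
  have val: "(\<integral>p. null_ind (\<lambda>j. potential_path lam (clip \<sigma>) (fst p) j + potential_path lam' \<tau> (snd p) j)
           \<partial>(P (\<lambda>j. max 0 a * unit_mass i j) \<Otimes>\<^sub>M P (\<lambda>j. max 0 m * pmf (\<pi> i) j)))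
     = exp_neg (neg_log (measure (P (unit_mass i)) potential_extinction) * ennreal (max 0 a))
     * exp_neg (neg_log (measure (P (pmf (\<pi> i))) potential_extinction) * ennreal (max 0 m))"
    if "0 < lam" "0 < lam'" "0 \<le> \<tau>" for lam lam' \<tau> \<sigma> a m
    using two_null_ind[OF finite_measures_scale[OF unit_mass_finite] finite_measures_scale[OF pmf_finite_measure] clip_range(1) that(3,1,2), of "max 0 a" "max 0 m" i "\<pi> i" \<sigma>]
      potential_extinction_scale[OF unit_mass_finite, of "max 0 a" i] potential_extinction_scale[OF pmf_finite_measure, of "max 0 m" "\<pi> i"] by simp
  from s show ?thesis
  proof
    assume s1: "s = 1"
    have "potential_path 1 \<sigma> \<omega> j \<le> potential_path (exp (8 * B)) 0 \<omega> j" if \<sigma>: "\<sigma> \<in> {0..1}" and \<omega>: "\<omega> \<in> space \<Omega>" for \<sigma> \<omega> j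
    proof -
      have "potential (real j + \<sigma>) \<omega> \<le> ennreal (exp (8 * B * \<sigma>)) * potential (real j) \<omega>"
        by (rule potential_shift[OF \<omega>]) (use \<sigma> in auto)
      also have "\<dots> \<le> ennreal (exp (8 * B)) * potential (real j) \<omega>"
        using \<sigma> B_pos by (intro mult_right_mono ennreal_leI) auto
      finally show ?thesis unfolding potential_path_def by (simp add: add.commute)
    qed
    then have "generator_ineq i (\<lambda>\<sigma> a m. s * (\<integral>p. null_ind (\<lambda>j. potential_path 1 (clip \<sigma>) (fst p) j + potential_path (exp (8 * B)) 0 (snd p) j)
           \<partial>(P (\<lambda>j. max 0 a * unit_mass i j) \<Otimes>\<^sub>M P (\<lambda>j. max 0 m * pmf (\<pi> i) j))))"
      by (intro generator_ineq_two[OF antitone_test_null_ind]) (use s1 in auto)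
    then show ?thesis by (simp only: val[OF zero_less_one exp_gt_zero order_refl])
  next
    assume s1: "s = - 1"
    have "potential_path 1 1 \<omega> j \<le> potential_path (exp (8 * B)) \<sigma> \<omega> j" if \<sigma>: "\<sigma> \<in> {0..1}" and \<omega>: "\<omega> \<in> space \<Omega>" for \<sigma> \<omega> j
    proof -
      have "potential ((\<sigma> + real j) + (1 - \<sigma>)) \<omega> \<le> ennreal (exp (8 * B * (1 - \<sigma>))) * potential (\<sigma> + real j) \<omega>"
        by (rule potential_shift[OF \<omega>]) (use \<sigma> in auto)
      also have "\<dots> \<le> ennreal (exp (8 * B)) * potential (\<sigma> + real j) \<omega>"
        using \<sigma> B_pos by (intro mult_right_mono ennreal_leI) auto
      finally show ?thesis unfolding potential_path_def by (simp add: add.commute)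
    qed
    then have "generator_ineq i (\<lambda>\<sigma> a m. s * (\<integral>p. null_ind (\<lambda>j. potential_path (exp (8 * B)) (clip \<sigma>) (fst p) j + potential_path 1 1 (snd p) j)
           \<partial>(P (\<lambda>j. max 0 a * unit_mass i j) \<Otimes>\<^sub>M P (\<lambda>j. max 0 m * pmf (\<pi> i) j))))"
      by (intro generator_ineq_two[OF antitone_test_null_ind]) (use s1 in auto)
    then show ?thesis by (simp only: val[OF exp_gt_zero zero_less_one zero_le_one])
  qed
qed

lemma neg_log_pos: "0 < p \<Longrightarrow> p \<le> 1 \<Longrightarrow> neg_log p = ennreal (- ln p) \<and> 0 \<le> - ln p"
  unfolding neg_log_def by simp

text \<open>
  The inequality holds with both signs.  The sign \<open>- 1\<close> alone excludes that the offspring population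
  survives almost surely.
\<close>

lemma extinction_equation:
  assumes p: "0 < measure (P (unit_mass i)) potential_extinction"
  shows "0 < measure (P (pmf (\<pi> i))) potential_extinction"
    and "\<psi> i (- ln (measure (P (unit_mass i)) potential_extinction)) = \<rho> i (- ln (measure (P (pmf (\<pi> i))) potential_extinction))"
proof -
  define w where "w = - ln (measure (P (unit_mass i)) potential_extinction)"
  have w: "neg_log (measure (P (unit_mass i)) potential_extinction) = ennreal w" "0 \<le> w"
    using neg_log_pos[OF p prob_space.prob_le_1[OF P_prob[OF unit_mass_finite]]] unfolding w_def by auto
  have wa: "exp_neg (ennreal w * ennreal (max 0 a)) = exp (- (max 0 a * w))" for a
    using w(2) by (intro exp_neg_scaled) auto
  show q: "0 < measure (P (pmf (\<pi> i))) potential_extinction"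
  proof (rule ccontr)
    assume "\<not> 0 < measure (P (pmf (\<pi> i))) potential_extinction"
    then have "neg_log (measure (P (pmf (\<pi> i))) potential_extinction) = \<infinity>"
      unfolding neg_log_def using measure_nonneg[of "P (pmf (\<pi> i))" potential_extinction] by simp
    moreover have "exp_neg (\<infinity> * ennreal (max 0 m)) = (if m \<le> 0 then 1 else 0)" for m
      by (auto simp: exp_neg_def ennreal_top_mult max_def)
    ultimately have "generator_ineq i (\<lambda>\<sigma> a m. - 1 * exp (- (max 0 a * w)) * (if m \<le> 0 then 1 else 0))"
      using generator_ineq_extinction[of "- 1" i] unfolding w(1) wa by (simp only: mult.assoc simp_thms)
    then show False by (rule generator_ineq_product_infinite[OF w(2)])
  qed
  define \<kappa> where "\<kappa> = - ln (measure (P (pmf (\<pi> i))) potential_extinction)"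
  have \<kappa>: "neg_log (measure (P (pmf (\<pi> i))) potential_extinction) = ennreal \<kappa>" "0 \<le> \<kappa>"
    using neg_log_pos[OF q prob_space.prob_le_1[OF P_prob[OF pmf_finite_measure]]] unfolding \<kappa>_def by auto
  have \<kappa>a: "exp_neg (ennreal \<kappa> * ennreal (max 0 a)) = exp (- (max 0 a * \<kappa>))" for a
    using \<kappa>(2) by (intro exp_neg_scaled) auto
  have "s * (\<psi> i w - \<rho> i \<kappa>) \<le> 0" if s: "s = 1 \<or> s = - 1" for s :: real
    by (rule generator_ineq_product_finite[OF w(2) \<kappa>(2) s])
      (use generator_ineq_extinction[OF s, of i] in \<open>simp only: w(1) \<kappa>(1) wa \<kappa>a mult.assoc\<close>)
  from this[of 1] this[of "- 1"] show "\<psi> i (- ln (measure (P (unit_mass i)) potential_extinction)) = \<rho> i (- ln (measure (P (pmf (\<pi> i))) potential_extinction))"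
    unfolding w_def[symmetric] \<kappa>_def[symmetric] by simp
qed

end

section \<open>Extinction of mixtures\<close>

lemma exp_poly_increment:
  "exp_poly G \<Longrightarrow> \<exists>N A M \<theta>. (\<forall>k j. 0 \<le> \<theta> k j) \<and> (\<forall>k. 0 \<le> A k) \<and>
    (\<forall>y z. \<bar>G (\<lambda>j. y j + z j) - G y\<bar> \<le> (\<Sum>k<(N::nat). A k * (1 - exp_mono (M k) (\<theta> k) z)))"
proof -
  assume "exp_poly G"
  then obtain N a M \<theta> where \<theta>: "\<And>k j. 0 \<le> \<theta> k j" and G: "G = (\<lambda>y. \<Sum>k<(N::nat). a k * exp_mono (M k) (\<theta> k) y)"
    using exp_poly_rep by blast
  have "\<bar>G (\<lambda>j. y j + z j) - G y\<bar> \<le> (\<Sum>k<N. \<bar>a k\<bar> * (1 - exp_mono (M k) (\<theta> k) z))" for y z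
  proof -
    have "G (\<lambda>j. y j + z j) - G y = (\<Sum>k<N. - (a k * (exp_mono (M k) (\<theta> k) y * (1 - exp_mono (M k) (\<theta> k) z))))"
      unfolding G exp_mono_plus sum_subtractf[symmetric] by (intro sum.cong refl) (simp add: algebra_simps)
    also have "\<bar>\<dots>\<bar> \<le> (\<Sum>k<N. \<bar>- (a k * (exp_mono (M k) (\<theta> k) y * (1 - exp_mono (M k) (\<theta> k) z)))\<bar>)"
      by (rule sum_abs)
    also have "\<dots> \<le> (\<Sum>k<N. \<bar>a k\<bar> * (1 - exp_mono (M k) (\<theta> k) z))"
    proof (rule sum_mono)
      fix k
      have "exp_mono (M k) (\<theta> k) y * (1 - exp_mono (M k) (\<theta> k) z) \<le> 1 * (1 - exp_mono (M k) (\<theta> k) z)"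
        using exp_mono_range[of "M k" "\<theta> k" z] exp_mono_range[of "M k" "\<theta> k" y] by (intro mult_right_mono) auto
      moreover have "0 \<le> exp_mono (M k) (\<theta> k) y * (1 - exp_mono (M k) (\<theta> k) z)"
        using exp_mono_range[of "M k" "\<theta> k" z] exp_mono_range[of "M k" "\<theta> k" y] by simp
      ultimately show "\<bar>- (a k * (exp_mono (M k) (\<theta> k) y * (1 - exp_mono (M k) (\<theta> k) z)))\<bar> \<le> \<bar>a k\<bar> * (1 - exp_mono (M k) (\<theta> k) z)"
        unfolding abs_minus_cancel abs_mult[of "a k"] by (intro mult_left_mono) auto
    qed
    finally show ?thesis .
  qed
  then show ?thesis using \<theta> by (intro exI[of _ N] exI[of _ "\<lambda>k. \<bar>a k\<bar>"] exI[of _ M] exI[of _ \<theta>]) auto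
qed

context mcsbp begin

lemma increment_small:
  assumes G: "exp_poly G" and \<nu>: "\<And>N. \<nu> N \<in> finite_measures" and small: "(\<lambda>N. suminf (\<nu> N)) \<longlonglongrightarrow> 0"
  shows "\<exists>g. (\<forall>y z. \<bar>G (\<lambda>j. y j + z j) - G y\<bar> \<le> g z) \<and> g \<in> borel_measurable seqs \<and> (\<exists>C. \<forall>z. \<bar>g z\<bar> \<le> C)
    \<and> (\<lambda>N. \<integral>\<omega>. g (potential_path 1 0 \<omega>) \<partial>P (\<nu> N)) \<longlonglongrightarrow> 0"
proof -
  obtain K A M \<theta> where \<theta>: "\<And>k j. 0 \<le> \<theta> k j" and A: "\<And>k. 0 \<le> A k" and
    inc: "\<And>y z. \<bar>G (\<lambda>j. y j + z j) - G y\<bar> \<le> (\<Sum>k<(K::nat). A k * (1 - exp_mono (M k) (\<theta> k) z))"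
    using exp_poly_increment[OF G] by blast
  define g where "g z = (\<Sum>k<K. A k * (1 - exp_mono (M k) (\<theta> k) z))" for z
  have [measurable]: "g \<in> borel_measurable seqs" unfolding g_def[abs_def]
    by (intro borel_measurable_sum borel_measurable_times borel_measurable_diff borel_measurable_const exp_mono_meas)
  have gb: "\<bar>g z\<bar> \<le> (\<Sum>k<K. A k)" for z
  proof -
    have "0 \<le> g z" unfolding g_def using A exp_mono_range by (intro sum_nonneg mult_nonneg_nonneg) auto
    moreover have "g z \<le> (\<Sum>k<K. A k * 1)" unfolding g_def using A exp_mono_range by (intro sum_mono mult_left_mono) auto
    ultimately show ?thesis by simp
  qed
  have lim: "(\<lambda>N. \<integral>\<omega>. exp_mono (M k) (\<theta> k) (potential_path 1 0 \<omega>) \<partial>P (\<nu> N)) \<longlonglongrightarrow> 1" for k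
  proof -
    obtain F C where FG: "\<forall>j. 0 \<le> F j \<and> F j \<le> C" and L: "\<forall>\<mu>\<in>finite_measures.
        (\<integral>\<omega>. exp_mono (M k) (\<theta> k) (potential_path 1 0 \<omega>) \<partial>P \<mu>) = exp (- lin F \<mu>)"
      using potential_path_laplace_0[of "\<theta> k" "M k", OF \<theta>] by (elim exE conjE) (rule that)
    have F: "0 \<le> F j" "F j \<le> C" for j using FG by simp_all
    have "(\<lambda>N. lin F (\<nu> N)) \<longlonglongrightarrow> 0"
    proof (rule tendsto_sandwich[OF _ _ tendsto_const])
      show "eventually (\<lambda>N. 0 \<le> lin F (\<nu> N)) sequentially"
        by (intro always_eventually allI lin_nonneg[OF \<nu> F])
      show "eventually (\<lambda>N. lin F (\<nu> N) \<le> C * suminf (\<nu> N)) sequentially"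
        using lin_mono[OF \<nu> F(1) F(2) order_refl] by (intro always_eventually allI) (simp add: lin_const[OF \<nu>])
      show "(\<lambda>N. C * suminf (\<nu> N)) \<longlonglongrightarrow> 0" using tendsto_mult[OF tendsto_const[of C] small] by simp
    qed
    from tendsto_exp[OF tendsto_minus[OF this]] show ?thesis
      unfolding bspec[OF L \<nu>] by simp
  qed
  have "(\<integral>\<omega>. g (potential_path 1 0 \<omega>) \<partial>P (\<nu> N)) = (\<Sum>k<K. A k * (1 - (\<integral>\<omega>. exp_mono (M k) (\<theta> k) (potential_path 1 0 \<omega>) \<partial>P (\<nu> N))))" for N
  proof -
    interpret prob_space "P (\<nu> N)" by (rule P_prob[OF \<nu>])
    have i: "integrable (P (\<nu> N)) (\<lambda>\<omega>. exp_mono (M k) (\<theta> k) (potential_path 1 0 \<omega>))" for k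
      by (rule bounded_integrable[OF P_prob[OF \<nu>] measurable_compose[OF potential_path_meas[OF \<nu>] exp_mono_meas] exp_mono_range(3)]) simp
    show ?thesis unfolding g_def
      by (subst Bochner_Integration.integral_sum) (use i in \<open>auto simp: prob_space\<close>)
  qed
  moreover have "(\<lambda>N. \<Sum>k<K. A k * (1 - (\<integral>\<omega>. exp_mono (M k) (\<theta> k) (potential_path 1 0 \<omega>) \<partial>P (\<nu> N)))) \<longlonglongrightarrow> (\<Sum>k<K. A k * (1 - 1))"
    by (intro tendsto_intros lim)
  ultimately have "(\<lambda>N. \<integral>\<omega>. g (potential_path 1 0 \<omega>) \<partial>P (\<nu> N)) \<longlonglongrightarrow> 0" by simp
  then show ?thesis
    using inc gb by (intro exI[of _ g] conjI) (auto simp: g_def)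
qed

text \<open>
  Let \<open>Y\<^sub>1\<close> and \<open>Y\<^sub>2\<close> be the potentials of the parts \<open>\<mu> N\<close> and \<open>\<nu> N\<close>, and approximate the indicator of
  extinction of the whole in mean square by \<open>G(Y\<^sub>1 + Y\<^sub>2)\<close>.  Since the second part is small, the
  square of \<open>G\<close> hardly depends on it, so \<open>G(Y\<^sub>1)\<close> is almost independent of whether the second part
  dies out.  If the first part dies out and the second does not, \<open>G(Y\<^sub>1 + Y\<^sub>2)\<close> is near \<open>0\<close>; by
  independence this bounds the probability that the second part survives.
\<close>

lemma small_population_dies:
  assumes \<mu>: "\<And>N. \<mu> N \<in> finite_measures" and \<nu>: "\<And>N. \<nu> N \<in> finite_measures" and small: "(\<lambda>N. suminf (\<nu> N)) \<longlonglongrightarrow> 0"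
    and \<gamma>: "\<gamma> \<in> finite_measures" "\<And>N j. \<mu> N j + \<nu> N j = \<gamma> j" and pos: "0 < measure (P \<gamma>) potential_extinction"
  shows "(\<lambda>N. measure (P (\<nu> N)) potential_extinction) \<longlonglongrightarrow> 1"
proof (rule LIMSEQ_I)
  fix r :: real assume r: "0 < r"
  define p where "p = measure (P \<gamma>) potential_extinction"
  \<comment> \<open>The two estimates below combine to \<open>p * (1 - q) \<le> 8 * \<epsilon>\<close>, where \<open>q\<close> is the extinction probability of
    the second part.\<close>
  define \<epsilon> where "\<epsilon> = r * p / 16"
  have \<epsilon>: "0 < \<epsilon>" unfolding \<epsilon>_def p_def using r pos by simp
  let ?Y = "potential_path 1 0"
  have Ym: "?Y \<in> P \<mu>' \<rightarrow>\<^sub>M seqs" if "\<mu>' \<in> finite_measures" for \<mu>' by (rule potential_path_meas[OF that]) simp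
  obtain G where G: "exp_poly G" "(\<integral>\<omega>. (null_ind (?Y \<omega>) - G (?Y \<omega>))\<^sup>2 \<partial>P \<gamma>) \<le> \<epsilon>"
    using antitone_test_approx[OF antitone_test_null_ind P_prob[OF \<gamma>(1)] Ym[OF \<gamma>(1)] \<epsilon>] by blast
  define H where "H y = (G y)\<^sup>2" for y
  have H: "exp_poly H" unfolding H_def[abs_def] by (rule exp_poly_power[OF G(1)])
  note Gm [measurable] = exp_poly_meas[OF G(1)] and Hm [measurable] = exp_poly_meas[OF H] and vm [measurable] = null_ind_meas
  obtain K where K: "\<And>y. \<bar>G y\<bar> \<le> K" using exp_poly_bounded[OF G(1)] by blast
  obtain K' where K': "\<And>y. \<bar>H y\<bar> \<le> K'" using exp_poly_bounded[OF H] by blast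
  obtain g where inc: "\<And>y z. \<bar>H (\<lambda>j. y j + z j) - H y\<bar> \<le> g z" and gm [measurable]: "g \<in> borel_measurable seqs"
    and gb: "\<exists>C. \<forall>z. \<bar>g z\<bar> \<le> C" and gl: "(\<lambda>N. \<integral>\<omega>. g (?Y \<omega>) \<partial>P (\<nu> N)) \<longlonglongrightarrow> 0"
    using increment_small[OF H \<nu> small] by blast
  obtain C where C: "\<And>z. \<bar>g z\<bar> \<le> C" using gb by blast
  have "eventually (\<lambda>N. (\<integral>\<omega>. g (?Y \<omega>) \<partial>P (\<nu> N)) < \<epsilon>) sequentially"
    by (rule order_tendstoD(2)[OF gl \<epsilon>])
  then obtain N0 where N0: "\<And>N. N0 \<le> N \<Longrightarrow> (\<integral>\<omega>. g (?Y \<omega>) \<partial>P (\<nu> N)) < \<epsilon>" unfolding eventually_sequentially by blast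
  have "norm (measure (P (\<nu> N)) potential_extinction - 1) < r" if N: "N0 \<le> N" for N
  proof -
    let ?Q = "P (\<mu> N) \<Otimes>\<^sub>M P (\<nu> N)"
    define Y1 where "Y1 p = ?Y (fst p)" for p :: "'w \<times> 'w"
    define Y2 where "Y2 p = ?Y (snd p)" for p :: "'w \<times> 'w"
    define Y where "Y p = (\<lambda>j. Y1 p j + Y2 p j)" for p
    have Q: "prob_space ?Q" by (rule prob_pair[OF P_prob[OF \<mu>] P_prob[OF \<nu>]])
    interpret Q: prob_space ?Q by (rule Q)
    have [measurable]: "Y1 \<in> ?Q \<rightarrow>\<^sub>M seqs" "Y2 \<in> ?Q \<rightarrow>\<^sub>M seqs"
      unfolding Y1_def[abs_def] Y2_def[abs_def]
      by (rule measurable_compose[OF measurable_fst Ym[OF \<mu>]] measurable_compose[OF measurable_snd Ym[OF \<nu>]])+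
    have [measurable]: "Y \<in> ?Q \<rightarrow>\<^sub>M seqs"
      unfolding Y_def[abs_def] Y1_def Y2_def by (rule plus_seqs_meas[OF Ym[OF \<mu>] Ym[OF \<nu>]])
    have \<gamma>eq: "(\<lambda>j. \<mu> N j + \<nu> N j) = \<gamma>" using \<gamma>(2) by auto
    have law: "(\<integral>\<omega>. h (?Y \<omega>) \<partial>P \<gamma>) = (\<integral>p. h (Y p) \<partial>?Q)" if "exp_closure h" for h
      using sum_law[OF \<mu> \<nu> that, of N N] unfolding \<gamma>eq Y_def Y1_def Y2_def .
    have close: "(\<integral>p. (null_ind (Y p) - G (Y p))\<^sup>2 \<partial>?Q) \<le> \<epsilon>"
      using G(2) law[OF exp_closure_square_diff[OF antitone_test_exp_closure[OF antitone_test_null_ind] G(1)]] by simp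
    have Ep: "(\<integral>p. null_ind (Y p) \<partial>?Q) = p"
      using law[OF antitone_test_exp_closure[OF antitone_test_null_ind]] integral_null_ind_potential_path[OF \<gamma>(1), of 0 1] unfolding p_def by simp
    have small_g: "(\<integral>p. g (Y2 p) \<partial>?Q) \<le> \<epsilon>"
    proof -
      have gi: "integrable ?Q (\<lambda>p. g (Y2 p))" by (rule bounded_integrable[OF Q _ C]) measurable
      interpret A: prob_space "P (\<mu> N)" by (rule P_prob[OF \<mu>])
      interpret B: prob_space "P (\<nu> N)" by (rule P_prob[OF \<nu>])
      interpret pair_sigma_finite "P (\<mu> N)" "P (\<nu> N)" ..
      have "(\<integral>p. g (Y2 p) \<partial>?Q) = (\<integral>\<omega>. g (?Y \<omega>) \<partial>P (\<nu> N))"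
        using integral_fst'[OF gi] unfolding Y2_def by (simp add: A.prob_space)
      then show ?thesis using N0[OF N] by simp
    qed
    define q where "q = measure (P (\<nu> N)) potential_extinction"
    have q1: "q \<le> 1" unfolding q_def by (rule prob_space.prob_le_1[OF P_prob[OF \<nu>]])
    define E where "E = (\<integral>p. null_ind (Y1 p) * H (Y1 p) \<partial>?Q)"
    have vH: "\<bar>null_ind y * H z\<bar> \<le> K'" for y z
      using mult_mono[OF null_ind_range(3)[of y] K'[of z]] by (simp add: abs_mult)
    have H0: "0 \<le> H y" for y unfolding H_def by simp
    have i1: "integrable ?Q (\<lambda>p. null_ind (Y1 p) * H (Y1 p))" by (rule bounded_integrable[OF Q _ vH]) measurable
    have i2: "integrable ?Q (\<lambda>p. g (Y2 p))" by (rule bounded_integrable[OF Q _ C]) measurable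
    have b3: "\<bar>(null_ind y - G y)\<^sup>2\<bar> \<le> (1 + K)\<^sup>2" for y
    proof -
      have "\<bar>null_ind y - G y\<bar> \<le> 1 + K" using null_ind_range(3)[of y] K[of y] by linarith
      from power_mono[OF this, of 2] show ?thesis by simp
    qed
    have i3: "integrable ?Q (\<lambda>p. (null_ind (Y p) - G (Y p))\<^sup>2)" by (rule bounded_integrable[OF Q _ b3]) measurable
    have i4: "integrable ?Q (\<lambda>p. null_ind (Y p))" by (rule bounded_integrable[OF Q _ null_ind_range(3)]) measurable
    have vY: "null_ind (Y p) = null_ind (Y1 p) * null_ind (Y2 p)" for p unfolding Y_def by (rule null_ind_plus)
    \<comment> \<open>On extinction of both parts \<open>G\<close> is near \<open>1\<close>, so its square is bounded below by one half minus the error.\<close>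
    have "(\<integral>p. null_ind (Y p) / 2 - (null_ind (Y p) - G (Y p))\<^sup>2 - g (Y2 p) \<partial>?Q) \<le> E"
      unfolding E_def
    proof (rule integral_mono)
      fix p
      have "null_ind (Y p) / 2 - (null_ind (Y p) - G (Y p))\<^sup>2 \<le> null_ind (Y1 p) * H (Y p)"
      proof (cases "null_ind (Y p) = 0")
        case True
        have "0 \<le> null_ind (Y1 p) * H (Y p)" by (rule mult_nonneg_nonneg[OF null_ind_range(1) H0])
        moreover have "0 \<le> (0 - G (Y p))\<^sup>2" by (rule zero_le_power2)
        ultimately show ?thesis unfolding True by linarith
      next
        case False
        then have v: "null_ind (Y p) = 1" "null_ind (Y1 p) = 1" using vY[of p] unfolding null_ind_def by (auto split: if_splits)
        have "0 \<le> (1 - 2 * G (Y p))\<^sup>2" by simp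
        then show ?thesis unfolding v H_def by (simp add: power2_eq_square algebra_simps)
      qed
      moreover have "null_ind (Y1 p) * H (Y p) \<le> null_ind (Y1 p) * H (Y1 p) + g (Y2 p)"
      proof -
        have i: "H (Y p) \<le> H (Y1 p) + g (Y2 p)" "0 \<le> g (Y2 p)" using inc[of "Y1 p" "Y2 p"] unfolding Y_def by auto
        show ?thesis using i unfolding null_ind_def by auto
      qed
      ultimately show "null_ind (Y p) / 2 - (null_ind (Y p) - G (Y p))\<^sup>2 - g (Y2 p) \<le> null_ind (Y1 p) * H (Y1 p)" by linarith
    qed (use i1 i2 i3 i4 in auto)
    then have lower: "p / 2 - 2 * \<epsilon> \<le> E" using i2 i3 i4 Ep close small_g by simp
    have i5: "integrable ?Q (\<lambda>p. null_ind (Y1 p) * H (Y1 p) * null_ind (Y2 p))"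
    proof (rule bounded_integrable[OF Q, where C = K'])
      show "\<bar>null_ind (Y1 p) * H (Y1 p) * null_ind (Y2 p)\<bar> \<le> K'" for p
        using vH[of "Y1 p" "Y1 p"] K'[of "Y1 p"] by (cases "null_ind (Y2 p) = 0") (auto simp: null_ind_def split: if_splits)
    qed measurable
    have prodE: "(\<integral>p. null_ind (Y1 p) * H (Y1 p) * null_ind (Y2 p) \<partial>?Q) = E * q"
    proof -
      interpret A: prob_space "P (\<mu> N)" by (rule P_prob[OF \<mu>])
      interpret B: prob_space "P (\<nu> N)" by (rule P_prob[OF \<nu>])
      interpret pair_sigma_finite "P (\<mu> N)" "P (\<nu> N)" ..
      have "E = (\<integral>\<omega>. null_ind (?Y \<omega>) * H (?Y \<omega>) \<partial>P (\<mu> N))"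
        using integral_fst'[OF i1] unfolding E_def Y1_def by (simp add: B.prob_space)
      moreover have "(\<integral>p. null_ind (Y1 p) * H (Y1 p) * null_ind (Y2 p) \<partial>?Q) = (\<integral>\<omega>. null_ind (?Y \<omega>) * H (?Y \<omega>) * (\<integral>\<omega>. null_ind (?Y \<omega>) \<partial>P (\<nu> N)) \<partial>P (\<mu> N))"
        using integral_fst'[OF i5] unfolding Y1_def Y2_def by simp
      ultimately show ?thesis using integral_null_ind_potential_path[OF \<nu>, of 0 1 N] unfolding q_def by simp
    qed
    have le: "(\<integral>p. null_ind (Y1 p) * H (Y1 p) - null_ind (Y1 p) * H (Y1 p) * null_ind (Y2 p) \<partial>?Q) \<le> (\<integral>p. (null_ind (Y p) - G (Y p))\<^sup>2 + g (Y2 p) \<partial>?Q)"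
    proof (rule integral_mono)
      fix p
      have i: "H (Y1 p) \<le> H (Y p) + g (Y2 p)" "0 \<le> g (Y2 p)" using inc[of "Y1 p" "Y2 p"] unfolding Y_def by auto
      show "null_ind (Y1 p) * H (Y1 p) - null_ind (Y1 p) * H (Y1 p) * null_ind (Y2 p) \<le> (null_ind (Y p) - G (Y p))\<^sup>2 + g (Y2 p)"
      proof (cases "null_ind (Y2 p) = 0")
        case True
        then show ?thesis using i H0[of "Y1 p"] H0[of "Y p"] vY[of p] unfolding null_ind_def[of "Y1 p"] H_def by auto
      next
        case False
        then have "null_ind (Y2 p) = 1" unfolding null_ind_def by (auto split: if_splits)
        then show ?thesis using i by simp
      qed
    qed (use i1 i2 i3 i5 in auto)
    have "(\<integral>p. null_ind (Y1 p) * H (Y1 p) - null_ind (Y1 p) * H (Y1 p) * null_ind (Y2 p) \<partial>?Q) = E - E * q"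
      using Bochner_Integration.integral_diff[OF i1 i5] unfolding prodE E_def[symmetric] .
    moreover have "(\<integral>p. (null_ind (Y p) - G (Y p))\<^sup>2 + g (Y2 p) \<partial>?Q) \<le> 2 * \<epsilon>"
      using Bochner_Integration.integral_add[OF i3 i2] close small_g by linarith
    ultimately have upper: "E * (1 - q) \<le> 2 * \<epsilon>"
      using le unfolding right_diff_distrib by linarith
    have "(p / 2 - 2 * \<epsilon>) * (1 - q) \<le> 2 * \<epsilon>"
      using mult_right_mono[OF lower, of "1 - q"] upper q1 by linarith
    moreover have "2 * \<epsilon> * (1 - q) \<le> 2 * \<epsilon> * 1"
      using \<epsilon> by (intro mult_left_mono) (auto simp: q_def)
    moreover have "(p / 2 - 2 * \<epsilon>) * (1 - q) = p * (1 - q) / 2 - 2 * \<epsilon> * (1 - q)"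
      by (simp add: left_diff_distrib)
    ultimately have "p * (1 - q) \<le> 8 * \<epsilon>" by linarith
    also have "8 * \<epsilon> < p * r" unfolding \<epsilon>_def using r pos by (simp add: p_def)
    finally have "1 - q < r" using pos unfolding p_def by simp
    then show ?thesis using q1 unfolding q_def by simp
  qed
  then show "\<exists>no. \<forall>N\<ge>no. norm (measure (P (\<nu> N)) potential_extinction - 1) < r" by blast
qed

lemma potential_extinction_finite_support:
  "measure (P (\<lambda>j. if j < N then \<gamma> j else 0)) potential_extinction = exp_neg (\<Sum>j<N. neg_log (measure (P (unit_mass j)) potential_extinction) * ennreal (\<gamma> j))"
  if \<gamma>: "\<gamma> \<in> finite_measures" for N :: nat
proof (induction N)
  case (Suc N)
  have f1: "(\<lambda>j. if j < N then \<gamma> j else 0) \<in> finite_measures"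
    using \<gamma> unfolding finite_measures_def by (auto intro: summable_finite[of "{..<N}"])
  have g0: "0 \<le> \<gamma> N" using \<gamma> by (simp add: finite_measures_def)
  have "(\<lambda>j. if j < Suc N then \<gamma> j else 0) = (\<lambda>j. (if j < N then \<gamma> j else 0) + \<gamma> N * unit_mass N j)"
    by (auto simp: unit_mass_def less_Suc_eq)
  then show ?case
    using potential_extinction_add[OF f1 finite_measures_scale[OF unit_mass_finite g0, of N]] Suc potential_extinction_scale[OF unit_mass_finite g0, of N]
    by (simp add: exp_neg_add)
qed (simp add: potential_extinction_zero)

text \<open>
  Over the first \<open>N\<close> types the extinction probability is a finite product, and by
  \<open>small_population_dies\<close> the remaining types do not contribute in the limit.
\<close>

lemma potential_extinction_mixture:
  assumes \<gamma>: "\<gamma> \<in> finite_measures" and pos: "0 < measure (P \<gamma>) potential_extinction"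
  shows "measure (P \<gamma>) potential_extinction = exp_neg (pairing (\<lambda>j. neg_log (measure (P (unit_mass j)) potential_extinction)) \<gamma>)"
proof -
  define \<mu> where "\<mu> N j = (if j < N then \<gamma> j else 0)" for N j :: nat
  define \<nu> where "\<nu> N j = (if j < N then 0 else \<gamma> j)" for N j :: nat
  have \<gamma>0: "0 \<le> \<gamma> j" and \<gamma>s: "summable \<gamma>" for j using \<gamma> by (auto simp: finite_measures_def)
  have \<mu>: "\<mu> N \<in> finite_measures" for N
    using \<gamma>0 unfolding finite_measures_def \<mu>_def[abs_def] by (auto intro: summable_finite[of "{..<N}"])
  have \<nu>s: "\<nu> N sums (suminf \<gamma> - (\<Sum>j<N. \<gamma> j))" for N
  proof -
    have "(\<lambda>j. \<nu> N (j + N)) = (\<lambda>j. \<gamma> (j + N))" unfolding \<nu>_def by auto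
    moreover have "(\<lambda>j. \<gamma> (j + N)) sums (suminf \<gamma> - (\<Sum>j<N. \<gamma> j))"
      using \<gamma>s by (simp add: sums_iff_shift summable_sums)
    moreover have "(\<Sum>j<N. \<nu> N j) = 0" unfolding \<nu>_def by simp
    ultimately show ?thesis using sums_iff_shift'[of "\<nu> N" N "suminf \<gamma> - (\<Sum>j<N. \<gamma> j)"] by simp
  qed
  have \<nu>: "\<nu> N \<in> finite_measures" for N
    using \<gamma>0 sums_summable[OF \<nu>s] unfolding finite_measures_def by (auto simp: \<nu>_def)
  have small: "(\<lambda>N. suminf (\<nu> N)) \<longlonglongrightarrow> 0"
    unfolding sums_unique[OF \<nu>s, symmetric]
    using tendsto_diff[OF tendsto_const[of "suminf \<gamma>"] summable_LIMSEQ[OF \<gamma>s]] by simp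
  have split: "\<mu> N j + \<nu> N j = \<gamma> j" for N j unfolding \<mu>_def \<nu>_def by simp
  have "measure (P \<gamma>) potential_extinction = measure (P (\<mu> N)) potential_extinction * measure (P (\<nu> N)) potential_extinction" for N
    using potential_extinction_add[OF \<mu>[of N] \<nu>[of N]] unfolding split by simp
  moreover have "measure (P (\<mu> N)) potential_extinction = exp_neg (\<Sum>j<N. neg_log (measure (P (unit_mass j)) potential_extinction) * ennreal (\<gamma> j))" for N
    unfolding \<mu>_def[abs_def] by (rule potential_extinction_finite_support[OF \<gamma>])
  ultimately have eq: "measure (P \<gamma>) potential_extinction = exp_neg (\<Sum>j<N. neg_log (measure (P (unit_mass j)) potential_extinction) * ennreal (\<gamma> j)) * measure (P (\<nu> N)) potential_extinction" for N
    by simp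
  have "(\<lambda>N. exp_neg (\<Sum>j<N. neg_log (measure (P (unit_mass j)) potential_extinction) * ennreal (\<gamma> j)))
     \<longlonglongrightarrow> exp_neg (pairing (\<lambda>j. neg_log (measure (P (unit_mass j)) potential_extinction)) \<gamma>)"
    unfolding pairing_def by (intro exp_neg_tendsto summable_LIMSEQ summableI)
  from tendsto_mult[OF this small_population_dies[OF \<mu> \<nu> small \<gamma> split pos]]
  show ?thesis unfolding eq[symmetric] by (simp add: LIMSEQ_const_iff)
qed

lemma fixed_point:
  assumes w: "\<And>i. w i = neg_log (measure (P (unit_mass i)) (extinction \<Omega> X))" and fin: "w i < \<infinity>"
  shows "pairing w (pmf (\<pi> i)) < \<infinity> \<and> psi b c l i (enn2real (w i)) + phi \<beta> d \<pi> n i w = 0"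
proof -
  have w': "w = (\<lambda>i. neg_log (measure (P (unit_mass i)) potential_extinction))"
    using w by (auto simp: prob_potential_extinction[OF unit_mass_finite])
  define p where "p = measure (P (unit_mass i)) potential_extinction"
  have "p \<noteq> 0" using fin unfolding w' neg_log_def p_def by auto
  then have p: "0 < p" unfolding p_def by (simp add: zero_less_measure_iff)
  have p1: "p \<le> 1" unfolding p_def by (rule prob_space.prob_le_1[OF P_prob[OF unit_mass_finite]])
  define q where "q = measure (P (pmf (\<pi> i))) potential_extinction"
  have q: "0 < q" and eq: "\<psi> i (- ln p) = \<rho> i (- ln q)"
    using extinction_equation[of i] p unfolding p_def q_def by auto
  have "q = exp_neg (pairing w (pmf (\<pi> i)))"
    unfolding q_def w' by (rule potential_extinction_mixture[OF pmf_finite_measure]) (use q in \<open>simp add: q_def\<close>)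
  then have fin': "pairing w (pmf (\<pi> i)) \<noteq> \<infinity>" and "q = exp (- enn2real (pairing w (pmf (\<pi> i))))"
    using q unfolding exp_neg_def by (auto split: if_splits)
  then have q': "- ln q = enn2real (pairing w (pmf (\<pi> i)))" by simp
  have "enn2real (w i) = - ln p" unfolding w' p_def[symmetric] using neg_log_pos[OF p p1] by simp
  then show ?thesis using eq fin' unfolding phi_eq q' by (simp add: less_top)
qed

end

theorem lemma1:
  fixes b c \<beta> d :: "nat \<Rightarrow> real" and l n :: "nat \<Rightarrow> real measure" and \<pi> :: "nat \<Rightarrow> nat pmf"
    and \<Omega> :: "'w measure" and X :: "real \<Rightarrow> 'w \<Rightarrow> nat \<Rightarrow> real"
    and P :: "(nat \<Rightarrow> real) \<Rightarrow> 'w measure" and w :: "nat \<Rightarrow> ennreal"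
  assumes "local_mechanism b c l" and "nonlocal_mechanism \<beta> d \<pi> n"
    and "is_mcsbp b c l \<beta> d \<pi> n \<Omega> X P"
    and "\<And>i. w i = neg_log (measure (P (unit_mass i)) (extinction \<Omega> X))"
  shows "\<forall>i. w i < \<infinity> \<longrightarrow>
    pairing w (pmf (\<pi> i)) < \<infinity> \<and> psi b c l i (enn2real (w i)) + phi \<beta> d \<pi> n i w = 0"
proof -
  interpret mcsbp b c \<beta> d l n \<pi> \<Omega> X P
    by unfold_locales (rule assms)+
  show ?thesis
    using fixed_point[of w, OF assms(4)] by blast
qed


end
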